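(* Let $1\le p\le2$, $s\ge0$, and let $K$ be a compact subset of $\mathbf{R}^n$. Then $K$ is a set of spectral synthesis for $M^{p,1}_s(\mathbf{R}^n)$ if and only if $K$ is a set of spectral synthesis for $\mathcal{F}L^1_s(\mathbf{R}^n)$.
   Context: $\langle \xi\rangle=(1+|\xi|^2)^{1/2}$; $\widehat f(\xi)=\int f(x)e^{-ix\xi}dx$ (extended to $\mathcal{S}'$). For $f\in\mathcal{S}'(\mathbf{R}^n)$ and a window $\phi\in\mathcal{S}(\mathbf{R}^n)\setminus\{0\}$, $V_\phi f(x,\xi)=\int_{\mathbf{R}^n} f(t)\overline{\phi(t-x)}e^{-it\xi}\,dt$ (by duality). The modulation space $M^{p,1}_s(\mathbf{R}^n)$ consists of all $f\in\mathcal{S}'(\mathbf{R}^n)$ with $\|f\|_{M^{p,1}_s}=\int\langle\xi\rangle^{s}\big(\int|V_\phi f(x,\xi)|^p\,dx\big)^{1/p}d\xi<\infty$; different windows give equivalent norms. The Fourier–Beurling algebra $\mathcal{F}L^1_s(\mathbf{R}^n)$ consists of all $f\in\mathcal{S}'(\mathbf{R}^n)$ with $\|f\|_{\mathcal{F}L^1_s}=\int\langle\xi\rangle^s|\widehat f(\xi)|\,d\xi<\infty$. For $s\ge 0$ both spaces consist of continuous functions and are algebras under pointwise multiplication, with continuous multiplication. Let $X$ be one of these two spaces. A linear subspace $I$ of $X$ is an ideal if $fg\in I$ whenever $f\in X$, $g\in I$; it is a closed ideal if moreover it is closed in $X$. The closed ideal generated by $S\subset X$ is the smallest closed ideal of $X$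 containing $S$. For a closed set $E\subset\mathbf{R}^n$ let $I(E)=\{f\in X\mid f(x)=0 \text{ for all } x\in E\}$ and let $J(E)$ be the closed ideal in $X$ generated by $J_0(E)=\{f\in X\mid f(x)=0\text{ in a neighborhood of }E\}$. $E$ is called a set of spectral synthesis for $X$ if $I(E)=J(E)$. *)

theory Defs
  imports "HOL-Analysis.Analysis"
begin

section \<open>Schwartz functions and tempered distributions\<close>

type_synonym 'n cfun = "real ^ 'n \<Rightarrow> complex"
type_synonym 'n distr = "'n cfun \<Rightarrow> complex"

definition bracket :: "real ^ 'n \<Rightarrow> real" where
  "bracket \<xi> = sqrt (1 + (norm \<xi>)\<^sup>2)"

definition partial :: "'n \<Rightarrow> 'n::finite cfun \<Rightarrow> 'n cfun" where
  "partial i f = (\<lambda>x. frechet_derivative f (at x) (axis i 1))"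

text \<open>The list \<open>js\<close> records the coordinate directions of an iterated partial derivative; by
  symmetry of mixed derivatives this is the usual \<open>\<partial>\<^sup>\<alpha>\<close> when the function is smooth.\<close>

definition iter_partial :: "'n list \<Rightarrow> 'n::finite cfun \<Rightarrow> 'n cfun" where
  "iter_partial js f = foldr partial js f"

definition schwartz :: "'n::finite cfun set" where
  "schwartz = {f. \<forall>js. (\<forall>x. iter_partial js f differentiable (at x)) \<and>
      (\<forall>k::nat. bounded (range (\<lambda>x. bracket x ^ k *\<^sub>R iter_partial js f x)))}"

definition schwartz_norm :: "nat \<Rightarrow> 'n::finite cfun \<Rightarrow> real" where
  "schwartz_norm k f =
     (\<Sum>js | length js \<le> k. SUP x. bracket x ^ k * cmod (iter_partial js f x))"

text \<open>A distribution is a functional on Schwartz functions; as HOL functions are total, its value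
  outside \<^const>\<open>schwartz\<close> is normalised to \<^const>\<open>undefined\<close>.\<close>

definition tempered_distributions :: "'n::finite distr set" where
  "tempered_distributions = {u \<in> extensional schwartz.
      (\<forall>\<phi>\<in>schwartz. \<forall>\<psi>\<in>schwartz. u (\<lambda>x. \<phi> x + \<psi> x) = u \<phi> + u \<psi>) \<and>
      (\<forall>c. \<forall>\<phi>\<in>schwartz. u (\<lambda>x. c * \<phi> x) = c * u \<phi>) \<and>
      (\<exists>C k. \<forall>\<phi>\<in>schwartz. cmod (u \<phi>) \<le> C * schwartz_norm k \<phi>)}"

definition distr_of :: "'n::finite cfun \<Rightarrow> 'n distr" where
  "distr_of f = (\<lambda>\<phi>\<in>schwartz. LINT x|lborel. f x * \<phi> x)"

definition given_by :: "'n::finite distr \<Rightarrow> 'n cfun \<Rightarrow> bool" where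
  "given_by u f \<longleftrightarrow> f \<in> borel_measurable lborel \<and>
     (\<forall>\<phi>\<in>schwartz. integrable lborel (\<lambda>x. f x * \<phi> x)) \<and> u = distr_of f"

definition fourier :: "'n::finite cfun \<Rightarrow> 'n cfun" where
  "fourier f = (\<lambda>\<xi>. LINT x|lborel. f x * exp (- (\<i> * of_real (x \<bullet> \<xi>))))"

definition fourier_distr :: "'n::finite distr \<Rightarrow> 'n distr" where
  "fourier_distr u = (\<lambda>\<phi>\<in>schwartz. u (fourier \<phi>))"


section \<open>Modulation spaces and Fourier--Beurling algebras\<close>

definition stft :: "'n::finite cfun \<Rightarrow> 'n distr \<Rightarrow> real ^ 'n \<Rightarrow> real ^ 'n \<Rightarrow> complex" where
  "stft \<phi> u x \<xi> = u (\<lambda>t. cnj (\<phi> (t - x)) * exp (- (\<i> * of_real (t \<bullet> \<xi>))))"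

definition Lp_norm :: "real \<Rightarrow> 'n::finite cfun \<Rightarrow> ennreal" where
  "Lp_norm p g = (let I = \<integral>\<^sup>+ x. ennreal (cmod (g x) powr p) \<partial>lborel
     in if I = \<infinity> then \<infinity> else ennreal (enn2real I powr (1 / p)))"

definition modulation_norm :: "'n::finite cfun \<Rightarrow> real \<Rightarrow> real \<Rightarrow> 'n distr \<Rightarrow> ennreal" where
  "modulation_norm \<phi> p s u =
     (\<integral>\<^sup>+ \<xi>. ennreal (bracket \<xi> powr s) * Lp_norm p (\<lambda>x. stft \<phi> u x \<xi>) \<partial>lborel)"

definition modulation_space :: "'n::finite cfun \<Rightarrow> real \<Rightarrow> real \<Rightarrow> 'n distr set" where
  "modulation_space \<phi> p s = {u \<in> tempered_distributions. modulation_norm \<phi> p s u < \<infinity>}"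

text \<open>The functions \<open>h\<close> representing the Fourier transform agree almost everywhere, so the infimum
  runs over a single value; it is \<open>\<infinity>\<close> if the Fourier transform is not a function.\<close>

definition fourier_beurling_norm :: "real \<Rightarrow> 'n::finite distr \<Rightarrow> ennreal" where
  "fourier_beurling_norm s u =
     (INF h \<in> {h. given_by (fourier_distr u) h}.
        \<integral>\<^sup>+ \<xi>. ennreal (bracket \<xi> powr s * cmod (h \<xi>)) \<partial>lborel)"

definition fourier_beurling_space :: "real \<Rightarrow> 'n::finite distr set" where
  "fourier_beurling_space s = {u \<in> tempered_distributions. fourier_beurling_norm s u < \<infinity>}"

text \<open>For \<open>s \<ge> 0\<close> every element of either space is given by a (unique, bounded) continuous
  function. To speak about point values and products, the elements are replaced by these
  functions.\<close>

definition continuous_functions_of :: "'n::finite distr set \<Rightarrow> 'n cfun set" where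
  "continuous_functions_of A = {f. continuous_on UNIV f \<and> (\<exists>u\<in>A. given_by u f)}"

definition norm_dist :: "('n::finite distr \<Rightarrow> ennreal) \<Rightarrow> 'n cfun \<Rightarrow> 'n cfun \<Rightarrow> real" where
  "norm_dist N f g = enn2real (N (distr_of (\<lambda>x. f x - g x)))"


section \<open>Closed ideals and spectral synthesis\<close>

text \<open>Below \<open>X\<close> is an algebra of functions under pointwise multiplication and \<open>d\<close> the metric
  defined by its norm.\<close>

definition function_ideal :: "'n cfun set \<Rightarrow> 'n cfun set \<Rightarrow> bool" where
  "function_ideal X I \<longleftrightarrow> I \<subseteq> X \<and> (\<lambda>x. 0) \<in> I \<and>
     (\<forall>f\<in>I. \<forall>g\<in>I. (\<lambda>x. f x + g x) \<in> I) \<and>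
     (\<forall>c. \<forall>f\<in>I. (\<lambda>x. c * f x) \<in> I) \<and>
     (\<forall>f\<in>X. \<forall>g\<in>I. (\<lambda>x. f x * g x) \<in> I)"

definition closed_ideal :: "'n cfun set \<Rightarrow> ('n cfun \<Rightarrow> 'n cfun \<Rightarrow> real) \<Rightarrow> 'n cfun set \<Rightarrow> bool" where
  "closed_ideal X d I \<longleftrightarrow> function_ideal X I \<and> closedin (Metric_space.mtopology X d) I"

definition generated_closed_ideal ::
  "'n cfun set \<Rightarrow> ('n cfun \<Rightarrow> 'n cfun \<Rightarrow> real) \<Rightarrow> 'n cfun set \<Rightarrow> 'n cfun set" where
  "generated_closed_ideal X d S = \<Inter> {I. closed_ideal X d I \<and> S \<subseteq> I}"

definition ideal_I :: "'n cfun set \<Rightarrow> (real ^ 'n) set \<Rightarrow> 'n cfun set" where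
  "ideal_I X E = {f \<in> X. \<forall>x\<in>E. f x = 0}"

definition ideal_J0 :: "'n::finite cfun set \<Rightarrow> (real ^ 'n) set \<Rightarrow> 'n cfun set" where
  "ideal_J0 X E = {f \<in> X. \<exists>U. open U \<and> E \<subseteq> U \<and> (\<forall>x\<in>U. f x = 0)}"

definition ideal_J ::
  "'n::finite cfun set \<Rightarrow> ('n cfun \<Rightarrow> 'n cfun \<Rightarrow> real) \<Rightarrow> (real ^ 'n) set \<Rightarrow> 'n cfun set" where
  "ideal_J X d E = generated_closed_ideal X d (ideal_J0 X E)"

definition spectral_synthesis ::
  "'n::finite cfun set \<Rightarrow> ('n cfun \<Rightarrow> 'n cfun \<Rightarrow> real) \<Rightarrow> (real ^ 'n) set \<Rightarrow> bool" where
  "spectral_synthesis X d E \<longleftrightarrow> closed E \<and> ideal_I X E = ideal_J X d E"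

definition spectral_synthesis_modulation ::
  "'n::finite cfun \<Rightarrow> real \<Rightarrow> real \<Rightarrow> (real ^ 'n) set \<Rightarrow> bool" where
  "spectral_synthesis_modulation \<phi> p s =
     spectral_synthesis (continuous_functions_of (modulation_space \<phi> p s))
       (norm_dist (modulation_norm \<phi> p s))"

definition spectral_synthesis_fourier_beurling :: "real \<Rightarrow> (real ^ 'n::finite) set \<Rightarrow> bool" where
  "spectral_synthesis_fourier_beurling s =
     spectral_synthesis (continuous_functions_of (fourier_beurling_space s))
       (norm_dist (fourier_beurling_norm s))"

end

theory Submission
  imports Defs "HOL-Probability.Probability" "HOL-Real_Asymp.Real_Asymp"
begin

text \<open>
  Write \<open>X\<close> for the Fourier--Beurling algebra, \<open>Y\<close> for the modulation space and \<open>V f\<close> for the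
  short-time Fourier transform. The two algebras are locally equal, and synthesis for a compact set
  only sees functions near that set. Precisely, three facts suffice: \<open>Y \<subseteq> X\<close> with a continuous
  inclusion, \<open>\<parallel>f g\<parallel>\<^sub>Y \<le> C \<parallel>f\<parallel>\<^sub>X \<parallel>g\<parallel>\<^sub>Y\<close> for \<open>f \<in> X\<close> and \<open>g \<in> Y\<close>, and a cutoff \<open>\<kappa> \<in> Y\<close> that
  equals \<open>1\<close> near \<open>K\<close>. Then \<open>f \<mapsto> \<kappa> f\<close> maps \<open>X\<close> continuously into \<open>Y\<close>, the difference \<open>f - \<kappa> f\<close>
  vanishes near \<open>K\<close> and so lies in the smallest ideal in question, and preimages of closed ideals
  under \<open>f \<mapsto> \<kappa> f\<close> and under the inclusion are closed ideals. This is \<open>synthesis_transfer\<close>, an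
  argument about abstract function algebras.

  The module inequality (\<open>mod_norm_mult_le\<close>) holds because multiplication by the inverse Fourier
  transform of \<open>h\<close> turns \<open>V f\<close> into an average of its frequency translates with density \<open>h\<close>;
  Minkowski's integral inequality and submultiplicativity of the weight do the rest.

  The inclusion is where \<open>p \<le> 2\<close> enters. For integrable \<open>f\<close> the function \<open>V f(\<cdot>, \<xi>)\<close> is a
  convolution whose transform is \<open>fourier f (\<xi> + \<eta>) \<cdot> cnj (fourier \<phi> \<eta>)\<close>. Plancherel bounds this in
  \<open>L\<^sup>2\<close> by \<open>\<parallel>V f(\<cdot>, \<xi>)\<parallel>\<^sub>2\<close>, and \<open>\<parallel>V f\<parallel>\<^sub>2\<^sup>2 \<le> \<parallel>V f\<parallel>\<^sub>p\<^sup>p \<parallel>V f\<parallel>\<^sub>\<infinity>\<^sup>2\<^sup>-\<^sup>p\<close>, where the supremum is in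
  turn at most the \<open>L\<^sup>1\<close> norm of the transform. Multiplying by another factor \<open>fourier \<phi>\<close> and
  integrating over \<open>\<xi>\<close>, the norm of \<open>f\<close> in \<open>X\<close> appears on both sides, with an arbitrarily small
  constant on the right, and can be absorbed (\<open>beurling_mass_fourier_le\<close>). This replaces the
  Hausdorff--Young inequality and its interpolation argument. For general \<open>f\<close> in \<open>Y\<close> one
  multiplies by Gaussians: the products are integrable, and they converge to \<open>f\<close> in \<open>Y\<close> because
  frequency translation is continuous in the mixed norm
  (\<open>mix_norm_translation_continuous\<close>), so completeness of weighted \<open>L\<^sup>1\<close> gives a transform for \<open>f\<close>
  (\<open>has_symbol_if_mod_norm_finite\<close>).

  Both spaces are defined through distributions. Testing on Gaussians shows that an element of \<open>X\<close>
  is the inverse transform of an integrable function, its symbol, at every point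
  (\<open>has_symbol_if_given_by\<close>); all estimates in \<open>X\<close> are made for symbols. An element of \<open>Y\<close> is a
  continuous function with integrable products against Schwartz functions, which makes \<open>V f\<close> an
  ordinary integral.
\<close>

section \<open>The Schwartz space\<close>

lemma bracket_ge_1: "1 \<le> bracket x"
  unfolding bracket_def by simp

lemma bracket_pos [simp]: "0 < bracket x"
  using bracket_ge_1[of x] by linarith

lemma bracket_neq_0 [simp]: "bracket x \<noteq> 0"
  using bracket_pos[of x] by (metis less_irrefl)

lemma bracket_nonneg [simp]: "0 \<le> bracket x"
  using bracket_pos less_imp_le by blast

lemma norm_le_bracket: "norm x \<le> bracket x"
  unfolding bracket_def by (rule real_le_rsqrt) simp

lemma bracket_power2: "bracket x ^ 2 = 1 + (norm x)\<^sup>2"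
  unfolding bracket_def by simp

lemma bracket_minus [simp]: "bracket (- x) = bracket x"
  unfolding bracket_def by simp

lemma continuous_bracket [continuous_intros]:
  "continuous_on A f \<Longrightarrow> continuous_on A (\<lambda>x. bracket (f x))"
  unfolding bracket_def by (intro continuous_intros)

lemma measurable_bracket [measurable]: "bracket \<in> borel_measurable borel"
  by (rule borel_measurable_continuous_onI) (intro continuous_intros)

lemma bracket_add_le: "bracket (x + y) \<le> 2 * bracket x * bracket y"
proof -
  have "(norm (x + y))\<^sup>2 \<le> (norm x + norm y)\<^sup>2"
    by (intro power_mono norm_triangle_ineq) auto
  also have "\<dots> \<le> 2 * (norm x)\<^sup>2 + 2 * (norm y)\<^sup>2"
    using sum_squares_bound[of "norm x" "norm y"] by (simp add: power2_sum)
  finally have le: "(norm (x + y))\<^sup>2 \<le> 2 * (norm x)\<^sup>2 + 2 * (norm y)\<^sup>2" .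
  have "4 * ((1 + (norm x)\<^sup>2) * (1 + (norm y)\<^sup>2)) =
      4 + 4 * (norm x)\<^sup>2 + 4 * (norm y)\<^sup>2 + 4 * ((norm x)\<^sup>2 * (norm y)\<^sup>2)"
    by (simp add: algebra_simps)
  with le mult_nonneg_nonneg[OF zero_le_power2[of "norm x"] zero_le_power2[of "norm y"]]
  have "1 + (norm (x + y))\<^sup>2 \<le> 4 * ((1 + (norm x)\<^sup>2) * (1 + (norm y)\<^sup>2))"
    using zero_le_power2[of "norm x"] zero_le_power2[of "norm y"] by linarith
  hence "bracket (x + y) ^ 2 \<le> (2 * bracket x * bracket y) ^ 2"
    by (simp add: power_mult_distrib bracket_power2 algebra_simps)
  thus ?thesis by (rule power2_le_imp_le) (simp add: mult_nonneg_nonneg)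
qed

lemma bracket_power_add_le: "bracket (x + y) ^ k \<le> 2 ^ k * bracket x ^ k * bracket y ^ k"
  using power_mono[OF bracket_add_le[of x y], of k] by (simp add: power_mult_distrib)

lemma bracket_power_double: "bracket x ^ (2 * k) = bracket x powr (2 * real k)"
  using powr_realpow[OF bracket_pos, of x "2 * k"] by simp

lemma bracket_powr_add_le:
  assumes "0 \<le> s" shows "bracket (x + y) powr s \<le> 2 powr s * bracket x powr s * bracket y powr s"
  using powr_mono2[OF assms _ bracket_add_le[of x y]] by (simp add: powr_mult)

definition rapid :: "'n::finite cfun \<Rightarrow> bool" where
  "rapid f \<longleftrightarrow> (\<forall>k::nat. \<exists>B. \<forall>x. bracket x ^ k * cmod (f x) \<le> B)"

definition slow :: "'n::finite cfun \<Rightarrow> bool" where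
  "slow f \<longleftrightarrow> (\<exists>k B. \<forall>x. cmod (f x) \<le> B * bracket x ^ k)"

text \<open>Recursion on the number of derivatives, instead of quantification over lists of directions, lets
  closure properties be proved by induction. The growth condition is a parameter because Schwartz
  functions get multiplied by functions whose derivatives only grow polynomially.\<close>

primrec smooth_upto :: "('n::finite cfun \<Rightarrow> bool) \<Rightarrow> nat \<Rightarrow> 'n cfun \<Rightarrow> bool" where
  "smooth_upto P 0 f \<longleftrightarrow> (\<forall>x. f differentiable (at x)) \<and> P f"
| "smooth_upto P (Suc n) f \<longleftrightarrow> (\<forall>x. f differentiable (at x)) \<and> P f \<and>
     (\<forall>j. smooth_upto P n (partial j f))"

lemma smooth_upto_iff:
  "smooth_upto P n f \<longleftrightarrow> (\<forall>js. length js \<le> n \<longrightarrow>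
     (\<forall>x. iter_partial js f differentiable (at x)) \<and> P (iter_partial js f))"
proof (induction n arbitrary: f)
  case 0
  show ?case by (simp add: iter_partial_def)
next
  case (Suc n)
  have snoc_eq: "iter_partial (js @ [j]) f = iter_partial js (partial j f)" for js j
    by (simp add: iter_partial_def)
  show ?case (is "?L \<longleftrightarrow> ?R")
  proof
    assume L: ?L
    show ?R
    proof (intro allI impI)
      fix js :: "'a list" assume len: "length js \<le> Suc n"
      show "(\<forall>x. iter_partial js f differentiable (at x)) \<and> P (iter_partial js f)"
      proof (cases js rule: rev_cases)
        case Nil
        thus ?thesis using L by (simp add: iter_partial_def)
      next
        case (snoc ks j)
        thus ?thesis using L Suc[of "partial j f"] len snoc_eq by auto
      qed
    qed
  next
    assume R: ?R
    have "smooth_upto P n (partial j f)" for j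
      unfolding Suc snoc_eq[symmetric] using R by auto
    moreover have "(\<forall>x. f differentiable (at x)) \<and> P f"
      using R[rule_format, of "[]"] by (simp add: iter_partial_def)
    ultimately show ?L by simp
  qed
qed

lemma rapid_iff_bounded:
  "rapid f \<longleftrightarrow> (\<forall>k::nat. bounded (range (\<lambda>x. bracket x ^ k *\<^sub>R f x)))"
  unfolding rapid_def bounded_iff by (simp add: abs_of_nonneg)

lemma schwartz_iff: "f \<in> schwartz \<longleftrightarrow> (\<forall>n. smooth_upto rapid n f)"
  unfolding schwartz_def smooth_upto_iff rapid_iff_bounded by auto

lemma schwartz_partial: "f \<in> schwartz \<Longrightarrow> partial j f \<in> schwartz"
  unfolding schwartz_iff by (metis smooth_upto.simps(2))

lemma schwartz_differentiable: "f \<in> schwartz \<Longrightarrow> f differentiable (at x)"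
  unfolding schwartz_iff by (metis smooth_upto.simps(1))

lemma schwartz_rapid: "f \<in> schwartz \<Longrightarrow> rapid f"
  unfolding schwartz_iff by (metis smooth_upto.simps(1))

lemma schwartz_continuous: "f \<in> schwartz \<Longrightarrow> continuous_on UNIV f"
  using schwartz_differentiable differentiable_imp_continuous_within
  by (metis continuous_at_imp_continuous_on)

lemma schwartz_measurable [measurable]: "f \<in> schwartz \<Longrightarrow> f \<in> borel_measurable borel"
  by (rule borel_measurable_continuous_onI) (rule schwartz_continuous)

subsection \<open>Partial derivatives\<close>

lemma partial_eq: "(f has_derivative D) (at x) \<Longrightarrow> partial i f x = D (axis i 1)"
  unfolding partial_def using frechet_derivative_at by metis

lemma differentiable_partial:
  assumes "f differentiable (at x)"
  shows "(f has_derivative (\<lambda>h. frechet_derivative f (at x) h)) (at x)"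
  using assms frechet_derivative_works by blast

lemma partial_add:
  assumes "\<forall>x. f differentiable (at x)" "\<forall>x. g differentiable (at x)"
  shows "partial i (\<lambda>x. f x + g x) = (\<lambda>x. partial i f x + partial i g x)"
proof
  fix x
  from assms have "((\<lambda>x. f x + g x) has_derivative
      (\<lambda>h. frechet_derivative f (at x) h + frechet_derivative g (at x) h)) (at x)"
    by (intro has_derivative_add differentiable_partial) auto
  from partial_eq[OF this] show "partial i (\<lambda>x. f x + g x) x = partial i f x + partial i g x"
    by (simp add: partial_def)
qed

lemma partial_mult:
  assumes "\<forall>x. f differentiable (at x)" "\<forall>x. g differentiable (at x)"
  shows "partial i (\<lambda>x. f x * g x) = (\<lambda>x. partial i f x * g x + f x * partial i g x)"
proof
  fix x
  from assms have "((\<lambda>x. f x * g x) has_derivative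
      (\<lambda>h. f x * frechet_derivative g (at x) h + frechet_derivative f (at x) h * g x)) (at x)"
    by (intro has_derivative_mult differentiable_partial) auto
  from partial_eq[OF this] show "partial i (\<lambda>x. f x * g x) x = partial i f x * g x + f x * partial i g x"
    by (simp add: partial_def)
qed

lemma partial_cnj:
  assumes "\<forall>x. f differentiable (at x)"
  shows "partial i (\<lambda>x. cnj (f x)) = (\<lambda>x. cnj (partial i f x))"
proof
  fix x
  from assms have "((\<lambda>x. cnj (f x)) has_derivative
      (\<lambda>h. cnj (frechet_derivative f (at x) h))) (at x)"
    by (intro has_derivative_cnj differentiable_partial) auto
  from partial_eq[OF this] show "partial i (\<lambda>x. cnj (f x)) x = cnj (partial i f x)"
    by (simp add: partial_def)
qed

lemma has_derivative_shift:
  assumes "(f has_derivative D) (at (x - a))"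
  shows "((\<lambda>x. f (x - a)) has_derivative D) (at (x::'a::real_normed_vector))"
proof -
  have "((\<lambda>x. x - a) has_derivative (\<lambda>h. h)) (at x)"
    by (auto intro!: derivative_eq_intros)
  from diff_chain_at[OF this, of f D] assms show ?thesis by (simp add: o_def)
qed

lemma partial_shift:
  assumes "\<forall>x. f differentiable (at x)"
  shows "partial i (\<lambda>x. f (x - a)) = (\<lambda>x. partial i f (x - a))"
proof
  fix x
  from assms have "((\<lambda>x. f (x - a)) has_derivative
      (\<lambda>h. frechet_derivative f (at (x - a)) h)) (at x)"
    by (intro has_derivative_shift differentiable_partial) auto
  from partial_eq[OF this] show "partial i (\<lambda>x. f (x - a)) x = partial i f (x - a)"
    by (simp add: partial_def)
qed

lemma differentiable_cnj':
  "\<forall>x. f differentiable (at x) \<Longrightarrow> \<forall>x. (\<lambda>x. cnj (f x)) differentiable (at x)"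
  using has_derivative_cnj unfolding differentiable_def by blast

lemma differentiable_shift:
  "\<forall>x. f differentiable (at x) \<Longrightarrow> \<forall>x. (\<lambda>x. f (x - a)) differentiable (at (x::'a::real_normed_vector))"
  using has_derivative_shift unfolding differentiable_def by blast

subsection \<open>Closure properties\<close>

lemma rapid_add: "rapid f \<Longrightarrow> rapid g \<Longrightarrow> rapid (\<lambda>x. f x + g x)"
  unfolding rapid_def
proof
  fix k
  assume "\<forall>k::nat. \<exists>B. \<forall>x. bracket x ^ k * cmod (f x) \<le> B" "\<forall>k::nat. \<exists>B. \<forall>x. bracket x ^ k * cmod (g x) \<le> B"
  then obtain B C where B: "bracket x ^ k * cmod (f x) \<le> B" and C: "bracket x ^ k * cmod (g x) \<le> C" for x
    by metis
  have "bracket x ^ k * cmod (f x + g x) \<le> B + C" for x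
  proof -
    have "bracket x ^ k * cmod (f x + g x) \<le> bracket x ^ k * (cmod (f x) + cmod (g x))"
      by (intro mult_left_mono norm_triangle_ineq) simp
    also have "\<dots> \<le> B + C" using B[of x] C[of x] by (simp add: distrib_left)
    finally show ?thesis .
  qed
  thus "\<exists>B. \<forall>x. bracket x ^ k * cmod (f x + g x) \<le> B" by blast
qed

lemma slow_mult_rapid: 
  assumes "slow g" "rapid f" shows "rapid (\<lambda>x. g x * f x)"
  unfolding rapid_def
proof
  fix k
  from assms(1) obtain m C where C: "\<And>x. cmod (g x) \<le> C * bracket x ^ m" unfolding slow_def by blast
  from assms(2) obtain B where B: "\<And>x. bracket x ^ (k + m) * cmod (f x) \<le> B" unfolding rapid_def by blast
  have C0: "0 \<le> C" using C[of 0] norm_ge_zero[of "g 0"]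
    by (meson bracket_pos order_trans zero_le_mult_iff zero_less_power not_le)
  have "bracket x ^ k * cmod (g x * f x) \<le> C * B" for x
  proof -
    have "bracket x ^ k * cmod (g x * f x) \<le> bracket x ^ k * ((C * bracket x ^ m) * cmod (f x))"
      unfolding norm_mult by (intro mult_left_mono mult_right_mono C) auto
    also have "\<dots> = C * (bracket x ^ (k + m) * cmod (f x))" by (simp add: power_add mult_ac)
    also have "\<dots> \<le> C * B" by (intro mult_left_mono B C0)
    finally show ?thesis .
  qed
  thus "\<exists>B. \<forall>x. bracket x ^ k * cmod (g x * f x) \<le> B" by blast
qed

lemma slow_const: "slow (\<lambda>x. c)"
  unfolding slow_def by (rule exI[of _ 0], rule exI[of _ "cmod c"]) simp

lemma smooth_upto_add:
  assumes "\<And>f g. P f \<Longrightarrow> P g \<Longrightarrow> P (\<lambda>x. f x + g x)"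
  shows "smooth_upto P n f \<Longrightarrow> smooth_upto P n g \<Longrightarrow> smooth_upto P n (\<lambda>x. f x + g x)"
proof (induction n arbitrary: f g)
  case 0
  thus ?case using assms by (auto intro!: differentiable_add)
next
  case (Suc n)
  hence d: "\<forall>x. f differentiable (at x)" "\<forall>x. g differentiable (at x)" and P: "P f" "P g" by auto
  show ?case using Suc.prems d P
    by (auto simp: partial_add[OF d] intro!: Suc.IH assms differentiable_add)
qed

lemma smooth_upto_Suc_down: "smooth_upto P (Suc n) f \<Longrightarrow> smooth_upto P n f"
  by (simp add: smooth_upto_iff)

lemma smooth_upto_mult:
  assumes PQ: "\<And>f g. P f \<Longrightarrow> Q g \<Longrightarrow> Q (\<lambda>x. f x * g x)"
    and Q: "\<And>f g. Q f \<Longrightarrow> Q g \<Longrightarrow> Q (\<lambda>x. f x + g x)"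
  shows "smooth_upto P n f \<Longrightarrow> smooth_upto Q n g \<Longrightarrow> smooth_upto Q n (\<lambda>x. f x * g x)"
proof (induction n arbitrary: f g)
  case 0
  thus ?case using PQ by (auto intro!: differentiable_mult)
next
  case (Suc n)
  hence d: "\<forall>x. f differentiable (at x)" "\<forall>x. g differentiable (at x)" and P: "P f" "Q g" by auto
  have n: "smooth_upto P n f" "smooth_upto Q n g"
    using Suc.prems by (blast intro: smooth_upto_Suc_down)+
  show ?case using Suc.prems d P n
    by (auto simp: partial_mult[OF d] intro!: smooth_upto_add Suc.IH PQ Q differentiable_mult)
qed

lemma smooth_rapid_mult:
  "smooth_upto slow n f \<Longrightarrow> smooth_upto rapid n g \<Longrightarrow> smooth_upto rapid n (\<lambda>x. f x * g x)"
  by (rule smooth_upto_mult; fast intro: slow_mult_rapid rapid_add)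

lemma smooth_slow_const: "smooth_upto slow n (\<lambda>x :: real^'n::finite. c)"
proof (induction n arbitrary: c)
  case (Suc n)
  have "partial j (\<lambda>x :: real^'n. c) = (\<lambda>x. 0)" for j
    by (auto simp: partial_def)
  with Suc show ?case by (auto simp: slow_const)
qed (auto simp: slow_const)

lemma schwartz_slow_mult:
  assumes "\<And>n. smooth_upto slow n g" "f \<in> schwartz"
  shows "(\<lambda>x. g x * f x) \<in> schwartz"
  unfolding schwartz_iff
proof
  fix n
  have "smooth_upto rapid n f" using assms(2) by (simp add: schwartz_iff)
  thus "smooth_upto rapid n (\<lambda>x. g x * f x)" by (intro smooth_rapid_mult assms(1))
qed

lemma schwartz_add: "f \<in> schwartz \<Longrightarrow> g \<in> schwartz \<Longrightarrow> (\<lambda>x. f x + g x) \<in> schwartz"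
  unfolding schwartz_iff
  by (auto intro: smooth_upto_add rapid_add)

lemma schwartz_cmult: "f \<in> schwartz \<Longrightarrow> (\<lambda>x. c * f x) \<in> schwartz"
  by (rule schwartz_slow_mult[OF smooth_slow_const])

lemma schwartz_zero: "(\<lambda>x :: real^'n::finite. 0) \<in> schwartz"
proof -
  have "rapid (\<lambda>x :: real^'n. 0)" by (auto simp: rapid_def)
  moreover have "partial j (\<lambda>x :: real^'n. 0) = (\<lambda>x. 0)" for j by (auto simp: partial_def)
  ultimately have "smooth_upto rapid n (\<lambda>x :: real^'n. 0)" for n by (induction n) auto
  thus ?thesis by (simp add: schwartz_iff)
qed

lemma schwartz_sum: "(\<And>i. i \<in> I \<Longrightarrow> f i \<in> schwartz) \<Longrightarrow> (\<lambda>x. \<Sum>i\<in>I. f i x) \<in> schwartz"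
  by (induction I rule: infinite_finite_induct) (auto simp: schwartz_zero schwartz_add)

lemma schwartz_cnj: "f \<in> schwartz \<Longrightarrow> (\<lambda>x. cnj (f x)) \<in> schwartz"
proof -
  have "smooth_upto rapid n f \<Longrightarrow> smooth_upto rapid n (\<lambda>x. cnj (f x))" for n and f :: "real^'n \<Rightarrow> complex"
    by (induction n arbitrary: f)
       (auto simp: partial_cnj differentiable_cnj'[THEN spec] rapid_def)
  thus "f \<in> schwartz \<Longrightarrow> (\<lambda>x. cnj (f x)) \<in> schwartz" unfolding schwartz_iff by blast
qed

lemma rapid_shift: assumes "rapid f" shows "rapid (\<lambda>x. f (x - a))"
  unfolding rapid_def
proof
  fix k
  obtain B where B: "\<And>x. bracket x ^ k * cmod (f x) \<le> B" using assms unfolding rapid_def by blast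
  have "bracket x ^ k * cmod (f (x - a)) \<le> (2 ^ k * bracket a ^ k) * B" for x
  proof -
    have "bracket x ^ k * cmod (f (x - a)) \<le> (2 ^ k * bracket (x - a) ^ k * bracket a ^ k) * cmod (f (x - a))"
      using bracket_power_add_le[of "x - a" a k] by (intro mult_right_mono) auto
    also have "\<dots> = (2 ^ k * bracket a ^ k) * (bracket (x - a) ^ k * cmod (f (x - a)))" by simp
    also have "\<dots> \<le> (2 ^ k * bracket a ^ k) * B" by (intro mult_left_mono B) auto
    finally show ?thesis .
  qed
  thus "\<exists>B. \<forall>x. bracket x ^ k * cmod (f (x - a)) \<le> B" by blast
qed

lemma schwartz_shift: "(f :: real^'n::finite \<Rightarrow> complex) \<in> schwartz \<Longrightarrow> (\<lambda>x. f (x - a)) \<in> schwartz"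
proof -
  have "smooth_upto rapid n f \<Longrightarrow> smooth_upto rapid n (\<lambda>x. f (x - a))" for n and f :: "real^'n \<Rightarrow> complex" and a
    by (induction n arbitrary: f)
       (auto simp: partial_shift differentiable_shift[THEN spec] rapid_shift)
  thus "f \<in> schwartz \<Longrightarrow> (\<lambda>x. f (x - a)) \<in> schwartz" unfolding schwartz_iff by blast
qed

lemma smooth_slow_coordinate: "smooth_upto slow n (\<lambda>x :: real^'n::finite. complex_of_real (x $ j))"
proof -
  have d: "((\<lambda>x. complex_of_real (x $ j)) has_derivative (\<lambda>h. complex_of_real (h $ j))) (at x)" for x :: "real^'n"
    by (rule bounded_linear_imp_has_derivative)
       (intro bounded_linear_compose[OF bounded_linear_of_real] bounded_linear_vec_nth)
  have "slow (\<lambda>x :: real^'n. complex_of_real (x $ j))" unfolding slow_def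
    by (rule exI[of _ 1], rule exI[of _ 1])
       (simp add: order_trans[OF component_le_norm_cart norm_le_bracket])
  moreover have "partial i (\<lambda>x :: real^'n. complex_of_real (x $ j)) = (\<lambda>x. complex_of_real (axis i 1 $ j))" for i
    using partial_eq[OF d] by auto
  ultimately show ?thesis using smooth_slow_const differentiableI[OF d]
    by (cases n) auto
qed

lemma schwartz_coordinate: "f \<in> schwartz \<Longrightarrow> (\<lambda>x. complex_of_real (x $ j) * f x) \<in> schwartz"
  by (rule schwartz_slow_mult[OF smooth_slow_coordinate])

lemma character_has_derivative:
  "((\<lambda>x. exp (\<i> * of_real (x \<bullet> a))) has_derivative
     (\<lambda>h. \<i> * of_real (h \<bullet> a) * exp (\<i> * of_real (x \<bullet> a)))) (at x)"
proof -
  have "((\<lambda>x. \<i> * of_real (x \<bullet> a)) has_derivative (\<lambda>h. \<i> * of_real (h \<bullet> a))) (at x)"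
    by (rule bounded_linear_imp_has_derivative)
       (intro bounded_linear_const_mult bounded_linear_compose[OF bounded_linear_of_real] bounded_linear_inner_left)
  moreover have "(exp has_derivative (*) (exp (\<i> * of_real (x \<bullet> a)))) (at (\<i> * of_real (x \<bullet> a)))"
    using DERIV_exp has_field_derivative_def by blast
  ultimately show ?thesis
    using diff_chain_at by (fastforce simp: o_def mult_ac)
qed

text \<open>A character satisfies \<open>\<partial>\<^sub>j e = \<i> a\<^sub>j e\<close>, so all its derivatives are bounded.\<close>

lemma smooth_slow_character: "smooth_upto slow n (\<lambda>x. c * exp (\<i> * of_real (x \<bullet> a)))"
proof (induction n arbitrary: c)
  have d: "((\<lambda>x. c * exp (\<i> * of_real (x \<bullet> a))) has_derivative
     (\<lambda>h. c * (\<i> * of_real (h \<bullet> a) * exp (\<i> * of_real (x \<bullet> a))))) (at x)" for x c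
    by (intro has_derivative_mult_right character_has_derivative)
  have s: "slow (\<lambda>x. c * exp (\<i> * of_real (x \<bullet> a)))" for c
    unfolding slow_def by (rule exI[of _ 0], rule exI[of _ "cmod c"]) (simp add: norm_mult)
  { case 0 show ?case using d s by (auto simp: differentiable_def) }
  { case (Suc n)
    have "partial j (\<lambda>x. c * exp (\<i> * of_real (x \<bullet> a))) =
        (\<lambda>x. (c * \<i> * of_real (axis j 1 \<bullet> a)) * exp (\<i> * of_real (x \<bullet> a)))" for j
      by (auto simp: partial_eq[OF d])
    with Suc d s show ?case by (auto simp: differentiable_def) }
qed

lemma schwartz_modulate:
  "f \<in> schwartz \<Longrightarrow> (\<lambda>x. exp (\<i> * of_real (x \<bullet> a)) * f x) \<in> schwartz"
  using schwartz_slow_mult[of "\<lambda>x. exp (\<i> * of_real (x \<bullet> a))" f] smooth_slow_character[of _ 1 a] by simp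

text \<open>The test functions with which the short-time Fourier transform pairs.\<close>

lemma schwartz_time_frequency_shift:
  assumes "\<phi> \<in> schwartz"
  shows "(\<lambda>t. cnj (\<phi> (t - x)) * exp (- (\<i> * of_real (t \<bullet> \<xi>)))) \<in> schwartz"
  using schwartz_modulate[OF schwartz_cnj[OF schwartz_shift[OF assms, of x]], of "- \<xi>"]
  by (simp add: mult.commute)

section \<open>Integration on Euclidean space\<close>

lemma distr_lborel_translate: "distr lborel borel (\<lambda>x. x + a) = (lborel :: 'a::euclidean_space measure)"
  using lborel_distr_plus[of a] by (simp add: add.commute cong: distr_cong)

lemma distr_lborel_reflect: "distr lborel borel (\<lambda>x. a - x) = (lborel :: 'a::euclidean_space measure)"
  using lborel_affine[of "-1" a] by (simp add: density_1)

lemma integral_translate: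
  fixes f :: "'a::euclidean_space \<Rightarrow> 'b::{banach, second_countable_topology}"
  assumes [measurable]: "f \<in> borel_measurable borel"
  shows "(LINT x|lborel. f (x + a)) = (LINT x|lborel. f x)"
  using integral_distr[of "\<lambda>x. x + a" lborel borel f] by (simp add: distr_lborel_translate)

lemma integrable_translate:
  fixes f :: "'a::euclidean_space \<Rightarrow> 'b::{banach, second_countable_topology}"
  assumes [measurable]: "f \<in> borel_measurable borel"
  shows "integrable lborel (\<lambda>x. f (x + a)) \<longleftrightarrow> integrable lborel f"
  using integrable_distr_eq[of "\<lambda>x. x + a" lborel borel f] by (simp add: distr_lborel_translate)

lemma nn_integral_translate:
  fixes f :: "'a::euclidean_space \<Rightarrow> ennreal"
  assumes [measurable]: "f \<in> borel_measurable borel"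
  shows "(\<integral>\<^sup>+ x. f (x + a) \<partial>lborel) = (\<integral>\<^sup>+ x. f x \<partial>lborel)"
  using nn_integral_distr[of "\<lambda>x. x + a" lborel borel f] by (simp add: distr_lborel_translate)

lemma integral_reflect:
  fixes f :: "'a::euclidean_space \<Rightarrow> 'b::{banach, second_countable_topology}"
  assumes [measurable]: "f \<in> borel_measurable borel"
  shows "(LINT x|lborel. f (a - x)) = (LINT x|lborel. f x)"
  using integral_distr[of "\<lambda>x. a - x" lborel borel f] by (simp add: distr_lborel_reflect)

lemma integrable_reflect:
  fixes f :: "'a::euclidean_space \<Rightarrow> 'b::{banach, second_countable_topology}"
  assumes [measurable]: "f \<in> borel_measurable borel"
  shows "integrable lborel (\<lambda>x. f (a - x)) \<longleftrightarrow> integrable lborel f"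
  using integrable_distr_eq[of "\<lambda>x. a - x" lborel borel f] by (simp add: distr_lborel_reflect)

lemma nn_integral_reflect:
  fixes f :: "'a::euclidean_space \<Rightarrow> ennreal"
  assumes [measurable]: "f \<in> borel_measurable borel"
  shows "(\<integral>\<^sup>+ x. f (a - x) \<partial>lborel) = (\<integral>\<^sup>+ x. f x \<partial>lborel)"
  using nn_integral_distr[of "\<lambda>x. a - x" lborel borel f] by (simp add: distr_lborel_reflect)

lemma integrable_mult_bounded:
  fixes f g :: "'a \<Rightarrow> complex"
  assumes "integrable M f" "g \<in> borel_measurable M" "\<And>x. cmod (g x) \<le> B"
  shows "integrable M (\<lambda>x. f x * g x)" "integrable M (\<lambda>x. g x * f x)"
proof -
  have B: "0 \<le> B" using order_trans[OF norm_ge_zero assms(3)] .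
  have [measurable]: "f \<in> borel_measurable M" using assms(1) by auto
  note [measurable] = assms(2)
  show "integrable M (\<lambda>x. f x * g x)"
  proof (rule Bochner_Integration.integrable_bound)
    show "integrable M (\<lambda>x. B * norm (f x))" using assms(1) by auto
    show "AE x in M. norm (f x * g x) \<le> norm (B * norm (f x))"
      using B assms(3) by (intro AE_I2) (auto simp: norm_mult mult.commute[of B] intro!: mult_left_mono)
  qed measurable
  thus "integrable M (\<lambda>x. g x * f x)" by (simp add: mult.commute)
qed

text \<open>The power \<open>2n\<close> is convenient because \<open>\<langle>x\<rangle>\<^sup>2\<^sup>n\<close> dominates the tensor product of the
  one-dimensional integrable weights \<open>1 + x\<^sub>i\<^sup>2\<close>.\<close>

lemma nn_integral_bracket_finite:
  "(\<integral>\<^sup>+ x. ennreal (inverse (bracket (x :: real^'n::finite) ^ (2 * CARD('n)))) \<partial>lborel) < \<infinity>"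
proof -
  have le: "inverse (bracket x ^ (2 * CARD('n))) \<le> (\<Prod>b\<in>Basis. inverse (1 + (x \<bullet> b)\<^sup>2))" for x :: "real^'n"
  proof -
    have "(\<Prod>b\<in>(Basis :: (real^'n) set). 1 + (x \<bullet> b)\<^sup>2) \<le> (\<Prod>b\<in>(Basis :: (real^'n) set). bracket x ^ 2)"
    proof (intro prod_mono conjI)
      fix b :: "real^'n" assume b: "b \<in> Basis"
      have "\<bar>x \<bullet> b\<bar> \<le> norm x" using Basis_le_norm[OF b] .
      hence "(x \<bullet> b)\<^sup>2 \<le> (norm x)\<^sup>2" by (metis abs_ge_zero power2_abs power_mono)
      thus "1 + (x \<bullet> b)\<^sup>2 \<le> bracket x ^ 2" by (simp add: bracket_power2)
    qed auto
    also have "\<dots> = bracket x ^ (2 * CARD('n))" by (simp add: power_mult)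
    finally have "inverse (bracket x ^ (2 * CARD('n))) \<le> inverse (\<Prod>b\<in>(Basis :: (real^'n) set). 1 + (x \<bullet> b)\<^sup>2)"
      by (intro le_imp_inverse_le prod_pos) (auto simp: add_pos_nonneg)
    thus ?thesis
      using prod_inversef[of "\<lambda>b. 1 + (x \<bullet> b)\<^sup>2" "Basis :: (real^'n) set"] by (simp add: o_def)
  qed
  have one: "(\<integral>\<^sup>+ t. ennreal (inverse (1 + t\<^sup>2)) \<partial>lborel) < \<infinity>"
  proof -
    have "integrable lborel (\<lambda>t::real. inverse (1 + t\<^sup>2))"
      using integrable_inverse_1_plus_square by (simp add: set_integrable_def einterval_def)
    from integrableD(2)[OF this] show ?thesis
      by (simp add: top.not_eq_extremum abs_of_nonneg)
  qed
  have "(\<integral>\<^sup>+ x. ennreal (inverse (bracket (x :: real^'n) ^ (2 * CARD('n)))) \<partial>lborel)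
      \<le> (\<integral>\<^sup>+ x. (\<Prod>b\<in>(Basis :: (real^'n) set). ennreal (inverse (1 + (x \<bullet> b)\<^sup>2))) \<partial>lborel)"
    by (intro nn_integral_mono) (use le in \<open>auto simp: prod_ennreal intro!: ennreal_leI\<close>)
  also have "\<dots> = (\<Prod>b\<in>(Basis :: (real^'n) set). \<integral>\<^sup>+ t. ennreal (inverse (1 + t\<^sup>2)) \<partial>lborel)"
    by (rule nn_integral_lborel_prod) auto
  also have "\<dots> < \<infinity>" using one
    by (simp add: power_less_top_ennreal)
  finally show ?thesis .
qed

lemma integrable_inverse_bracket:
  "integrable lborel (\<lambda>x :: real^'n::finite. inverse (bracket x ^ (2 * CARD('n))))"
proof (rule integrableI_nonneg)
  show "(\<integral>\<^sup>+ x. ennreal (inverse (bracket (x::real^'n) ^ (2 * CARD('n)))) \<partial>lborel) < \<infinity>"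
    by (rule nn_integral_bracket_finite)
qed (auto intro!: AE_I2)

lemma integrable_bracket_bound:
  fixes f :: "real^'n::finite \<Rightarrow> 'b::{banach, second_countable_topology}"
  assumes "f \<in> borel_measurable lborel"
    and "\<And>x. bracket x ^ (2 * CARD('n)) * norm (f x) \<le> C"
  shows "integrable lborel f"
proof (rule Bochner_Integration.integrable_bound)
  show "integrable lborel (\<lambda>x::real^'n. C * inverse (bracket x ^ (2 * CARD('n))))"
    using integrable_inverse_bracket by auto
  show "AE x in lborel. norm (f x) \<le> norm (C * inverse (bracket x ^ (2 * CARD('n))))"
  proof (intro AE_I2)
    fix x :: "real^'n"
    have "norm (f x) \<le> C * inverse (bracket x ^ (2 * CARD('n)))"
      using assms(2)[of x] by (simp add: field_simps)
    thus "norm (f x) \<le> norm (C * inverse (bracket x ^ (2 * CARD('n))))" by simp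
  qed
qed (rule assms)

lemma rapidD: "rapid f \<Longrightarrow> \<exists>B\<ge>0. \<forall>x. bracket x ^ k * cmod (f x) \<le> B"
  unfolding rapid_def by (meson bracket_nonneg mult_nonneg_nonneg norm_ge_zero order_trans zero_le_power)

lemma rapid_integrable:
  assumes "rapid f" "f \<in> borel_measurable borel" shows "integrable lborel f"
  using rapidD[OF assms(1)] integrable_bracket_bound[of f] assms(2) by auto

lemma schwartz_integrable: "f \<in> schwartz \<Longrightarrow> integrable lborel f"
  by (intro rapid_integrable schwartz_rapid) auto

lemma rapid_bounded: "rapid f \<Longrightarrow> \<exists>B. \<forall>x. cmod (f x) \<le> B"
  using rapidD[of f 0] by auto

lemma rapid_powr_integrable:
  assumes "rapid f" "f \<in> borel_measurable borel"
  shows "integrable lborel (\<lambda>x. bracket x powr s * cmod (f x))"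
proof -
  have [measurable]: "f \<in> borel_measurable borel" by fact
  obtain k :: nat where k: "s \<le> k" using real_arch_simple by blast
  obtain B where B: "\<And>x. bracket x ^ (2 * CARD('a) + k) * cmod (f x) \<le> B" 
    using rapidD[OF assms(1)] by blast
  show ?thesis
  proof (rule integrable_bracket_bound)
    fix x :: "real^'a"
    have "bracket x powr s \<le> bracket x ^ k"
      using powr_mono[OF k bracket_ge_1[of x]] by (simp add: powr_realpow)
    hence "bracket x ^ (2 * CARD('a)) * (bracket x powr s * cmod (f x)) \<le> bracket x ^ (2 * CARD('a)) * (bracket x ^ k * cmod (f x))"
      by (intro mult_left_mono mult_right_mono) auto
    also have "\<dots> \<le> B" using B[of x] by (simp add: power_add mult_ac)
    finally show "bracket x ^ (2 * CARD('a)) * norm (bracket x powr s * cmod (f x)) \<le> B" by (simp add: abs_mult)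
  qed measurable
qed

section \<open>The Fourier transform\<close>

lemma norm_character [simp]: "cmod (exp (- (\<i> * complex_of_real r))) = 1"
  using norm_exp_i_times[of "- r"] by simp

lemma character_measurable [measurable]: "(\<lambda>x. exp (- (\<i> * of_real (x \<bullet> \<xi>)))) \<in> borel_measurable borel"
  by (intro borel_measurable_continuous_onI continuous_intros)

lemma character_integrable:
  "integrable lborel f \<Longrightarrow> integrable lborel (\<lambda>x. f x * exp (- (\<i> * of_real (x \<bullet> \<xi>))))"
  by (rule integrable_mult_bounded(1)[where B = 1]) auto

lemma norm_fourier_le:
  assumes "integrable lborel f" shows "cmod (fourier f \<xi>) \<le> (LINT x|lborel. cmod (f x))"
  unfolding fourier_def
  by (rule order_trans[OF integral_norm_bound]) (simp add: norm_mult)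

lemma continuous_fourier:
  assumes "integrable lborel f" shows "continuous_on UNIV (fourier f)"
  unfolding continuous_on_sequentially
proof (intro allI ballI impI, elim conjE)
  fix X :: "nat \<Rightarrow> real^'a" and a assume "X \<longlonglongrightarrow> a"
  show "(fourier f \<circ> X) \<longlonglongrightarrow> fourier f a"
    unfolding fourier_def o_def
  proof (rule integral_dominated_convergence[where w = "\<lambda>x. cmod (f x)"])
    show "AE x in lborel. (\<lambda>n. f x * exp (- (\<i> * of_real (x \<bullet> X n)))) \<longlonglongrightarrow> f x * exp (- (\<i> * of_real (x \<bullet> a)))"
      by (intro AE_I2 tendsto_intros \<open>X \<longlonglongrightarrow> a\<close>)
  qed (use assms in \<open>auto simp: norm_mult\<close>)
qed

lemma fourier_measurable [measurable]: "integrable lborel f \<Longrightarrow> fourier f \<in> borel_measurable borel"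
  by (intro borel_measurable_continuous_onI continuous_fourier)

lemma fourier_add:
  "integrable lborel f \<Longrightarrow> integrable lborel g \<Longrightarrow> fourier (\<lambda>x. f x + g x) \<xi> = fourier f \<xi> + fourier g \<xi>"
  unfolding fourier_def distrib_right by (intro Bochner_Integration.integral_add character_integrable)

lemma fourier_cmult: "fourier (\<lambda>x. c * f x) \<xi> = c * fourier f \<xi>"
  unfolding fourier_def by (simp add: mult.assoc)

lemma fourier_diff:
  "integrable lborel f \<Longrightarrow> integrable lborel g \<Longrightarrow> fourier (\<lambda>x. f x - g x) \<xi> = fourier f \<xi> - fourier g \<xi>"
  unfolding fourier_def left_diff_distrib by (intro Bochner_Integration.integral_diff character_integrable)

text \<open>The integral of a derivative vanishes because the integral of every difference
  \<open>f (x + t e\<^sub>j) - f x\<close> does.\<close>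

lemma integral_partial_eq_0:
  fixes f :: "real^'n::finite \<Rightarrow> complex"
  assumes f: "f \<in> schwartz"
  shows "(LINT x|lborel. partial j f x) = 0"
proof -
  let ?N = "2 * CARD('n)" and ?e = "axis j 1 :: real^'n"
  note [measurable] = schwartz_measurable[OF f]
  obtain B where B: "B \<ge> 0" "\<And>x. bracket x ^ ?N * cmod (partial j f x) \<le> B"
    using rapidD[OF schwartz_rapid[OF schwartz_partial[OF f]]] by blast
  define q where "q n x = of_real (real (Suc n)) * (f (x + (1 / real (Suc n)) *\<^sub>R ?e) - f x)" for n x
  have line: "((\<lambda>t. f (x + t *\<^sub>R ?e)) has_derivative (\<lambda>t. t *\<^sub>R partial j f (x + u *\<^sub>R ?e))) (at u)" for x u
  proof -
    have "((\<lambda>t. x + t *\<^sub>R ?e) has_derivative (\<lambda>t. t *\<^sub>R ?e)) (at u)"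
      by (auto intro!: derivative_eq_intros)
    from diff_chain_at[OF this differentiable_partial[OF schwartz_differentiable[OF f]]]
    have "((\<lambda>t. f (x + t *\<^sub>R ?e)) has_derivative
        (\<lambda>t. frechet_derivative f (at (x + u *\<^sub>R ?e)) (t *\<^sub>R ?e))) (at u)" by (simp add: o_def)
    thus ?thesis
      unfolding partial_def
      using linear_frechet_derivative[OF schwartz_differentiable[OF f]] by (simp add: linear_cmul)
  qed
  have bound: "cmod (q n x) \<le> 4 ^ ?N * B * inverse (bracket x ^ ?N)" for n x
  proof -
    have "norm (f (x + (1 / real (Suc n)) *\<^sub>R ?e) - f (x + 0 *\<^sub>R ?e))
        \<le> (4 ^ ?N * B * inverse (bracket x ^ ?N)) * norm (1 / real (Suc n) - 0)"
    proof (rule differentiable_bound[where S = "{0..1}" and f = "\<lambda>t. f (x + t *\<^sub>R ?e)"])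
      fix u :: real assume u: "u \<in> {0..1}"
      show "((\<lambda>t. f (x + t *\<^sub>R ?e)) has_derivative (\<lambda>t. t *\<^sub>R partial j f (x + u *\<^sub>R ?e))) (at u within {0..1})"
        using line has_derivative_at_withinI by blast
      have "bracket (- (u *\<^sub>R ?e)) \<le> 2"
        unfolding bracket_minus bracket_def using u by (intro real_le_lsqrt) (auto simp: power_le_one intro: order_trans[OF power_le_one])
      moreover have "bracket x \<le> 2 * bracket (x + u *\<^sub>R ?e) * bracket (- (u *\<^sub>R ?e))"
        using bracket_add_le[of "x + u *\<^sub>R ?e" "- (u *\<^sub>R ?e)"] by simp
      ultimately have "bracket x \<le> 2 * bracket (x + u *\<^sub>R ?e) * 2"
        by (meson bracket_nonneg mult_left_mono mult_nonneg_nonneg order_trans zero_le_numeral)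
      hence "bracket x \<le> 4 * bracket (x + u *\<^sub>R ?e)" by simp
      hence "bracket x ^ ?N \<le> 4 ^ ?N * bracket (x + u *\<^sub>R ?e) ^ ?N"
        using power_mono[of "bracket x" "4 * bracket (x + u *\<^sub>R ?e)" ?N] by (simp add: power_mult_distrib)
      hence "bracket x ^ ?N * cmod (partial j f (x + u *\<^sub>R ?e))
          \<le> 4 ^ ?N * (bracket (x + u *\<^sub>R ?e) ^ ?N * cmod (partial j f (x + u *\<^sub>R ?e)))"
        using mult_right_mono[OF _ norm_ge_zero] by (metis mult.assoc)
      also have "\<dots> \<le> 4 ^ ?N * B" by (intro mult_left_mono B) auto
      finally have c: "cmod (partial j f (x + u *\<^sub>R ?e)) \<le> 4 ^ ?N * B * inverse (bracket x ^ ?N)"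
        by (simp add: field_simps)
      show "onorm (\<lambda>t. t *\<^sub>R partial j f (x + u *\<^sub>R ?e)) \<le> 4 ^ ?N * B * inverse (bracket x ^ ?N)"
        by (rule onorm_le) (use c in \<open>auto intro!: mult_left_mono simp: mult.commute\<close>)
    qed auto
    hence "cmod (f (x + (1 / real (Suc n)) *\<^sub>R ?e) - f x) \<le> (4 ^ ?N * B * inverse (bracket x ^ ?N)) * (1 / real (Suc n))"
      by (simp del: of_nat_Suc)
    from mult_left_mono[OF this, of "real (Suc n)"]
    have "real (Suc n) * cmod (f (x + (1 / real (Suc n)) *\<^sub>R ?e) - f x) \<le> 4 ^ ?N * B * inverse (bracket x ^ ?N)"
      by (simp del: of_nat_Suc)
    thus ?thesis by (simp only: q_def norm_mult norm_of_real abs_of_nat)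
  qed
  have lim: "(\<lambda>n. q n x) \<longlonglongrightarrow> partial j f x" for x
  proof -
    have l0: "((\<lambda>t. norm (f (x + t *\<^sub>R ?e) - f x - t *\<^sub>R partial j f x) / norm t) \<longlongrightarrow> 0) (at 0)"
      using line[of x 0] by (simp add: has_derivative_at)
    have eq: "norm (f (x + t *\<^sub>R ?e) - f x - t *\<^sub>R partial j f x) / norm t
        = norm ((f (x + t *\<^sub>R ?e) - f x) /\<^sub>R t - partial j f x)" if "t \<noteq> 0" for t
    proof -
      have "(f (x + t *\<^sub>R ?e) - f x) /\<^sub>R t - partial j f x
          = (f (x + t *\<^sub>R ?e) - f x - t *\<^sub>R partial j f x) /\<^sub>R t"
        using that by (simp add: scaleR_diff_right)
      thus ?thesis by (simp add: divide_inverse mult.commute)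
    qed
    have "((\<lambda>t. norm ((f (x + t *\<^sub>R ?e) - f x) /\<^sub>R t - partial j f x)) \<longlongrightarrow> 0) (at 0)"
      by (rule Lim_transform_eventually[OF l0]) (unfold eventually_at_filter, intro always_eventually allI impI eq)
    hence "((\<lambda>t. (f (x + t *\<^sub>R ?e) - f x) /\<^sub>R t) \<longlongrightarrow> partial j f x) (at 0)"
      by (rule LIM_zero_cancel[OF tendsto_norm_zero_cancel])
    moreover have "filterlim (\<lambda>n. 1 / real (Suc n)) (at 0) sequentially"
      unfolding filterlim_at using lim_1_over_n[THEN LIMSEQ_Suc] by auto
    ultimately have "(\<lambda>n. (f (x + (1 / real (Suc n)) *\<^sub>R ?e) - f x) /\<^sub>R (1 / real (Suc n))) \<longlonglongrightarrow> partial j f x"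
      by (rule filterlim_compose)
    thus ?thesis by (simp add: q_def scaleR_conv_of_real)
  qed
  have "(\<lambda>n. LINT x|lborel. q n x) \<longlonglongrightarrow> (LINT x|lborel. partial j f x)"
  proof (rule integral_dominated_convergence[where w = "\<lambda>x. 4 ^ ?N * B * inverse (bracket x ^ ?N)"])
    show "integrable lborel (\<lambda>x::real^'n. 4 ^ ?N * B * inverse (bracket x ^ ?N))"
      using integrable_inverse_bracket by auto
    show "partial j f \<in> borel_measurable lborel"
      using schwartz_partial[OF f] by auto
    show "q n \<in> borel_measurable lborel" for n unfolding q_def by measurable
  qed (use lim bound in auto)
  moreover have "(LINT x|lborel. q n x) = 0" for n
  proof -
    have "integrable lborel (\<lambda>x. f (x + a))" for a
      using integrable_translate[of f a] schwartz_integrable[OF f] by simp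
    thus ?thesis unfolding q_def
      by (simp add: integral_translate schwartz_integrable[OF f])
  qed
  ultimately show ?thesis by (simp add: LIMSEQ_const_iff)
qed

lemma fourier_partial:
  assumes f: "f \<in> schwartz"
  shows "fourier (partial j f) \<xi> = \<i> * of_real (\<xi> $ j) * fourier f \<xi>"
proof -
  let ?e = "\<lambda>x. exp (- (\<i> * complex_of_real (x \<bullet> \<xi>)))"
  have e: "(\<lambda>x. f x * ?e x) \<in> schwartz"
    using schwartz_modulate[OF f, of "- \<xi>"] by (simp add: mult.commute)
  have d: "(?e has_derivative (\<lambda>h. - \<i> * of_real (h \<bullet> \<xi>) * ?e x)) (at x)" for x
    using character_has_derivative[of "- \<xi>" x] by simp
  have "partial j (\<lambda>x. f x * ?e x) = (\<lambda>x. partial j f x * ?e x + f x * partial j ?e x)"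
    by (rule partial_mult) (use d f in \<open>auto simp: schwartz_differentiable intro: differentiableI\<close>)
  also have "partial j ?e = (\<lambda>x. - \<i> * of_real (\<xi> $ j) * ?e x)"
    using partial_eq[OF d] by (simp add: inner_axis' fun_eq_iff)
  finally have "0 = (LINT x|lborel. partial j f x * ?e x + (- \<i> * of_real (\<xi> $ j)) * (f x * ?e x))"
    using integral_partial_eq_0[OF e, of j] by (simp add: mult_ac)
  also have "\<dots> = fourier (partial j f) \<xi> + (- \<i> * of_real (\<xi> $ j)) * fourier f \<xi>"
    unfolding fourier_def
    using character_integrable[OF schwartz_integrable[OF schwartz_partial[OF f]]]
      character_integrable[OF schwartz_integrable[OF f]]
    by (subst Bochner_Integration.integral_add) auto
  finally show ?thesis by simp
qed

text \<open>By Taylor's formula for the character, the remainder is at most \<open>\<bar>h\<bar>\<^sup>2\<close> times the integral of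
  \<open>\<langle>x\<rangle>\<^sup>2 \<bar>f x\<bar>\<close>.\<close>

lemma fourier_has_derivative:
  fixes f :: "real^'n::finite \<Rightarrow> complex"
  assumes f: "f \<in> schwartz"
  shows "(fourier f has_derivative
    (\<lambda>h. \<Sum>j\<in>UNIV. of_real (h $ j) * fourier (\<lambda>x. - \<i> * (of_real (x $ j) * f x)) \<xi>)) (at \<xi>)"
proof -
  let ?D = "\<lambda>h. \<Sum>j\<in>UNIV. of_real (h $ j) * fourier (\<lambda>x. - \<i> * (of_real (x $ j) * f x)) \<xi>"
  let ?C = "LINT x|lborel. bracket x powr 2 * cmod (f x)"
  have m [measurable]: "f \<in> borel_measurable borel" using f by auto
  have intC: "integrable lborel (\<lambda>x. bracket x powr 2 * cmod (f x))"
    by (rule rapid_powr_integrable[OF schwartz_rapid[OF f] m])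
  have coord: "(\<lambda>x. - \<i> * (of_real (x $ j) * f x)) \<in> schwartz" for j
    by (intro schwartz_cmult schwartz_coordinate f)
  have D: "?D h = (LINT x|lborel. f x * (- \<i> * of_real (x \<bullet> h)) * exp (- (\<i> * of_real (x \<bullet> \<xi>))))" for h
  proof -
    have "?D h = (LINT x|lborel. (\<Sum>j\<in>UNIV. of_real (h $ j) * ((- \<i> * (of_real (x $ j) * f x)) * exp (- (\<i> * of_real (x \<bullet> \<xi>))))))"
      unfolding fourier_def
      by (subst Bochner_Integration.integral_sum)
         (intro integrable_mult_right character_integrable schwartz_integrable[OF coord], simp)
    also have "\<dots> = (LINT x|lborel. f x * (- \<i> * of_real (x \<bullet> h)) * exp (- (\<i> * of_real (x \<bullet> \<xi>))))"
      by (intro Bochner_Integration.integral_cong)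
         (auto simp: inner_vec_def sum_distrib_left sum_distrib_right mult_ac)
    finally show ?thesis .
  qed
  have intD: "integrable lborel (\<lambda>x. f x * (- \<i> * of_real (x \<bullet> h)) * exp (- (\<i> * of_real (x \<bullet> \<xi>))))" for h
  proof -
    have "(\<lambda>x. f x * (- \<i> * of_real (x \<bullet> h))) = (\<lambda>x. \<Sum>j\<in>UNIV. of_real (h $ j) * (- \<i> * (of_real (x $ j) * f x)))"
      by (auto simp: inner_vec_def sum_distrib_left sum_distrib_right mult_ac)
    moreover have "integrable lborel (\<lambda>x. \<Sum>j\<in>UNIV. of_real (h $ j) * (- \<i> * (of_real (x $ j) * f x)))"
      by (intro Bochner_Integration.integrable_sum integrable_mult_right schwartz_integrable coord)
    ultimately show ?thesis by (intro character_integrable) simp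
  qed
  show ?thesis
  proof (rule has_derivativeI_sandwich[of 1, where H = "\<lambda>y. ?C * norm (y - \<xi>)"])
    show "bounded_linear ?D"
      by (intro bounded_linear_sum bounded_linear_mult_const bounded_linear_compose[OF bounded_linear_of_real] bounded_linear_vec_nth)
    show "((\<lambda>y. ?C * norm (y - \<xi>)) \<longlongrightarrow> 0) (at \<xi>)"
      by (rule tendsto_eq_intros refl | simp)+
    fix y assume y: "y \<noteq> \<xi>"
    let ?h = "y - \<xi>"
    have fi: "integrable lborel f" by (rule schwartz_integrable[OF f])
    have "fourier f y - fourier f \<xi> - ?D ?h = (LINT x|lborel. f x * exp (- (\<i> * of_real (x \<bullet> y)))
        - f x * exp (- (\<i> * of_real (x \<bullet> \<xi>))) - f x * (- \<i> * of_real (x \<bullet> ?h)) * exp (- (\<i> * of_real (x \<bullet> \<xi>))))"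
      unfolding D unfolding fourier_def using character_integrable[OF fi] intD
      by (simp only: Bochner_Integration.integral_diff Bochner_Integration.integrable_diff)
    also have "norm \<dots> \<le> (LINT x|lborel. (norm ?h)\<^sup>2 * (bracket x powr 2 * cmod (f x)))"
    proof (rule Bochner_Integration.integral_norm_bound_integral)
      fix x :: "real^'n"
      let ?t = "- (x \<bullet> ?h)"
      have a: "cmod (iexp ?t - (\<Sum>k \<le> 1. (\<i> * ?t)^k / fact k)) \<le> \<bar>?t\<bar> ^ Suc 1 / fact (Suc 1)" by (rule iexp_approx1)
      have "\<bar>?t\<bar> ^ Suc 1 / fact (Suc 1) \<le> \<bar>?t\<bar> ^ 2" by (simp add: power2_eq_square)
      with a have a: "cmod (iexp ?t - (\<Sum>k \<le> 1. (\<i> * ?t)^k / fact k)) \<le> \<bar>?t\<bar> ^ 2" by linarith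
      have "f x * exp (- (\<i> * of_real (x \<bullet> y)))
        - f x * exp (- (\<i> * of_real (x \<bullet> \<xi>))) - f x * (- \<i> * of_real (x \<bullet> ?h)) * exp (- (\<i> * of_real (x \<bullet> \<xi>)))
        = f x * exp (- (\<i> * of_real (x \<bullet> \<xi>))) * (iexp ?t - (\<Sum>k \<le> 1. (\<i> * ?t)^k / fact k))"
        by (simp add: algebra_simps inner_diff_right exp_diff exp_minus exp_add field_simps)
      also have "norm \<dots> \<le> cmod (f x) * (\<bar>?t\<bar> ^ 2)"
        using a unfolding norm_mult norm_character by (intro mult_mono) auto
      also have "\<dots> \<le> cmod (f x) * (norm x * norm ?h) ^ 2"
        by (intro mult_left_mono power_mono) (auto simp: Cauchy_Schwarz_ineq2)
      also have "\<dots> \<le> cmod (f x) * (bracket x * norm ?h) ^ 2"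
        by (intro mult_left_mono power_mono mult_right_mono norm_le_bracket) auto
      also have "\<dots> = (norm ?h)\<^sup>2 * (bracket x powr 2 * cmod (f x))"
        by (simp add: power_mult_distrib powr_numeral)
      finally show "norm (f x * exp (- (\<i> * of_real (x \<bullet> y)))
        - f x * exp (- (\<i> * of_real (x \<bullet> \<xi>))) - f x * (- \<i> * of_real (x \<bullet> ?h)) * exp (- (\<i> * of_real (x \<bullet> \<xi>))))
        \<le> (norm ?h)\<^sup>2 * (bracket x powr 2 * cmod (f x))" .
    qed (intro Bochner_Integration.integrable_diff character_integrable fi intD integrable_mult_right intC)+
    also have "\<dots> = ?C * (norm ?h)\<^sup>2" by simp
    finally show "norm (fourier f y - fourier f \<xi> - ?D ?h) / norm ?h \<le> ?C * norm ?h"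
      using y by (simp add: divide_simps power2_eq_square mult.assoc)
  qed auto
qed

lemma partial_fourier:
  fixes f :: "real^'n::finite \<Rightarrow> complex"
  assumes f: "f \<in> schwartz"
  shows "partial j (fourier f) = fourier (\<lambda>x. - \<i> * (of_real (x $ j) * f x))"
proof
  fix \<xi> :: "real^'n"
  show "partial j (fourier f) \<xi> = fourier (\<lambda>x. - \<i> * (of_real (x $ j) * f x)) \<xi>"
    unfolding partial_eq[OF fourier_has_derivative[OF f]] axis_def
    by (subst sum.remove[of _ j]) (auto intro!: sum.neutral)
qed

text \<open>\<open>\<langle>\<xi>\<rangle>\<^sup>2\<close> times the transform of \<open>f\<close> is the transform of \<open>f - \<Delta>f\<close>.\<close>

lemma bracket_power_fourier_bounded:
  "f \<in> schwartz \<Longrightarrow> \<exists>B. \<forall>\<xi>. bracket \<xi> ^ (2 * k) * cmod (fourier f \<xi>) \<le> B"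
proof (induction k arbitrary: f)
  case 0
  thus ?case using norm_fourier_le[OF schwartz_integrable] by auto
next
  case (Suc k)
  let ?g = "\<lambda>x. f x + (\<Sum>j\<in>UNIV. - 1 * partial j (partial j f) x)"
  have sum: "(\<lambda>x. \<Sum>j\<in>UNIV. - 1 * partial j (partial j f) x) \<in> schwartz"
    by (intro schwartz_sum schwartz_cmult schwartz_partial Suc.prems)
  hence "?g \<in> schwartz" by (intro schwartz_add Suc.prems)
  from Suc.IH[OF this] obtain B where B: "\<And>\<xi>. bracket \<xi> ^ (2 * k) * cmod (fourier ?g \<xi>) \<le> B" by blast
  have "fourier ?g \<xi> = of_real (bracket \<xi> ^ 2) * fourier f \<xi>" for \<xi>
  proof -
    have "fourier ?g \<xi> = fourier f \<xi> + fourier (\<lambda>x. \<Sum>j\<in>UNIV. - 1 * partial j (partial j f) x) \<xi>"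
      by (intro fourier_add schwartz_integrable sum Suc.prems)
    also have "fourier (\<lambda>x. \<Sum>j\<in>UNIV. - 1 * partial j (partial j f) x) \<xi> =
        (\<Sum>j\<in>UNIV. - 1 * fourier (partial j (partial j f)) \<xi>)"
      unfolding fourier_def sum_distrib_right mult.assoc
      by (subst Bochner_Integration.integral_sum)
         (intro integrable_mult_right character_integrable schwartz_integrable schwartz_partial Suc.prems, simp)
    also have "\<dots> = (\<Sum>j\<in>UNIV. of_real ((\<xi> $ j)\<^sup>2)) * fourier f \<xi>"
      by (simp add: fourier_partial schwartz_partial Suc.prems sum_distrib_right sum_distrib_left power2_eq_square mult_ac)
    also have "(\<Sum>j\<in>UNIV. of_real ((\<xi> $ j)\<^sup>2)) = complex_of_real ((norm \<xi>)\<^sup>2)"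
      by (simp add: norm_vec_def L2_set_def sum_nonneg)
    finally show ?thesis by (simp add: bracket_power2 algebra_simps)
  qed
  hence "bracket \<xi> ^ (2 * Suc k) * cmod (fourier f \<xi>) = bracket \<xi> ^ (2 * k) * cmod (fourier ?g \<xi>)" for \<xi>
    by (simp add: norm_mult power2_eq_square mult_ac)
  thus ?case using B by metis
qed

lemma rapid_fourier: "f \<in> schwartz \<Longrightarrow> rapid (fourier f)"
  unfolding rapid_def
proof
  fix k assume "f \<in> schwartz"
  then obtain B where B: "\<And>\<xi>. bracket \<xi> ^ (2 * k) * cmod (fourier f \<xi>) \<le> B"
    using bracket_power_fourier_bounded by blast
  have "bracket \<xi> ^ k * cmod (fourier f \<xi>) \<le> B" for \<xi>
  proof -
    have "bracket \<xi> ^ k \<le> bracket \<xi> ^ (2 * k)" by (intro power_increasing bracket_ge_1) simp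
    hence "bracket \<xi> ^ k * cmod (fourier f \<xi>) \<le> bracket \<xi> ^ (2 * k) * cmod (fourier f \<xi>)"
      by (intro mult_right_mono) auto
    with B[of \<xi>] show ?thesis by linarith
  qed
  thus "\<exists>B. \<forall>\<xi>. bracket \<xi> ^ k * cmod (fourier f \<xi>) \<le> B" by blast
qed

lemma schwartz_fourier: assumes "f \<in> schwartz" shows "fourier f \<in> schwartz"
proof -
  have "smooth_upto rapid n (fourier f)" for n
    using assms
  proof (induction n arbitrary: f)
    case (Suc n)
    have "smooth_upto rapid n (fourier (\<lambda>x. - \<i> * (of_real (x $ j) * f x)))" for j
      by (intro Suc.IH schwartz_cmult schwartz_coordinate Suc.prems)
    thus ?case using Suc.prems
      by (simp only: smooth_upto.simps partial_fourier[OF Suc.prems] rapid_fourier)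
         (blast intro: differentiableI[OF fourier_has_derivative])
  qed (auto intro: differentiableI[OF fourier_has_derivative] rapid_fourier)
  thus ?thesis unfolding schwartz_iff by blast
qed

section \<open>Gaussians, inversion and Plancherel\<close>

lemma measurable_cnj [measurable]: "f \<in> borel_measurable M \<Longrightarrow> (\<lambda>x. cnj (f x)) \<in> borel_measurable M"
  by (rule borel_measurable_continuous_on[OF continuous_on_cnj[OF continuous_on_id]])

definition gauss :: "real \<Rightarrow> real^'n::finite \<Rightarrow> real" where
  "gauss a x = exp (- (a * (norm x)\<^sup>2 / 2))"

text \<open>The Fourier transform of \<^term>\<open>gauss a\<close>; up to the factor \<open>(2\<pi>)\<^sup>n\<close> this is the heat kernel
  at time \<open>a\<close>.\<close>

definition heat :: "real \<Rightarrow> real^'n::finite \<Rightarrow> real" where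
  "heat a x = sqrt (2 * pi / a) ^ CARD('n) * exp (- ((norm x)\<^sup>2 / (2 * a)))"

lemma gauss_nonneg [simp]: "0 \<le> gauss a x" and gauss_pos [simp]: "0 < gauss a x"
  by (simp_all add: gauss_def)

lemma gauss_le_1: "0 \<le> a \<Longrightarrow> gauss a x \<le> 1"
  by (simp add: gauss_def)

lemma heat_nonneg [simp]: "0 < a \<Longrightarrow> 0 \<le> heat a x" by (simp add: heat_def)

lemma heat_minus [simp]: "heat a (- x) = heat a x" by (simp add: heat_def)

lemma heat_minus_commute: "heat a (x - y) = heat a (y - x)" by (simp add: heat_def norm_minus_commute)

lemma gauss_measurable [measurable]: "gauss a \<in> borel_measurable borel"
  unfolding gauss_def by measurable

lemma heat_measurable [measurable]: "heat a \<in> borel_measurable borel"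
  unfolding heat_def by measurable

lemma partial_gauss:
  fixes j :: "'n::finite"
  shows "partial j (\<lambda>x. complex_of_real (gauss a x)) = (\<lambda>x. of_real (- a) * (of_real (x $ j) * of_real (gauss a x)))"
    and gauss_differentiable: "(\<lambda>x. complex_of_real (gauss a x)) differentiable (at (x0 :: real^'n))"
proof -
  have d: "((\<lambda>x. complex_of_real (gauss a x)) has_derivative
     (\<lambda>h. of_real (- a * (x \<bullet> h) * gauss a x))) (at x)" for x :: "real^'n"
  proof -
    have "((\<lambda>x. gauss a x) has_derivative (\<lambda>h. - a * (x \<bullet> h) * gauss a x)) (at x)"
      unfolding gauss_def power2_norm_eq_inner
      by (auto intro!: derivative_eq_intros simp: inner_commute fun_eq_iff)
    thus ?thesis by (rule has_derivative_of_real)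
  qed
  show "partial j (\<lambda>x. complex_of_real (gauss a x)) = (\<lambda>x. of_real (- a) * (of_real (x $ j) * of_real (gauss a x)))"
    using partial_eq[OF d] by (simp add: fun_eq_iff inner_axis mult_ac)
  show "(\<lambda>x. complex_of_real (gauss a x)) differentiable (at x0)"
    by (rule differentiableI[OF d])
qed

lemma rapid_gauss:
  assumes "0 < a" shows "rapid (\<lambda>x. complex_of_real (gauss a x))"
  unfolding rapid_def
proof
  fix k :: nat
  have "((\<lambda>r. sqrt (1 + r\<^sup>2) ^ k * exp (- (a * r\<^sup>2 / 2))) \<longlongrightarrow> 0) at_top"
    using assms by real_asymp
  hence "eventually (\<lambda>r. sqrt (1 + r\<^sup>2) ^ k * exp (- (a * r\<^sup>2 / 2)) < 1) at_top"
    by (rule order_tendstoD) simp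
  then obtain R where R: "\<And>r. r \<ge> R \<Longrightarrow> sqrt (1 + r\<^sup>2) ^ k * exp (- (a * r\<^sup>2 / 2)) < 1"
    unfolding eventually_at_top_linorder by blast
  have "bracket x ^ k * gauss a x \<le> max 1 (sqrt (1 + R\<^sup>2) ^ k)" for x :: "real^'a"
  proof (cases "norm x \<ge> R")
    case True
    hence "bracket x ^ k * gauss a x < 1" using R[of "norm x"] by (simp add: bracket_def gauss_def)
    thus ?thesis by linarith
  next
    case False
    have "bracket x ^ k * gauss a x \<le> sqrt (1 + R\<^sup>2) ^ k * 1"
      using False assms by (intro mult_mono power_mono)
        (auto simp: bracket_def gauss_le_1 intro!: power_mono)
    thus ?thesis by simp
  qed
  thus "\<exists>B. \<forall>x::real^'a. bracket x ^ k * cmod (complex_of_real (gauss a x)) \<le> B"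
    by (intro exI[of _ "max 1 (sqrt (1 + R\<^sup>2) ^ k)"]) simp
qed

lemma schwartz_gauss:
  assumes "0 < a" shows "(\<lambda>x :: real^'n::finite. complex_of_real (gauss a x)) \<in> schwartz"
  unfolding schwartz_iff
proof
  fix n
  show "smooth_upto rapid n (\<lambda>x :: real^'n. complex_of_real (gauss a x))"
  proof (induction n)
    case (Suc n)
    have "smooth_upto rapid n (\<lambda>x :: real^'n. of_real (- a) * (of_real (x $ j) * complex_of_real (gauss a x)))" for j
      by (intro smooth_rapid_mult smooth_slow_const smooth_slow_coordinate Suc)
    thus ?case
      unfolding smooth_upto.simps partial_gauss
      using rapid_gauss[OF assms] gauss_differentiable by blast
  qed (simp add: rapid_gauss[OF assms] gauss_differentiable)
qed

lemma gauss_integrable: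
  assumes "0 < a" shows "integrable lborel (gauss a :: real^'n::finite \<Rightarrow> real)"
  using schwartz_integrable[OF schwartz_gauss[OF assms, where 'n='n]]
  by (simp only: complex_of_real_integrable_eq)

lemma integral_lborel_prod:
  fixes f :: "'a::euclidean_space \<Rightarrow> real \<Rightarrow> complex"
  assumes "\<And>b. b \<in> Basis \<Longrightarrow> integrable lborel (f b)"
  shows "(LINT x|lborel. (\<Prod>b\<in>(Basis :: 'a set). f b (x \<bullet> b))) = (\<Prod>b\<in>Basis. LINT t|lborel. f b t)"
proof -
  interpret product_sigma_finite "\<lambda>b::'a. lborel :: real measure"
    by standard
  have [measurable]: "f b \<in> borel_measurable borel" if "b \<in> Basis" for b using assms[OF that] by auto
  have "(LINT x|lborel. (\<Prod>b\<in>(Basis :: 'a set). f b (x \<bullet> b))) =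
      (LINT g|(\<Pi>\<^sub>M b\<in>Basis. lborel). (\<Prod>b\<in>(Basis :: 'a set). f b ((\<Sum>b\<in>Basis. g b *\<^sub>R b) \<bullet> b)))"
    unfolding lborel_eq[where 'a='a] by (rule integral_distr) measurable
  also have "\<dots> = (LINT g|(\<Pi>\<^sub>M b\<in>Basis. lborel). (\<Prod>b\<in>(Basis :: 'a set). f b (g b)))"
    by (intro Bochner_Integration.integral_cong prod.cong) auto
  also have "\<dots> = (\<Prod>b\<in>Basis. LINT t|lborel. f b t)"
    by (rule product_integral_prod) (use assms in auto)
  finally show ?thesis .
qed

text \<open>A rescaling of the characteristic function of the standard normal distribution.\<close>

lemma gauss_fourier_1d:
  assumes a: "0 < a"
  shows "integrable lborel (\<lambda>t::real. complex_of_real (exp (- (a * t\<^sup>2 / 2))) * exp (- (\<i> * of_real (t * \<eta>))))" (is ?I)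
    and "(LINT t|lborel. complex_of_real (exp (- (a * t\<^sup>2 / 2))) * exp (- (\<i> * of_real (t * \<eta>))))
      = of_real (sqrt (2 * pi / a) * exp (- (\<eta>\<^sup>2 / (2 * a))))" (is ?E)
proof -
  define c where "c = sqrt a"
  have c: "c > 0" "c\<^sup>2 = a" using a by (auto simp: c_def)
  let ?g = "\<lambda>t::real. std_normal_density t *\<^sub>R iexp (- \<eta> / c * t)"
  have d: "std_normal_distribution = density lborel std_normal_density" by simp
  have int: "integrable lborel ?g"
  proof (rule Bochner_Integration.integrable_bound)
    show "integrable lborel std_normal_density" by simp
    show "AE x in lborel. norm (?g x) \<le> norm (std_normal_density x)" by (auto simp del: normal_density_def)
  qed measurable
  have "(LINT t|lborel. ?g t) = char std_normal_distribution (- \<eta> / c)"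
    unfolding char_def by (subst integral_density) auto
  also have "\<dots> = of_real (exp (- (\<eta>\<^sup>2 / (2 * a))))"
    using c by (simp add: char_std_normal_distribution power_divide field_simps)
  finally have e: "(LINT t|lborel. ?g t) = of_real (exp (- (\<eta>\<^sup>2 / (2 * a))))" .
  have g: "?g (c * t) = of_real (1 / sqrt (2 * pi)) * (complex_of_real (exp (- (a * t\<^sup>2 / 2))) * exp (- (\<i> * of_real (t * \<eta>))))" for t
    using c by (simp add: std_normal_density_def power_mult_distrib scaleR_conv_of_real mult_ac)
  have int2: "integrable lborel (\<lambda>t. ?g (c * t))"
    using lborel_integrable_real_affine[OF int, of c 0] c by simp
  have "of_real (sqrt (2 * pi)) * ?g (c * t) = complex_of_real (exp (- (a * t\<^sup>2 / 2))) * exp (- (\<i> * of_real (t * \<eta>)))" for t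
    unfolding g by simp
  with integrable_mult_right[OF int2, of "of_real (sqrt (2 * pi))"] show ?I by simp
  have "(LINT t|lborel. ?g t) = \<bar>c\<bar> *\<^sub>R (LINT t|lborel. ?g (0 + c * t))"
    by (rule lborel_integral_real_affine) (use c in auto)
  also have "\<dots> = of_real (c / sqrt (2 * pi)) * (LINT t|lborel. complex_of_real (exp (- (a * t\<^sup>2 / 2))) * exp (- (\<i> * of_real (t * \<eta>))))"
    unfolding add_0 g using c by (simp add: scaleR_conv_of_real)
  finally have "of_real (c / sqrt (2 * pi)) * (LINT t|lborel. complex_of_real (exp (- (a * t\<^sup>2 / 2))) * exp (- (\<i> * of_real (t * \<eta>)))) = of_real (exp (- (\<eta>\<^sup>2 / (2 * a))))"
    using e by simp
  hence "(LINT t|lborel. complex_of_real (exp (- (a * t\<^sup>2 / 2))) * exp (- (\<i> * of_real (t * \<eta>)))) =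
     of_real (sqrt (2 * pi) / c) * of_real (exp (- (\<eta>\<^sup>2 / (2 * a))))"
    using c by (simp add: field_simps)
  thus ?E using c by (simp add: c_def real_sqrt_divide)
qed

lemma fourier_gauss:
  assumes a: "0 < a"
  shows "fourier (\<lambda>x. complex_of_real (gauss a x)) (\<xi> :: real^'n::finite) = of_real (heat a \<xi>)"
proof -
  let ?f = "\<lambda>b t. complex_of_real (exp (- (a * t\<^sup>2 / 2))) * exp (- (\<i> * of_real (t * (\<xi> \<bullet> b))))"
  have "complex_of_real (gauss a x) * exp (- (\<i> * of_real (x \<bullet> \<xi>))) = (\<Prod>b\<in>Basis. ?f b (x \<bullet> b))" for x :: "real^'n"
  proof -
    have "(norm x)\<^sup>2 = (\<Sum>b\<in>Basis. (x \<bullet> b)\<^sup>2)"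
      unfolding norm_eq_sqrt_inner by (simp add: euclidean_inner[of x x] power2_eq_square sum_nonneg)
    hence "gauss a x = (\<Prod>b\<in>Basis. exp (- (a * (x \<bullet> b)\<^sup>2 / 2)))"
      unfolding gauss_def by (simp add: exp_sum[symmetric] sum_distrib_left sum_divide_distrib sum_negf)
    moreover have "exp (- (\<i> * complex_of_real (x \<bullet> \<xi>))) = (\<Prod>b\<in>Basis. exp (- (\<i> * of_real ((x \<bullet> b) * (\<xi> \<bullet> b)))))"
      by (subst euclidean_inner) (simp add: exp_sum[symmetric] sum_distrib_left sum_negf)
    ultimately show ?thesis by (simp add: prod.distrib)
  qed
  hence "fourier (\<lambda>x. complex_of_real (gauss a x)) \<xi> = (LINT x|lborel. (\<Prod>b\<in>Basis. ?f b (x \<bullet> b)))"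
    unfolding fourier_def by simp
  also have "\<dots> = (\<Prod>b\<in>Basis. LINT t|lborel. ?f b t)"
    by (rule integral_lborel_prod) (rule gauss_fourier_1d[OF a])
  also have "\<dots> = (\<Prod>b\<in>Basis. of_real (sqrt (2 * pi / a) * exp (- ((\<xi> \<bullet> b)\<^sup>2 / (2 * a)))))"
    by (simp only: gauss_fourier_1d[OF a])
  also have "\<dots> = of_real (sqrt (2 * pi / a) ^ CARD('n) * exp (- ((\<Sum>b\<in>Basis. (\<xi> \<bullet> b)\<^sup>2) / (2 * a))))"
    by (simp add: prod.distrib exp_sum[symmetric] sum_divide_distrib sum_negf flip: of_real_prod)
  also have "(\<Sum>b\<in>Basis. (\<xi> \<bullet> b)\<^sup>2) = (norm \<xi>)\<^sup>2"
    unfolding norm_eq_sqrt_inner by (simp add: euclidean_inner[of \<xi> \<xi>] power2_eq_square sum_nonneg)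
  finally show ?thesis by (simp add: heat_def)
qed

text \<open>The Gaussian with frequency \<open>x\<close>; its transform is a heat kernel centred at \<open>x\<close>.\<close>

definition wave :: "real \<Rightarrow> real^'n::finite \<Rightarrow> real^'n \<Rightarrow> complex" where
  "wave a x \<zeta> = exp (\<i> * of_real (\<zeta> \<bullet> x)) * of_real (gauss a \<zeta>)"

lemma schwartz_wave: "0 < a \<Longrightarrow> wave a x \<in> schwartz"
  unfolding wave_def by (intro schwartz_modulate schwartz_gauss)

lemma fourier_wave: assumes "0 < a" shows "fourier (wave a x) t = of_real (heat a (t - x))"
proof -
  have "fourier (wave a x) t = fourier (\<lambda>x. complex_of_real (gauss a x)) (t - x)"
    unfolding fourier_def wave_def
    by (intro Bochner_Integration.integral_cong)
       (simp_all add: inner_diff_right exp_diff exp_minus field_simps)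
  thus ?thesis using fourier_gauss[OF assms] by simp
qed

lemma heat_eq_gauss: "0 < a \<Longrightarrow> heat a (x :: real^'n::finite) = sqrt (2 * pi / a) ^ CARD('n) * gauss (1 / a) x"
  by (simp add: heat_def gauss_def)

lemma heat_integrable:
  assumes "0 < a" shows "integrable lborel (heat a :: real^'n::finite \<Rightarrow> real)"
proof -
  have "heat a = (\<lambda>x :: real^'n. sqrt (2 * pi / a) ^ CARD('n) * gauss (1 / a) x)"
    by (auto simp: heat_eq_gauss assms)
  thus ?thesis using gauss_integrable[of "1 / a", where 'n='n] assms by simp
qed

text \<open>The integral is the value at \<open>0\<close> of the transform of the inverse Gaussian.\<close>

lemma integral_heat: 
  assumes "0 < a" shows "(LINT x|lborel. heat a (x :: real^'n::finite)) = (2 * pi) ^ CARD('n)"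
proof -
  have "complex_of_real (LINT x|lborel. gauss (1 / a) (x :: real^'n)) = of_real (heat (1 / a) (0 :: real^'n))"
    using fourier_gauss[of "1 / a" "0 :: real^'n"] assms by (simp add: fourier_def)
  hence "(LINT x|lborel. gauss (1 / a) (x :: real^'n)) = heat (1 / a) (0 :: real^'n)"
    by (simp only: of_real_eq_iff)
  hence "(LINT x|lborel. gauss (1 / a) (x :: real^'n)) = sqrt (2 * pi * a) ^ CARD('n)"
    by (simp add: heat_def)
  moreover have "sqrt (2 * pi / a) * sqrt (2 * pi * a) = 2 * pi"
  proof -
    have "sqrt (2 * pi / a) * sqrt (2 * pi * a) = sqrt ((2 * pi)\<^sup>2)"
      unfolding real_sqrt_mult[symmetric] using assms by (simp add: power2_eq_square)
    also have "\<dots> = 2 * pi" by (subst real_sqrt_abs) simp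
    finally show ?thesis .
  qed
  ultimately show ?thesis using assms
    by (simp only: heat_eq_gauss Bochner_Integration.integral_mult_right_zero power_mult_distrib[symmetric])
qed

text \<open>Away from the centre the kernels \<^term>\<open>heat a\<close> tend to \<open>0\<close> faster than a multiple of
  the fixed Gaussian \<^term>\<open>gauss 1\<close>, so integrability against that Gaussian suffices.\<close>

lemma heat_approximate_identity:
  fixes g :: "real^'n::finite \<Rightarrow> 'b::{banach, second_countable_topology}"
  assumes g: "integrable lborel (\<lambda>y. gauss 1 (y - x) *\<^sub>R g y)"
    and gm: "g \<in> borel_measurable borel" and cont: "isCont g x"
  shows "(\<lambda>k. LINT y|lborel. heat (1 / real (Suc k)) (y - x) *\<^sub>R g y) \<longlonglongrightarrow> ((2 * pi) ^ CARD('n)) *\<^sub>R g x"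
proof -
  note [measurable] = gm
  define a where "a k = 1 / real (Suc k)" for k
  have a: "0 < a k" "a k \<le> 1" for k by (auto simp: a_def)
  let ?G = "\<lambda>y. gauss 1 (y - x) * norm (g y - g x)"
  have gx: "integrable lborel (\<lambda>y. gauss b (y - x) *\<^sub>R g x)" if "0 < b" for b
    using integrable_translate[of "gauss b" "- x"] gauss_integrable[OF that]
    by (intro integrable_scaleR_left) simp
  have "integrable lborel (\<lambda>y. norm (gauss 1 (y - x) *\<^sub>R g y - gauss 1 (y - x) *\<^sub>R g x))"
    using g gx[of 1] by (intro integrable_norm Bochner_Integration.integrable_diff) auto
  hence G: "integrable lborel ?G"
    by (simp flip: scaleR_diff_right)
  have hi: "integrable lborel (\<lambda>y. heat (a k) (y - x))" for k
    using integrable_translate[of "heat (a k)" "- x"] heat_integrable a by auto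
  have ih: "(LINT y|lborel. heat (a k) (y - x)) = (2 * pi) ^ CARD('n)" for k
    using integral_translate[of "heat (a k)" "- x"] integral_heat[where 'n='n] a by auto
  \<comment> \<open>Outside the ball of radius \<open>r\<close> the \<open>k\<close>-th kernel is at most \<open>c r k\<close> times \<^term>\<open>gauss 1\<close>.\<close>
  define c where "c r k = sqrt (2 * pi * real (Suc k)) ^ CARD('n) * exp (- (r\<^sup>2 * real k / 2))" for r k
  have c0: "c r \<longlonglongrightarrow> 0" if "r > 0" for r
    unfolding c_def using that by real_asymp
  have far: "heat (a k) y \<le> c r k * gauss 1 y" if "norm y \<ge> r" "r > 0" for k r and y :: "real^'n"
  proof -
    have "r\<^sup>2 * real k / 2 + (norm y)\<^sup>2 / 2 \<le> (norm y)\<^sup>2 / (2 * a k)"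
      using mult_right_mono[OF power_mono[OF that(1), of 2], of "real k"] that(2)
      by (simp add: a_def field_simps)
    hence "exp (- ((norm y)\<^sup>2 / (2 * a k))) \<le> exp (- (r\<^sup>2 * real k / 2)) * gauss 1 y"
      by (simp add: gauss_def flip: exp_add)
    from mult_left_mono[OF this, of "sqrt (2 * pi / a k) ^ CARD('n)"] show ?thesis
      using a[of k] by (simp add: heat_def c_def a_def mult.assoc)
  qed
  have hg: "integrable lborel (\<lambda>y. heat (a k) (y - x) *\<^sub>R g y)" for k
  proof (rule Bochner_Integration.integrable_bound)
    let ?C = "sqrt (2 * pi / a k) ^ CARD('n)"
    show "integrable lborel (\<lambda>y. ?C *\<^sub>R norm (gauss 1 (y - x) *\<^sub>R g y))"
      by (intro integrable_scaleR_right integrable_norm g)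
    have "heat (a k) z \<le> ?C * gauss 1 z" for z :: "real^'n"
      unfolding heat_def gauss_def using mult_left_le_one_le[of "(norm z)\<^sup>2" "a k"] a[of k]
      by (intro mult_left_mono) (auto simp: field_simps)
    from mult_right_mono[OF this] show "AE y in lborel. norm (heat (a k) (y - x) *\<^sub>R g y) \<le> norm (?C *\<^sub>R norm (gauss 1 (y - x) *\<^sub>R g y))"
      using a[of k] by (intro AE_I2) (simp add: mult.assoc)
  qed measurable
  show ?thesis unfolding a_def[symmetric]
  proof (rule LIMSEQ_I)
    fix e :: real assume e: "e > 0"
    define \<delta> where "\<delta> = e / (2 * (2 * pi) ^ CARD('n))"
    have \<delta>: "\<delta> > 0" using e by (simp add: \<delta>_def)
    from cont[unfolded continuous_at_eps_delta, rule_format, OF \<delta>] obtain r where r: "r > 0"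
      "\<And>y. dist y x < r \<Longrightarrow> dist (g y) (g x) < \<delta>" by blast
    have "(\<lambda>k. c r k * (LINT y|lborel. ?G y)) \<longlonglongrightarrow> 0 * (LINT y|lborel. ?G y)"
      by (intro tendsto_mult c0 r tendsto_const)
    from LIMSEQ_D[OF this, of "e / 2"] e obtain N where
      N: "\<And>k. k \<ge> N \<Longrightarrow> \<bar>c r k * (LINT y|lborel. ?G y)\<bar> < e / 2" by auto
    show "\<exists>no. \<forall>k\<ge>no. norm ((LINT y|lborel. heat (a k) (y - x) *\<^sub>R g y) - (2 * pi) ^ CARD('n) *\<^sub>R g x) < e"
    proof (intro exI[of _ N] allI impI)
      fix k assume k: "k \<ge> N"
      have hgx: "integrable lborel (\<lambda>y. heat (a k) (y - x) *\<^sub>R g x)"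
        using hi[of k] by simp
      have ihg: "(LINT y|lborel. heat (a k) (y - x) *\<^sub>R g x) = (2 * pi) ^ CARD('n) *\<^sub>R g x"
        by (subst integral_scaleR_left) (simp_all only: hi ih)
      have "(LINT y|lborel. heat (a k) (y - x) *\<^sub>R g y) - (2 * pi) ^ CARD('n) *\<^sub>R g x
          = (LINT y|lborel. heat (a k) (y - x) *\<^sub>R g y - heat (a k) (y - x) *\<^sub>R g x)"
        by (simp only: Bochner_Integration.integral_diff[OF hg hgx] ihg)
      also have "norm \<dots> \<le> (LINT y|lborel. \<delta> * heat (a k) (y - x) + c r k * ?G y)"
      proof (rule Bochner_Integration.integral_norm_bound_integral)
        show "integrable lborel (\<lambda>y. heat (a k) (y - x) *\<^sub>R g y - heat (a k) (y - x) *\<^sub>R g x)"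
          using hg[of k] hgx by auto
        show "integrable lborel (\<lambda>y. \<delta> * heat (a k) (y - x) + c r k * ?G y)"
          using hi[of k] G by auto
        fix y :: "real^'n"
        have n: "norm (heat (a k) (y - x) *\<^sub>R g y - heat (a k) (y - x) *\<^sub>R g x) = heat (a k) (y - x) * norm (g y - g x)"
          using a[of k] by (simp flip: scaleR_diff_right)
        have cn: "0 \<le> c r k" by (simp add: c_def)
        show "norm (heat (a k) (y - x) *\<^sub>R g y - heat (a k) (y - x) *\<^sub>R g x) \<le> \<delta> * heat (a k) (y - x) + c r k * ?G y"
        proof (cases "norm (y - x) < r")
          case True
          hence "heat (a k) (y - x) * norm (g y - g x) \<le> heat (a k) (y - x) * \<delta>"
            using r(2)[of y] a[of k] by (intro mult_left_mono) (auto simp: dist_norm)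
          thus ?thesis unfolding n using cn by (simp add: mult.commute add_increasing2)
        next
          case False
          hence "heat (a k) (y - x) * norm (g y - g x) \<le> c r k * gauss 1 (y - x) * norm (g y - g x)"
            using far[of r "y - x" k] r(1) by (intro mult_right_mono) auto
          moreover have "0 \<le> \<delta> * heat (a k) (y - x)" using \<delta> a[of k] by simp
          ultimately show ?thesis unfolding n by (simp add: mult.assoc)
        qed
      qed
      also have "\<dots> = e / 2 + c r k * (LINT y|lborel. ?G y)"
        using hi[of k] G by (simp add: ih \<delta>_def)
      also have "\<dots> < e" using N[OF k] by linarith
      finally show "norm ((LINT y|lborel. heat (a k) (y - x) *\<^sub>R g y) - (2 * pi) ^ CARD('n) *\<^sub>R g x) < e" .
    qed
  qed
qed

lemma gauss_tendsto_1: "(\<lambda>k. gauss (1 / real (Suc k)) x) \<longlonglongrightarrow> 1"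
  unfolding gauss_def by real_asymp

text \<open>Inversion by Gauss--Weierstrass summation, in the form that applies both to an integrable
  function with its transform and to a distribution tested against Gaussians.\<close>

lemma inversion_from_waves:
  fixes f h :: "real^'n::finite \<Rightarrow> complex"
  assumes f: "integrable lborel (\<lambda>y. gauss 1 (y - x) *\<^sub>R f y)" "f \<in> borel_measurable borel" "isCont f x"
    and h: "integrable lborel h"
    and eq: "\<And>a. 0 < a \<Longrightarrow> (LINT y|lborel. f y * of_real (heat a (y - x))) = (LINT \<zeta>|lborel. h \<zeta> * wave a x \<zeta>)"
  shows "(LINT \<zeta>|lborel. h \<zeta> * exp (\<i> * of_real (\<zeta> \<bullet> x))) = (2 * pi) ^ CARD('n) * f x"
proof -
  let ?a = "\<lambda>k. 1 / real (Suc k)"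
  have [measurable]: "h \<in> borel_measurable borel" using h by auto
  have "(\<lambda>k. LINT \<zeta>|lborel. h \<zeta> * wave (?a k) x \<zeta>) \<longlonglongrightarrow> (LINT \<zeta>|lborel. h \<zeta> * exp (\<i> * of_real (\<zeta> \<bullet> x)))"
  proof (rule integral_dominated_convergence[where w = "\<lambda>\<zeta>. cmod (h \<zeta>)"])
    show "AE \<zeta> in lborel. (\<lambda>k. h \<zeta> * wave (?a k) x \<zeta>) \<longlonglongrightarrow> h \<zeta> * exp (\<i> * of_real (\<zeta> \<bullet> x))"
    proof (intro AE_I2)
      fix \<zeta> :: "real^'n"
      have "(\<lambda>k. h \<zeta> * (exp (\<i> * of_real (\<zeta> \<bullet> x)) * of_real (gauss (?a k) \<zeta>))) \<longlonglongrightarrow> h \<zeta> * (exp (\<i> * of_real (\<zeta> \<bullet> x)) * of_real 1)"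
        by (intro tendsto_mult tendsto_const tendsto_of_real gauss_tendsto_1)
      thus "(\<lambda>k. h \<zeta> * wave (?a k) x \<zeta>) \<longlonglongrightarrow> h \<zeta> * exp (\<i> * of_real (\<zeta> \<bullet> x))" by (simp add: wave_def)
    qed
    show "AE \<zeta> in lborel. norm (h \<zeta> * wave (?a k) x \<zeta>) \<le> cmod (h \<zeta>)" for k
      by (intro AE_I2) (auto simp: norm_mult wave_def intro!: mult_left_le gauss_le_1)
    show "(\<lambda>\<zeta>. h \<zeta> * exp (\<i> * of_real (\<zeta> \<bullet> x))) \<in> borel_measurable lborel"
      using character_measurable[of "- x"] by simp
    show "(\<lambda>\<zeta>. h \<zeta> * wave (?a k) x \<zeta>) \<in> borel_measurable lborel" for k
      using schwartz_measurable[OF schwartz_wave[of "?a k" x]] by simp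
  qed (use h in auto)
  moreover have "(\<lambda>k. LINT \<zeta>|lborel. h \<zeta> * wave (?a k) x \<zeta>) \<longlonglongrightarrow> ((2 * pi) ^ CARD('n)) *\<^sub>R f x"
    using heat_approximate_identity[OF f] eq by (simp add: scaleR_conv_of_real mult.commute)
  ultimately show ?thesis
    using LIMSEQ_unique by (fastforce simp: scaleR_conv_of_real)
qed

lemma integrable_pair_mult:
  fixes f g :: "real^'n::finite \<Rightarrow> complex"
  assumes f: "integrable lborel f" and g: "integrable lborel g"
    and k [measurable]: "case_prod k \<in> borel_measurable (borel \<Otimes>\<^sub>M borel)" and b: "\<And>x y. cmod (k x y) \<le> B"
  shows "integrable (lborel \<Otimes>\<^sub>M lborel) (\<lambda>(x, y). f x * g y * k x y)"
proof (rule lborel_pair.Fubini_integrable)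
  have [measurable]: "f \<in> borel_measurable borel" "g \<in> borel_measurable borel" using f g by auto
  have [measurable]: "case_prod k \<in> borel_measurable (lborel \<Otimes>\<^sub>M lborel)" using k
    by (simp add: lborel_prod borel_prod)
  show "(\<lambda>(x, y). f x * g y * k x y) \<in> borel_measurable (lborel \<Otimes>\<^sub>M lborel)" by measurable
  have B: "0 \<le> B" using order_trans[OF norm_ge_zero b] .
  have gk: "integrable lborel (\<lambda>y. g y * k x y)" for x
    by (rule integrable_mult_bounded(1)[OF g _ b]) measurable
  have "integrable lborel (\<lambda>y. f x * (g y * k x y))" for x
    using gk by (rule integrable_mult_right)
  thus "AE x in lborel. integrable lborel (\<lambda>y. case (x, y) of (x, y) \<Rightarrow> f x * g y * k x y)"
    by (simp add: mult.assoc)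
  show "integrable lborel (\<lambda>x. LINT y|lborel. norm (case (x, y) of (x, y) \<Rightarrow> f x * g y * k x y))"
  proof (rule Bochner_Integration.integrable_bound)
    show "integrable lborel (\<lambda>x. cmod (f x) * (B * (LINT y|lborel. cmod (g y))))"
      using f by auto
    show "AE x in lborel. norm (LINT y|lborel. norm (case (x, y) of (x, y) \<Rightarrow> f x * g y * k x y))
         \<le> norm (cmod (f x) * (B * (LINT y|lborel. cmod (g y))))"
    proof (intro AE_I2)
      fix x
      have "(LINT y|lborel. cmod (g y * k x y)) \<le> (LINT y|lborel. B * cmod (g y))"
      proof (intro integral_mono integrable_norm gk)
        show "integrable lborel (\<lambda>y. B * cmod (g y))" using g by auto
        show "cmod (g y * k x y) \<le> B * cmod (g y)" for y
          using mult_left_mono[OF b[of x y] norm_ge_zero[of "g y"]] by (simp add: norm_mult mult.commute)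
      qed
      hence "(LINT y|lborel. cmod (f x * g y * k x y)) \<le> cmod (f x) * (B * (LINT y|lborel. cmod (g y)))"
        by (simp add: norm_mult mult.assoc mult_left_mono)
      moreover have "0 \<le> (LINT y|lborel. cmod (f x * g y * k x y))" by simp
      ultimately show "norm (LINT y|lborel. norm (case (x, y) of (x, y) \<Rightarrow> f x * g y * k x y))
         \<le> norm (cmod (f x) * (B * (LINT y|lborel. cmod (g y))))" by simp
    qed
  qed measurable
qed

lemma fourier_multiplication_formula:
  fixes f g :: "real^'n::finite \<Rightarrow> complex"
  assumes f: "integrable lborel f" and g: "integrable lborel g"
  shows "(LINT \<xi>|lborel. fourier f \<xi> * g \<xi>) = (LINT x|lborel. f x * fourier g x)"
proof -
  let ?e = "\<lambda>(x :: real^'n) (\<xi> :: real^'n). exp (- (\<i> * complex_of_real (x \<bullet> \<xi>)))"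
  have "case_prod ?e \<in> borel_measurable (borel \<Otimes>\<^sub>M borel)"
    unfolding borel_prod case_prod_beta by (intro borel_measurable_continuous_onI continuous_intros)
  from integrable_pair_mult[OF f g this, of 1]
  have int: "integrable (lborel \<Otimes>\<^sub>M lborel) (\<lambda>(x, \<xi>). f x * g \<xi> * ?e x \<xi>)" by simp
  have "(LINT \<xi>|lborel. fourier f \<xi> * g \<xi>) = (LINT \<xi>|lborel. LINT x|lborel. f x * g \<xi> * ?e x \<xi>)"
    unfolding fourier_def by (subst integral_mult_left_zero[symmetric]) (simp add: mult_ac)
  also have "\<dots> = (LINT x|lborel. LINT \<xi>|lborel. f x * g \<xi> * ?e x \<xi>)"
    using lborel_pair.Fubini_integral[OF int] by simp
  also have "\<dots> = (LINT x|lborel. f x * fourier g x)"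
    unfolding fourier_def by (subst integral_mult_right_zero[symmetric]) (simp add: mult_ac inner_commute)
  finally show ?thesis .
qed

lemma gauss_shift_integrable:
  assumes "integrable lborel (f :: real^'n::finite \<Rightarrow> complex)"
  shows "integrable lborel (\<lambda>y. gauss 1 (y - x) *\<^sub>R f y)"
proof -
  have "integrable lborel (\<lambda>y. of_real (gauss 1 (y - x)) * f y)"
    by (rule integrable_mult_bounded(2)[where B = 1]) (use assms in \<open>auto simp: gauss_le_1\<close>)
  thus ?thesis by (simp add: scaleR_conv_of_real)
qed

theorem fourier_inversion:
  fixes f :: "real^'n::finite \<Rightarrow> complex"
  assumes f: "integrable lborel f" "isCont f x" and h: "integrable lborel (fourier f)"
  shows "(LINT \<xi>|lborel. fourier f \<xi> * exp (\<i> * of_real (\<xi> \<bullet> x))) = (2 * pi) ^ CARD('n) * f x"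
proof (rule inversion_from_waves)
  fix a :: real assume a: "0 < a"
  show "(LINT y|lborel. f y * of_real (heat a (y - x))) = (LINT \<zeta>|lborel. fourier f \<zeta> * wave a x \<zeta>)"
    using fourier_multiplication_formula[OF f(1) schwartz_integrable[OF schwartz_wave[OF a, of x]]]
    by (simp add: fourier_wave[OF a])
qed (use f h gauss_shift_integrable in auto)

text \<open>Only this half of Plancherel's theorem is used. Regularised by a Gaussian, the left side is
  \<open>\<integral>\<integral> f x \<cdot> cnj (f y) \<cdot> heat a (x - y)\<close>, which Schur's test bounds uniformly in \<open>a\<close>.\<close>

theorem plancherel_le:
  fixes f :: "real^'n::finite \<Rightarrow> complex"
  assumes f: "integrable lborel f"
  shows "(\<integral>\<^sup>+ \<xi>. ennreal ((cmod (fourier f \<xi>))\<^sup>2) \<partial>lborel)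
    \<le> ennreal ((2 * pi) ^ CARD('n)) * (\<integral>\<^sup>+ x. ennreal ((cmod (f x))\<^sup>2) \<partial>lborel)"
proof -
  have [measurable]: "f \<in> borel_measurable borel" using f by auto
  have [measurable]: "fourier f \<in> borel_measurable borel" using f by auto
  define R where "R = (\<integral>\<^sup>+ x. ennreal ((cmod (f x))\<^sup>2) \<partial>lborel)"
  let ?n = "(2 * pi) ^ CARD('n)"
  have main: "(\<integral>\<^sup>+ \<xi>. ennreal ((cmod (fourier f \<xi>))\<^sup>2 * gauss a \<xi>) \<partial>lborel) \<le> ennreal ?n * R" if a: "0 < a" for a
  proof -
    let ?g = "\<lambda>y. cnj (f (0 - y))"
    have g: "integrable lborel ?g" using integrable_reflect[of f 0] f by simp
    have fg: "fourier ?g \<xi> = cnj (fourier f \<xi>)" for \<xi>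
    proof -
      have "fourier ?g \<xi> = (LINT y|lborel. (\<lambda>z. cnj (f z * exp (- (\<i> * of_real (z \<bullet> \<xi>))))) (0 - y))"
        unfolding fourier_def by (simp add: exp_cnj)
      also have "\<dots> = (LINT z|lborel. cnj (f z * exp (- (\<i> * of_real (z \<bullet> \<xi>)))))"
        by (rule integral_reflect) measurable
      also have "\<dots> = cnj (LINT z|lborel. f z * exp (- (\<i> * of_real (z \<bullet> \<xi>))))"
        by (rule Bochner_Integration.integral_cnj)
      finally show ?thesis unfolding fourier_def .
    qed
    define w where "w = (\<lambda>\<xi>. cnj (fourier f \<xi>) * complex_of_real (gauss a \<xi>))"
    obtain B where B: "\<And>\<xi>. cmod (fourier f \<xi>) \<le> B" using norm_fourier_le[OF f] by blast
    have gi: "integrable lborel (\<lambda>\<xi> :: real^'n. complex_of_real (gauss a \<xi>))"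
      using gauss_integrable[OF a, where 'n='n] by (simp only: complex_of_real_integrable_eq)
    have w: "integrable lborel w"
      unfolding w_def by (rule integrable_mult_bounded(2)[OF gi, where B = B]) (use B in auto)
    have fw: "fourier w x = (LINT y|lborel. cnj (f y) * of_real (heat a (x - y)))" for x
    proof -
      have "fourier w x = (LINT \<xi>|lborel. fourier ?g \<xi> * wave a (- x) \<xi>)"
        unfolding fg by (subst fourier_def) (simp add: w_def wave_def mult_ac)
      also have "\<dots> = (LINT y|lborel. ?g y * fourier (wave a (- x)) y)"
        by (intro fourier_multiplication_formula g schwartz_integrable schwartz_wave a)
      also have "\<dots> = (LINT y|lborel. (\<lambda>z. cnj (f z) * of_real (heat a (x - z))) (0 - y))"
        by (simp add: fourier_wave[OF a] add.commute)
      also have "\<dots> = (LINT y|lborel. cnj (f y) * of_real (heat a (x - y)))"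
        by (rule integral_reflect) measurable
      finally show ?thesis .
    qed
    have int: "integrable lborel (\<lambda>\<xi>. (cmod (fourier f \<xi>))\<^sup>2 * gauss a \<xi>)"
    proof -
      have "integrable lborel (\<lambda>\<xi>. Re (w \<xi> * fourier f \<xi>))"
        by (intro integrable_Re integrable_mult_bounded(1)[OF w _ B]) auto
      moreover have "w \<xi> * fourier f \<xi> = of_real ((cmod (fourier f \<xi>))\<^sup>2 * gauss a \<xi>)" for \<xi>
        unfolding w_def of_real_mult complex_norm_square by (simp add: mult_ac)
      ultimately show ?thesis by (simp del: of_real_mult of_real_power)
    qed
    have "(\<integral>\<^sup>+ \<xi>. ennreal ((cmod (fourier f \<xi>))\<^sup>2 * gauss a \<xi>) \<partial>lborel)
        = ennreal (LINT \<xi>|lborel. (cmod (fourier f \<xi>))\<^sup>2 * gauss a \<xi>)"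
      by (intro nn_integral_eq_integral int) auto
    also have "(LINT \<xi>|lborel. (cmod (fourier f \<xi>))\<^sup>2 * gauss a \<xi>) = cmod (LINT \<xi>|lborel. fourier f \<xi> * w \<xi>)"
    proof -
      have "fourier f \<xi> * w \<xi> = of_real ((cmod (fourier f \<xi>))\<^sup>2 * gauss a \<xi>)" for \<xi>
        unfolding w_def of_real_mult complex_norm_square by (simp add: mult_ac)
      moreover have "0 \<le> (LINT \<xi>|lborel. (cmod (fourier f \<xi>))\<^sup>2 * gauss a \<xi>)" by simp
      ultimately show ?thesis by (simp del: of_real_mult of_real_power)
    qed
    also have "(LINT \<xi>|lborel. fourier f \<xi> * w \<xi>) = (LINT x|lborel. f x * fourier w x)"
      by (rule fourier_multiplication_formula[OF f w])
    also have "ennreal (cmod \<dots>) \<le> (\<integral>\<^sup>+ x. ennreal (cmod (f x * fourier w x)) \<partial>lborel)"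
      by (rule integral_norm_bound_ennreal)
         (rule integrable_mult_bounded(1)[OF f _ norm_fourier_le[OF w]], use w in measurable)
    also have "\<dots> \<le> (\<integral>\<^sup>+ x. (\<integral>\<^sup>+ y. ennreal (((cmod (f x))\<^sup>2 + (cmod (f y))\<^sup>2) / 2 * heat a (x - y)) \<partial>lborel) \<partial>lborel)"
    proof (intro nn_integral_mono)
      fix x :: "real^'n"
      have hx: "integrable lborel (\<lambda>y. heat a (x - y))"
        using integrable_reflect[of "heat a" x] heat_integrable[OF a] by auto
      have hb: "cmod (of_real (heat a (x - y))) \<le> sqrt (2 * pi / a) ^ CARD('n)" for y
        unfolding norm_of_real heat_def using a by (auto simp: abs_mult intro!: mult_left_le)
      have "ennreal (cmod (f x * fourier w x)) = ennreal (cmod (LINT y|lborel. f x * (cnj (f y) * of_real (heat a (x - y)))))"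
        unfolding fw by simp
      also have "\<dots> \<le> (\<integral>\<^sup>+ y. ennreal (cmod (f x * (cnj (f y) * of_real (heat a (x - y))))) \<partial>lborel)"
        by (intro integral_norm_bound_ennreal integrable_mult_right integrable_mult_bounded(1)[OF _ _ hb])
           (use f in auto)
      also have "\<dots> \<le> (\<integral>\<^sup>+ y. ennreal (((cmod (f x))\<^sup>2 + (cmod (f y))\<^sup>2) / 2 * heat a (x - y)) \<partial>lborel)"
      proof (intro nn_integral_mono ennreal_leI)
        fix y
        have "cmod (f x) * cmod (f y) \<le> ((cmod (f x))\<^sup>2 + (cmod (f y))\<^sup>2) / 2"
          using sum_squares_bound[of "cmod (f x)" "cmod (f y)"] by simp
        from mult_right_mono[OF this, of "heat a (x - y)"] a
        show "cmod (f x * (cnj (f y) * of_real (heat a (x - y)))) \<le> ((cmod (f x))\<^sup>2 + (cmod (f y))\<^sup>2) / 2 * heat a (x - y)"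
          by (simp add: norm_mult mult.assoc)
      qed
      finally show "ennreal (cmod (f x * fourier w x)) \<le> (\<integral>\<^sup>+ y. ennreal (((cmod (f x))\<^sup>2 + (cmod (f y))\<^sup>2) / 2 * heat a (x - y)) \<partial>lborel)" .
    qed
    also have "\<dots> = ennreal ?n * R"
    proof -
      define H where "H = (\<integral>\<^sup>+ y. ennreal (heat a (y :: real^'n)) \<partial>lborel)"
      have H: "H = ennreal ?n"
        unfolding H_def integral_heat[OF a, where 'n='n, symmetric]
        by (intro nn_integral_eq_integral heat_integrable a) (use a in auto)
      have Hx: "(\<integral>\<^sup>+ y. ennreal (heat a (x - y)) \<partial>lborel) = H" for x :: "real^'n"
        unfolding H_def by (rule nn_integral_reflect) measurable
      have Hy: "(\<integral>\<^sup>+ x. ennreal (heat a (x - y)) \<partial>lborel) = H" for y :: "real^'n"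
        unfolding heat_minus_commute[of a _ y] by (rule Hx)
      have "(\<integral>\<^sup>+ x. (\<integral>\<^sup>+ y. ennreal (((cmod (f x))\<^sup>2 + (cmod (f y))\<^sup>2) / 2 * heat a (x - y)) \<partial>lborel) \<partial>lborel)
         = (\<integral>\<^sup>+ x. (\<integral>\<^sup>+ y. ennreal ((cmod (f x))\<^sup>2 / 2) * ennreal (heat a (x - y)) + ennreal ((cmod (f y))\<^sup>2 / 2) * ennreal (heat a (x - y)) \<partial>lborel) \<partial>lborel)"
        using a by (intro nn_integral_cong)
          (simp add: ennreal_mult'[symmetric] ennreal_plus[symmetric] add_divide_distrib distrib_right del: ennreal_plus)
      also have "\<dots> = (\<integral>\<^sup>+ x. (\<integral>\<^sup>+ y. ennreal ((cmod (f x))\<^sup>2 / 2) * ennreal (heat a (x - y)) \<partial>lborel) \<partial>lborel)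
          + (\<integral>\<^sup>+ x. (\<integral>\<^sup>+ y. ennreal ((cmod (f y))\<^sup>2 / 2) * ennreal (heat a (x - y)) \<partial>lborel) \<partial>lborel)"
        by (simp add: nn_integral_add)
      also have "(\<integral>\<^sup>+ x. (\<integral>\<^sup>+ y. ennreal ((cmod (f y))\<^sup>2 / 2) * ennreal (heat a (x - y)) \<partial>lborel) \<partial>lborel)
          = (\<integral>\<^sup>+ y. (\<integral>\<^sup>+ x. ennreal ((cmod (f y))\<^sup>2 / 2) * ennreal (heat a (x - y)) \<partial>lborel) \<partial>lborel)"
        by (rule lborel_pair.Fubini') measurable
      also have "\<dots> = H * (\<integral>\<^sup>+ y. ennreal ((cmod (f y))\<^sup>2 / 2) \<partial>lborel)"
        by (simp add: nn_integral_cmult Hy nn_integral_multc mult.commute)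
      also have "(\<integral>\<^sup>+ x. (\<integral>\<^sup>+ y. ennreal ((cmod (f x))\<^sup>2 / 2) * ennreal (heat a (x - y)) \<partial>lborel) \<partial>lborel)
         = H * (\<integral>\<^sup>+ y. ennreal ((cmod (f y))\<^sup>2 / 2) \<partial>lborel)"
        by (simp add: nn_integral_cmult Hx nn_integral_multc mult.commute)
      also have "H * (\<integral>\<^sup>+ y. ennreal ((cmod (f y))\<^sup>2 / 2) \<partial>lborel) + H * (\<integral>\<^sup>+ y. ennreal ((cmod (f y))\<^sup>2 / 2) \<partial>lborel)
         = H * (\<integral>\<^sup>+ y. ennreal ((cmod (f y))\<^sup>2 / 2) + ennreal ((cmod (f y))\<^sup>2 / 2) \<partial>lborel)"
        by (subst nn_integral_add) (auto simp: distrib_left)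
      also have "\<dots> = H * R" unfolding R_def by (simp flip: ennreal_plus)
      finally show ?thesis by (simp add: H)
    qed
    finally show ?thesis .
  qed
  have "(\<integral>\<^sup>+ \<xi>. ennreal ((cmod (fourier f \<xi>))\<^sup>2) \<partial>lborel)
      = (\<integral>\<^sup>+ \<xi>. liminf (\<lambda>k. ennreal ((cmod (fourier f \<xi>))\<^sup>2 * gauss (1 / real (Suc k)) \<xi>)) \<partial>lborel)"
  proof (intro nn_integral_cong)
    fix \<xi> :: "real^'n"
    have "(\<lambda>k. ennreal ((cmod (fourier f \<xi>))\<^sup>2 * gauss (1 / real (Suc k)) \<xi>)) \<longlonglongrightarrow> ennreal ((cmod (fourier f \<xi>))\<^sup>2 * 1)"
      by (intro tendsto_ennrealI tendsto_mult tendsto_const gauss_tendsto_1)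
    from lim_imp_Liminf[OF sequentially_bot this, symmetric]
    show "ennreal ((cmod (fourier f \<xi>))\<^sup>2) = liminf (\<lambda>k. ennreal ((cmod (fourier f \<xi>))\<^sup>2 * gauss (1 / real (Suc k)) \<xi>))"
      unfolding mult_1_right .
  qed
  also have "\<dots> \<le> liminf (\<lambda>k. \<integral>\<^sup>+ \<xi>. ennreal ((cmod (fourier f \<xi>))\<^sup>2 * gauss (1 / real (Suc k)) \<xi>) \<partial>lborel)"
    by (rule nn_integral_liminf) measurable
  also have "\<dots> \<le> ennreal ?n * R"
    by (rule Liminf_le) (use main in auto)
  finally show ?thesis unfolding R_def .
qed

section \<open>Lebesgue norms and Minkowski's integral inequality\<close>

text \<open>The norm of \<^const>\<open>Lp_norm\<close> on an arbitrary measure space, so that the triangle inequality becomes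
  the integral inequality over a space with two points.\<close>

definition lpn :: "real \<Rightarrow> 'a measure \<Rightarrow> ('a \<Rightarrow> real) \<Rightarrow> ennreal" where
  "lpn p M g = (let I = \<integral>\<^sup>+ x. ennreal (g x powr p) \<partial>M
     in if I = \<infinity> then \<infinity> else ennreal (enn2real I powr (1 / p)))"

lemma Lp_norm_eq_lpn: "Lp_norm p g = lpn p lborel (\<lambda>x. cmod (g x))"
  by (simp add: Lp_norm_def lpn_def)

lemma lpn_le_iff:
  assumes p: "0 < p" and c: "0 \<le> c"
  shows "lpn p M g \<le> ennreal c \<longleftrightarrow> (\<integral>\<^sup>+ x. ennreal (g x powr p) \<partial>M) \<le> ennreal (c powr p)"
proof (cases "\<integral>\<^sup>+ x. ennreal (g x powr p) \<partial>M" rule: ennreal_cases)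
  case (real r)
  have "lpn p M g \<le> ennreal c \<longleftrightarrow> r powr (1 / p) \<le> c"
    using real c by (simp add: lpn_def)
  also have "\<dots> \<longleftrightarrow> r \<le> c powr p"
  proof
    assume "r powr (1 / p) \<le> c"
    from powr_mono2[OF _ _ this, of p] p real show "r \<le> c powr p" by (simp add: powr_powr)
  next
    assume "r \<le> c powr p"
    from powr_mono2[OF _ _ this, of "1 / p"] p c real show "r powr (1 / p) \<le> c" by (simp add: powr_powr)
  qed
  finally show ?thesis using real by simp
next
  case top
  thus ?thesis by (simp add: lpn_def top_unique)
qed

lemma lpn_measurable:
  assumes "sigma_finite_measure X" "case_prod a \<in> borel_measurable (M \<Otimes>\<^sub>M X)"
  shows "(\<lambda>y. lpn p X (a y)) \<in> borel_measurable M"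
proof -
  interpret sigma_finite_measure X by fact
  note [measurable] = assms(2)
  show ?thesis unfolding lpn_def Let_def by measurable
qed

lemma lpn_mono:
  assumes "0 < p" "AE x in M. 0 \<le> f x \<and> f x \<le> g x" shows "lpn p M f \<le> lpn p M g"
proof (cases "lpn p M g" rule: ennreal_cases)
  case (real c)
  have "(\<integral>\<^sup>+ x. ennreal (f x powr p) \<partial>M) \<le> (\<integral>\<^sup>+ x. ennreal (g x powr p) \<partial>M)"
  proof (intro nn_integral_mono_AE)
    show "AE x in M. ennreal (f x powr p) \<le> ennreal (g x powr p)"
      using assms(2) by eventually_elim (use assms(1) in \<open>auto intro!: ennreal_leI powr_mono2\<close>)
  qed
  also have "\<dots> \<le> ennreal (c powr p)" using lpn_le_iff[OF assms(1) real(1), of M g] real by simp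
  finally show ?thesis using lpn_le_iff[OF assms(1) real(1), of M f] real by simp
qed simp

lemma lpn_0 [simp]: "0 < p \<Longrightarrow> lpn p M (\<lambda>x. 0) = 0"
  by (simp add: lpn_def)

lemma lpn_cmult:
  assumes "0 < p" "0 \<le> c" and [measurable]: "g \<in> borel_measurable M" and g: "\<And>x. 0 \<le> g x"
  shows "lpn p M (\<lambda>x. c * g x) = ennreal c * lpn p M g"
proof (cases "c = 0")
  case False
  hence c: "c > 0" using assms by simp
  have e: "(\<integral>\<^sup>+ x. ennreal ((c * g x) powr p) \<partial>M) = ennreal (c powr p) * (\<integral>\<^sup>+ x. ennreal (g x powr p) \<partial>M)"
    using c g by (simp add: powr_mult ennreal_mult nn_integral_cmult)
  show ?thesis
  proof (cases "\<integral>\<^sup>+ x. ennreal (g x powr p) \<partial>M" rule: ennreal_cases)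
    case (real r)
    thus ?thesis unfolding lpn_def e using c assms(1)
      by (simp add: ennreal_mult[symmetric] powr_mult powr_powr enn2real_mult ennreal_mult_eq_top_iff)
  next
    case top
    thus ?thesis unfolding lpn_def e using c by (simp add: ennreal_mult_eq_top_iff ennreal_top_eq_mult_iff)
  qed
qed (use assms in simp)

text \<open>Weighted arithmetic--geometric mean inequality applied to \<open>a\<^sup>p z\<^sup>1\<^sup>-\<^sup>p\<close> and \<open>z\<close>.\<close>

lemma young_weighted:
  fixes a z p :: real
  assumes "1 \<le> p" "0 \<le> a" "0 < z"
  shows "a \<le> (1 / p) * (a powr p * z powr (1 - p)) + (1 - 1 / p) * z"
proof (cases "a = 0")
  case True
  thus ?thesis using assms by (simp add: mult_nonneg_nonneg)
next
  case False
  hence a: "a > 0" using assms by simp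
  have "(a powr p * z powr (1 - p)) powr (1 / p) * z powr (1 - 1 / p)
      \<le> (1 / p) * (a powr p * z powr (1 - p)) + (1 - 1 / p) * z"
    using assms a by (intro Youngs_inequality_0) auto
  moreover have "(a powr p * z powr (1 - p)) powr (1 / p) * z powr (1 - 1 / p) = a"
  proof -
    have "(a powr p * z powr (1 - p)) powr (1 / p) * z powr (1 - 1 / p) =
        a * (z powr ((1 - p) / p) * z powr (1 - 1 / p))"
      using assms a by (simp add: powr_mult powr_powr)
    also have "z powr ((1 - p) / p) * z powr (1 - 1 / p) = z powr 0"
      unfolding powr_add[symmetric] using assms by (simp add: field_simps)
    finally show ?thesis using assms by simp
  qed
  ultimately show ?thesis by simp
qed

text \<open>Jensen's inequality for \<open>t\<^sup>p\<close> and the probability density \<open>N/T\<close>, applied to \<open>a/N\<close>.\<close>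

lemma jensen_powr:
  fixes a N :: "'a \<Rightarrow> real"
  assumes p: "1 \<le> p" and [measurable]: "a \<in> borel_measurable M" "N \<in> borel_measurable M"
    and a: "\<And>x. 0 \<le> a x" and N: "\<And>x. 0 < N x" and T: "(\<integral>\<^sup>+ x. ennreal (N x) \<partial>M) = ennreal T" "0 < T"
    and G: "0 \<le> G" "ennreal G \<le> (\<integral>\<^sup>+ x. ennreal (a x) \<partial>M)"
  shows "ennreal (G powr p) \<le> ennreal (T powr (p - 1)) * (\<integral>\<^sup>+ x. ennreal (a x powr p * N x powr (1 - p)) \<partial>M)"
proof (cases "G = 0")
  case False
  hence G0: "G > 0" using G by simp
  define S where "S = (\<integral>\<^sup>+ x. ennreal (a x powr p * N x powr (1 - p)) \<partial>M)"
  show ?thesis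
  proof (cases S rule: ennreal_cases)
    case top
    thus ?thesis using T by (simp add: S_def[symmetric] ennreal_mult_top)
  next
    case (real \<sigma>)
    \<comment> \<open>For this \<open>y\<close> the second term of Young's inequality integrates to the fraction \<open>1 - 1/p\<close> of
      \<open>G\<close>, which is moved to the left.\<close>
    define y where "y = G / T"
    have y: "y > 0" using G0 T by (simp add: y_def)
    have "ennreal G \<le> (\<integral>\<^sup>+ x. ennreal ((1 / p) * y powr (1 - p)) * ennreal (a x powr p * N x powr (1 - p)) + ennreal ((1 - 1 / p) * y) * ennreal (N x) \<partial>M)"
    proof (rule order_trans[OF G(2)], intro nn_integral_mono)
      fix x
      have "a x \<le> (1 / p) * (a x powr p * (y * N x) powr (1 - p)) + (1 - 1 / p) * (y * N x)"
        using y N by (intro young_weighted p a) auto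
      also have "\<dots> = ((1 / p) * y powr (1 - p)) * (a x powr p * N x powr (1 - p)) + ((1 - 1 / p) * y) * N x"
        using y N[of x] by (simp add: powr_mult algebra_simps)
      finally have "ennreal (a x) \<le> ennreal \<dots>" by (rule ennreal_leI)
      also have "\<dots> = ennreal ((1 / p) * y powr (1 - p)) * ennreal (a x powr p * N x powr (1 - p)) + ennreal ((1 - 1 / p) * y) * ennreal (N x)"
      proof -
        have nn: "0 \<le> (1 / p) * y powr (1 - p)" "0 \<le> (1 - 1 / p) * y"
          using p y by auto
        show ?thesis
          unfolding ennreal_mult'[OF nn(1), symmetric] ennreal_mult'[OF nn(2), symmetric]
          using N[of x] by (intro ennreal_plus mult_nonneg_nonneg[OF nn(1)] mult_nonneg_nonneg[OF nn(2)]) auto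
      qed
      finally show "ennreal (a x) \<le> \<dots>" .
    qed
    also have "\<dots> = ennreal ((1 / p) * y powr (1 - p)) * S + ennreal ((1 - 1 / p) * y) * ennreal T"
      unfolding S_def by (subst nn_integral_add) (auto simp: nn_integral_cmult T)
    also have "\<dots> = ennreal ((1 / p) * y powr (1 - p) * \<sigma> + (1 - 1 / p) * y * T)"
    proof -
      have nn: "0 \<le> (1 / p) * y powr (1 - p)" "0 \<le> (1 - 1 / p) * y"
        using p y by auto
      show ?thesis
        unfolding real ennreal_mult'[OF nn(1), symmetric] ennreal_mult'[OF nn(2), symmetric]
        using real T
        by (intro ennreal_plus[symmetric] mult_nonneg_nonneg[OF nn(1)] mult_nonneg_nonneg[OF nn(2)]) auto
    qed
    finally have "G \<le> (1 / p) * y powr (1 - p) * \<sigma> + (1 - 1 / p) * G"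
      using p y T real G0 by (subst (asm) ennreal_le_iff)
        (auto simp: y_def intro!: add_nonneg_nonneg mult_nonneg_nonneg divide_nonneg_nonneg)
    hence "G / p \<le> y powr (1 - p) * \<sigma> / p" by (simp add: algebra_simps)
    hence "G \<le> y powr (1 - p) * \<sigma>" using p by (simp add: divide_le_cancel)
    hence "G powr (p - 1) * G \<le> G powr (p - 1) * (y powr (1 - p) * \<sigma>)" by (intro mult_left_mono) auto
    also have "\<dots> = T powr (p - 1) * \<sigma>"
      using G0 T by (simp add: y_def powr_divide powr_diff field_simps)
    also have "G powr (p - 1) * G = G powr p" using G0 by (simp add: powr_diff)
    finally have "ennreal (G powr p) \<le> ennreal (T powr (p - 1) * \<sigma>)" by (rule ennreal_leI)
    thus ?thesis unfolding S_def[symmetric] real(2) by (simp add: ennreal_mult')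
  qed
qed (use p in simp)

text \<open>With \<open>N y\<close> the norm of \<open>a y\<close> (made positive by a small integrable summand), Jensen's
  inequality under the integral over \<open>x\<close> yields \<open>T\<^sup>p\<close>, where \<open>T\<close> is the integral of \<open>N\<close>.\<close>

theorem minkowski_integral:
  fixes a :: "'a \<Rightarrow> 'b \<Rightarrow> real"
  assumes M: "sigma_finite_measure M" and X: "sigma_finite_measure X" and p: "1 \<le> p"
    and am: "case_prod a \<in> borel_measurable (M \<Otimes>\<^sub>M X)" and a: "\<And>y x. 0 \<le> a y x"
    and G: "\<And>x. 0 \<le> G x" "\<And>x. x \<in> space X \<Longrightarrow> ennreal (G x) \<le> (\<integral>\<^sup>+ y. ennreal (a y x) \<partial>M)"
  shows "lpn p X G \<le> (\<integral>\<^sup>+ y. lpn p X (a y) \<partial>M)"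
proof (cases "\<integral>\<^sup>+ y. lpn p X (a y) \<partial>M" rule: ennreal_cases)
  case (real T0)
  interpret M: sigma_finite_measure M by fact
  interpret X: sigma_finite_measure X by fact
  interpret pair_sigma_finite M X ..
  note [measurable] = am lpn_measurable[OF X am]
  obtain k :: "'a \<Rightarrow> real" where k [measurable]: "k \<in> borel_measurable M" and k0: "\<And>x. k x > 0" and ki: "integrable M k"
    using M.obtain_positive_integrable_function by metis
  let ?K = "integral\<^sup>L M k"
  have K: "?K \<ge> 0" "(\<integral>\<^sup>+ y. ennreal (k y) \<partial>M) = ennreal ?K"
    using k0 ki by (simp_all add: less_imp_le nn_integral_eq_integral)
  have fin: "AE y in M. lpn p X (a y) \<noteq> \<infinity>"
    using real by (intro nn_integral_PInf_AE) auto
  have est: "lpn p X G \<le> ennreal (T0 + e * (?K + 1))" if e: "e > 0" for e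
  proof -
    define N where "N y = enn2real (lpn p X (a y)) + e * k y" for y
    have [measurable]: "N \<in> borel_measurable M" unfolding N_def by measurable
    have N: "N y > 0" for y using e k0[of y] by (simp add: N_def add_nonneg_pos)
    have "(\<integral>\<^sup>+ y. ennreal (N y) \<partial>M) = (\<integral>\<^sup>+ y. lpn p X (a y) + ennreal e * ennreal (k y) \<partial>M)"
    proof (intro nn_integral_cong_AE)
      show "AE y in M. ennreal (N y) = lpn p X (a y) + ennreal e * ennreal (k y)"
        using fin
      proof eventually_elim
        case (elim y)
        thus ?case using e k0[of y]
          by (simp add: N_def ennreal_plus ennreal_mult less_imp_le less_top)
      qed
    qed
    also have "\<dots> = ennreal T0 + ennreal e * ennreal ?K"
      by (subst nn_integral_add) (auto simp: nn_integral_cmult real K)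
    also have "\<dots> = ennreal (T0 + e * ?K)" using real e K by (simp add: ennreal_mult ennreal_plus)
    finally have NT: "(\<integral>\<^sup>+ y. ennreal (N y) \<partial>M) = ennreal (T0 + e * ?K)" .
    show ?thesis
    proof (cases "T0 + e * ?K = 0")
      case True
      \<comment> \<open>A positive function with integral \<open>0\<close> lives on a null space.\<close>
      hence "(\<integral>\<^sup>+ y. ennreal (N y) \<partial>M) = 0" using NT by simp
      hence "AE y in M. ennreal (N y) = 0" by (subst (asm) nn_integral_0_iff_AE) auto
      hence "AE y in M. False" by eventually_elim (metis N ennreal_eq_0_iff not_le)
      hence "(\<integral>\<^sup>+ y. ennreal (a y x) \<partial>M) = 0" if "x \<in> space X" for x
        by (subst nn_integral_cong_AE[where v = "\<lambda>_. 0"]) auto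
      hence "G x = 0" if "x \<in> space X" for x using G[of x] that by (simp add: antisym)
      hence "(\<integral>\<^sup>+ x. ennreal (G x powr p) \<partial>X) = 0" using p by (simp cong: nn_integral_cong)
      hence "lpn p X G = 0" using p by (simp add: lpn_def)
      thus ?thesis by simp
    next
      case False
      define T where "T = T0 + e * ?K"
      have T: "T > 0" using False real K e by (simp add: T_def less_le)
      have "(\<integral>\<^sup>+ x. ennreal (G x powr p) \<partial>X)
          \<le> (\<integral>\<^sup>+ x. ennreal (T powr (p - 1)) * (\<integral>\<^sup>+ y. ennreal (a y x powr p * N y powr (1 - p)) \<partial>M) \<partial>X)"
        by (intro nn_integral_mono jensen_powr p a N T G NT[folded T_def]) measurable
      also have "\<dots> = ennreal (T powr (p - 1)) * (\<integral>\<^sup>+ x. (\<integral>\<^sup>+ y. ennreal (a y x powr p * N y powr (1 - p)) \<partial>M) \<partial>X)"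
        by (rule nn_integral_cmult) measurable
      also have "(\<integral>\<^sup>+ x. (\<integral>\<^sup>+ y. ennreal (a y x powr p * N y powr (1 - p)) \<partial>M) \<partial>X)
          = (\<integral>\<^sup>+ y. (\<integral>\<^sup>+ x. ennreal (a y x powr p * N y powr (1 - p)) \<partial>X) \<partial>M)"
        by (rule Fubini') measurable
      also have "\<dots> = (\<integral>\<^sup>+ y. (\<integral>\<^sup>+ x. ennreal (a y x powr p) \<partial>X) * ennreal (N y powr (1 - p)) \<partial>M)"
        by (intro nn_integral_cong) (simp add: ennreal_mult nn_integral_multc)
      also have "\<dots> \<le> (\<integral>\<^sup>+ y. ennreal (N y) \<partial>M)"
      proof (intro nn_integral_mono_AE)
        show "AE y in M. (\<integral>\<^sup>+ x. ennreal (a y x powr p) \<partial>X) * ennreal (N y powr (1 - p)) \<le> ennreal (N y)"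
          using fin
        proof eventually_elim
          case (elim y)
          have "lpn p X (a y) = ennreal (enn2real (lpn p X (a y)))" using elim by (simp add: less_top)
          also have "\<dots> \<le> ennreal (N y)" using e k0[of y] by (intro ennreal_leI) (simp add: N_def)
          finally have "(\<integral>\<^sup>+ x. ennreal (a y x powr p) \<partial>X) \<le> ennreal (N y powr p)"
            using N[of y] p by (subst (asm) lpn_le_iff) auto
          hence "(\<integral>\<^sup>+ x. ennreal (a y x powr p) \<partial>X) * ennreal (N y powr (1 - p)) \<le> ennreal (N y powr p) * ennreal (N y powr (1 - p))"
            by (rule mult_right_mono) simp
          also have "\<dots> = ennreal (N y)" using N[of y]
            by (simp add: ennreal_mult[symmetric] powr_add[symmetric])
          finally show ?case .
        qed
      qed
      also have "\<dots> = ennreal T" using NT by (simp add: T_def)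
      also have "ennreal (T powr (p - 1)) * ennreal T = ennreal (T powr p)"
        using T by (simp add: ennreal_mult[symmetric] powr_diff)
      finally have "lpn p X G \<le> ennreal T" using p T by (subst lpn_le_iff) (auto simp: mult_left_mono)
      also have "\<dots> \<le> ennreal (T0 + e * (?K + 1))" using e by (intro ennreal_leI) (simp add: T_def)
      finally show ?thesis .
    qed
  qed
  show ?thesis
  proof (rule ennreal_le_epsilon)
    fix e :: real assume e: "e > 0"
    have "lpn p X G \<le> ennreal (T0 + (e / (?K + 1)) * (?K + 1))" using e K by (intro est) (auto simp: add_nonneg_pos)
    also have "(e / (?K + 1)) * (?K + 1) = e" using K by simp
    also have "ennreal (T0 + e) = ennreal T0 + ennreal e" using real e by (simp add: ennreal_plus)
    finally show "lpn p X G \<le> (\<integral>\<^sup>+ y. lpn p X (a y) \<partial>M) + ennreal e" using real by simp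
  qed
qed simp

lemma lpn_triangle:
  assumes X: "sigma_finite_measure X" and p: "1 \<le> p"
    and [measurable]: "f \<in> borel_measurable X" "g \<in> borel_measurable X"
    and nn: "\<And>x. 0 \<le> f x" "\<And>x. 0 \<le> g x" and h: "\<And>x. 0 \<le> h x" "\<And>x. h x \<le> f x + g x"
  shows "lpn p X h \<le> lpn p X f + lpn p X g"
proof -
  let ?M = "count_space (UNIV :: bool set)"
  let ?a = "\<lambda>b x. if b then f x else g x"
  have "lpn p X h \<le> (\<integral>\<^sup>+ b. lpn p X (?a b) \<partial>?M)"
  proof (rule minkowski_integral)
    show "sigma_finite_measure ?M" by (rule sigma_finite_measure_count_space_finite) simp
    show "case_prod ?a \<in> borel_measurable (?M \<Otimes>\<^sub>M X)"
      by (rule measurable_pair_measure_countable1) (auto split: if_splits)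
    fix x
    show "ennreal (h x) \<le> (\<integral>\<^sup>+ b. ennreal (?a b x) \<partial>?M)"
      using h(2)[of x] nn[of x]
      by (simp add: nn_integral_count_space_finite UNIV_bool ennreal_plus[symmetric] add.commute del: ennreal_plus)
  qed (use assms in auto)
  also have "\<dots> = lpn p X f + lpn p X g"
    by (simp add: nn_integral_count_space_finite UNIV_bool add.commute)
  finally show ?thesis .
qed

section \<open>The Fourier--Beurling algebra as inverse transforms of weighted integrable functions\<close>

definition inverse_fourier :: "(real^'n::finite \<Rightarrow> complex) \<Rightarrow> real^'n \<Rightarrow> complex" where
  "inverse_fourier h t = (LINT \<zeta>|lborel. h \<zeta> * exp (\<i> * of_real (\<zeta> \<bullet> t))) / (2 * pi) ^ CARD('n)"

definition beurling_mass :: "real \<Rightarrow> (real^'n::finite \<Rightarrow> complex) \<Rightarrow> ennreal" where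
  "beurling_mass s h = (\<integral>\<^sup>+ \<zeta>. ennreal (bracket \<zeta> powr s * cmod (h \<zeta>)) \<partial>lborel)"

text \<open>The symbol is the Fourier transform of \<open>f\<close> as a function; equality with its inverse transform is
  required at every point, which picks the continuous representative.\<close>

definition has_symbol :: "real \<Rightarrow> (real^'n::finite \<Rightarrow> complex) \<Rightarrow> (real^'n \<Rightarrow> complex) \<Rightarrow> bool" where
  "has_symbol s f h \<longleftrightarrow> h \<in> borel_measurable borel \<and> beurling_mass s h < \<infinity> \<and> f = inverse_fourier h"

lemma inverse_fourier_eq: "inverse_fourier h t = fourier h (- t) / (2 * pi) ^ CARD('n)"
  for h :: "real^'n::finite \<Rightarrow> complex"
  by (simp add: inverse_fourier_def fourier_def)

lemma bracket_powr_ge_1: "0 \<le> s \<Longrightarrow> 1 \<le> bracket x powr s"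
  by (simp add: ge_one_powr_ge_zero bracket_ge_1)

lemma nn_integral_norm_le_beurling_mass:
  fixes h :: "real^'n::finite \<Rightarrow> complex"
  assumes "0 \<le> s" shows "(\<integral>\<^sup>+ x. ennreal (cmod (h x)) \<partial>lborel) \<le> beurling_mass s h"
  unfolding beurling_mass_def
proof (intro nn_integral_mono ennreal_leI)
  fix x :: "real^'n"
  show "cmod (h x) \<le> bracket x powr s * cmod (h x)"
    using mult_right_mono[OF bracket_powr_ge_1[OF assms, of x] norm_ge_zero[of "h x"]] by simp
qed

lemma beurling_mass_integrable:
  assumes "0 \<le> s" "h \<in> borel_measurable borel" "beurling_mass s h < \<infinity>"
  shows "integrable lborel h"
  using assms nn_integral_norm_le_beurling_mass[OF assms(1), of h]
  by (intro integrableI_bounded) auto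

lemma has_symbol_integrable: "0 \<le> s \<Longrightarrow> has_symbol s f h \<Longrightarrow> integrable lborel h"
  unfolding has_symbol_def using beurling_mass_integrable by blast

lemma continuous_inverse_fourier:
  fixes h :: "real^'n::finite \<Rightarrow> complex"
  assumes "integrable lborel h" shows "continuous_on UNIV (inverse_fourier h)"
proof -
  have "continuous_on UNIV (\<lambda>t. fourier h (- t))"
    by (rule continuous_on_compose2[OF continuous_fourier[OF assms]]) (auto intro: continuous_intros)
  thus ?thesis unfolding inverse_fourier_eq[abs_def] by (auto intro!: continuous_intros)
qed

lemma norm_inverse_fourier_le:
  fixes h :: "real^'n::finite \<Rightarrow> complex"
  assumes "integrable lborel h"
  shows "cmod (inverse_fourier h t) \<le> (LINT x|lborel. cmod (h x)) / (2 * pi) ^ CARD('n)"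
  unfolding inverse_fourier_eq norm_divide
  using norm_fourier_le[OF assms, of "- t"] by (simp add: norm_power divide_right_mono norm_mult)

lemma norm_value_le_beurling_mass:
  fixes h :: "real^'n::finite \<Rightarrow> complex"
  assumes s: "0 \<le> s" and h: "has_symbol s f h"
  shows "ennreal (cmod (f t)) \<le> ennreal (1 / (2 * pi) ^ CARD('n)) * beurling_mass s h"
proof -
  have i: "integrable lborel h" using has_symbol_integrable[OF s h] .
  have "cmod (f t) \<le> (1 / (2 * pi) ^ CARD('n)) * (LINT x|lborel. cmod (h x))"
    using norm_inverse_fourier_le[OF i, of t] h by (simp add: has_symbol_def)
  hence "ennreal (cmod (f t)) \<le> ennreal (1 / (2 * pi) ^ CARD('n)) * ennreal (LINT x|lborel. cmod (h x))"
    by (subst ennreal_mult[symmetric]) (auto intro: ennreal_leI)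
  also have "ennreal (LINT x|lborel. cmod (h x)) = (\<integral>\<^sup>+ x. ennreal (cmod (h x)) \<partial>lborel)"
    using i by (intro nn_integral_eq_integral[symmetric]) auto
  also have "\<dots> \<le> beurling_mass s h" by (rule nn_integral_norm_le_beurling_mass[OF s])
  finally show ?thesis by (simp add: mult_left_mono)
qed

text \<open>One summand of the Schwartz norm is a weighted supremum of the function itself. With exponent
  \<open>2n\<close> it controls the \<open>L\<^sup>1\<close> norm, so bounded functions define tempered distributions.\<close>

lemma schwartz_norm_bound:
  fixes \<psi> :: "real^'n::finite \<Rightarrow> complex"
  assumes \<psi>: "\<psi> \<in> schwartz"
  shows "bracket x ^ k * cmod (\<psi> x) \<le> schwartz_norm k \<psi>"
proof -
  have bdd: "bdd_above (range (\<lambda>x. bracket x ^ k * cmod (iter_partial js \<psi> x)))" for js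
  proof -
    have "bounded (range (\<lambda>x. bracket x ^ k *\<^sub>R iter_partial js \<psi> x))"
      using \<psi> unfolding schwartz_def by blast
    then obtain B where "\<And>x. norm (bracket x ^ k *\<^sub>R iter_partial js \<psi> x) \<le> B"
      unfolding bounded_iff by blast
    thus ?thesis by (intro bdd_aboveI[of _ B]) auto
  qed
  have fin: "finite {js :: 'n list. length js \<le> k}"
    using finite_lists_length_le[of "UNIV :: 'n set" k] by simp
  have "bracket x ^ k * cmod (\<psi> x) \<le> (SUP x. bracket x ^ k * cmod (iter_partial [] \<psi> x))"
    using cSUP_upper[OF _ bdd[of "[]"], of x] by (simp add: iter_partial_def)
  also have "\<dots> \<le> schwartz_norm k \<psi>"
    unfolding schwartz_norm_def
  proof (rule member_le_sum[OF _ _ fin, of "[]"])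
    fix js :: "'n list"
    have "0 \<le> bracket x ^ k * cmod (iter_partial js \<psi> x)" by simp
    also have "\<dots> \<le> (SUP x. bracket x ^ k * cmod (iter_partial js \<psi> x))"
      by (rule cSUP_upper[OF _ bdd]) simp
    finally show "0 \<le> (SUP x. bracket x ^ k * cmod (iter_partial js \<psi> x))" .
  qed simp
  finally show ?thesis .
qed

lemma bounded_given_by:
  fixes f :: "real^'n::finite \<Rightarrow> complex"
  assumes fm: "f \<in> borel_measurable borel" and B: "\<And>x. cmod (f x) \<le> B"
  shows "given_by (distr_of f) f" and "distr_of f \<in> tempered_distributions"
proof -
  let ?N = "2 * CARD('n)"
  have [measurable]: "f \<in> borel_measurable borel" by fact
  have i: "integrable lborel (\<lambda>x. f x * \<phi> x)" if "\<phi> \<in> schwartz" for \<phi>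
    by (rule integrable_mult_bounded(2)[OF schwartz_integrable[OF that] _ B]) simp
  show "given_by (distr_of f) f" unfolding given_by_def using i by simp
  have B0: "0 \<le> B" using order_trans[OF norm_ge_zero B] .
  define C where "C = B * (LINT x|lborel. inverse (bracket (x :: real^'n) ^ ?N))"
  have "cmod (distr_of f \<phi>) \<le> C * schwartz_norm ?N \<phi>" if \<phi>: "\<phi> \<in> schwartz" for \<phi>
  proof -
    have "cmod (LINT x|lborel. f x * \<phi> x) \<le> (LINT x :: real^'n|lborel. (B * schwartz_norm ?N \<phi>) * inverse (bracket x ^ ?N))"
    proof (rule Bochner_Integration.integral_norm_bound_integral)
      fix x :: "real^'n"
      have "cmod (\<phi> x) \<le> schwartz_norm ?N \<phi> * inverse (bracket x ^ ?N)"
        using schwartz_norm_bound[OF \<phi>, of x ?N] by (simp add: field_simps)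
      hence "cmod (f x) * cmod (\<phi> x) \<le> B * (schwartz_norm ?N \<phi> * inverse (bracket x ^ ?N))"
        using B B0 by (intro mult_mono) auto
      thus "norm (f x * \<phi> x) \<le> (B * schwartz_norm ?N \<phi>) * inverse (bracket x ^ ?N)"
        by (simp add: norm_mult mult.assoc)
    qed (use i[OF \<phi>] integrable_inverse_bracket in auto)
    thus ?thesis using \<phi> by (simp add: distr_of_def C_def mult_ac)
  qed
  moreover have "distr_of f (\<lambda>x. \<phi> x + \<psi> x) = distr_of f \<phi> + distr_of f \<psi>"
    if "\<phi> \<in> schwartz" "\<psi> \<in> schwartz" for \<phi> \<psi>
    using that i schwartz_add[OF that] by (simp add: distr_of_def distrib_left)
  moreover have "distr_of f (\<lambda>x. c * \<phi> x) = c * distr_of f \<phi>" if "\<phi> \<in> schwartz" for \<phi> c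
    using that schwartz_cmult[OF that, of c] by (simp add: distr_of_def mult.left_commute)
  ultimately show "distr_of f \<in> tempered_distributions"
    unfolding tempered_distributions_def by (auto simp: distr_of_def)
qed

lemma fourier_reflect:
  fixes f :: "real^'n::finite \<Rightarrow> complex"
  assumes [measurable]: "f \<in> borel_measurable borel"
  shows "fourier (\<lambda>t. f (- t)) x = fourier f (- x)"
proof -
  have "fourier (\<lambda>t. f (- t)) x = (LINT t|lborel. (\<lambda>t. f t * exp (- (\<i> * of_real (t \<bullet> - x)))) (0 - t))"
    unfolding fourier_def by simp
  also have "\<dots> = (LINT t|lborel. f t * exp (- (\<i> * of_real (t \<bullet> - x))))"
    by (rule integral_reflect) measurable
  finally show ?thesis unfolding fourier_def .
qed

text \<open>The multiplication formula moves the transform from \<open>h\<close> to the transform of the test function,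
  where Fourier inversion applies.\<close>

lemma fourier_distr_inverse_fourier:
  fixes h :: "real^'n::finite \<Rightarrow> complex"
  assumes s: "0 \<le> s" and h: "has_symbol s f h"
  shows "given_by (fourier_distr (distr_of f)) h"
proof -
  have hi: "integrable lborel h" using has_symbol_integrable[OF s h] .
  have hm [measurable]: "h \<in> borel_measurable borel" and f: "f = inverse_fourier h"
    using h by (auto simp: has_symbol_def)
  have "fourier_distr (distr_of f) \<psi> = (LINT x|lborel. h x * \<psi> x)" if \<psi>: "\<psi> \<in> schwartz" for \<psi>
  proof -
    have F: "fourier \<psi> \<in> schwartz" by (rule schwartz_fourier[OF \<psi>])
    note [measurable] = schwartz_measurable[OF F] fourier_measurable[OF hi]
    have Fi: "integrable lborel (\<lambda>t. fourier \<psi> (- t))"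
      using integrable_reflect[of "fourier \<psi>" 0] schwartz_integrable[OF F] by simp
    have inv: "fourier (\<lambda>t. fourier \<psi> (- t)) x = (2 * pi) ^ CARD('n) * \<psi> x" for x
    proof -
      have "fourier (\<lambda>t. fourier \<psi> (- t)) x = (LINT \<xi>|lborel. fourier \<psi> \<xi> * exp (\<i> * of_real (\<xi> \<bullet> x)))"
        unfolding fourier_reflect[OF schwartz_measurable[OF F]] by (subst fourier_def) simp
      also have "\<dots> = (2 * pi) ^ CARD('n) * \<psi> x"
        using schwartz_continuous[OF \<psi>]
        by (intro fourier_inversion schwartz_integrable \<psi> F) (simp add: continuous_on_eq_continuous_at)
      finally show ?thesis .
    qed
    have "fourier_distr (distr_of f) \<psi> = (LINT t|lborel. f t * fourier \<psi> t)"
      using \<psi> F by (simp add: fourier_distr_def distr_of_def)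
    also have "\<dots> = (LINT t|lborel. (\<lambda>t. fourier h t * fourier \<psi> (- t)) (0 - t)) / (2 * pi) ^ CARD('n)"
      by (simp add: f inverse_fourier_eq)
    also have "(LINT t|lborel. (\<lambda>t. fourier h t * fourier \<psi> (- t)) (0 - t)) = (LINT t|lborel. fourier h t * fourier \<psi> (- t))"
      by (rule integral_reflect) measurable
    also have "\<dots> = (LINT x|lborel. h x * fourier (\<lambda>t. fourier \<psi> (- t)) x)"
      by (rule fourier_multiplication_formula[OF hi Fi])
    also have "\<dots> = (LINT x|lborel. (2 * pi) ^ CARD('n) * (h x * \<psi> x))"
      unfolding inv by (simp add: mult_ac)
    also have "\<dots> = (2 * pi) ^ CARD('n) * (LINT x|lborel. h x * \<psi> x)" by (rule integral_mult_right_zero)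
    finally show ?thesis by simp
  qed
  moreover have "integrable lborel (\<lambda>x. h x * \<psi> x)" if \<psi>: "\<psi> \<in> schwartz" for \<psi>
  proof -
    obtain B where "\<And>x. cmod (\<psi> x) \<le> B" using rapid_bounded[OF schwartz_rapid[OF \<psi>]] by blast
    thus ?thesis using schwartz_measurable[OF \<psi>] by (intro integrable_mult_bounded(1)[OF hi]) auto
  qed
  ultimately show ?thesis
    unfolding given_by_def by (auto simp: distr_of_def fourier_distr_def fun_eq_iff restrict_def)
qed

text \<open>Testing the Fourier transform of \<open>f\<close> on Gaussians recovers the values of \<open>f\<close>.\<close>

lemma has_symbol_if_given_by:
  fixes f h :: "real^'n::finite \<Rightarrow> complex"
  assumes s: "0 \<le> s" and f: "continuous_on UNIV f" "given_by (distr_of f) f"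
    and h: "given_by (fourier_distr (distr_of f)) h" "beurling_mass s h < \<infinity>"
  shows "has_symbol s f h"
proof -
  have hm: "h \<in> borel_measurable borel" using h by (simp add: given_by_def)
  have hi: "integrable lborel h" by (rule beurling_mass_integrable[OF s hm h(2)])
  have "f x = inverse_fourier h x" for x
  proof -
    have "(LINT \<zeta>|lborel. h \<zeta> * exp (\<i> * of_real (\<zeta> \<bullet> x))) = (2 * pi) ^ CARD('n) * f x"
    proof (rule inversion_from_waves)
      have "(\<lambda>y. complex_of_real (gauss 1 (y - x))) \<in> schwartz"
        by (rule schwartz_shift[OF schwartz_gauss]) simp
      hence "integrable lborel (\<lambda>y. f y * of_real (gauss 1 (y - x)))"
        using f(2) by (auto simp: given_by_def)
      thus "integrable lborel (\<lambda>y. gauss 1 (y - x) *\<^sub>R f y)"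
        by (simp add: scaleR_conv_of_real mult.commute)
      show "isCont f x" using f(1) by (simp add: continuous_on_eq_continuous_at)
      fix a :: real assume a: "0 < a"
      have "(LINT y|lborel. f y * of_real (heat a (y - x))) = distr_of f (fourier (wave a x))"
        using schwartz_fourier[OF schwartz_wave[OF a, of x]] by (simp add: distr_of_def fourier_wave[OF a])
      also have "\<dots> = fourier_distr (distr_of f) (wave a x)"
        using schwartz_wave[OF a, of x] by (simp add: fourier_distr_def)
      also have "\<dots> = distr_of h (wave a x)" using h(1) by (simp add: given_by_def)
      also have "\<dots> = (LINT \<zeta>|lborel. h \<zeta> * wave a x \<zeta>)"
        using schwartz_wave[OF a, of x] by (simp add: distr_of_def)
      finally show "(LINT y|lborel. f y * of_real (heat a (y - x))) = (LINT \<zeta>|lborel. h \<zeta> * wave a x \<zeta>)" .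
    qed (use f hi borel_measurable_continuous_onI in auto)
    thus ?thesis by (simp add: inverse_fourier_def)
  qed
  thus ?thesis using hm h(2) by (auto simp: has_symbol_def)
qed

abbreviation FB :: "real \<Rightarrow> (real^'n::finite \<Rightarrow> complex) set" where
  "FB s \<equiv> continuous_functions_of (fourier_beurling_space s)"

lemma has_symbol_bounded:
  assumes s: "0 \<le> s" and h: "has_symbol s f h"
  shows "continuous_on UNIV f" "\<exists>B. \<forall>x. cmod (f x) \<le> B"
proof -
  have i: "integrable lborel h" and f: "f = inverse_fourier h"
    using has_symbol_integrable[OF s h] h by (auto simp: has_symbol_def)
  show "continuous_on UNIV f" unfolding f by (rule continuous_inverse_fourier[OF i])
  show "\<exists>B. \<forall>x. cmod (f x) \<le> B" unfolding f using norm_inverse_fourier_le[OF i] by blast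
qed

lemma FB_iff:
  assumes s: "0 \<le> s" shows "f \<in> FB s \<longleftrightarrow> (\<exists>h. has_symbol s f h)"
proof
  assume "f \<in> FB s"
  then obtain u where c: "continuous_on UNIV f" and u: "u \<in> fourier_beurling_space s" "given_by u f"
    unfolding continuous_functions_of_def by blast
  have uf: "u = distr_of f" using u by (simp add: given_by_def)
  from u obtain h where h: "given_by (fourier_distr u) h"
    "(\<integral>\<^sup>+ \<xi>. ennreal (bracket \<xi> powr s * cmod (h \<xi>)) \<partial>lborel) < \<infinity>"
    unfolding fourier_beurling_space_def fourier_beurling_norm_def by (auto simp: INF_less_iff)
  have "has_symbol s f h"
    using has_symbol_if_given_by[OF s c] u h by (simp add: uf beurling_mass_def)
  thus "\<exists>h. has_symbol s f h" by blast
next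
  assume "\<exists>h. has_symbol s f h"
  then obtain h where h: "has_symbol s f h" by blast
  have c: "continuous_on UNIV f" and "\<exists>B. \<forall>x. cmod (f x) \<le> B" using has_symbol_bounded[OF s h] .
  then obtain B where "\<And>x. cmod (f x) \<le> B" by blast
  from bounded_given_by[OF borel_measurable_continuous_onI[OF c] this]
  have g: "given_by (distr_of f) f" "distr_of f \<in> tempered_distributions" .
  have "fourier_beurling_norm s (distr_of f) \<le> beurling_mass s h"
    unfolding fourier_beurling_norm_def beurling_mass_def
    by (rule INF_lower) (simp add: fourier_distr_inverse_fourier[OF s h])
  also have "\<dots> < \<infinity>" using h by (simp add: has_symbol_def)
  finally have "distr_of f \<in> fourier_beurling_space s"
    unfolding fourier_beurling_space_def using g by simp
  thus "f \<in> FB s" unfolding continuous_functions_of_def using c g by blast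
qed

lemma FB_norm_le:
  assumes "0 \<le> s" "has_symbol s f h" shows "fourier_beurling_norm s (distr_of f) \<le> beurling_mass s h"
  unfolding fourier_beurling_norm_def beurling_mass_def
  by (rule INF_lower) (simp add: fourier_distr_inverse_fourier[OF assms])

lemma continuous_functions_ofD: "f \<in> continuous_functions_of A \<Longrightarrow> given_by (distr_of f) f \<and> distr_of f \<in> A \<and> continuous_on UNIV f"
  unfolding continuous_functions_of_def given_by_def by auto

text \<open>Inequalities proved for symbols pass to the norm, an infimum over symbols, through this lemma
  and \<open>ennreal_le_epsilon\<close>.\<close>

lemma FB_norm_approx:
  assumes s: "0 \<le> s" and f: "f \<in> FB s" and C: "fourier_beurling_norm s (distr_of f) < C"
  shows "\<exists>h. has_symbol s f h \<and> beurling_mass s h < C"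
proof -
  from C obtain h where h: "given_by (fourier_distr (distr_of f)) h" "beurling_mass s h < C"
    unfolding fourier_beurling_norm_def beurling_mass_def by (auto simp: INF_less_iff)
  have "beurling_mass s h < \<infinity>" using h(2) by (simp add: order.strict_trans2)
  thus ?thesis using has_symbol_if_given_by[OF s _ _ h(1)] continuous_functions_ofD[OF f] h(2) by blast
qed

lemma FB_norm_finite: "f \<in> FB s \<Longrightarrow> fourier_beurling_norm s (distr_of f) < \<infinity>"
  using continuous_functions_ofD[of f] by (auto simp: fourier_beurling_space_def)

subsection \<open>Algebra structure\<close>

lemma beurling_mass_add_le:
  assumes [measurable]: "h \<in> borel_measurable borel" "k \<in> borel_measurable borel"
  shows "beurling_mass s (\<lambda>x. h x + k x) \<le> beurling_mass s h + beurling_mass s k"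
proof -
  have "beurling_mass s (\<lambda>x. h x + k x) \<le> (\<integral>\<^sup>+ x. ennreal (bracket x powr s * cmod (h x)) + ennreal (bracket x powr s * cmod (k x)) \<partial>lborel)"
    unfolding beurling_mass_def
    by (intro nn_integral_mono)
       (auto simp: ennreal_plus[symmetric] distrib_left[symmetric] norm_triangle_ineq simp del: ennreal_plus
             intro!: ennreal_leI mult_left_mono)
  also have "\<dots> = beurling_mass s h + beurling_mass s k"
    unfolding beurling_mass_def by (rule nn_integral_add) measurable
  finally show ?thesis .
qed

lemma beurling_mass_cmult:
  assumes [measurable]: "h \<in> borel_measurable borel"
  shows "beurling_mass s (\<lambda>x. c * h x) = ennreal (cmod c) * beurling_mass s h"
  unfolding beurling_mass_def
  by (subst nn_integral_cmult[symmetric]) (auto simp: norm_mult ennreal_mult[symmetric] mult_ac)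

lemma has_symbol_add:
  assumes s: "0 \<le> s" and f: "has_symbol s f h" and g: "has_symbol s g k"
  shows "has_symbol s (\<lambda>x. f x + g x) (\<lambda>x. h x + k x)"
proof -
  have m [measurable]: "h \<in> borel_measurable borel" "k \<in> borel_measurable borel"
    using f g by (auto simp: has_symbol_def)
  have i: "integrable lborel h" "integrable lborel k" using has_symbol_integrable[OF s] f g by blast+
  have "inverse_fourier (\<lambda>x. h x + k x) t = inverse_fourier h t + inverse_fourier k t" for t
    by (simp add: inverse_fourier_eq fourier_add[OF i] add_divide_distrib)
  moreover have "beurling_mass s (\<lambda>x. h x + k x) < \<infinity>"
    using beurling_mass_add_le[OF m, of s] f g by (auto simp: has_symbol_def intro: le_less_trans)
  ultimately show ?thesis using f g by (auto simp: has_symbol_def)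
qed

lemma has_symbol_cmult:
  assumes f: "has_symbol s f h" shows "has_symbol s (\<lambda>x. c * f x) (\<lambda>x. c * h x)"
proof -
  have m: "h \<in> borel_measurable borel" using f by (auto simp: has_symbol_def)
  have "inverse_fourier (\<lambda>x. c * h x) t = c * inverse_fourier h t" for t
    by (simp add: inverse_fourier_eq fourier_cmult)
  thus ?thesis using f beurling_mass_cmult[OF m, of s c]
    by (auto simp: has_symbol_def ennreal_mult_less_top)
qed

lemma norm_integral_le_nn_integral:
  fixes f :: "'a \<Rightarrow> 'b::{banach, second_countable_topology}"
  shows "ennreal (norm (integral\<^sup>L M f)) \<le> (\<integral>\<^sup>+ x. ennreal (norm (f x)) \<partial>M)"
proof (cases "integrable M f")
  case True thus ?thesis by (rule integral_norm_bound_ennreal)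
qed (simp add: not_integrable_integral_eq)

definition conv :: "(real^'n::finite \<Rightarrow> complex) \<Rightarrow> (real^'n \<Rightarrow> complex) \<Rightarrow> real^'n \<Rightarrow> complex" where
  "conv h k \<zeta> = (LINT \<eta>|lborel. h \<eta> * k (\<zeta> - \<eta>))"

lemma conv_measurable:
  assumes [measurable]: "h \<in> borel_measurable borel" "k \<in> borel_measurable borel"
  shows "conv h k \<in> borel_measurable borel"
  unfolding conv_def by measurable


lemma fourier_conv:
  fixes h k :: "real^'n::finite \<Rightarrow> complex"
  assumes hi: "integrable lborel h" and ki: "integrable lborel k"
  shows "integrable lborel (conv h k)" and "fourier (conv h k) t = fourier h t * fourier k t"
proof -
  have [measurable]: "h \<in> borel_measurable borel" "k \<in> borel_measurable borel" using hi ki by auto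
  let ?e = "\<lambda>\<tau> \<zeta>. exp (- (\<i> * complex_of_real (\<zeta> \<bullet> \<tau>)))"
  have int: "integrable (lborel \<Otimes>\<^sub>M lborel) (\<lambda>(\<eta>, \<zeta>). h \<eta> * (k (\<zeta> - \<eta>) * ?e \<tau> \<zeta>))" for \<tau> :: "real^'n"
  proof (rule lborel_pair.Fubini_integrable)
    have kt: "integrable lborel (\<lambda>\<zeta>. k (\<zeta> - \<eta>))" for \<eta>
      using integrable_translate[of k "- \<eta>"] ki by simp
    show "AE \<eta> in lborel. integrable lborel (\<lambda>\<zeta>. case (\<eta>, \<zeta>) of (\<eta>, \<zeta>) \<Rightarrow> h \<eta> * (k (\<zeta> - \<eta>) * ?e \<tau> \<zeta>))"
      using character_integrable[OF kt] by auto
    have "(LINT \<zeta>|lborel. norm (k (\<zeta> - \<eta>))) = (LINT \<zeta>|lborel. norm (k \<zeta>))" for \<eta>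
      using integral_translate[of "\<lambda>\<zeta>. norm (k \<zeta>)" "- \<eta>"] by simp
    thus "integrable lborel (\<lambda>\<eta>. LINT \<zeta>|lborel. norm (case (\<eta>, \<zeta>) of (\<eta>, \<zeta>) \<Rightarrow> h \<eta> * (k (\<zeta> - \<eta>) * ?e \<tau> \<zeta>)))"
      using hi by (simp add: norm_mult)
  qed measurable
  show "integrable lborel (conv h k)"
    using lborel_pair.integrable_snd[OF int[of 0]] by (simp add: conv_def[abs_def])
  have "fourier (conv h k) t = (LINT \<zeta>|lborel. LINT \<eta>|lborel. h \<eta> * (k (\<zeta> - \<eta>) * ?e t \<zeta>))"
    unfolding fourier_def conv_def by (simp add: mult.assoc[symmetric])
  also have "\<dots> = (LINT \<eta>|lborel. LINT \<zeta>|lborel. h \<eta> * (k (\<zeta> - \<eta>) * ?e t \<zeta>))"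
    using lborel_pair.Fubini_integral[OF int] by simp
  also have "\<dots> = (LINT \<eta>|lborel. h \<eta> * ?e t \<eta> * (LINT \<zeta>|lborel. k \<zeta> * ?e t \<zeta>))"
  proof (intro Bochner_Integration.integral_cong refl)
    fix \<eta>
    have "(LINT \<zeta>|lborel. h \<eta> * (k (\<zeta> - \<eta>) * ?e t \<zeta>)) = h \<eta> * ?e t \<eta> * (LINT \<zeta>|lborel. (\<lambda>\<zeta>. k \<zeta> * ?e t \<zeta>) (\<zeta> + - \<eta>))"
      unfolding integral_mult_right_zero[symmetric]
      by (intro Bochner_Integration.integral_cong)
         (simp_all add: inner_diff_left exp_diff exp_minus right_diff_distrib field_simps)
    also have "(LINT \<zeta>|lborel. (\<lambda>\<zeta>. k \<zeta> * ?e t \<zeta>) (\<zeta> + - \<eta>)) = (LINT \<zeta>|lborel. k \<zeta> * ?e t \<zeta>)"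
      by (rule integral_translate) measurable
    finally show "(LINT \<zeta>|lborel. h \<eta> * (k (\<zeta> - \<eta>) * ?e t \<zeta>)) = h \<eta> * ?e t \<eta> * (LINT \<zeta>|lborel. k \<zeta> * ?e t \<zeta>)" .
  qed
  finally show "fourier (conv h k) t = fourier h t * fourier k t"
    unfolding fourier_def by simp
qed

lemma continuous_conv:
  fixes h k :: "real^'n::finite \<Rightarrow> complex"
  assumes hi: "integrable lborel h" and k: "continuous_on UNIV k" and B: "\<And>x. cmod (k x) \<le> B"
  shows "continuous_on UNIV (conv h k)"
  unfolding continuous_on_sequentially
proof (intro allI ballI impI, elim conjE)
  fix X :: "nat \<Rightarrow> real^'n" and a assume X: "X \<longlonglongrightarrow> a"
  have [measurable]: "h \<in> borel_measurable borel" "k \<in> borel_measurable borel"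
    using hi borel_measurable_continuous_onI[OF k] by auto
  show "(conv h k \<circ> X) \<longlonglongrightarrow> conv h k a"
    unfolding conv_def o_def
  proof (rule integral_dominated_convergence[where w = "\<lambda>x. cmod (h x) * B"])
    have "(\<lambda>n. k (X n - x)) \<longlonglongrightarrow> k (a - x)" for x
      by (rule continuous_on_tendsto_compose[OF k]) (auto intro!: tendsto_intros X)
    thus "AE x in lborel. (\<lambda>n. h x * k (X n - x)) \<longlonglongrightarrow> h x * k (a - x)"
      by (intro AE_I2 tendsto_intros)
    show "AE x in lborel. norm (h x * k (X i - x)) \<le> cmod (h x) * B" for i
      using B by (intro AE_I2) (auto simp: norm_mult intro!: mult_left_mono)
  qed (use hi in auto)
qed

text \<open>Submultiplicativity of the weight: \<open>\<langle>\<zeta>\<rangle>\<^sup>s \<le> 2\<^sup>s \<langle>\<eta>\<rangle>\<^sup>s \<langle>\<zeta> - \<eta>\<rangle>\<^sup>s\<close>, in the form of a weighted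
  Young inequality.\<close>

lemma weighted_conv_le:
  fixes A B :: "real^'n::finite \<Rightarrow> ennreal"
  assumes s: "0 \<le> s" and [measurable]: "A \<in> borel_measurable borel" "B \<in> borel_measurable borel"
  shows "(\<integral>\<^sup>+ \<zeta>. ennreal (bracket \<zeta> powr s) * (\<integral>\<^sup>+ \<eta>. A \<eta> * B (\<zeta> - \<eta>) \<partial>lborel) \<partial>lborel)
    \<le> ennreal (2 powr s) * (\<integral>\<^sup>+ \<zeta>. ennreal (bracket \<zeta> powr s) * A \<zeta> \<partial>lborel) * (\<integral>\<^sup>+ \<zeta>. ennreal (bracket \<zeta> powr s) * B \<zeta> \<partial>lborel)"
proof -
  let ?w = "\<lambda>\<zeta>. ennreal (bracket \<zeta> powr s)"
  have w: "?w \<zeta> \<le> ennreal (2 powr s) * ?w \<eta> * ?w (\<zeta> - \<eta>)" for \<zeta> \<eta> :: "real^'n"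
    using ennreal_leI[OF bracket_powr_add_le[OF s, of \<eta> "\<zeta> - \<eta>"]] by (simp add: ennreal_mult)
  have "(\<integral>\<^sup>+ \<zeta>. ?w \<zeta> * (\<integral>\<^sup>+ \<eta>. A \<eta> * B (\<zeta> - \<eta>) \<partial>lborel) \<partial>lborel)
      = (\<integral>\<^sup>+ \<zeta>. (\<integral>\<^sup>+ \<eta>. ?w \<zeta> * (A \<eta> * B (\<zeta> - \<eta>)) \<partial>lborel) \<partial>lborel)"
    by (intro nn_integral_cong nn_integral_cmult[symmetric]) measurable
  also have "\<dots> \<le> (\<integral>\<^sup>+ \<zeta>. (\<integral>\<^sup>+ \<eta>. (ennreal (2 powr s) * (?w \<eta> * A \<eta>)) * (?w (\<zeta> - \<eta>) * B (\<zeta> - \<eta>)) \<partial>lborel) \<partial>lborel)"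
  proof (intro nn_integral_mono)
    fix \<zeta> \<eta> :: "real^'n"
    have "?w \<zeta> * (A \<eta> * B (\<zeta> - \<eta>)) \<le> (ennreal (2 powr s) * ?w \<eta> * ?w (\<zeta> - \<eta>)) * (A \<eta> * B (\<zeta> - \<eta>))"
      by (intro mult_right_mono w) simp
    thus "?w \<zeta> * (A \<eta> * B (\<zeta> - \<eta>)) \<le> (ennreal (2 powr s) * (?w \<eta> * A \<eta>)) * (?w (\<zeta> - \<eta>) * B (\<zeta> - \<eta>))"
      by (simp add: mult_ac)
  qed
  also have "\<dots> = (\<integral>\<^sup>+ \<eta>. (\<integral>\<^sup>+ \<zeta>. (ennreal (2 powr s) * (?w \<eta> * A \<eta>)) * (?w (\<zeta> - \<eta>) * B (\<zeta> - \<eta>)) \<partial>lborel) \<partial>lborel)"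
    by (rule lborel_pair.Fubini') measurable
  also have "\<dots> = (\<integral>\<^sup>+ \<eta>. (ennreal (2 powr s) * (?w \<eta> * A \<eta>)) * (\<integral>\<^sup>+ \<zeta>. ?w \<zeta> * B \<zeta> \<partial>lborel) \<partial>lborel)"
  proof (intro nn_integral_cong)
    fix \<eta> :: "real^'n"
    have "(\<integral>\<^sup>+ \<zeta>. (\<lambda>\<zeta>. ?w \<zeta> * B \<zeta>) (\<zeta> + - \<eta>) \<partial>lborel) = (\<integral>\<^sup>+ \<zeta>. ?w \<zeta> * B \<zeta> \<partial>lborel)"
      by (rule nn_integral_translate) measurable
    thus "(\<integral>\<^sup>+ \<zeta>. (ennreal (2 powr s) * (?w \<eta> * A \<eta>)) * (?w (\<zeta> - \<eta>) * B (\<zeta> - \<eta>)) \<partial>lborel)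
      = (ennreal (2 powr s) * (?w \<eta> * A \<eta>)) * (\<integral>\<^sup>+ \<zeta>. ?w \<zeta> * B \<zeta> \<partial>lborel)"
      by (subst nn_integral_cmult) auto
  qed
  also have "\<dots> = ennreal (2 powr s) * (\<integral>\<^sup>+ \<zeta>. ?w \<zeta> * A \<zeta> \<partial>lborel) * (\<integral>\<^sup>+ \<zeta>. ?w \<zeta> * B \<zeta> \<partial>lborel)"
    by (simp add: nn_integral_multc nn_integral_cmult)
  finally show ?thesis .
qed

lemma beurling_mass_eq: "beurling_mass s h = (\<integral>\<^sup>+ \<zeta>. ennreal (bracket \<zeta> powr s) * ennreal (cmod (h \<zeta>)) \<partial>lborel)"
  unfolding beurling_mass_def by (simp add: ennreal_mult)

lemma has_symbol_mult:
  fixes f g h k :: "real^'n::finite \<Rightarrow> complex"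
  assumes s: "0 \<le> s" and f: "has_symbol s f h" and g: "has_symbol s g k"
  shows "has_symbol s (\<lambda>x. f x * g x) (\<lambda>\<zeta>. (1 / (2 * pi) ^ CARD('n)) * conv h k \<zeta>)"
proof -
  let ?c = "complex_of_real (2 * pi) ^ CARD('n)"
  have [measurable]: "h \<in> borel_measurable borel" "k \<in> borel_measurable borel"
    using f g by (auto simp: has_symbol_def)
  have hi: "integrable lborel h" and ki: "integrable lborel k" using has_symbol_integrable[OF s] f g by blast+
  have m [measurable]: "conv h k \<in> borel_measurable borel"
    by (rule conv_measurable) auto
  have "beurling_mass s (conv h k) \<le> (\<integral>\<^sup>+ \<zeta>. ennreal (bracket \<zeta> powr s) * (\<integral>\<^sup>+ \<eta>. ennreal (cmod (h \<eta>)) * ennreal (cmod (k (\<zeta> - \<eta>))) \<partial>lborel) \<partial>lborel)"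
    unfolding beurling_mass_eq
  proof (intro nn_integral_mono mult_left_mono)
    fix \<zeta> :: "real^'n"
    have "ennreal (cmod (conv h k \<zeta>)) \<le> (\<integral>\<^sup>+ \<eta>. ennreal (cmod (h \<eta> * k (\<zeta> - \<eta>))) \<partial>lborel)"
      unfolding conv_def by (rule norm_integral_le_nn_integral)
    thus "ennreal (cmod (conv h k \<zeta>)) \<le> (\<integral>\<^sup>+ \<eta>. ennreal (cmod (h \<eta>)) * ennreal (cmod (k (\<zeta> - \<eta>))) \<partial>lborel)"
      by (simp add: norm_mult ennreal_mult)
  qed simp
  also have "\<dots> \<le> ennreal (2 powr s) * beurling_mass s h * beurling_mass s k"
    unfolding beurling_mass_eq by (rule weighted_conv_le[OF s]) measurable
  also have "\<dots> < \<infinity>" using f g by (simp add: has_symbol_def ennreal_mult_less_top)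
  finally have fin: "beurling_mass s (conv h k) < \<infinity>" .
  have "has_symbol s (inverse_fourier (conv h k)) (conv h k)"
    using m fin by (simp add: has_symbol_def)
  from has_symbol_cmult[OF this, of "1 / ?c"] show ?thesis
    using f g by (simp add: has_symbol_def inverse_fourier_eq fourier_conv[OF hi ki])
qed

lemma FB_add: "0 \<le> s \<Longrightarrow> f \<in> FB s \<Longrightarrow> g \<in> FB s \<Longrightarrow> (\<lambda>x. f x + g x) \<in> FB s"
  using has_symbol_add by (fastforce simp: FB_iff)

lemma FB_cmult: "0 \<le> s \<Longrightarrow> f \<in> FB s \<Longrightarrow> (\<lambda>x. c * f x) \<in> FB s"
  using has_symbol_cmult by (fastforce simp: FB_iff)

lemma FB_diff: "0 \<le> s \<Longrightarrow> f \<in> FB s \<Longrightarrow> g \<in> FB s \<Longrightarrow> (\<lambda>x. f x - g x) \<in> FB s"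
  using FB_add[of s f "\<lambda>x. - 1 * g x"] FB_cmult[of s g "- 1"] by simp

lemma FB_mult: "0 \<le> s \<Longrightarrow> f \<in> FB s \<Longrightarrow> g \<in> FB s \<Longrightarrow> (\<lambda>x. f x * g x) \<in> FB s"
  using has_symbol_mult by (fastforce simp: FB_iff)

lemma FB_zero: "0 \<le> s \<Longrightarrow> (\<lambda>x. 0) \<in> FB s"
proof -
  have "has_symbol s (\<lambda>x::real^'n. 0) (\<lambda>x. 0)"
    by (auto simp: has_symbol_def beurling_mass_def inverse_fourier_def)
  thus "0 \<le> s \<Longrightarrow> (\<lambda>x. 0) \<in> FB s" using FB_iff by blast
qed

section \<open>The short-time Fourier transform of functions\<close>

text \<open>A priori an element of the modulation space is only known to be a continuous function whose
  products with Schwartz functions are integrable; its short-time Fourier transform is then an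
  absolutely convergent integral.\<close>

definition tested :: "(real^'n::finite \<Rightarrow> complex) \<Rightarrow> bool" where
  "tested f \<longleftrightarrow> f \<in> borel_measurable borel \<and> (\<forall>\<psi>\<in>schwartz. integrable lborel (\<lambda>x. f x * \<psi> x))"

definition stf :: "(real^'n::finite \<Rightarrow> complex) \<Rightarrow> (real^'n \<Rightarrow> complex) \<Rightarrow> real^'n \<Rightarrow> real^'n \<Rightarrow> complex" where
  "stf \<phi> f \<xi> x = fourier (\<lambda>t. f t * cnj (\<phi> (t - x))) \<xi>"

definition slice :: "(real^'n::finite \<Rightarrow> complex) \<Rightarrow> real \<Rightarrow> (real^'n \<Rightarrow> complex) \<Rightarrow> real^'n \<Rightarrow> ennreal" where
  "slice \<phi> p f \<xi> = lpn p lborel (\<lambda>x. cmod (stf \<phi> f \<xi> x))"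

definition mod_norm :: "(real^'n::finite \<Rightarrow> complex) \<Rightarrow> real \<Rightarrow> real \<Rightarrow> (real^'n \<Rightarrow> complex) \<Rightarrow> ennreal" where
  "mod_norm \<phi> p s f = (\<integral>\<^sup>+ \<xi>. ennreal (bracket \<xi> powr s) * slice \<phi> p f \<xi> \<partial>lborel)"

lemma tested_if_given_by: "given_by (distr_of f) f \<longleftrightarrow> tested f"
  by (auto simp: given_by_def tested_def)

lemma tested_measurable [measurable_dest]: "tested f \<Longrightarrow> f \<in> borel_measurable borel"
  by (simp add: tested_def)

lemma tested_integrable:
  fixes \<phi> :: "real^'n::finite \<Rightarrow> complex"
  assumes "tested f" "\<phi> \<in> schwartz" shows "integrable lborel (\<lambda>t. f t * cnj (\<phi> (t - x)))"
  using assms(1) schwartz_cnj[OF schwartz_shift[OF assms(2), of x]] by (simp add: tested_def)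

lemma tested_bounded_mult:
  assumes f: "tested f" and g: "g \<in> borel_measurable borel" "\<And>x. cmod (g x) \<le> B"
  shows "tested (\<lambda>x. g x * f x)"
  unfolding tested_def
proof (intro conjI ballI)
  have [measurable]: "f \<in> borel_measurable borel" "g \<in> borel_measurable borel" using f g by (auto simp: tested_def)
  show "(\<lambda>x. g x * f x) \<in> borel_measurable borel" by measurable
  fix \<psi> :: "real^'a \<Rightarrow> complex" assume "\<psi> \<in> schwartz"
  hence "integrable lborel (\<lambda>x. g x * (f x * \<psi> x))"
    using f g by (intro integrable_mult_bounded(2)[where B = B and f = "\<lambda>x. f x * \<psi> x" and g = g])
      (auto simp: tested_def)
  thus "integrable lborel (\<lambda>x. g x * f x * \<psi> x)" by (simp add: mult.assoc)
qed

lemma tested_diff: "tested f \<Longrightarrow> tested g \<Longrightarrow> tested (\<lambda>x. f x - g x)"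
  by (auto simp: tested_def left_diff_distrib)

lemma stft_distr_of:
  assumes "\<phi> \<in> schwartz" shows "stft \<phi> (distr_of f) x \<xi> = stf \<phi> f \<xi> x"
  using schwartz_time_frequency_shift[OF assms, of x \<xi>]
  by (simp add: stft_def distr_of_def stf_def fourier_def mult.assoc)

lemma modulation_norm_distr_of:
  assumes "\<phi> \<in> schwartz" shows "modulation_norm \<phi> p s (distr_of f) = mod_norm \<phi> p s f"
  by (simp add: modulation_norm_def mod_norm_def slice_def Lp_norm_eq_lpn stft_distr_of[OF assms])

lemma stf_measurable:
  fixes f \<phi> :: "real^'n::finite \<Rightarrow> complex"
  assumes f [measurable]: "f \<in> borel_measurable borel" and \<phi> [measurable]: "\<phi> \<in> borel_measurable borel"
  shows "(\<lambda>(\<xi>, x). stf \<phi> f \<xi> x) \<in> borel_measurable (lborel \<Otimes>\<^sub>M lborel)"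
proof -
  have "(\<lambda>z::(real^'n) \<times> (real^'n). exp (- (\<i> * complex_of_real (fst z \<bullet> snd z)))) \<in> borel_measurable borel"
    by (intro borel_measurable_continuous_onI continuous_intros)
  hence [measurable]: "(\<lambda>z::(real^'n) \<times> (real^'n). exp (- (\<i> * complex_of_real (fst z \<bullet> snd z)))) \<in> borel_measurable (borel \<Otimes>\<^sub>M borel)"
    by (simp add: borel_prod)
  have "(\<lambda>w::((real^'n) \<times> (real^'n)) \<times> (real^'n). (snd w, fst (fst w))) \<in> (lborel \<Otimes>\<^sub>M lborel) \<Otimes>\<^sub>M lborel \<rightarrow>\<^sub>M borel \<Otimes>\<^sub>M borel"
    by measurable
  from measurable_compose[OF this \<open>(\<lambda>z. exp (- (\<i> * complex_of_real (fst z \<bullet> snd z)))) \<in> borel_measurable (borel \<Otimes>\<^sub>M borel)\<close>]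
  have [measurable]: "(\<lambda>w::((real^'n) \<times> (real^'n)) \<times> (real^'n). exp (- (\<i> * complex_of_real (snd w \<bullet> fst (fst w))))) \<in> borel_measurable ((lborel \<Otimes>\<^sub>M lborel) \<Otimes>\<^sub>M lborel)"
    by simp
  have "(\<lambda>z::(real^'n) \<times> (real^'n). LINT t|lborel. f t * cnj (\<phi> (t - snd z)) * exp (- (\<i> * complex_of_real (t \<bullet> fst z)))) \<in> borel_measurable (lborel \<Otimes>\<^sub>M lborel)"
    by (intro lborel.borel_measurable_lebesgue_integral) (simp add: case_prod_beta, measurable)
  thus ?thesis unfolding stf_def fourier_def by (simp add: case_prod_beta)
qed

lemma cmod_stf_measurable:
  fixes f \<phi> :: "real^'n::finite \<Rightarrow> complex"
  assumes "f \<in> borel_measurable borel" "\<phi> \<in> borel_measurable borel"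
  shows "case_prod (\<lambda>\<xi> x. cmod (stf \<phi> f \<xi> x)) \<in> borel_measurable (lborel \<Otimes>\<^sub>M lborel)"
  using measurable_compose[OF stf_measurable[OF assms] borel_measurable_norm] by (simp add: case_prod_beta)

lemma stf_measurable2:
  fixes f \<phi> :: "real^'n::finite \<Rightarrow> complex"
  assumes "f \<in> borel_measurable borel" "\<phi> \<in> borel_measurable borel"
  shows "stf \<phi> f \<xi> \<in> borel_measurable borel"
  using measurable_Pair2[OF stf_measurable[OF assms], of \<xi>] by simp

lemma slice_measurable:
  assumes "f \<in> borel_measurable borel" "\<phi> \<in> borel_measurable borel"
  shows "slice \<phi> p f \<in> borel_measurable borel"
  unfolding slice_def[abs_def]
  using lpn_measurable[OF sigma_finite_lborel cmod_stf_measurable[OF assms], of p] by simp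

lemma stf_add:
  assumes "tested f" "tested g" "\<phi> \<in> schwartz"
  shows "stf \<phi> (\<lambda>t. f t + g t) \<xi> x = stf \<phi> f \<xi> x + stf \<phi> g \<xi> x"
  unfolding stf_def distrib_right using assms by (intro fourier_add tested_integrable)

lemma stf_cmult: "stf \<phi> (\<lambda>t. c * f t) \<xi> x = c * stf \<phi> f \<xi> x"
  unfolding stf_def mult.assoc by (rule fourier_cmult)

lemma mod_norm_add_le:
  assumes p: "1 \<le> p" and f: "tested f" and g: "tested g" and \<phi>: "\<phi> \<in> schwartz"
  shows "mod_norm \<phi> p s (\<lambda>t. f t + g t) \<le> mod_norm \<phi> p s f + mod_norm \<phi> p s g"
proof -
  note m [measurable] = tested_measurable[OF f] tested_measurable[OF g] schwartz_measurable[OF \<phi>]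
  note [measurable] = slice_measurable[OF m(1) m(3), of p] slice_measurable[OF m(2) m(3), of p]
    stf_measurable2[OF m(1) m(3)] stf_measurable2[OF m(2) m(3)]
  have "slice \<phi> p (\<lambda>t. f t + g t) \<xi> \<le> slice \<phi> p f \<xi> + slice \<phi> p g \<xi>" for \<xi>
    unfolding slice_def stf_add[OF f g \<phi>]
    by (rule lpn_triangle[OF sigma_finite_lborel p]) (auto intro: norm_triangle_ineq)
  hence "mod_norm \<phi> p s (\<lambda>t. f t + g t) \<le> (\<integral>\<^sup>+ \<xi>. ennreal (bracket \<xi> powr s) * (slice \<phi> p f \<xi> + slice \<phi> p g \<xi>) \<partial>lborel)"
    unfolding mod_norm_def by (intro nn_integral_mono mult_left_mono) auto
  also have "\<dots> = mod_norm \<phi> p s f + mod_norm \<phi> p s g"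
    unfolding mod_norm_def distrib_left by (rule nn_integral_add) auto
  finally show ?thesis .
qed

lemma mod_norm_cmult:
  assumes p: "1 \<le> p" and f: "tested f" and \<phi>: "\<phi> \<in> schwartz"
  shows "mod_norm \<phi> p s (\<lambda>t. c * f t) = ennreal (cmod c) * mod_norm \<phi> p s f"
proof -
  note m [measurable] = tested_measurable[OF f] schwartz_measurable[OF \<phi>]
  note [measurable] = slice_measurable[OF m, of p] stf_measurable2[OF m]
  have "slice \<phi> p (\<lambda>t. c * f t) \<xi> = ennreal (cmod c) * slice \<phi> p f \<xi>" for \<xi>
    unfolding slice_def stf_cmult norm_mult using p by (intro lpn_cmult) auto
  thus ?thesis
    unfolding mod_norm_def by (simp add: mult.left_commute nn_integral_cmult)
qed

text \<open>Multiplication by \<open>e\<^sup>i\<^sup>\<eta>\<^sup>t\<close> translates the short-time Fourier transform by \<open>\<eta>\<close> in frequency;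
  multiplication by an inverse Fourier transform is a superposition of such translations.\<close>

lemma stf_mult:
  fixes f \<phi> h :: "real^'n::finite \<Rightarrow> complex"
  assumes f: "tested f" and \<phi>: "\<phi> \<in> schwartz" and h: "integrable lborel h"
  shows "stf \<phi> (\<lambda>t. inverse_fourier h t * f t) \<xi> x
    = (LINT \<eta>|lborel. h \<eta> * stf \<phi> f (\<xi> - \<eta>) x) / (2 * pi) ^ CARD('n)"
proof -
  let ?c = "complex_of_real (2 * pi) ^ CARD('n)"
  let ?k = "\<lambda>(t :: real^'n) (\<eta> :: real^'n). exp (- (\<i> * complex_of_real (t \<bullet> (\<xi> - \<eta>))))"
  have F: "integrable lborel (\<lambda>t. f t * cnj (\<phi> (t - x)))" by (rule tested_integrable[OF f \<phi>])
  have km: "case_prod ?k \<in> borel_measurable (borel \<Otimes>\<^sub>M borel)"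
    unfolding borel_prod case_prod_beta by (intro borel_measurable_continuous_onI continuous_intros)
  have int: "integrable (lborel \<Otimes>\<^sub>M lborel) (\<lambda>(t, \<eta>). (f t * cnj (\<phi> (t - x))) * h \<eta> * ?k t \<eta>)"
    by (rule integrable_pair_mult[OF F h km, of 1]) simp
  have "?c * stf \<phi> (\<lambda>t. inverse_fourier h t * f t) \<xi> x = (LINT t|lborel. ?c * (inverse_fourier h t * f t * cnj (\<phi> (t - x)) * exp (- (\<i> * complex_of_real (t \<bullet> \<xi>)))))"
    unfolding stf_def fourier_def by (rule integral_mult_right_zero[symmetric])
  also have "\<dots> = (LINT t|lborel. LINT \<eta>|lborel. (f t * cnj (\<phi> (t - x))) * h \<eta> * ?k t \<eta>)"
  proof (intro Bochner_Integration.integral_cong refl)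
    fix t
    have "(LINT \<eta>|lborel. (f t * cnj (\<phi> (t - x))) * h \<eta> * ?k t \<eta>)
       = (LINT \<eta>|lborel. (f t * cnj (\<phi> (t - x)) * exp (- (\<i> * complex_of_real (t \<bullet> \<xi>)))) * (h \<eta> * exp (\<i> * complex_of_real (\<eta> \<bullet> t))))"
      by (intro Bochner_Integration.integral_cong refl)
         (simp add: inner_diff_right right_diff_distrib exp_diff exp_minus inner_commute field_simps)
    also have "\<dots> = (f t * cnj (\<phi> (t - x)) * exp (- (\<i> * complex_of_real (t \<bullet> \<xi>)))) * (LINT \<eta>|lborel. h \<eta> * exp (\<i> * complex_of_real (\<eta> \<bullet> t)))"
      by (rule integral_mult_right_zero)
    finally show "?c * (inverse_fourier h t * f t * cnj (\<phi> (t - x)) * exp (- (\<i> * complex_of_real (t \<bullet> \<xi>))))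
        = (LINT \<eta>|lborel. (f t * cnj (\<phi> (t - x))) * h \<eta> * ?k t \<eta>)" by (simp add: inverse_fourier_def)
  qed
  also have "\<dots> = (LINT \<eta>|lborel. LINT t|lborel. (f t * cnj (\<phi> (t - x))) * h \<eta> * ?k t \<eta>)"
    using lborel_pair.Fubini_integral[OF int] by simp
  also have "\<dots> = (LINT \<eta>|lborel. h \<eta> * stf \<phi> f (\<xi> - \<eta>) x)"
    unfolding stf_def fourier_def integral_mult_right_zero[symmetric]
    by (intro Bochner_Integration.integral_cong refl) (simp add: mult_ac)
  finally show ?thesis by (simp add: field_simps)
qed

lemma norm_div_2pi_le:
  "cmod (z / complex_of_real ((2 * pi) ^ n)) \<le> cmod z"
proof -
  have "1 \<le> (2 * pi) ^ n" using pi_ge_two by (intro one_le_power) simp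
  thus ?thesis by (simp add: norm_divide norm_mult norm_power divide_le_eq mult_le_cancel_left1)
qed

text \<open>Minkowski's inequality for the superposition of translates, followed by the weighted Young
  inequality in the frequency variable.\<close>

theorem mod_norm_mult_le:
  fixes f \<phi> h :: "real^'n::finite \<Rightarrow> complex"
  assumes p: "1 \<le> p" and s: "0 \<le> s" and f: "tested f" and \<phi>: "\<phi> \<in> schwartz" and h: "has_symbol s g h"
  shows "mod_norm \<phi> p s (\<lambda>t. g t * f t) \<le> ennreal (2 powr s) * beurling_mass s h * mod_norm \<phi> p s f"
proof -
  note m [measurable] = tested_measurable[OF f] schwartz_measurable[OF \<phi>]
  note [measurable] = slice_measurable[OF m, of p] stf_measurable2[OF m] stf_measurable[OF m]
  have hi: "integrable lborel h" and hm [measurable]: "h \<in> borel_measurable borel" and g: "g = inverse_fourier h"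
    using has_symbol_integrable[OF s h] h by (auto simp: has_symbol_def)
  have sl: "slice \<phi> p (\<lambda>t. g t * f t) \<xi> \<le> (\<integral>\<^sup>+ \<eta>. ennreal (cmod (h \<eta>)) * slice \<phi> p f (\<xi> - \<eta>) \<partial>lborel)" for \<xi>
  proof -
    let ?a = "\<lambda>\<eta> x. cmod (h \<eta>) * cmod (stf \<phi> f (\<xi> - \<eta>) x)"
    have "slice \<phi> p (\<lambda>t. g t * f t) \<xi> \<le> (\<integral>\<^sup>+ \<eta>. lpn p lborel (?a \<eta>) \<partial>lborel)"
      unfolding slice_def
    proof (rule minkowski_integral[OF sigma_finite_lborel sigma_finite_lborel p])
      have "(\<lambda>z::(real^'n) \<times> (real^'n). (\<xi> - fst z, snd z)) \<in> lborel \<Otimes>\<^sub>M lborel \<rightarrow>\<^sub>M lborel \<Otimes>\<^sub>M lborel"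
        by measurable
      from measurable_compose[OF this cmod_stf_measurable[OF m]]
      have [measurable]: "(\<lambda>z. cmod (stf \<phi> f (\<xi> - fst z) (snd z))) \<in> borel_measurable (lborel \<Otimes>\<^sub>M lborel)" by simp
      show "case_prod ?a \<in> borel_measurable (lborel \<Otimes>\<^sub>M lborel)" unfolding case_prod_beta by measurable
      fix x :: "real^'n"
      have "ennreal (cmod (stf \<phi> (\<lambda>t. g t * f t) \<xi> x)) \<le> ennreal (cmod (LINT \<eta>|lborel. h \<eta> * stf \<phi> f (\<xi> - \<eta>) x))"
        unfolding g stf_mult[OF f \<phi> hi] by (intro ennreal_leI norm_div_2pi_le)
      also have "\<dots> \<le> (\<integral>\<^sup>+ \<eta>. ennreal (cmod (h \<eta> * stf \<phi> f (\<xi> - \<eta>) x)) \<partial>lborel)"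
        by (rule norm_integral_le_nn_integral)
      finally show "ennreal (cmod (stf \<phi> (\<lambda>t. g t * f t) \<xi> x)) \<le> (\<integral>\<^sup>+ \<eta>. ennreal (?a \<eta> x) \<partial>lborel)"
        by (simp add: norm_mult)
    qed auto
    also have "\<dots> = (\<integral>\<^sup>+ \<eta>. ennreal (cmod (h \<eta>)) * slice \<phi> p f (\<xi> - \<eta>) \<partial>lborel)"
      unfolding slice_def using p by (intro nn_integral_cong lpn_cmult) auto
    finally show ?thesis .
  qed
  have "mod_norm \<phi> p s (\<lambda>t. g t * f t) \<le> (\<integral>\<^sup>+ \<xi>. ennreal (bracket \<xi> powr s) * (\<integral>\<^sup>+ \<eta>. ennreal (cmod (h \<eta>)) * slice \<phi> p f (\<xi> - \<eta>) \<partial>lborel) \<partial>lborel)"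
    unfolding mod_norm_def by (intro nn_integral_mono mult_left_mono sl) simp
  also have "\<dots> \<le> ennreal (2 powr s) * beurling_mass s h * mod_norm \<phi> p s f"
    unfolding mod_norm_def beurling_mass_eq by (rule weighted_conv_le[OF s]) measurable
  finally show ?thesis .
qed

abbreviation MS :: "(real^'n::finite \<Rightarrow> complex) \<Rightarrow> real \<Rightarrow> real \<Rightarrow> (real^'n \<Rightarrow> complex) set" where
  "MS \<phi> p s \<equiv> continuous_functions_of (modulation_space \<phi> p s)"

lemma MS_iff:
  assumes "\<phi> \<in> schwartz"
  shows "f \<in> MS \<phi> p s \<longleftrightarrow> continuous_on UNIV f \<and> tested f \<and> distr_of f \<in> tempered_distributions \<and> mod_norm \<phi> p s f < \<infinity>"
proof
  assume f: "f \<in> MS \<phi> p s"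
  from continuous_functions_ofD[OF this] show "continuous_on UNIV f \<and> tested f \<and> distr_of f \<in> tempered_distributions \<and> mod_norm \<phi> p s f < \<infinity>"
    by (simp add: modulation_space_def modulation_norm_distr_of[OF assms] tested_if_given_by)
next
  assume "continuous_on UNIV f \<and> tested f \<and> distr_of f \<in> tempered_distributions \<and> mod_norm \<phi> p s f < \<infinity>"
  thus "f \<in> MS \<phi> p s"
    unfolding continuous_functions_of_def modulation_space_def
    using modulation_norm_distr_of[OF assms, of p s f] tested_if_given_by[of f] by auto
qed

section \<open>Integrable elements of the modulation space lie in the Fourier--Beurling algebra\<close>

text \<open>A geometric mean that contains \<open>x\<close> at least to the power \<open>1/2\<close> admits an arbitrarily small
  factor in front of \<open>y\<close>. The two cases are \<open>x \<ge> \<sigma>\<^sup>2 y\<close> and \<open>x < \<sigma>\<^sup>2 y\<close>.\<close>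

lemma interpolation_powr:
  fixes x y \<sigma> p :: real
  assumes p: "1 \<le> p" "p \<le> 2" and xy: "0 \<le> x" "0 \<le> y" and \<sigma>: "0 < \<sigma>" "\<sigma> \<le> 1"
  shows "y powr (2 - p) * x powr p \<le> (x / \<sigma> + \<sigma> * y)\<^sup>2"
proof (cases "x = 0 \<or> y = 0")
  case True
  thus ?thesis by auto
next
  case False
  hence pos: "x > 0" "y > 0" using xy by auto
  have sq: "\<sigma>\<^sup>2 > 0" "\<sigma>\<^sup>2 \<le> 1" using \<sigma> by (auto simp: power_le_one)
  show ?thesis
  proof (cases "\<sigma>\<^sup>2 * y \<le> x")
    case True
    have "y powr (2 - p) \<le> (x / \<sigma>\<^sup>2) powr (2 - p)"
      using True pos sq p by (intro powr_mono2) (auto simp: field_simps)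
    hence "y powr (2 - p) * x powr p \<le> (x / \<sigma>\<^sup>2) powr (2 - p) * x powr p"
      by (rule mult_right_mono) simp
    also have "\<dots> = (x powr (2 - p) * x powr p) * (1 / \<sigma>\<^sup>2) powr (2 - p)"
      using pos sq by (simp add: powr_divide powr_mult)
    also have "x powr (2 - p) * x powr p = x\<^sup>2"
      using pos by (simp add: powr_add[symmetric])
    also have "(1 / \<sigma>\<^sup>2) powr (2 - p) \<le> (1 / \<sigma>\<^sup>2) powr 1"
      using sq p by (intro powr_mono) (auto simp: field_simps)
    also have "x\<^sup>2 * (1 / \<sigma>\<^sup>2) powr 1 = (x / \<sigma>)\<^sup>2" using sq by (simp add: power_divide)
    also have "\<dots> \<le> (x / \<sigma> + \<sigma> * y)\<^sup>2" using pos \<sigma> by (intro power_mono) auto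
    finally show ?thesis by (simp add: mult_left_mono)
  next
    case False
    have "x powr p \<le> (\<sigma>\<^sup>2 * y) powr p"
      using False pos sq p by (intro powr_mono2) auto
    hence "y powr (2 - p) * x powr p \<le> y powr (2 - p) * (\<sigma>\<^sup>2 * y) powr p"
      by (rule mult_left_mono) simp
    also have "\<dots> = (\<sigma>\<^sup>2) powr p * (y powr (2 - p) * y powr p)"
      using pos sq by (simp add: powr_mult)
    also have "y powr (2 - p) * y powr p = y\<^sup>2"
      using pos by (simp add: powr_add[symmetric])
    also have "(\<sigma>\<^sup>2) powr p \<le> (\<sigma>\<^sup>2) powr 1"
      using sq p by (intro powr_mono') auto
    also have "(\<sigma>\<^sup>2) powr 1 * y\<^sup>2 = (\<sigma> * y)\<^sup>2" using sq by (simp add: power_mult_distrib)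
    also have "\<dots> \<le> (x / \<sigma> + \<sigma> * y)\<^sup>2" using pos \<sigma> by (intro power_mono) auto
    finally show ?thesis by (simp add: mult_right_mono)
  qed
qed

lemma ennreal_square_le_cancel:
  assumes "z\<^sup>2 \<le> ennreal (r\<^sup>2)" "0 \<le> r" shows "z \<le> ennreal r"
proof (cases z rule: ennreal_cases)
  case (real q)
  hence "q\<^sup>2 \<le> r\<^sup>2" using assms by (simp add: ennreal_power)
  thus ?thesis using real assms by (auto intro!: ennreal_leI simp: power2_le_iff_abs_le)
next
  case top
  thus ?thesis using assms by (simp add: power2_eq_square top_unique ennreal_mult_top)
qed

text \<open>In the variable \<open>x\<close>, the short-time Fourier transform at frequency \<open>\<xi>\<close> is the convolution of
  the modulated \<open>f\<close> with the reflected conjugate window.\<close>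

lemma stf_slice:
  fixes f \<phi> :: "real^'n::finite \<Rightarrow> complex"
  assumes f: "integrable lborel f" and \<phi>: "\<phi> \<in> schwartz"
  shows "integrable lborel (stf \<phi> f \<xi>)" "continuous_on UNIV (stf \<phi> f \<xi>)"
    and "fourier (stf \<phi> f \<xi>) \<eta> = fourier f (\<xi> + \<eta>) * cnj (fourier \<phi> \<eta>)"
proof -
  let ?u = "\<lambda>t. f t * exp (- (\<i> * complex_of_real (t \<bullet> \<xi>)))" and ?v = "\<lambda>y. cnj (\<phi> (0 - y))"
  note [measurable] = schwartz_measurable[OF \<phi>]
  have eq: "stf \<phi> f \<xi> = conv ?u ?v"
    by (intro ext) (simp add: stf_def fourier_def conv_def mult_ac)
  have u: "integrable lborel ?u" by (rule character_integrable[OF f])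
  have v: "integrable lborel ?v"
    using integrable_reflect[of \<phi> 0] schwartz_integrable[OF \<phi>] by simp
  obtain B where B: "\<And>x. cmod (\<phi> x) \<le> B" using rapid_bounded[OF schwartz_rapid[OF \<phi>]] by blast
  have vc: "continuous_on UNIV ?v"
    by (intro continuous_on_cnj continuous_on_compose2[OF schwartz_continuous[OF \<phi>]] continuous_intros) auto
  show "integrable lborel (stf \<phi> f \<xi>)" unfolding eq by (rule fourier_conv(1)[OF u v])
  show "continuous_on UNIV (stf \<phi> f \<xi>)" unfolding eq by (rule continuous_conv[OF u vc, of B]) (simp add: B)
  have "fourier ?u \<eta> = fourier f (\<xi> + \<eta>)"
    unfolding fourier_def by (simp add: inner_add_right distrib_left exp_add[symmetric] mult.assoc add.commute)
  moreover have "fourier ?v \<eta> = cnj (fourier \<phi> \<eta>)"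
  proof -
    have "fourier ?v \<eta> = (LINT y|lborel. (\<lambda>z. cnj (\<phi> z * exp (- (\<i> * of_real (z \<bullet> \<eta>))))) (0 - y))"
      unfolding fourier_def by (simp add: exp_cnj)
    also have "\<dots> = (LINT z|lborel. cnj (\<phi> z * exp (- (\<i> * of_real (z \<bullet> \<eta>)))))"
      by (rule integral_reflect) measurable
    also have "\<dots> = cnj (LINT z|lborel. \<phi> z * exp (- (\<i> * of_real (z \<bullet> \<eta>))))"
      by (rule Bochner_Integration.integral_cnj)
    finally show ?thesis unfolding fourier_def .
  qed
  ultimately show "fourier (stf \<phi> f \<xi>) \<eta> = fourier f (\<xi> + \<eta>) * cnj (fourier \<phi> \<eta>)"
    unfolding eq fourier_conv(2)[OF u v] by simp
qed

text \<open>Fourier inversion for the slice, whose transform is an integrable function.\<close>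

lemma norm_stf_le:
  fixes f \<phi> :: "real^'n::finite \<Rightarrow> complex"
  assumes f: "integrable lborel f" and \<phi>: "\<phi> \<in> schwartz"
  shows "integrable lborel (\<lambda>\<eta>. cmod (fourier f (\<xi> + \<eta>)) * cmod (fourier \<phi> \<eta>))"
    and "cmod (stf \<phi> f \<xi> x) \<le> (LINT \<eta>|lborel. cmod (fourier f (\<xi> + \<eta>)) * cmod (fourier \<phi> \<eta>))"
proof -
  let ?F = "stf \<phi> f \<xi>"
  have \<phi>i: "integrable lborel (fourier \<phi>)" by (rule schwartz_integrable[OF schwartz_fourier[OF \<phi>]])
  have [measurable]: "fourier f \<in> borel_measurable borel" using f by auto
  have Fi: "integrable lborel ?F" and Fc: "continuous_on UNIV ?F"
    and FF: "fourier ?F \<eta> = fourier f (\<xi> + \<eta>) * cnj (fourier \<phi> \<eta>)" for \<eta>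
    using stf_slice[OF f \<phi>] by blast+
  have FFn: "cmod (fourier ?F \<eta>) = cmod (fourier f (\<xi> + \<eta>)) * cmod (fourier \<phi> \<eta>)" for \<eta>
    by (simp add: FF norm_mult)
  obtain B where B: "\<And>\<xi>. cmod (fourier f \<xi>) \<le> B" using norm_fourier_le[OF f] by blast
  have "integrable lborel (\<lambda>\<eta>. cnj (fourier \<phi> \<eta>))" using \<phi>i by simp
  from integrable_mult_bounded(2)[OF this, of "\<lambda>\<eta>. fourier f (\<xi> + \<eta>)" B] B
  have FFi: "integrable lborel (fourier ?F)" by (simp add: FF[abs_def])
  show "integrable lborel (\<lambda>\<eta>. cmod (fourier f (\<xi> + \<eta>)) * cmod (fourier \<phi> \<eta>))"
    using integrable_norm[OF FFi] by (simp add: FFn)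
  have "?F x = inverse_fourier (fourier ?F) x"
    using fourier_inversion[OF Fi _ FFi, of x] Fc
    by (simp add: inverse_fourier_def continuous_on_eq_continuous_at)
  also have "cmod \<dots> \<le> cmod (LINT \<zeta>|lborel. fourier ?F \<zeta> * exp (\<i> * of_real (\<zeta> \<bullet> x)))"
    unfolding inverse_fourier_def by (rule norm_div_2pi_le)
  also have "\<dots> \<le> (LINT \<eta>|lborel. cmod (fourier f (\<xi> + \<eta>)) * cmod (fourier \<phi> \<eta>))"
    unfolding FFn[symmetric]
    by (rule order_trans[OF integral_norm_bound]) (simp add: norm_mult)
  finally show "cmod (?F x) \<le> (LINT \<eta>|lborel. cmod (fourier f (\<xi> + \<eta>)) * cmod (fourier \<phi> \<eta>))" .
qed

text \<open>The substitute for the Hausdorff--Young inequality. For \<open>p = 2\<close> the first term alone would do,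
  by Plancherel; for \<open>p < 2\<close> the factor \<open>\<bar>stf\<bar>\<^sup>2\<^sup>-\<^sup>p\<close> of \<open>\<bar>stf\<bar>\<^sup>2\<close> is bounded by the \<open>L\<^sup>1\<close> norm of the
  transform, which reproduces the quantity to be estimated, with a factor \<open>\<sigma>\<close> at our disposal.\<close>

lemma local_spectrum_le:
  fixes f \<phi> :: "real^'n::finite \<Rightarrow> complex" and q :: "real^'n \<Rightarrow> ennreal"
  assumes p: "1 \<le> p" "p \<le> 2" and f: "integrable lborel f" and \<phi>: "\<phi> \<in> schwartz"
    and qm [measurable]: "q \<in> borel_measurable borel"
    and L: "(\<integral>\<^sup>+ \<eta>. (ennreal (cmod (fourier \<phi> \<eta>)) * q \<eta>)\<^sup>2 \<partial>lborel) = ennreal L" "0 \<le> L"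
    and \<sigma>: "0 < \<sigma>" "\<sigma> \<le> 1"
  shows "(\<integral>\<^sup>+ \<eta>. ennreal (cmod (fourier f (\<xi> + \<eta>)) * cmod (fourier \<phi> \<eta>)) * (ennreal (cmod (fourier \<phi> \<eta>)) * q \<eta>) \<partial>lborel)
    \<le> ennreal (sqrt ((2 * pi) ^ CARD('n) * L)) * (ennreal (1 / \<sigma>) * slice \<phi> p f \<xi>
        + ennreal \<sigma> * (\<integral>\<^sup>+ \<eta>. ennreal (cmod (fourier f (\<xi> + \<eta>)) * cmod (fourier \<phi> \<eta>)) \<partial>lborel))"
proof -
  let ?F = "stf \<phi> f \<xi>" and ?K = "(2 * pi) ^ CARD('n)"
  let ?Z = "\<integral>\<^sup>+ \<eta>. ennreal (cmod (fourier f (\<xi> + \<eta>)) * cmod (fourier \<phi> \<eta>)) * (ennreal (cmod (fourier \<phi> \<eta>)) * q \<eta>) \<partial>lborel"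
  have \<phi>i: "integrable lborel (fourier \<phi>)" by (rule schwartz_integrable[OF schwartz_fourier[OF \<phi>]])
  have [measurable]: "fourier f \<in> borel_measurable borel" "fourier \<phi> \<in> borel_measurable borel"
    using f \<phi>i by auto
  have Fi: "integrable lborel ?F"
    and FF: "fourier ?F \<eta> = fourier f (\<xi> + \<eta>) * cnj (fourier \<phi> \<eta>)" for \<eta>
    using stf_slice[OF f \<phi>] by blast+
  have [measurable]: "?F \<in> borel_measurable borel" using Fi by auto
  have FFn: "cmod (fourier ?F \<eta>) = cmod (fourier f (\<xi> + \<eta>)) * cmod (fourier \<phi> \<eta>)" for \<eta>
    by (simp add: FF norm_mult)
  define y where "y = (LINT \<eta>|lborel. cmod (fourier f (\<xi> + \<eta>)) * cmod (fourier \<phi> \<eta>))"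
  have yi: "integrable lborel (\<lambda>\<eta>. cmod (fourier f (\<xi> + \<eta>)) * cmod (fourier \<phi> \<eta>))"
    by (rule norm_stf_le(1)[OF f \<phi>])
  have y0: "0 \<le> y" unfolding y_def by simp
  have Y: "(\<integral>\<^sup>+ \<eta>. ennreal (cmod (fourier f (\<xi> + \<eta>)) * cmod (fourier \<phi> \<eta>)) \<partial>lborel) = ennreal y"
    unfolding y_def by (intro nn_integral_eq_integral yi) auto
  have sup: "cmod (?F x) \<le> y" for x
    unfolding y_def by (rule norm_stf_le(2)[OF f \<phi>])
  show ?thesis
  proof (cases "slice \<phi> p f \<xi>" rule: ennreal_cases)
    case (real x)
    have "?Z\<^sup>2 \<le> (\<integral>\<^sup>+ \<eta>. (ennreal (cmod (fourier f (\<xi> + \<eta>)) * cmod (fourier \<phi> \<eta>)))\<^sup>2 \<partial>lborel)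
        * (\<integral>\<^sup>+ \<eta>. (ennreal (cmod (fourier \<phi> \<eta>)) * q \<eta>)\<^sup>2 \<partial>lborel)"
      by (rule Cauchy_Schwarz_nn_integral) measurable
    also have "\<dots> = (\<integral>\<^sup>+ \<eta>. ennreal ((cmod (fourier ?F \<eta>))\<^sup>2) \<partial>lborel) * ennreal L"
      unfolding L FFn by (simp add: ennreal_power)
    also have "\<dots> \<le> ennreal ?K * (\<integral>\<^sup>+ x. ennreal ((cmod (?F x))\<^sup>2) \<partial>lborel) * ennreal L"
      by (intro mult_right_mono plancherel_le[OF Fi]) simp
    also have "\<dots> \<le> ennreal ?K * (ennreal (y powr (2 - p)) * ennreal (x powr p)) * ennreal L"
    proof (intro mult_right_mono mult_left_mono)
      have "(\<integral>\<^sup>+ x. ennreal ((cmod (?F x))\<^sup>2) \<partial>lborel) \<le> (\<integral>\<^sup>+ x. ennreal (y powr (2 - p)) * ennreal (cmod (?F x) powr p) \<partial>lborel)"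
      proof (intro nn_integral_mono)
        fix x
        have "(cmod (?F x))\<^sup>2 \<le> y powr (2 - p) * cmod (?F x) powr p"
        proof (cases "?F x = 0")
          case False
          hence "(cmod (?F x))\<^sup>2 = cmod (?F x) powr (2 - p) * cmod (?F x) powr p"
            by (simp add: powr_add[symmetric])
          also have "\<dots> \<le> y powr (2 - p) * cmod (?F x) powr p"
            using p sup[of x] by (intro mult_right_mono powr_mono2) auto
          finally show ?thesis .
        qed simp
        thus "ennreal ((cmod (?F x))\<^sup>2) \<le> ennreal (y powr (2 - p)) * ennreal (cmod (?F x) powr p)"
          by (simp add: ennreal_mult[symmetric] ennreal_leI)
      qed
      also have "\<dots> = ennreal (y powr (2 - p)) * (\<integral>\<^sup>+ x. ennreal (cmod (?F x) powr p) \<partial>lborel)"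
        by (rule nn_integral_cmult) measurable
      also have "\<dots> \<le> ennreal (y powr (2 - p)) * ennreal (x powr p)"
        using lpn_le_iff[of p x lborel "\<lambda>x. cmod (?F x)"] p real
        by (intro mult_left_mono) (auto simp: slice_def)
      finally show "(\<integral>\<^sup>+ x. ennreal ((cmod (?F x))\<^sup>2) \<partial>lborel) \<le> ennreal (y powr (2 - p)) * ennreal (x powr p)" .
    qed auto
    also have "\<dots> = ennreal ((?K * L) * (y powr (2 - p) * x powr p))"
      using L(2) by (simp add: ennreal_mult'' ennreal_mult' mult_ac)
    also have "\<dots> \<le> ennreal ((?K * L) * (x / \<sigma> + \<sigma> * y)\<^sup>2)"
      using interpolation_powr[OF p real(1) y0 \<sigma>] L(2) by (intro ennreal_leI mult_left_mono) auto
    also have "(?K * L) * (x / \<sigma> + \<sigma> * y)\<^sup>2 = (sqrt (?K * L) * (x / \<sigma> + \<sigma> * y))\<^sup>2"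
      using L(2) by (simp add: power_mult_distrib)
    finally have "?Z \<le> ennreal (sqrt (?K * L) * (x / \<sigma> + \<sigma> * y))"
      by (rule ennreal_square_le_cancel) (use real y0 \<sigma> L in \<open>auto intro!: mult_nonneg_nonneg add_nonneg_nonneg\<close>)
    also have "\<dots> = ennreal (sqrt (?K * L)) * (ennreal (1 / \<sigma>) * ennreal x + ennreal \<sigma> * ennreal y)"
      using real y0 \<sigma> L by (simp add: ennreal_mult'[symmetric] ennreal_plus[symmetric] del: ennreal_plus)
    finally show ?thesis unfolding Y real(2) .
  next
    case top
    \<comment> \<open>The constant may vanish, in which case so does the left side.\<close>
    show ?thesis
    proof (cases "L = 0")
      case True
      hence "(\<integral>\<^sup>+ \<eta>. (ennreal (cmod (fourier \<phi> \<eta>)) * q \<eta>)\<^sup>2 \<partial>lborel) = 0" using L(1) by simp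
      hence "AE \<eta> in lborel. (ennreal (cmod (fourier \<phi> \<eta>)) * q \<eta>)\<^sup>2 = 0"
        by (subst (asm) nn_integral_0_iff_AE) auto
      hence "AE \<eta> in lborel. ennreal (cmod (fourier f (\<xi> + \<eta>)) * cmod (fourier \<phi> \<eta>)) * (ennreal (cmod (fourier \<phi> \<eta>)) * q \<eta>) = 0"
        by eventually_elim auto
      hence "?Z = 0" by (subst nn_integral_0_iff_AE) auto
      thus ?thesis by simp
    next
      case False
      thus ?thesis using top \<sigma> L(2) by (simp add: ennreal_mult_top ennreal_top_mult)
    qed
  qed
qed

text \<open>The damping factor makes the weight integrable, while the moderateness constants do not depend
  on \<open>\<lambda>\<close>.\<close>

definition damped_weight :: "real \<Rightarrow> nat \<Rightarrow> real \<Rightarrow> real^'n::finite \<Rightarrow> real" where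
  "damped_weight s N \<delta> \<zeta> = bracket \<zeta> powr s / (1 + \<delta> * (norm \<zeta>)\<^sup>2) ^ N"

lemma damped_weight_measurable [measurable]: "damped_weight s N \<delta> \<in> borel_measurable borel"
  unfolding damped_weight_def by measurable

lemma damped_weight_nonneg [simp]: "0 \<le> \<delta> \<Longrightarrow> 0 \<le> damped_weight s N \<delta> \<zeta>"
  by (simp add: damped_weight_def)

lemma damped_weight_le:
  assumes "0 \<le> \<delta>" shows "damped_weight s N \<delta> \<zeta> \<le> bracket \<zeta> powr s"
proof -
  have one: "1 \<le> (1 + \<delta> * (norm \<zeta>)\<^sup>2) ^ N" using assms by (intro one_le_power) simp
  have "bracket \<zeta> powr s * 1 \<le> bracket \<zeta> powr s * (1 + \<delta> * (norm \<zeta>)\<^sup>2) ^ N"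
    by (intro mult_left_mono one) simp
  thus ?thesis unfolding damped_weight_def using one by (subst pos_divide_le_eq) auto
qed

lemma damped_weight_moderate:
  fixes \<zeta> \<eta> :: "real^'n::finite"
  assumes s: "0 \<le> s" and \<delta>: "0 \<le> \<delta>" "\<delta> \<le> 1"
  shows "damped_weight s N \<delta> (\<zeta> + \<eta>) \<le> (2 powr s * 2 ^ N) * (damped_weight s N \<delta> \<zeta> * bracket \<eta> powr (s + 2 * real N))"
proof -
  have *: "1 + \<delta> * (norm \<zeta>)\<^sup>2 \<le> 2 * (1 + \<delta> * (norm (\<zeta> + \<eta>))\<^sup>2) * (bracket \<eta>)\<^sup>2"
  proof -
    have "norm \<zeta> \<le> norm (\<zeta> + \<eta>) + norm \<eta>"
      using norm_triangle_ineq4[of "\<zeta> + \<eta>" \<eta>] by simp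
    hence "(norm \<zeta>)\<^sup>2 \<le> (norm (\<zeta> + \<eta>) + norm \<eta>)\<^sup>2" by (intro power_mono) auto
    also have "\<dots> \<le> 2 * (norm (\<zeta> + \<eta>))\<^sup>2 + 2 * (norm \<eta>)\<^sup>2"
      using sum_squares_bound[of "norm (\<zeta> + \<eta>)" "norm \<eta>"] by (simp add: power2_sum)
    finally have "\<delta> * (norm \<zeta>)\<^sup>2 \<le> \<delta> * (2 * (norm (\<zeta> + \<eta>))\<^sup>2 + 2 * (norm \<eta>)\<^sup>2)"
      using \<delta> by (intro mult_left_mono) auto
    moreover have "\<delta> * (norm \<eta>)\<^sup>2 \<le> (norm \<eta>)\<^sup>2" using \<delta> by (simp add: mult_left_le_one_le)
    moreover have "0 \<le> \<delta> * (norm (\<zeta> + \<eta>))\<^sup>2 * (norm \<eta>)\<^sup>2" using \<delta> by simp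
    ultimately show ?thesis by (simp add: bracket_power2 algebra_simps)
  qed
  have pos: "0 < 1 + \<delta> * (norm x)\<^sup>2" for x :: "real^'n" using \<delta> by (simp add: add_pos_nonneg)
  have "1 / (1 + \<delta> * (norm (\<zeta> + \<eta>))\<^sup>2) ^ N \<le> 2 ^ N * (1 / (1 + \<delta> * (norm \<zeta>)\<^sup>2) ^ N) * ((bracket \<eta>)\<^sup>2) ^ N"
  proof -
    have alg: "1 / B ^ N \<le> 2 ^ N * (1 / A ^ N) * q ^ N"
      if "A ^ N \<le> (2 * B * q) ^ N" "0 < A" "0 < B" for A B q :: real
      using that by (simp add: power_mult_distrib field_simps)
    show ?thesis using pos[of \<zeta>] by (intro alg power_mono * pos) auto
  qed
  hence "bracket (\<zeta> + \<eta>) powr s * (1 / (1 + \<delta> * (norm (\<zeta> + \<eta>))\<^sup>2) ^ N)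
      \<le> (2 powr s * bracket \<zeta> powr s * bracket \<eta> powr s) * (2 ^ N * (1 / (1 + \<delta> * (norm \<zeta>)\<^sup>2) ^ N) * ((bracket \<eta>)\<^sup>2) ^ N)"
    using pos[of "\<zeta> + \<eta>"] by (intro mult_mono bracket_powr_add_le[OF s]) auto
  also have "((bracket \<eta>)\<^sup>2) ^ N = bracket \<eta> powr (2 * real N)"
    by (simp only: bracket_power_double power_mult[symmetric])
  finally show ?thesis
    by (simp add: damped_weight_def powr_add mult_ac)
qed

lemma damped_weight_integrable:
  fixes N :: nat
  assumes s: "s + 2 * real CARD('n) \<le> 2 * real N" and \<delta>: "0 < \<delta>" "\<delta> \<le> 1"
  shows "integrable lborel (damped_weight s N \<delta> :: real^'n::finite \<Rightarrow> real)"
proof (rule integrable_bracket_bound)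
  fix x :: "real^'n"
  have "\<delta> * (bracket x)\<^sup>2 \<le> 1 + \<delta> * (norm x)\<^sup>2" using \<delta> by (simp add: bracket_power2 algebra_simps)
  hence le: "(\<delta> * (bracket x)\<^sup>2) ^ N \<le> (1 + \<delta> * (norm x)\<^sup>2) ^ N" using \<delta> by (intro power_mono) auto
  have pos: "0 < (\<delta> * (bracket x)\<^sup>2) ^ N"
    using \<delta> by (intro zero_less_power mult_pos_pos bracket_pos) auto
  have "bracket x ^ (2 * CARD('n)) * bracket x powr s = bracket x powr (s + 2 * real CARD('n))"
    unfolding bracket_power_double powr_add by (rule mult.commute)
  also have "\<dots> \<le> bracket x powr (2 * real N)" by (intro powr_mono s bracket_ge_1)
  also have "\<dots> = ((bracket x)\<^sup>2) ^ N" by (simp only: bracket_power_double power_mult[symmetric])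
  finally have "bracket x ^ (2 * CARD('n)) * damped_weight s N \<delta> x \<le> ((bracket x)\<^sup>2) ^ N / (\<delta> * (bracket x)\<^sup>2) ^ N"
    unfolding damped_weight_def times_divide_eq_right using le pos by (intro frac_le) auto
  also have "\<dots> = (1 / \<delta>) ^ N" using \<delta> by (simp add: power_mult_distrib power_divide)
  finally show "bracket x ^ (2 * CARD('n)) * norm (damped_weight s N \<delta> x) \<le> (1 / \<delta>) ^ N" using \<delta> by simp
qed measurable

text \<open>A finite quantity that reappears on the right with at most half its factor can be absorbed.\<close>

lemma ennreal_absorb_half:
  fixes T a b c :: ennreal
  assumes "a * T \<le> c + b * T" "2 * b \<le> a" "T < \<infinity>" "b < \<infinity>"
  shows "a * T \<le> 2 * c"
proof -
  have "2 * (b * T) \<le> a * T" using assms(2) by (simp add: mult.assoc[symmetric] mult_right_mono)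
  have "b * T < \<infinity>" using assms by (simp add: ennreal_mult_less_top)
  then obtain r where r: "b * T = ennreal r" "0 \<le> r" by (cases "b * T" rule: ennreal_cases) auto
  have "a * T + a * T \<le> 2 * c + 2 * (b * T)"
    using add_mono[OF assms(1) assms(1)] unfolding mult_2 by (simp only: ac_simps)
  also have "\<dots> \<le> 2 * c + a * T" using \<open>2 * (b * T) \<le> a * T\<close> by (intro add_mono) auto
  finally have le: "a * T + a * T \<le> 2 * c + a * T" .
  show ?thesis
  proof (cases "a * T = top")
    case True
    hence "c + b * T = top" using assms(1) by (simp add: top_unique)
    hence "c = top" using r by (simp add: ennreal_add_eq_top)
    thus ?thesis by (simp add: ennreal_mult_top)
  next
    case False
    have "a * T + a * T \<le> a * T + 2 * c" using le by (simp add: add.commute)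
    thus ?thesis using False by (simp add: ennreal_add_left_cancel_le)
  qed
qed

text \<open>Otherwise inversion would give \<open>\<phi> = 0\<close>. The integral is the constant that is divided by in the
  next theorem.\<close>

lemma fourier_not_AE_zero:
  fixes \<phi> :: "real^'n::finite \<Rightarrow> complex"
  assumes \<phi>: "\<phi> \<in> schwartz" and nz: "\<phi> \<noteq> (\<lambda>x. 0)"
  shows "(\<integral>\<^sup>+ \<eta>. (ennreal (cmod (fourier \<phi> \<eta>)))\<^sup>2 \<partial>lborel) \<noteq> 0"
proof
  have F: "fourier \<phi> \<in> schwartz" by (rule schwartz_fourier[OF \<phi>])
  note [measurable] = schwartz_measurable[OF F]
  assume "(\<integral>\<^sup>+ \<eta>. (ennreal (cmod (fourier \<phi> \<eta>)))\<^sup>2 \<partial>lborel) = 0"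
  hence "AE \<eta> in lborel. (ennreal (cmod (fourier \<phi> \<eta>)))\<^sup>2 = 0"
    by (subst (asm) nn_integral_0_iff_AE) auto
  hence z: "AE \<eta> in lborel. fourier \<phi> \<eta> * exp (\<i> * of_real (\<eta> \<bullet> x)) = 0" for x
    by eventually_elim (simp add: ennreal_eq_0_iff)
  have "\<phi> x = 0" for x
  proof -
    have "(2 * pi) ^ CARD('n) * \<phi> x = (LINT \<xi>|lborel. fourier \<phi> \<xi> * exp (\<i> * of_real (\<xi> \<bullet> x)))"
      using schwartz_continuous[OF \<phi>]
      by (intro fourier_inversion[symmetric] schwartz_integrable \<phi> F) (simp add: continuous_on_eq_continuous_at)
    also have "\<dots> = 0" by (rule integral_eq_zero_AE[OF z])
    finally show ?thesis by simp
  qed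
  thus False using nz by auto
qed

text \<open>Integrating the local estimate over \<open>\<xi>\<close> bounds \<open>\<integral> w \<bar>fourier f\<bar>\<close> by the modulation norm plus
  \<open>\<sigma>\<close> times itself. For a damped weight this integral is finite, so small \<open>\<sigma>\<close> lets it be absorbed;
  the damping is removed last.\<close>

theorem beurling_mass_fourier_le:
  fixes \<phi> :: "real^'n::finite \<Rightarrow> complex"
  assumes p: "1 \<le> p" "p \<le> 2" and s: "0 \<le> s" and \<phi>: "\<phi> \<in> schwartz" and nz: "\<phi> \<noteq> (\<lambda>x. 0)"
  shows "\<exists>C\<ge>0. \<forall>f. integrable lborel f \<longrightarrow> beurling_mass s (fourier f) \<le> ennreal C * mod_norm \<phi> p s f"
proof -
  obtain N :: nat where "(s + 2 * real CARD('n)) / 2 \<le> real N"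
    using real_arch_simple by blast
  hence N: "s + 2 * real CARD('n) \<le> 2 * real N" by simp
  define M where "M = s + 2 * real N"
  define c where "c = (2 powr s * 2 ^ N :: real)"
  have c: "c > 0" by (simp add: c_def)
  define P where "P \<eta> = ennreal (cmod (fourier \<phi> \<eta>))" for \<eta>
  define Q where "Q \<eta> = ennreal (bracket (\<eta> :: real^'n) powr M)" for \<eta>
  have F: "fourier \<phi> \<in> schwartz" by (rule schwartz_fourier[OF \<phi>])
  note [measurable] = schwartz_measurable[OF F]
  have [measurable]: "P \<in> borel_measurable borel" "Q \<in> borel_measurable borel"
    unfolding P_def Q_def by measurable
  obtain B where B: "\<And>\<eta>. bracket \<eta> ^ 0 * cmod (fourier \<phi> \<eta>) \<le> B" "0 \<le> B"
    using rapidD[OF schwartz_rapid[OF F], of 0] by blast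
  have PB: "P \<eta> \<le> ennreal B" for \<eta> unfolding P_def using B by (intro ennreal_leI) auto
  have S: "(\<integral>\<^sup>+ \<eta>. P \<eta> * ennreal (bracket \<eta> powr r) \<partial>lborel) < \<infinity>" for r
  proof -
    have "(\<integral>\<^sup>+ \<eta>. ennreal (bracket \<eta> powr r * cmod (fourier \<phi> \<eta>)) \<partial>lborel) < \<infinity>"
      using rapid_powr_integrable[OF schwartz_rapid[OF F] schwartz_measurable[OF F], of r]
      by (simp add: integrable_iff_bounded abs_mult)
    thus ?thesis by (simp add: P_def ennreal_mult mult.commute)
  qed
  have fin1: "(\<integral>\<^sup>+ \<eta>. P \<eta> * Q \<eta> \<partial>lborel) < \<infinity>" using S unfolding Q_def .
  have fin2: "(\<integral>\<^sup>+ \<eta>. (P \<eta> * Q \<eta>)\<^sup>2 \<partial>lborel) < \<infinity>"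
  proof -
    have "(\<integral>\<^sup>+ \<eta>. (P \<eta> * Q \<eta>)\<^sup>2 \<partial>lborel) \<le> (\<integral>\<^sup>+ \<eta>. ennreal B * (P \<eta> * ennreal (bracket \<eta> powr (2 * M))) \<partial>lborel)"
    proof (intro nn_integral_mono)
      fix \<eta> :: "real^'n"
      have "(Q \<eta>)\<^sup>2 = ennreal (bracket \<eta> powr (2 * M))"
        unfolding Q_def power2_eq_square by (simp add: ennreal_mult[symmetric] powr_add[symmetric])
      hence "(P \<eta> * Q \<eta>)\<^sup>2 = P \<eta> * (P \<eta> * ennreal (bracket \<eta> powr (2 * M)))"
        by (simp only: power_mult_distrib power2_eq_square[of "P \<eta>"] mult.assoc)
      also have "\<dots> \<le> ennreal B * (P \<eta> * ennreal (bracket \<eta> powr (2 * M)))"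
        by (intro mult_right_mono PB) simp
      finally show "(P \<eta> * Q \<eta>)\<^sup>2 \<le> ennreal B * (P \<eta> * ennreal (bracket \<eta> powr (2 * M)))" .
    qed
    also have "\<dots> = ennreal B * (\<integral>\<^sup>+ \<eta>. P \<eta> * ennreal (bracket \<eta> powr (2 * M)) \<partial>lborel)"
      by (rule nn_integral_cmult) measurable
    also have "\<dots> < \<infinity>" using S[of "2 * M"] by (simp add: ennreal_mult_less_top)
    finally show ?thesis .
  qed
  define S2 where "S2 = enn2real (\<integral>\<^sup>+ \<eta>. (P \<eta>)\<^sup>2 \<partial>lborel)"
  have S2: "(\<integral>\<^sup>+ \<eta>. (P \<eta>)\<^sup>2 \<partial>lborel) = ennreal S2" "S2 > 0"
  proof -
    have "(\<integral>\<^sup>+ \<eta>. (P \<eta>)\<^sup>2 \<partial>lborel) \<le> (\<integral>\<^sup>+ \<eta>. ennreal B * (P \<eta> * ennreal (bracket \<eta> powr 0)) \<partial>lborel)"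
      unfolding power2_eq_square by (intro nn_integral_mono) (use PB in \<open>auto intro!: mult_right_mono\<close>)
    also have "\<dots> = ennreal B * (\<integral>\<^sup>+ \<eta>. P \<eta> * ennreal (bracket \<eta> powr 0) \<partial>lborel)"
      by (rule nn_integral_cmult) measurable
    also have "\<dots> < \<infinity>" using S[of 0] by (simp add: ennreal_mult_less_top)
    finally have "(\<integral>\<^sup>+ \<eta>. (P \<eta>)\<^sup>2 \<partial>lborel) < \<infinity>" .
    thus eq: "(\<integral>\<^sup>+ \<eta>. (P \<eta>)\<^sup>2 \<partial>lborel) = ennreal S2" by (simp add: S2_def less_top)
    show "S2 > 0" using fourier_not_AE_zero[OF \<phi> nz] eq unfolding P_def by (cases "S2 > 0") (auto simp: ennreal_neg)
  qed
  define S1 where "S1 = enn2real (\<integral>\<^sup>+ \<eta>. P \<eta> * Q \<eta> \<partial>lborel)"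
  have S1: "(\<integral>\<^sup>+ \<eta>. P \<eta> * Q \<eta> \<partial>lborel) = ennreal S1" "S1 \<ge> 0" using fin1 by (auto simp: S1_def less_top)
  define L where "L = enn2real (\<integral>\<^sup>+ \<eta>. (P \<eta> * Q \<eta>)\<^sup>2 \<partial>lborel)"
  have L: "(\<integral>\<^sup>+ \<eta>. (P \<eta> * Q \<eta>)\<^sup>2 \<partial>lborel) = ennreal L" "L \<ge> 0" using fin2 by (auto simp: L_def less_top)
  define D where "D = sqrt ((2 * pi) ^ CARD('n) * L)"
  have D: "D \<ge> 0" using L by (simp add: D_def)
  \<comment> \<open>The choice makes the self-referential term at most half of the left side.\<close>
  define \<sigma> where "\<sigma> = min 1 (S2 / (2 * c * (D * c * S1 + 1)))"
  have den: "2 * c * (D * c * S1 + 1) > 0" using c D S1 by (intro mult_pos_pos add_nonneg_pos) auto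
  have \<sigma>: "0 < \<sigma>" "\<sigma> \<le> 1" using S2 den by (auto simp: \<sigma>_def)
  have \<sigma>2: "2 * (D * \<sigma> * c * S1) \<le> S2 / c"
  proof -
    have "\<sigma> \<le> S2 / (2 * c * (D * c * S1 + 1))" by (simp add: \<sigma>_def)
    hence "\<sigma> * (2 * c * (D * c * S1 + 1)) \<le> S2" by (simp only: pos_le_divide_eq[OF den])
    moreover have "0 \<le> \<sigma> * (2 * c)" using \<sigma> c by simp
    ultimately have "\<sigma> * (2 * c * (D * c * S1)) \<le> S2" by (simp add: algebra_simps)
    thus ?thesis using c by (simp add: field_simps)
  qed
  define C where "C = 2 * D / \<sigma> * (c / S2)"
  have main: "(\<integral>\<^sup>+ \<zeta>. ennreal (damped_weight s N \<delta> \<zeta>) * ennreal (cmod (fourier f \<zeta>)) \<partial>lborel) \<le> ennreal C * mod_norm \<phi> p s f"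
    if f: "integrable lborel f" and \<delta>: "0 < \<delta>" "\<delta> \<le> 1" for \<delta> and f :: "real^'n \<Rightarrow> complex"
  proof -
    define w where "w \<zeta> = ennreal (damped_weight s N \<delta> (\<zeta> :: real^'n))" for \<zeta>
    define a where "a \<zeta> = ennreal (cmod (fourier f \<zeta>))" for \<zeta>
    have [measurable]: "fourier f \<in> borel_measurable borel" "f \<in> borel_measurable borel" using f by auto
    have [measurable]: "w \<in> borel_measurable borel" "a \<in> borel_measurable borel"
      unfolding w_def a_def by measurable
    define T where "T = (\<integral>\<^sup>+ \<zeta>. w \<zeta> * a \<zeta> \<partial>lborel)"
    have shift: "(\<integral>\<^sup>+ \<xi>. w (\<xi> + \<eta>) * a (\<xi> + \<eta>) \<partial>lborel) = T" for \<eta>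
      unfolding T_def by (rule nn_integral_translate[of "\<lambda>\<zeta>. w \<zeta> * a \<zeta>"]) measurable
    have w1: "w (\<xi> + \<eta>) \<le> ennreal c * (w \<xi> * Q \<eta>)" for \<xi> \<eta>
      using ennreal_leI[OF damped_weight_moderate[OF s, of \<delta> N \<xi> \<eta>]] \<delta>
      by (simp add: w_def Q_def M_def c_def ennreal_mult)
    have w2: "w \<xi> \<le> ennreal c * (w (\<xi> + \<eta>) * Q \<eta>)" for \<xi> \<eta>
      using w1[of "\<xi> + \<eta>" "- \<eta>"] by (simp add: Q_def)
    have Tfin: "T < \<infinity>"
    proof -
      obtain A where A: "\<And>\<xi>. cmod (fourier f \<xi>) \<le> A" using norm_fourier_le[OF f] by blast
      have "T \<le> (\<integral>\<^sup>+ \<zeta>. w \<zeta> * ennreal A \<partial>lborel)"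
        unfolding T_def a_def by (intro nn_integral_mono mult_left_mono ennreal_leI A) simp
      also have "\<dots> = (\<integral>\<^sup>+ \<zeta>. w \<zeta> \<partial>lborel) * ennreal A" by (rule nn_integral_multc) measurable
      also have "(\<integral>\<^sup>+ \<zeta>. w \<zeta> \<partial>lborel) < \<infinity>"
        using damped_weight_integrable[OF N \<delta>] \<delta> unfolding w_def by (simp add: integrable_iff_bounded)
      hence "(\<integral>\<^sup>+ \<zeta>. w \<zeta> \<partial>lborel) * ennreal A < \<infinity>" by (simp add: ennreal_mult_less_top)
      finally show ?thesis .
    qed
    define X where "X = (\<integral>\<^sup>+ \<xi>. w \<xi> * slice \<phi> p f \<xi> \<partial>lborel)"
    note [measurable] = slice_measurable[OF \<open>f \<in> borel_measurable borel\<close> schwartz_measurable[OF \<phi>], of p]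
    have XM: "X \<le> mod_norm \<phi> p s f"
      unfolding X_def mod_norm_def w_def using \<delta>
      by (intro nn_integral_mono mult_right_mono ennreal_leI damped_weight_le) auto
    have Zeq: "a (\<xi> + \<eta>) * P \<eta> * (ennreal (cmod (fourier \<phi> \<eta>)) * Q \<eta>) = a (\<xi> + \<eta>) * ((P \<eta>)\<^sup>2 * Q \<eta>)" for \<xi> \<eta>
      by (simp add: P_def power2_eq_square mult.assoc)
    have Yeq: "ennreal (cmod (fourier f (\<xi> + \<eta>)) * cmod (fourier \<phi> \<eta>)) = a (\<xi> + \<eta>) * P \<eta>" for \<xi> \<eta>
      by (simp add: a_def P_def ennreal_mult)
    have loc: "(\<integral>\<^sup>+ \<eta>. a (\<xi> + \<eta>) * ((P \<eta>)\<^sup>2 * Q \<eta>) \<partial>lborel)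
       \<le> ennreal D * (ennreal (1 / \<sigma>) * slice \<phi> p f \<xi> + ennreal \<sigma> * (\<integral>\<^sup>+ \<eta>. a (\<xi> + \<eta>) * P \<eta> \<partial>lborel))" for \<xi>
      using local_spectrum_le[OF p f \<phi> \<open>Q \<in> borel_measurable borel\<close> L[unfolded P_def] \<sigma>, of \<xi>]
      unfolding Yeq Zeq D_def .
    have "ennreal (S2 / c) * T = ennreal (1 / c) * (\<integral>\<^sup>+ \<eta>. (P \<eta>)\<^sup>2 * T \<partial>lborel)"
      using S2 c by (simp add: nn_integral_multc ennreal_mult[symmetric] mult.assoc[symmetric])
    also have "\<dots> = ennreal (1 / c) * (\<integral>\<^sup>+ \<eta>. (\<integral>\<^sup>+ \<xi>. (P \<eta>)\<^sup>2 * (w (\<xi> + \<eta>) * a (\<xi> + \<eta>)) \<partial>lborel) \<partial>lborel)"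
      by (simp add: nn_integral_cmult shift)
    also have "\<dots> \<le> ennreal (1 / c) * (\<integral>\<^sup>+ \<eta>. (\<integral>\<^sup>+ \<xi>. ennreal c * (w \<xi> * (a (\<xi> + \<eta>) * ((P \<eta>)\<^sup>2 * Q \<eta>))) \<partial>lborel) \<partial>lborel)"
    proof (intro mult_left_mono nn_integral_mono)
      fix \<xi> \<eta> :: "real^'n"
      have "(P \<eta>)\<^sup>2 * (w (\<xi> + \<eta>) * a (\<xi> + \<eta>)) \<le> (P \<eta>)\<^sup>2 * ((ennreal c * (w \<xi> * Q \<eta>)) * a (\<xi> + \<eta>))"
        by (intro mult_left_mono mult_right_mono w1) auto
      thus "(P \<eta>)\<^sup>2 * (w (\<xi> + \<eta>) * a (\<xi> + \<eta>)) \<le> ennreal c * (w \<xi> * (a (\<xi> + \<eta>) * ((P \<eta>)\<^sup>2 * Q \<eta>)))"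
        by (simp add: mult_ac)
    qed simp
    also have "\<dots> = ennreal (1 / c) * (\<integral>\<^sup>+ \<xi>. (\<integral>\<^sup>+ \<eta>. ennreal c * (w \<xi> * (a (\<xi> + \<eta>) * ((P \<eta>)\<^sup>2 * Q \<eta>))) \<partial>lborel) \<partial>lborel)"
      by (rule arg_cong[where f = "(*) (ennreal (1 / c))"], rule lborel_pair.Fubini') measurable
    also have "\<dots> = ennreal (1 / c) * (ennreal c * (\<integral>\<^sup>+ \<xi>. w \<xi> * (\<integral>\<^sup>+ \<eta>. a (\<xi> + \<eta>) * ((P \<eta>)\<^sup>2 * Q \<eta>) \<partial>lborel) \<partial>lborel))"
      by (simp add: nn_integral_cmult)
    also have "\<dots> = (\<integral>\<^sup>+ \<xi>. w \<xi> * (\<integral>\<^sup>+ \<eta>. a (\<xi> + \<eta>) * ((P \<eta>)\<^sup>2 * Q \<eta>) \<partial>lborel) \<partial>lborel)"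
      using c by (simp add: mult.assoc[symmetric] ennreal_mult[symmetric])
    also have "\<dots> \<le> (\<integral>\<^sup>+ \<xi>. w \<xi> * (ennreal D * (ennreal (1 / \<sigma>) * slice \<phi> p f \<xi> + ennreal \<sigma> * (\<integral>\<^sup>+ \<eta>. a (\<xi> + \<eta>) * P \<eta> \<partial>lborel))) \<partial>lborel)"
      by (intro nn_integral_mono mult_left_mono loc) simp
    also have "\<dots> = (\<integral>\<^sup>+ \<xi>. ennreal (D / \<sigma>) * (w \<xi> * slice \<phi> p f \<xi>) + ennreal (D * \<sigma>) * (w \<xi> * (\<integral>\<^sup>+ \<eta>. a (\<xi> + \<eta>) * P \<eta> \<partial>lborel)) \<partial>lborel)"
    proof (intro nn_integral_cong)
      fix \<xi>
      have "ennreal (D / \<sigma>) = ennreal D * ennreal (1 / \<sigma>)" "ennreal (D * \<sigma>) = ennreal D * ennreal \<sigma>"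
        using D \<sigma> by (simp_all flip: ennreal_mult)
      thus "w \<xi> * (ennreal D * (ennreal (1 / \<sigma>) * slice \<phi> p f \<xi> + ennreal \<sigma> * (\<integral>\<^sup>+ \<eta>. a (\<xi> + \<eta>) * P \<eta> \<partial>lborel)))
        = ennreal (D / \<sigma>) * (w \<xi> * slice \<phi> p f \<xi>) + ennreal (D * \<sigma>) * (w \<xi> * (\<integral>\<^sup>+ \<eta>. a (\<xi> + \<eta>) * P \<eta> \<partial>lborel))"
        by (simp only: distrib_left mult_ac)
    qed
    also have "\<dots> = ennreal (D / \<sigma>) * X + ennreal (D * \<sigma>) * (\<integral>\<^sup>+ \<xi>. w \<xi> * (\<integral>\<^sup>+ \<eta>. a (\<xi> + \<eta>) * P \<eta> \<partial>lborel) \<partial>lborel)"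
      unfolding X_def by (simp add: nn_integral_add nn_integral_cmult)
    also have "\<dots> \<le> ennreal (D / \<sigma>) * X + ennreal (D * \<sigma>) * (ennreal (c * S1) * T)"
    proof (intro add_left_mono mult_left_mono)
      have "(\<integral>\<^sup>+ \<xi>. w \<xi> * (\<integral>\<^sup>+ \<eta>. a (\<xi> + \<eta>) * P \<eta> \<partial>lborel) \<partial>lborel) = (\<integral>\<^sup>+ \<xi>. (\<integral>\<^sup>+ \<eta>. w \<xi> * (a (\<xi> + \<eta>) * P \<eta>) \<partial>lborel) \<partial>lborel)"
        by (intro nn_integral_cong nn_integral_cmult[symmetric]) measurable
      also have "\<dots> \<le> (\<integral>\<^sup>+ \<xi>. (\<integral>\<^sup>+ \<eta>. (ennreal c * (P \<eta> * Q \<eta>)) * (w (\<xi> + \<eta>) * a (\<xi> + \<eta>)) \<partial>lborel) \<partial>lborel)"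
      proof (intro nn_integral_mono)
        fix \<xi> \<eta> :: "real^'n"
        have "w \<xi> * (a (\<xi> + \<eta>) * P \<eta>) \<le> (ennreal c * (w (\<xi> + \<eta>) * Q \<eta>)) * (a (\<xi> + \<eta>) * P \<eta>)"
          by (intro mult_right_mono w2) simp
        thus "w \<xi> * (a (\<xi> + \<eta>) * P \<eta>) \<le> (ennreal c * (P \<eta> * Q \<eta>)) * (w (\<xi> + \<eta>) * a (\<xi> + \<eta>))"
          by (simp add: mult_ac)
      qed
      also have "\<dots> = (\<integral>\<^sup>+ \<eta>. (\<integral>\<^sup>+ \<xi>. (ennreal c * (P \<eta> * Q \<eta>)) * (w (\<xi> + \<eta>) * a (\<xi> + \<eta>)) \<partial>lborel) \<partial>lborel)"
        by (rule lborel_pair.Fubini') measurable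
      also have "\<dots> = (\<integral>\<^sup>+ \<eta>. (ennreal c * (P \<eta> * Q \<eta>)) * T \<partial>lborel)"
        by (simp add: nn_integral_cmult shift)
      also have "\<dots> = ennreal (c * S1) * T"
        using c S1 by (simp add: nn_integral_multc nn_integral_cmult ennreal_mult)
      finally show "(\<integral>\<^sup>+ \<xi>. w \<xi> * (\<integral>\<^sup>+ \<eta>. a (\<xi> + \<eta>) * P \<eta> \<partial>lborel) \<partial>lborel) \<le> ennreal (c * S1) * T" .
    qed auto
    also have "\<dots> = ennreal (D / \<sigma>) * X + ennreal (D * \<sigma> * c * S1) * T"
      using D \<sigma> c S1 by (simp add: ennreal_mult mult.assoc)
    finally have "ennreal (S2 / c) * T \<le> ennreal (D / \<sigma>) * X + ennreal (D * \<sigma> * c * S1) * T" .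
    moreover have "2 * ennreal (D * \<sigma> * c * S1) \<le> ennreal (S2 / c)"
    proof -
      have "2 * ennreal (D * \<sigma> * c * S1) = ennreal (2 * (D * \<sigma> * c * S1))"
        using D \<sigma> c S1 by (simp add: ennreal_mult mult.assoc)
      thus ?thesis using ennreal_leI[OF \<sigma>2] by simp
    qed
    ultimately have "ennreal (S2 / c) * T \<le> 2 * (ennreal (D / \<sigma>) * X)"
      by (rule ennreal_absorb_half) (use Tfin in auto)
    hence "ennreal (c / S2) * (ennreal (S2 / c) * T) \<le> ennreal (c / S2) * (2 * (ennreal (D / \<sigma>) * X))"
      by (rule mult_left_mono) simp
    also have "ennreal (c / S2) * (ennreal (S2 / c) * T) = T"
      using c S2(2) by (simp add: mult.assoc[symmetric] ennreal_mult[symmetric])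
    also have "ennreal (c / S2) * (2 * (ennreal (D / \<sigma>) * X)) = ennreal C * X"
    proof -
      have "ennreal C = 2 * ennreal (D / \<sigma>) * ennreal (c / S2)"
        using D \<sigma> c S2(2) by (simp add: C_def ennreal_mult[symmetric] ennreal_numeral[symmetric] del: ennreal_numeral)
      thus ?thesis by (simp only: mult_ac)
    qed
    also have "\<dots> \<le> ennreal C * mod_norm \<phi> p s f" by (intro mult_left_mono XM) simp
    finally show ?thesis unfolding T_def w_def a_def .
  qed
  have "beurling_mass s (fourier f) \<le> ennreal C * mod_norm \<phi> p s f" if f: "integrable lborel f" for f :: "real^'n \<Rightarrow> complex"
  proof -
    have [measurable]: "fourier f \<in> borel_measurable borel" using f by auto
    let ?w = "\<lambda>k. damped_weight s N (1 / real (Suc k))"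
    have "beurling_mass s (fourier f) = (\<integral>\<^sup>+ \<zeta>. liminf (\<lambda>k. ennreal (?w k \<zeta>) * ennreal (cmod (fourier f \<zeta>))) \<partial>lborel)"
      unfolding beurling_mass_eq
    proof (intro nn_integral_cong)
      fix \<zeta> :: "real^'n"
      have "(\<lambda>k. ?w k \<zeta>) \<longlonglongrightarrow> bracket \<zeta> powr s / (1 + 0 * (norm \<zeta>)\<^sup>2) ^ N"
        unfolding damped_weight_def
        by (intro tendsto_intros lim_1_over_n[THEN LIMSEQ_Suc]) auto
      hence "(\<lambda>k. ennreal (?w k \<zeta>) * ennreal (cmod (fourier f \<zeta>))) \<longlonglongrightarrow> ennreal (bracket \<zeta> powr s) * ennreal (cmod (fourier f \<zeta>))"
        by (intro tendsto_mult_ennreal tendsto_ennrealI) auto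
      from lim_imp_Liminf[OF sequentially_bot this, symmetric]
      show "ennreal (bracket \<zeta> powr s) * ennreal (cmod (fourier f \<zeta>)) = liminf (\<lambda>k. ennreal (?w k \<zeta>) * ennreal (cmod (fourier f \<zeta>)))" .
    qed
    also have "\<dots> \<le> liminf (\<lambda>k. \<integral>\<^sup>+ \<zeta>. ennreal (?w k \<zeta>) * ennreal (cmod (fourier f \<zeta>)) \<partial>lborel)"
      by (rule nn_integral_liminf) measurable
    also have "\<dots> \<le> ennreal C * mod_norm \<phi> p s f"
      by (rule Liminf_le) (use main[OF f] in auto)
    finally show ?thesis .
  qed
  moreover have "C \<ge> 0" using D \<sigma> c S2 by (simp add: C_def)
  ultimately show ?thesis by blast
qed

section \<open>Elements of the modulation space lie in the Fourier--Beurling algebra\<close>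

subsection \<open>Mixed norms\<close>

lemma ennreal_tendsto_0I:
  assumes "\<And>e::real. 0 < e \<Longrightarrow> eventually (\<lambda>k. u k \<le> ennreal e) F" shows "(u \<longlongrightarrow> 0) F"
proof (rule order_tendstoI)
  fix a :: ennreal assume "0 < a"
  then obtain b where b: "0 < b" "b < a" using dense by blast
  then obtain e where e: "b = ennreal e" "0 \<le> e" by (cases b rule: ennreal_cases) auto
  with b have "0 < e" by (simp add: ennreal_less_zero_iff)
  from assms[OF this] show "eventually (\<lambda>k. u k < a) F"
    by eventually_elim (use b e in auto)
qed simp

lemma ennreal_tendsto_0D:
  assumes "(u \<longlongrightarrow> (0::ennreal)) F" "0 < (e::real)" shows "eventually (\<lambda>k. u k \<le> ennreal e) F"
  using order_tendstoD(2)[OF assms(1), of "ennreal e"] assms(2)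
  by (auto elim!: eventually_mono)

lemma lpn_dominated_convergence_0:
  assumes p: "0 < p" and [measurable]: "\<And>k. u k \<in> borel_measurable M" "U \<in> borel_measurable M"
    and u: "\<And>k x. 0 \<le> u k x" "\<And>k x. u k x \<le> U x" and fin: "lpn p M U < \<infinity>"
    and lim: "\<And>x. (\<lambda>k. u k x) \<longlonglongrightarrow> 0"
  shows "(\<lambda>k. lpn p M (u k)) \<longlonglongrightarrow> 0"
proof (rule ennreal_tendsto_0I)
  fix e :: real assume e: "0 < e"
  have "(\<integral>\<^sup>+ x. ennreal (U x powr p) \<partial>M) < \<infinity>"
    using fin by (auto simp: lpn_def less_top[symmetric] split: if_splits)
  hence "(\<lambda>k. \<integral>\<^sup>+ x. ennreal (u k x powr p) \<partial>M) \<longlonglongrightarrow> (\<integral>\<^sup>+ x. 0 \<partial>M)"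
  proof (intro nn_integral_dominated_convergence[where w = "\<lambda>x. ennreal (U x powr p)"])
    show "AE x in M. ennreal (u k x powr p) \<le> ennreal (U x powr p)" for k
      using u p by (intro AE_I2 ennreal_leI powr_mono2) auto
    show "AE x in M. (\<lambda>k. ennreal (u k x powr p)) \<longlonglongrightarrow> 0"
    proof (intro AE_I2)
      fix x
      have "(\<lambda>k. u k x powr p) \<longlonglongrightarrow> 0"
        by (rule tendsto_zero_powrI[OF lim tendsto_const]) (use u p in auto)
      from tendsto_ennrealI[OF this] show "(\<lambda>k. ennreal (u k x powr p)) \<longlonglongrightarrow> 0" by simp
    qed
  qed auto
  hence "(\<lambda>k. \<integral>\<^sup>+ x. ennreal (u k x powr p) \<partial>M) \<longlonglongrightarrow> 0" by simp
  from ennreal_tendsto_0D[OF this, of "e powr p"] e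
  show "\<forall>\<^sub>F k in sequentially. lpn p M (u k) \<le> ennreal e"
    by (simp add: lpn_le_iff[OF p])
qed

lemma lpn_finite_iff: "lpn p M g < \<infinity> \<longleftrightarrow> (\<integral>\<^sup>+ x. ennreal (g x powr p) \<partial>M) < \<infinity>"
  by (auto simp: lpn_def Let_def less_top[symmetric])

definition mix_norm :: "real \<Rightarrow> real \<Rightarrow> (real^'n::finite \<Rightarrow> real^'n \<Rightarrow> real) \<Rightarrow> ennreal" where
  "mix_norm p s U = (\<integral>\<^sup>+ \<xi>. ennreal (bracket \<xi> powr s) * lpn p lborel (U \<xi>) \<partial>lborel)"

lemma mod_norm_eq_mix_norm: "mod_norm \<phi> p s f = mix_norm p s (\<lambda>\<xi> x. cmod (stf \<phi> f \<xi> x))"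
  by (simp add: mod_norm_def mix_norm_def slice_def)

lemma lpn_lborel_measurable:
  fixes U :: "real^'n::finite \<Rightarrow> real^'n \<Rightarrow> real"
  assumes "case_prod U \<in> borel_measurable (lborel \<Otimes>\<^sub>M lborel)"
  shows "(\<lambda>\<xi>. lpn p lborel (U \<xi>)) \<in> borel_measurable borel"
  using lpn_measurable[OF sigma_finite_lborel assms, of p] by simp

lemma section_measurable:
  fixes U :: "real^'n::finite \<Rightarrow> real^'n \<Rightarrow> real"
  assumes "case_prod U \<in> borel_measurable (lborel \<Otimes>\<^sub>M lborel)"
  shows "U \<xi> \<in> borel_measurable borel"
  using measurable_Pair2[OF assms, of \<xi>] by simp

lemma mix_norm_triangle:
  fixes U :: "real^'n::finite \<Rightarrow> real^'n \<Rightarrow> real"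
  assumes p: "1 \<le> p" and m: "case_prod U \<in> borel_measurable (lborel \<Otimes>\<^sub>M lborel)" "case_prod V \<in> borel_measurable (lborel \<Otimes>\<^sub>M lborel)"
    and nn: "\<And>\<xi> x. 0 \<le> U \<xi> x" "\<And>\<xi> x. 0 \<le> V \<xi> x" and W: "\<And>\<xi> x. 0 \<le> W \<xi> x" "\<And>\<xi> x. W \<xi> x \<le> U \<xi> x + V \<xi> x"
  shows "mix_norm p s W \<le> mix_norm p s U + mix_norm p s V"
proof -
  note [measurable] = lpn_lborel_measurable[OF m(1)] lpn_lborel_measurable[OF m(2)] section_measurable[OF m(1)] section_measurable[OF m(2)]
  have "mix_norm p s W \<le> (\<integral>\<^sup>+ \<xi>. ennreal (bracket \<xi> powr s) * (lpn p lborel (U \<xi>) + lpn p lborel (V \<xi>)) \<partial>lborel)"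
    unfolding mix_norm_def
    by (intro nn_integral_mono mult_left_mono lpn_triangle[OF sigma_finite_lborel p]) (use nn W in auto)
  also have "\<dots> = mix_norm p s U + mix_norm p s V"
    unfolding mix_norm_def distrib_left by (rule nn_integral_add) auto
  finally show ?thesis .
qed

lemma mix_norm_shift_le:
  fixes U :: "real^'n::finite \<Rightarrow> real^'n \<Rightarrow> real"
  assumes s: "0 \<le> s" and m: "case_prod U \<in> borel_measurable (lborel \<Otimes>\<^sub>M lborel)"
  shows "mix_norm p s (\<lambda>\<xi>. U (\<xi> - \<eta>)) \<le> ennreal (2 powr s * bracket \<eta> powr s) * mix_norm p s U"
proof -
  note [measurable] = lpn_lborel_measurable[OF m]
  have "mix_norm p s (\<lambda>\<xi>. U (\<xi> - \<eta>)) \<le> (\<integral>\<^sup>+ \<xi>. ennreal (2 powr s * bracket \<eta> powr s) * (ennreal (bracket (\<xi> - \<eta>) powr s) * lpn p lborel (U (\<xi> - \<eta>))) \<partial>lborel)"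
    unfolding mix_norm_def
  proof (intro nn_integral_mono)
    fix \<xi> :: "real^'n"
    have "ennreal (bracket \<xi> powr s) \<le> ennreal (2 powr s * bracket \<eta> powr s) * ennreal (bracket (\<xi> - \<eta>) powr s)"
      using ennreal_leI[OF bracket_powr_add_le[OF s, of \<eta> "\<xi> - \<eta>"]] by (simp add: ennreal_mult)
    from mult_right_mono[OF this, of "lpn p lborel (U (\<xi> - \<eta>))"]
    show "ennreal (bracket \<xi> powr s) * lpn p lborel (U (\<xi> - \<eta>)) \<le> ennreal (2 powr s * bracket \<eta> powr s) * (ennreal (bracket (\<xi> - \<eta>) powr s) * lpn p lborel (U (\<xi> - \<eta>)))"
      by (simp add: mult.assoc)
  qed
  also have "\<dots> = ennreal (2 powr s * bracket \<eta> powr s) * (\<integral>\<^sup>+ \<xi>. (\<lambda>\<xi>. ennreal (bracket \<xi> powr s) * lpn p lborel (U \<xi>)) (\<xi> + - \<eta>) \<partial>lborel)"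
    by (simp add: nn_integral_cmult)
  also have "(\<integral>\<^sup>+ \<xi>. (\<lambda>\<xi>. ennreal (bracket \<xi> powr s) * lpn p lborel (U \<xi>)) (\<xi> + - \<eta>) \<partial>lborel) = mix_norm p s U"
    unfolding mix_norm_def by (rule nn_integral_translate) measurable
  finally show ?thesis .
qed

lemma mix_norm_dominated_convergence_0:
  fixes u :: "nat \<Rightarrow> real^'n::finite \<Rightarrow> real^'n \<Rightarrow> real"
  assumes p: "0 < p" and m: "\<And>k. case_prod (u k) \<in> borel_measurable (lborel \<Otimes>\<^sub>M lborel)"
      "case_prod U \<in> borel_measurable (lborel \<Otimes>\<^sub>M lborel)"
    and u: "\<And>k \<xi> x. 0 \<le> u k \<xi> x" "\<And>k \<xi> x. u k \<xi> x \<le> U \<xi> x" and fin: "mix_norm p s U < \<infinity>"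
    and lim: "\<And>\<xi> x. (\<lambda>k. u k \<xi> x) \<longlonglongrightarrow> 0"
  shows "(\<lambda>k. mix_norm p s (u k)) \<longlonglongrightarrow> 0"
proof -
  note [measurable] = lpn_lborel_measurable[OF m(1)] lpn_lborel_measurable[OF m(2)] section_measurable[OF m(1)] section_measurable[OF m(2)]
  have "(\<lambda>k. mix_norm p s (u k)) \<longlonglongrightarrow> (\<integral>\<^sup>+ \<xi>. 0 \<partial>(lborel :: (real^'n) measure))"
    unfolding mix_norm_def
  proof (intro nn_integral_dominated_convergence[where w = "\<lambda>\<xi>. ennreal (bracket \<xi> powr s) * lpn p lborel (U \<xi>)"])
    show "AE \<xi> in lborel. ennreal (bracket \<xi> powr s) * lpn p lborel (u k \<xi>) \<le> ennreal (bracket \<xi> powr s) * lpn p lborel (U \<xi>)" for k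
      using u p by (intro AE_I2 mult_left_mono lpn_mono) auto
    have "AE \<xi> in lborel. ennreal (bracket \<xi> powr s) * lpn p lborel (U \<xi>) \<noteq> \<infinity>"
      using fin unfolding mix_norm_def by (intro nn_integral_PInf_AE) auto
    thus "AE \<xi> in lborel. (\<lambda>k. ennreal (bracket \<xi> powr s) * lpn p lborel (u k \<xi>)) \<longlonglongrightarrow> 0"
    proof eventually_elim
      case (elim \<xi>)
      hence "lpn p lborel (U \<xi>) < \<infinity>"
        by (auto simp: ennreal_mult_eq_top_iff ennreal_eq_0_iff less_top[symmetric] not_le)
      hence "(\<lambda>k. lpn p lborel (u k \<xi>)) \<longlonglongrightarrow> 0"
        using p u lim by (intro lpn_dominated_convergence_0[where U = "U \<xi>"]) auto
      from tendsto_mult_ennreal[OF tendsto_const this, of "ennreal (bracket \<xi> powr s)"]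
      show ?case by simp
    qed
  qed (use fin in \<open>auto simp: mix_norm_def\<close>)
  thus ?thesis by simp
qed

subsection \<open>Continuity of frequency translations\<close>

text \<open>The factor truncates in \<open>x\<close>, tapers in \<open>\<xi>\<close> and limits the size of \<open>V\<close>; it depends
  continuously on \<open>\<xi>\<close> whenever \<open>V\<close> does.\<close>

definition cutoff :: "nat \<Rightarrow> (real^'n::finite \<Rightarrow> real^'n \<Rightarrow> complex) \<Rightarrow> real^'n \<Rightarrow> real^'n \<Rightarrow> real" where
  "cutoff L V \<xi> x = (if norm x \<le> real (Suc L) then 1 else 0) * max 0 (1 - norm \<xi> / real (Suc L)) / (1 + cmod (V \<xi> x) / real (Suc L))"

lemma cutoff_bounds:
  "0 \<le> cutoff L V \<xi> x" "cutoff L V \<xi> x \<le> 1" "cutoff L V \<xi> x * cmod (V \<xi> x) \<le> real (Suc L)"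
  "norm x > real (Suc L) \<or> norm \<xi> > real (Suc L) \<Longrightarrow> cutoff L V \<xi> x = 0"
proof -
  let ?l = "real (Suc L)"
  have l: "?l > 0" by simp
  define N where "N = (if norm x \<le> ?l then 1 else 0) * max 0 (1 - norm \<xi> / ?l)"
  define q where "q = 1 + cmod (V \<xi> x) / ?l"
  have eq: "cutoff L V \<xi> x = N / q" by (simp add: cutoff_def N_def q_def)
  have q: "q \<ge> 1" by (simp add: q_def)
  have N: "0 \<le> N" "N \<le> 1" unfolding N_def by (auto intro!: mult_le_one)
  show "0 \<le> cutoff L V \<xi> x" unfolding eq using N q by (intro divide_nonneg_nonneg) auto
  show "cutoff L V \<xi> x \<le> 1" unfolding eq using N q by (subst pos_divide_le_eq) linarith+
  have "cutoff L V \<xi> x * cmod (V \<xi> x) \<le> 1 / q * cmod (V \<xi> x)"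
    unfolding eq using N q by (intro mult_right_mono divide_right_mono) auto
  also have "\<dots> = cmod (V \<xi> x) / q" by simp
  also have "\<dots> \<le> ?l"
  proof (subst pos_divide_le_eq)
    show "0 < q" using q by linarith
    have "?l * q = ?l + cmod (V \<xi> x)" unfolding q_def distrib_left using l by simp
    thus "cmod (V \<xi> x) \<le> ?l * q" using l by linarith
  qed
  finally show "cutoff L V \<xi> x * cmod (V \<xi> x) \<le> ?l" .
  show "norm x > ?l \<or> norm \<xi> > ?l \<Longrightarrow> cutoff L V \<xi> x = 0"
    by (auto simp: cutoff_def max_def field_simps split: if_splits)
qed

lemma cutoff_tendsto_1: "(\<lambda>L. cutoff L V \<xi> x) \<longlonglongrightarrow> 1"
proof -
  have inv: "(\<lambda>L. c / real (Suc L)) \<longlonglongrightarrow> 0" for c :: real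
    by (rule LIMSEQ_Suc[OF lim_const_over_n])
  have "eventually (\<lambda>L. norm x \<le> real L) sequentially"
    using eventually_ge_at_top[of "nat \<lceil>norm x\<rceil>"] by eventually_elim linarith
  hence "eventually (\<lambda>L. (if norm x \<le> real (Suc L) then 1 else 0) = (1::real)) sequentially"
    by eventually_elim auto
  hence "(\<lambda>L. if norm x \<le> real (Suc L) then 1 else 0 :: real) \<longlonglongrightarrow> 1"
    by (rule tendsto_eventually)
  hence "(\<lambda>L. (if norm x \<le> real (Suc L) then 1 else 0) * max 0 (1 - norm \<xi> / real (Suc L)) / (1 + cmod (V \<xi> x) / real (Suc L)))
     \<longlonglongrightarrow> 1 * max 0 (1 - 0) / (1 + 0)"
    by (intro tendsto_intros inv) auto
  thus ?thesis by (simp add: cutoff_def)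
qed

text \<open>Translation in \<open>\<xi>\<close> is continuous for the mixed norm. The function is first replaced by a
  bounded one of bounded support that is still continuous in \<open>\<xi>\<close>; for this part dominated
  convergence applies, and the remainder is small in norm together with its translates.\<close>

lemma mix_norm_translation_continuous:
  fixes V :: "real^'n::finite \<Rightarrow> real^'n \<Rightarrow> complex"
  assumes p: "1 \<le> p" and s: "0 \<le> s"
    and m: "(\<lambda>(\<xi>, x). V \<xi> x) \<in> borel_measurable (lborel \<Otimes>\<^sub>M lborel)"
    and c: "\<And>x. continuous_on UNIV (\<lambda>\<xi>. V \<xi> x)"
    and fin: "mix_norm p s (\<lambda>\<xi> x. cmod (V \<xi> x)) < \<infinity>" and X: "X \<longlonglongrightarrow> 0"
  shows "(\<lambda>k. mix_norm p s (\<lambda>\<xi> x. cmod (V (\<xi> - X k) x - V \<xi> x))) \<longlonglongrightarrow> 0"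
proof (rule ennreal_tendsto_0I)
  fix e :: real assume e: "0 < e"
  have p0: "0 < p" using p by simp
  have Vm [measurable]: "(\<lambda>z. V (fst z) (snd z)) \<in> borel_measurable (lborel \<Otimes>\<^sub>M lborel)"
    using m by (simp add: case_prod_beta)
  have [measurable]: "(\<lambda>z. V (fst z - \<eta>) (snd z)) \<in> borel_measurable (lborel \<Otimes>\<^sub>M lborel)" for \<eta>
  proof -
    have "(\<lambda>z::(real^'n) \<times> (real^'n). (fst z - \<eta>, snd z)) \<in> lborel \<Otimes>\<^sub>M lborel \<rightarrow>\<^sub>M lborel \<Otimes>\<^sub>M lborel"
      by measurable
    from measurable_compose[OF this Vm] show ?thesis by simp
  qed
  have km [measurable]: "(\<lambda>z. cutoff L V (fst z) (snd z)) \<in> borel_measurable (lborel \<Otimes>\<^sub>M lborel)" for L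
    unfolding cutoff_def by measurable
  have km2 [measurable]: "(\<lambda>z. cutoff L V (fst z - \<eta>) (snd z)) \<in> borel_measurable (lborel \<Otimes>\<^sub>M lborel)" for L \<eta>
    unfolding cutoff_def by measurable
  define G where "G L \<xi> x = of_real (cutoff L V \<xi> x) * V \<xi> x" for L \<xi> x
  define H where "H L \<xi> x = cmod (V \<xi> x - G L \<xi> x)" for L \<xi> x
  have Heq: "H L \<xi> x = (1 - cutoff L V \<xi> x) * cmod (V \<xi> x)" for L \<xi> x
  proof -
    have "V \<xi> x - G L \<xi> x = of_real (1 - cutoff L V \<xi> x) * V \<xi> x" by (simp add: G_def algebra_simps)
    thus ?thesis unfolding H_def using cutoff_bounds(2)[of L V \<xi> x] by (simp only: norm_mult norm_of_real)
  qed
  have Hm: "case_prod (H L) \<in> borel_measurable (lborel \<Otimes>\<^sub>M lborel)" for L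
    unfolding Heq case_prod_beta by measurable
  have "(\<lambda>L. mix_norm p s (H L)) \<longlonglongrightarrow> 0"
  proof (rule mix_norm_dominated_convergence_0[OF p0 Hm _ _ _ fin])
    show "case_prod (\<lambda>\<xi> x. cmod (V \<xi> x)) \<in> borel_measurable (lborel \<Otimes>\<^sub>M lborel)"
      unfolding case_prod_beta by measurable
    show "0 \<le> H L \<xi> x" for L \<xi> x by (simp add: H_def)
    show "H L \<xi> x \<le> cmod (V \<xi> x)" for L \<xi> x
      unfolding Heq using cutoff_bounds(1,2)[of L V \<xi> x] by (intro mult_left_le_one_le) auto
    have "(\<lambda>L. (1 - cutoff L V \<xi> x) * cmod (V \<xi> x)) \<longlonglongrightarrow> (1 - 1) * cmod (V \<xi> x)" for \<xi> x
      by (intro tendsto_intros cutoff_tendsto_1)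
    thus "(\<lambda>L. H L \<xi> x) \<longlonglongrightarrow> 0" for \<xi> x unfolding Heq by simp
  qed
  define A where "A = 2 + 2 powr s * 2 powr s"
  have A: "A > 0" by (simp add: A_def add_pos_pos)
  define d where "d = e / (2 * A)"
  have d: "d > 0" using e A by (simp add: d_def)
  from ennreal_tendsto_0D[OF \<open>(\<lambda>L. mix_norm p s (H L)) \<longlonglongrightarrow> 0\<close> d] obtain L where L: "mix_norm p s (H L) \<le> ennreal d"
    by (auto simp: eventually_sequentially)
  let ?l = "real (Suc L)"
  define u where "u k \<xi> x = (if norm (X k) \<le> 1 then cmod (G L (\<xi> - X k) x - G L \<xi> x) else 0)" for k \<xi> x
  define U where "U \<xi> x = 2 * ?l * (if norm \<xi> \<le> ?l + 1 then 1 else 0) * (if norm x \<le> ?l then 1 else 0)" for \<xi> x :: "real^'n"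
  have "(\<lambda>k. mix_norm p s (u k)) \<longlonglongrightarrow> 0"
  proof (rule mix_norm_dominated_convergence_0[OF p0])
    show "case_prod (u k) \<in> borel_measurable (lborel \<Otimes>\<^sub>M lborel)" for k
      unfolding u_def G_def case_prod_beta by measurable
    show "case_prod U \<in> borel_measurable (lborel \<Otimes>\<^sub>M lborel)"
      unfolding U_def case_prod_beta by measurable
    show "0 \<le> u k \<xi> x" for k \<xi> x by (simp add: u_def)
    have Gb: "cmod (G L \<xi> x) \<le> ?l" for \<xi> x
      using cutoff_bounds(1,3)[of L V \<xi> x] by (simp add: G_def norm_mult)
    show "u k \<xi> x \<le> U \<xi> x" for k \<xi> x
    proof (cases "norm (X k) \<le> 1 \<and> norm \<xi> \<le> ?l + 1 \<and> norm x \<le> ?l")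
      case True
      have "cmod (G L (\<xi> - X k) x - G L \<xi> x) \<le> ?l + ?l"
        by (intro norm_triangle_le_diff add_mono Gb)
      thus ?thesis using True by (simp add: u_def U_def)
    next
      case False
      have "u k \<xi> x = 0"
      proof (cases "norm (X k) \<le> 1")
        case True
        with False have "norm x > ?l \<or> norm \<xi> > ?l + 1" by auto
        moreover have "norm \<xi> \<le> norm (\<xi> - X k) + norm (X k)" by (metis diff_add_cancel norm_triangle_ineq)
        ultimately have "(norm x > ?l \<or> norm \<xi> > ?l) \<and> (norm x > ?l \<or> norm (\<xi> - X k) > ?l)" using True by auto
        thus ?thesis by (simp add: u_def G_def cutoff_bounds(4))
      qed (simp add: u_def)
      thus ?thesis by (simp add: U_def)
    qed
    show "(\<lambda>k. u k \<xi> x) \<longlonglongrightarrow> 0" for \<xi> x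
    proof -
      have cG: "continuous_on UNIV (\<lambda>\<xi>. G L \<xi> x)"
        unfolding G_def cutoff_def
        by (intro continuous_intros c) (auto simp: add_nonneg_eq_0_iff)
      have "(\<lambda>k. \<xi> - X k) \<longlonglongrightarrow> \<xi>" using tendsto_diff[OF tendsto_const X, of \<xi>] by simp
      from continuous_on_tendsto_compose[OF cG this]
      have "(\<lambda>k. G L (\<xi> - X k) x) \<longlonglongrightarrow> G L \<xi> x" by simp
      from tendsto_norm_zero[OF LIM_zero[OF this]]
      have l0: "(\<lambda>k. cmod (G L (\<xi> - X k) x - G L \<xi> x)) \<longlonglongrightarrow> 0" .
      show ?thesis by (rule tendsto_sandwich[OF _ _ tendsto_const l0]) (auto simp: u_def)
    qed
    show "mix_norm p s U < \<infinity>"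
    proof -
      have bx: "lpn p lborel (U \<xi>) \<le> indicator (cball 0 (?l + 1)) \<xi> * lpn p lborel (\<lambda>x::real^'n. 2 * ?l * (if norm x \<le> ?l then 1 else 0))" for \<xi>
        using p0 by (cases "norm \<xi> \<le> ?l + 1") (simp_all add: U_def[abs_def])
      have "(\<integral>\<^sup>+ x. ennreal ((2 * ?l * (if norm (x::real^'n) \<le> ?l then 1 else 0)) powr p) \<partial>lborel)
          = (\<integral>\<^sup>+ x. ennreal ((2 * ?l) powr p) * indicator (cball 0 ?l) (x::real^'n) \<partial>lborel)"
        by (intro nn_integral_cong) (auto simp: indicator_def)
      also have "\<dots> < \<infinity>"
        using emeasure_lborel_cball_finite[of "0::real^'n" ?l]
        by (subst nn_integral_cmult_indicator) (auto simp: ennreal_mult_less_top)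
      finally have l1: "lpn p lborel (\<lambda>x::real^'n. 2 * ?l * (if norm x \<le> ?l then 1 else 0)) < \<infinity>" (is "?q < \<infinity>")
        by (simp only: lpn_finite_iff)
      have "mix_norm p s U \<le> (\<integral>\<^sup>+ \<xi>. (ennreal (bracket_bound) * ?q) * indicator (cball 0 (?l + 1)) (\<xi> :: real^'n) \<partial>lborel)"
        if bb: "\<And>\<xi> :: real^'n. norm \<xi> \<le> ?l + 1 \<Longrightarrow> bracket \<xi> powr s \<le> bracket_bound" for bracket_bound
        unfolding mix_norm_def
      proof (intro nn_integral_mono)
        fix \<xi> :: "real^'n"
        have "ennreal (bracket \<xi> powr s) * lpn p lborel (U \<xi>) \<le> ennreal (bracket \<xi> powr s) * (indicator (cball 0 (?l + 1)) \<xi> * ?q)"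
          by (intro mult_left_mono bx) simp
        also have "\<dots> \<le> (ennreal (bracket_bound) * ?q) * indicator (cball 0 (?l + 1)) \<xi>"
          using bb[of \<xi>] by (auto simp: indicator_def intro!: mult_right_mono ennreal_leI)
        finally show "ennreal (bracket \<xi> powr s) * lpn p lborel (U \<xi>) \<le> (ennreal (bracket_bound) * ?q) * indicator (cball 0 (?l + 1)) \<xi>" .
      qed
      moreover have "bracket \<xi> powr s \<le> (2 + ?l) powr s" if "norm \<xi> \<le> ?l + 1" for \<xi> :: "real^'n"
      proof -
        have "(norm \<xi>)\<^sup>2 \<le> (?l + 1)\<^sup>2" using that by (intro power_mono) auto
        hence "bracket \<xi> \<le> 2 + ?l"
          unfolding bracket_def by (intro real_le_lsqrt) (auto simp: power2_eq_square algebra_simps)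
        thus ?thesis using s by (intro powr_mono2) auto
      qed
      ultimately have "mix_norm p s U \<le> (\<integral>\<^sup>+ \<xi>. (ennreal ((2 + ?l) powr s) * ?q) * indicator (cball 0 (?l + 1)) (\<xi> :: real^'n) \<partial>lborel)"
        by blast
      also have "\<dots> < \<infinity>"
        using l1 emeasure_lborel_cball_finite[of "0::real^'n" "?l + 1"]
        by (subst nn_integral_cmult_indicator) (auto simp: ennreal_mult_less_top)
      finally show ?thesis .
    qed
  qed
  from ennreal_tendsto_0D[OF this d] have ev1: "\<forall>\<^sub>F k in sequentially. mix_norm p s (u k) \<le> ennreal d" .
  have ev2: "\<forall>\<^sub>F k in sequentially. norm (X k) < 1"
    using order_tendstoD(2)[OF tendsto_norm_zero[OF X], of 1] by simp
  from ev1 ev2 show "\<forall>\<^sub>F k in sequentially. mix_norm p s (\<lambda>\<xi> x. cmod (V (\<xi> - X k) x - V \<xi> x)) \<le> ennreal e"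
  proof eventually_elim
    case (elim k)
    have um: "case_prod (u k) \<in> borel_measurable (lborel \<Otimes>\<^sub>M lborel)"
      unfolding u_def G_def case_prod_beta by measurable
    have Hm2: "case_prod (\<lambda>\<xi>. H L (\<xi> - X k)) \<in> borel_measurable (lborel \<Otimes>\<^sub>M lborel)"
      unfolding Heq case_prod_beta by measurable
    have H2m: "case_prod (\<lambda>\<xi> x. H L (\<xi> - X k) x + H L \<xi> x) \<in> borel_measurable (lborel \<Otimes>\<^sub>M lborel)"
      unfolding Heq case_prod_beta by measurable
    have t1: "mix_norm p s (\<lambda>\<xi> x. cmod (V (\<xi> - X k) x - V \<xi> x))
        \<le> mix_norm p s (u k) + mix_norm p s (\<lambda>\<xi> x. H L (\<xi> - X k) x + H L \<xi> x)"
    proof (rule mix_norm_triangle[OF p um H2m])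
      fix \<xi> x
      have "V (\<xi> - X k) x - V \<xi> x = (G L (\<xi> - X k) x - G L \<xi> x) + ((V (\<xi> - X k) x - G L (\<xi> - X k) x) - (V \<xi> x - G L \<xi> x))"
        by simp
      also have "cmod \<dots> \<le> cmod (G L (\<xi> - X k) x - G L \<xi> x) + (H L (\<xi> - X k) x + H L \<xi> x)"
        unfolding H_def by (intro norm_triangle_le add_left_mono norm_triangle_ineq4)
      finally show "cmod (V (\<xi> - X k) x - V \<xi> x) \<le> u k \<xi> x + (H L (\<xi> - X k) x + H L \<xi> x)"
        using elim(2) by (simp add: u_def)
    qed (auto simp: u_def H_def)
    have t2: "mix_norm p s (\<lambda>\<xi> x. H L (\<xi> - X k) x + H L \<xi> x) \<le> mix_norm p s (\<lambda>\<xi>. H L (\<xi> - X k)) + mix_norm p s (H L)"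
      by (rule mix_norm_triangle[OF p Hm2 Hm]) (auto simp: H_def)
    have t3: "mix_norm p s (\<lambda>\<xi>. H L (\<xi> - X k)) \<le> ennreal (2 powr s * bracket (X k) powr s) * mix_norm p s (H L)"
      by (rule mix_norm_shift_le[OF s Hm])
    have t4: "ennreal (2 powr s * bracket (X k) powr s) * mix_norm p s (H L) \<le> ennreal (2 powr s * 2 powr s) * ennreal d"
    proof (intro mult_mono ennreal_leI mult_left_mono L powr_mono2 s)
      have "(norm (X k))\<^sup>2 \<le> 1" using elim(2) by (simp add: power_le_one)
      thus "bracket (X k) \<le> 2" unfolding bracket_def by (intro real_le_lsqrt) auto
    qed auto
    have "mix_norm p s (\<lambda>\<xi> x. cmod (V (\<xi> - X k) x - V \<xi> x)) \<le> ennreal d + (ennreal (2 powr s * 2 powr s) * ennreal d + ennreal d)"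
      by (rule order_trans[OF t1 add_mono[OF elim(1) order_trans[OF t2 add_mono[OF order_trans[OF t3 t4] L]]]])
    also have "\<dots> = ennreal (A * d)"
      using d by (simp add: A_def ennreal_mult[symmetric] ennreal_plus[symmetric] algebra_simps del: ennreal_plus)
    also have "\<dots> \<le> ennreal e" using A e by (intro ennreal_leI) (simp add: d_def)
    finally show ?case .
  qed
qed

subsection \<open>Approximation by Gaussian multiples\<close>

lemma has_symbol_gauss:
  assumes a: "0 < a"
  shows "has_symbol s (\<lambda>t :: real^'n::finite. complex_of_real (gauss a t)) (\<lambda>\<zeta>. of_real (heat a \<zeta>))"
proof -
  have hi: "integrable lborel (\<lambda>\<zeta> :: real^'n. complex_of_real (heat a \<zeta>))"
    using heat_integrable[OF a, where 'n='n] by (simp only: complex_of_real_integrable_eq)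
  have f: "fourier (\<lambda>x :: real^'n. complex_of_real (gauss a x)) = (\<lambda>\<zeta>. of_real (heat a \<zeta>))"
    using fourier_gauss[OF a] by blast
  have gc: "continuous_on UNIV (\<lambda>x :: real^'n. complex_of_real (gauss a x))"
    by (rule schwartz_continuous[OF schwartz_gauss[OF a]])
  have "complex_of_real (gauss a t) = inverse_fourier (\<lambda>\<zeta>. of_real (heat a \<zeta>)) t" for t :: "real^'n"
    using fourier_inversion[OF schwartz_integrable[OF schwartz_gauss[OF a]], of t] hi
      gc
    unfolding f by (simp add: inverse_fourier_def continuous_on_eq_continuous_at)
  moreover have "beurling_mass s (\<lambda>\<zeta> :: real^'n. complex_of_real (heat a \<zeta>)) < \<infinity>"
  proof -
    have g: "(\<lambda>x :: real^'n. complex_of_real (gauss (1 / a) x)) \<in> schwartz" using a by (intro schwartz_gauss) simp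
    have "integrable lborel (\<lambda>x :: real^'n. sqrt (2 * pi / a) ^ CARD('n) * (bracket x powr s * cmod (of_real (gauss (1 / a) x))))"
      by (intro integrable_mult_right rapid_powr_integrable schwartz_rapid[OF g] schwartz_measurable[OF g])
    moreover have "cmod (complex_of_real (heat a x)) = sqrt (2 * pi / a) ^ CARD('n) * cmod (complex_of_real (gauss (1 / a) x))" for x :: "real^'n"
      unfolding norm_of_real using a by (simp add: heat_eq_gauss abs_mult)
    ultimately have "integrable lborel (\<lambda>x :: real^'n. bracket x powr s * cmod (complex_of_real (heat a x)))"
      by (simp only: mult.left_commute)
    thus ?thesis unfolding beurling_mass_def by (simp add: integrable_iff_bounded abs_mult)
  qed
  ultimately show ?thesis unfolding has_symbol_def by auto
qed

lemma stf_increment_measurable: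
  fixes f \<phi> :: "real^'n::finite \<Rightarrow> complex"
  assumes m: "f \<in> borel_measurable borel" "\<phi> \<in> borel_measurable borel"
  defines "D \<equiv> \<lambda>\<eta> \<xi> x. cmod (stf \<phi> f (\<xi> - \<eta>) x - stf \<phi> f \<xi> x)"
  shows "(\<lambda>z::((real^'n) \<times> (real^'n)) \<times> (real^'n). D (fst (fst z)) (snd (fst z)) (snd z)) \<in> borel_measurable ((lborel \<Otimes>\<^sub>M lborel) \<Otimes>\<^sub>M lborel)" (is ?D)
    and "(\<lambda>z::(real^'n) \<times> (real^'n). lpn p lborel (D (fst z) (snd z))) \<in> borel_measurable (lborel \<Otimes>\<^sub>M lborel)"
proof -
  have sm: "(\<lambda>z. stf \<phi> f (fst z) (snd z)) \<in> borel_measurable (lborel \<Otimes>\<^sub>M lborel)"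
    using stf_measurable[OF m] by (simp add: case_prod_beta)
  have "(\<lambda>z::((real^'n) \<times> (real^'n)) \<times> (real^'n). (snd (fst z) - fst (fst z), snd z)) \<in> (lborel \<Otimes>\<^sub>M lborel) \<Otimes>\<^sub>M lborel \<rightarrow>\<^sub>M lborel \<Otimes>\<^sub>M lborel"
    by measurable
  from measurable_compose[OF this sm]
  have [measurable]: "(\<lambda>z::((real^'n) \<times> (real^'n)) \<times> (real^'n). stf \<phi> f (snd (fst z) - fst (fst z)) (snd z)) \<in> borel_measurable ((lborel \<Otimes>\<^sub>M lborel) \<Otimes>\<^sub>M lborel)" by simp
  have "(\<lambda>z::((real^'n) \<times> (real^'n)) \<times> (real^'n). (snd (fst z), snd z)) \<in> (lborel \<Otimes>\<^sub>M lborel) \<Otimes>\<^sub>M lborel \<rightarrow>\<^sub>M lborel \<Otimes>\<^sub>M lborel"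
    by measurable
  from measurable_compose[OF this sm]
  have [measurable]: "(\<lambda>z::((real^'n) \<times> (real^'n)) \<times> (real^'n). stf \<phi> f (snd (fst z)) (snd z)) \<in> borel_measurable ((lborel \<Otimes>\<^sub>M lborel) \<Otimes>\<^sub>M lborel)" by simp
  show D: ?D unfolding D_def by measurable
  show "(\<lambda>z::(real^'n) \<times> (real^'n). lpn p lborel (D (fst z) (snd z))) \<in> borel_measurable (lborel \<Otimes>\<^sub>M lborel)"
    by (rule lpn_measurable[OF sigma_finite_lborel]) (use D in \<open>simp add: case_prod_beta\<close>)
qed

text \<open>The kernel \<^term>\<open>heat a\<close> has integral \<open>(2\<pi>)\<^sup>n\<close>, so multiplying by a Gaussian averages frequency
  translates, and subtracting \<open>f\<close> leaves an average of increments.\<close>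

lemma mod_norm_gauss_mult_diff_le:
  fixes f \<phi> :: "real^'n::finite \<Rightarrow> complex"
  assumes p: "1 \<le> p" and f: "tested f" and \<phi>: "\<phi> \<in> schwartz" and a: "0 < a"
  shows "mod_norm \<phi> p s (\<lambda>t. of_real (gauss a t) * f t - f t)
    \<le> (\<integral>\<^sup>+ \<eta>. ennreal (heat a \<eta>) * mix_norm p s (\<lambda>\<xi> x. cmod (stf \<phi> f (\<xi> - \<eta>) x - stf \<phi> f \<xi> x)) \<partial>lborel)"
proof -
  let ?c = "(2 * pi) ^ CARD('n)" and ?h = "\<lambda>\<eta> :: real^'n. complex_of_real (heat a \<eta>)"
  note m [measurable] = tested_measurable[OF f] schwartz_measurable[OF \<phi>]
  have hi: "integrable lborel ?h"
    using heat_integrable[OF a, where 'n='n] by (simp only: complex_of_real_integrable_eq)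
  have g: "(\<lambda>t. complex_of_real (gauss a t)) = inverse_fourier ?h"
    using has_symbol_gauss[OF a, where 'n='n] by (simp add: has_symbol_def)
  have ft: "integrable lborel (\<lambda>t. f t * cnj (\<phi> (t - x)))" for x by (rule tested_integrable[OF f \<phi>])
  have eq: "stf \<phi> (\<lambda>t. of_real (gauss a t) * f t - f t) \<xi> x = (LINT \<eta>|lborel. ?h \<eta> * (stf \<phi> f (\<xi> - \<eta>) x - stf \<phi> f \<xi> x)) / ?c" for \<xi> x
  proof -
    have gf: "tested (\<lambda>t. of_real (gauss a t) * f t)"
      by (rule tested_bounded_mult[OF f, where B = 1]) (use a in \<open>auto intro: gauss_le_1\<close>)
    have "stf \<phi> (\<lambda>t. of_real (gauss a t) * f t - f t) \<xi> x = stf \<phi> (\<lambda>t. of_real (gauss a t) * f t) \<xi> x - stf \<phi> f \<xi> x"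
      unfolding stf_def left_diff_distrib by (intro fourier_diff tested_integrable gf f \<phi>)
    also have "stf \<phi> (\<lambda>t. of_real (gauss a t) * f t) \<xi> x = (LINT \<eta>|lborel. ?h \<eta> * stf \<phi> f (\<xi> - \<eta>) x) / ?c"
      using stf_mult[OF f \<phi> hi, of \<xi> x] unfolding g[symmetric] .
    also have "stf \<phi> f \<xi> x = (LINT \<eta>|lborel. ?h \<eta> * stf \<phi> f \<xi> x) / ?c"
      using integral_heat[OF a, where 'n='n] by simp
    also have "(LINT \<eta>|lborel. ?h \<eta> * stf \<phi> f (\<xi> - \<eta>) x) / ?c - (LINT \<eta>|lborel. ?h \<eta> * stf \<phi> f \<xi> x) / ?c
       = (LINT \<eta>|lborel. ?h \<eta> * (stf \<phi> f (\<xi> - \<eta>) x - stf \<phi> f \<xi> x)) / ?c"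
    proof -
      have i1: "integrable lborel (\<lambda>\<eta>. ?h \<eta> * stf \<phi> f (\<xi> - \<eta>) x)"
        by (rule integrable_mult_bounded(1)[OF hi, where B = "LINT t|lborel. cmod (f t * cnj (\<phi> (t - x)))"])
           (use ft fourier_measurable[OF ft] in \<open>auto simp: stf_def intro!: norm_fourier_le\<close>)
      have i2: "integrable lborel (\<lambda>\<eta>. ?h \<eta> * stf \<phi> f \<xi> x)" using hi by simp
      show ?thesis unfolding right_diff_distrib Bochner_Integration.integral_diff[OF i1 i2] by (simp add: diff_divide_distrib)
    qed
    finally show ?thesis .
  qed
  let ?D = "\<lambda>\<eta> \<xi> x. cmod (stf \<phi> f (\<xi> - \<eta>) x - stf \<phi> f \<xi> x)"
  note Dm [measurable] = stf_increment_measurable(1)[OF m] and lm [measurable] = stf_increment_measurable(2)[OF m, of p]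
  have Dm2: "(\<lambda>z. ?D (fst z) \<xi> (snd z)) \<in> borel_measurable (lborel \<Otimes>\<^sub>M lborel)" for \<xi> :: "real^'n"
  proof -
    have "(\<lambda>z::((real^'n) \<times> (real^'n)). ((fst z, \<xi>), snd z)) \<in> lborel \<Otimes>\<^sub>M lborel \<rightarrow>\<^sub>M (lborel \<Otimes>\<^sub>M lborel) \<Otimes>\<^sub>M lborel"
      by measurable
    from measurable_compose[OF this Dm] show ?thesis by simp
  qed
  have sl: "slice \<phi> p (\<lambda>t. of_real (gauss a t) * f t - f t) \<xi> \<le> (\<integral>\<^sup>+ \<eta>. ennreal (heat a \<eta>) * lpn p lborel (?D \<eta> \<xi>) \<partial>lborel)" for \<xi>
  proof -
    note [measurable] = Dm2[of \<xi>]
    have sec [measurable]: "?D \<eta> \<xi> \<in> borel_measurable borel" for \<eta>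
      using measurable_compose[OF _ Dm2[of \<xi>], of "\<lambda>x. (\<eta>, x)" borel] by simp
    have "slice \<phi> p (\<lambda>t. of_real (gauss a t) * f t - f t) \<xi> \<le> (\<integral>\<^sup>+ \<eta>. lpn p lborel (\<lambda>x. heat a \<eta> * ?D \<eta> \<xi> x) \<partial>lborel)"
      unfolding slice_def
    proof (rule minkowski_integral[OF sigma_finite_lborel sigma_finite_lborel p])
      show "(\<lambda>(\<eta>, x). heat a \<eta> * ?D \<eta> \<xi> x) \<in> borel_measurable (lborel \<Otimes>\<^sub>M lborel)"
        unfolding case_prod_beta by measurable
      show "0 \<le> heat a \<eta> * ?D \<eta> \<xi> x" for \<eta> x using a by simp
      fix x :: "real^'n"
      have "ennreal (cmod (stf \<phi> (\<lambda>t. of_real (gauss a t) * f t - f t) \<xi> x)) \<le> ennreal (cmod (LINT \<eta>|lborel. ?h \<eta> * (stf \<phi> f (\<xi> - \<eta>) x - stf \<phi> f \<xi> x)))"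
        unfolding eq by (intro ennreal_leI norm_div_2pi_le)
      also have "\<dots> \<le> (\<integral>\<^sup>+ \<eta>. ennreal (cmod (?h \<eta> * (stf \<phi> f (\<xi> - \<eta>) x - stf \<phi> f \<xi> x))) \<partial>lborel)"
        by (rule norm_integral_le_nn_integral)
      finally show "ennreal (cmod (stf \<phi> (\<lambda>t. of_real (gauss a t) * f t - f t) \<xi> x)) \<le> (\<integral>\<^sup>+ \<eta>. ennreal (heat a \<eta> * ?D \<eta> \<xi> x) \<partial>lborel)"
        using a by (simp add: norm_mult)
    qed auto
    also have "\<dots> = (\<integral>\<^sup>+ \<eta>. ennreal (heat a \<eta>) * lpn p lborel (?D \<eta> \<xi>) \<partial>lborel)"
      using p a by (intro nn_integral_cong lpn_cmult) auto
    finally show ?thesis .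
  qed
  have "mod_norm \<phi> p s (\<lambda>t. of_real (gauss a t) * f t - f t)
     \<le> (\<integral>\<^sup>+ \<xi>. ennreal (bracket \<xi> powr s) * (\<integral>\<^sup>+ \<eta>. ennreal (heat a \<eta>) * lpn p lborel (?D \<eta> \<xi>) \<partial>lborel) \<partial>lborel)"
    unfolding mod_norm_def by (intro nn_integral_mono mult_left_mono sl) simp
  also have "\<dots> = (\<integral>\<^sup>+ \<xi>. (\<integral>\<^sup>+ \<eta>. ennreal (heat a \<eta>) * (ennreal (bracket \<xi> powr s) * lpn p lborel (?D \<eta> \<xi>)) \<partial>lborel) \<partial>lborel)"
  proof (intro nn_integral_cong)
    fix \<xi> :: "real^'n"
    have [measurable]: "(\<lambda>\<eta>. lpn p lborel (?D \<eta> \<xi>)) \<in> borel_measurable borel"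
      using lpn_measurable[OF sigma_finite_lborel, of "\<lambda>\<eta>. ?D \<eta> \<xi>" lborel p] Dm2[of \<xi>] by (simp add: case_prod_beta)
    show "ennreal (bracket \<xi> powr s) * (\<integral>\<^sup>+ \<eta>. ennreal (heat a \<eta>) * lpn p lborel (?D \<eta> \<xi>) \<partial>lborel)
       = (\<integral>\<^sup>+ \<eta>. ennreal (heat a \<eta>) * (ennreal (bracket \<xi> powr s) * lpn p lborel (?D \<eta> \<xi>)) \<partial>lborel)"
      by (subst nn_integral_cmult[symmetric]) (auto simp: mult_ac)
  qed
  also have "\<dots> = (\<integral>\<^sup>+ \<eta>. (\<integral>\<^sup>+ \<xi>. ennreal (heat a \<eta>) * (ennreal (bracket \<xi> powr s) * lpn p lborel (?D \<eta> \<xi>)) \<partial>lborel) \<partial>lborel)"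
  proof (rule lborel_pair.Fubini')
    show "(\<lambda>(\<eta>, \<xi>). ennreal (heat a \<eta>) * (ennreal (bracket \<xi> powr s) * lpn p lborel (?D \<eta> \<xi>))) \<in> borel_measurable (lborel \<Otimes>\<^sub>M lborel)"
      unfolding case_prod_beta by measurable
  qed
  also have "\<dots> = (\<integral>\<^sup>+ \<eta>. ennreal (heat a \<eta>) * mix_norm p s (?D \<eta>) \<partial>lborel)"
    unfolding mix_norm_def
  proof (intro nn_integral_cong nn_integral_cmult)
    fix \<eta> :: "real^'n"
    show "(\<lambda>\<xi>. ennreal (bracket \<xi> powr s) * lpn p lborel (?D \<eta> \<xi>)) \<in> borel_measurable lborel"
      using measurable_compose[OF _ lm, of "\<lambda>\<xi>. (\<eta>, \<xi>)" lborel] by simp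
  qed
  finally show ?thesis .
qed

text \<open>The increment norm is continuous at \<open>0\<close>, where it vanishes, and grows at most like \<open>\<langle>\<eta>\<rangle>\<^sup>s\<close>; the
  heat kernels average it to its value at \<open>0\<close>.\<close>

lemma mod_norm_gauss_mult_tendsto:
  fixes f \<phi> :: "real^'n::finite \<Rightarrow> complex"
  assumes p: "1 \<le> p" and s: "0 \<le> s" and f: "tested f" and \<phi>: "\<phi> \<in> schwartz" and fin: "mod_norm \<phi> p s f < \<infinity>"
  shows "(\<lambda>k. mod_norm \<phi> p s (\<lambda>t. of_real (gauss (1 / real (Suc k)) t) * f t - f t)) \<longlonglongrightarrow> 0"
proof -
  note m = tested_measurable[OF f] schwartz_measurable[OF \<phi>]
  let ?D = "\<lambda>\<eta> \<xi> x. cmod (stf \<phi> f (\<xi> - \<eta>) x - stf \<phi> f \<xi> x)"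
  define \<omega> where "\<omega> \<eta> = mix_norm p s (?D \<eta>)" for \<eta>
  note lm [measurable] = stf_increment_measurable(2)[OF m, of p]
  have [measurable]: "\<omega> \<in> borel_measurable borel"
  proof -
    have "(\<lambda>\<eta>. \<integral>\<^sup>+ \<xi>. ennreal (bracket \<xi> powr s) * lpn p lborel (?D \<eta> \<xi>) \<partial>lborel) \<in> borel_measurable lborel"
      by (rule lborel.borel_measurable_nn_integral) (simp add: case_prod_beta)
    thus ?thesis unfolding \<omega>_def mix_norm_def by simp
  qed
  have mf: "mod_norm \<phi> p s f = mix_norm p s (\<lambda>\<xi> x. cmod (stf \<phi> f \<xi> x))" by (rule mod_norm_eq_mix_norm)
  obtain M where M: "mod_norm \<phi> p s f = ennreal M" "0 \<le> M"
    using fin by (cases "mod_norm \<phi> p s f" rule: ennreal_cases) auto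
  define C where "C = (2 powr s + 1) * M"
  have \<omega>_le: "\<omega> \<eta> \<le> ennreal (C * bracket \<eta> powr s)" for \<eta>
  proof -
    have Vm: "case_prod (\<lambda>\<xi> x. cmod (stf \<phi> f \<xi> x)) \<in> borel_measurable (lborel \<Otimes>\<^sub>M lborel)"
      by (rule cmod_stf_measurable[OF m])
    have Vm2: "case_prod (\<lambda>\<xi> x. cmod (stf \<phi> f (\<xi> - \<eta>) x)) \<in> borel_measurable (lborel \<Otimes>\<^sub>M lborel)"
    proof -
      have "(\<lambda>z::(real^'n) \<times> (real^'n). (fst z - \<eta>, snd z)) \<in> lborel \<Otimes>\<^sub>M lborel \<rightarrow>\<^sub>M lborel \<Otimes>\<^sub>M lborel"
        by measurable
      from measurable_compose[OF this Vm] show ?thesis by (simp add: case_prod_beta)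
    qed
    have "\<omega> \<eta> \<le> mix_norm p s (\<lambda>\<xi> x. cmod (stf \<phi> f (\<xi> - \<eta>) x)) + mix_norm p s (\<lambda>\<xi> x. cmod (stf \<phi> f \<xi> x))"
      unfolding \<omega>_def by (rule mix_norm_triangle[OF p Vm2 Vm]) (auto intro: norm_triangle_ineq4)
    also have "mix_norm p s (\<lambda>\<xi> x. cmod (stf \<phi> f (\<xi> - \<eta>) x)) \<le> ennreal (2 powr s * bracket \<eta> powr s) * mix_norm p s (\<lambda>\<xi> x. cmod (stf \<phi> f \<xi> x))"
      using mix_norm_shift_le[OF s Vm, of p \<eta>] .
    finally have "\<omega> \<eta> \<le> ennreal (2 powr s * bracket \<eta> powr s) * ennreal M + ennreal M"
      unfolding mf[symmetric] M(1) by (simp add: add_right_mono)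
    also have "\<dots> = ennreal (2 powr s * bracket \<eta> powr s * M + M)"
      using M by (simp add: ennreal_mult[symmetric] ennreal_plus[symmetric] del: ennreal_plus)
    also have "\<dots> \<le> ennreal (C * bracket \<eta> powr s)"
      using mult_left_mono[OF bracket_powr_ge_1[OF s, of \<eta>] M(2)]
      by (intro ennreal_leI) (simp add: C_def algebra_simps)
    finally show ?thesis .
  qed
  define g where "g \<eta> = enn2real (\<omega> \<eta>)" for \<eta>
  have [measurable]: "g \<in> borel_measurable borel" unfolding g_def by measurable
  have g0: "0 \<le> g \<eta>" for \<eta> by (simp add: g_def)
  have g: "\<omega> \<eta> = ennreal (g \<eta>)" for \<eta>
    using le_less_trans[OF \<omega>_le ennreal_less_top] by (simp add: g_def)
  have C0: "0 \<le> C" using M by (simp add: C_def)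
  have g_le: "g \<eta> \<le> C * bracket \<eta> powr s" for \<eta>
    using \<omega>_le[of \<eta>] C0 unfolding g by (subst (asm) ennreal_le_iff) auto
  have decay: "integrable lborel (\<lambda>\<eta> :: real^'n. gauss a \<eta> * g \<eta>)" if a: "0 < a" for a
  proof (rule Bochner_Integration.integrable_bound)
    have "(\<lambda>x :: real^'n. complex_of_real (gauss a x)) \<in> schwartz" by (rule schwartz_gauss[OF a])
    note S = this
    show "integrable lborel (\<lambda>\<eta> :: real^'n. C * (bracket \<eta> powr s * cmod (of_real (gauss a \<eta>))))"
      by (intro integrable_mult_right rapid_powr_integrable schwartz_rapid[OF S] schwartz_measurable[OF S])
    show "AE \<eta> in lborel. norm (gauss a \<eta> * g \<eta>) \<le> norm (C * (bracket \<eta> powr s * cmod (of_real (gauss a (\<eta> :: real^'n)))))"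
      using g_le g0 C0 by (intro AE_I2) (simp add: abs_mult mult_ac)
  qed measurable
  have hg: "integrable lborel (\<lambda>\<eta> :: real^'n. heat a \<eta> * g \<eta>)" if a: "0 < a" for a
    using integrable_mult_right[OF decay[of "1 / a"], of "sqrt (2 * pi / a) ^ CARD('n)"] a
    by (simp add: heat_eq_gauss mult.assoc)
  have D0: "g 0 = 0"
    using p by (simp add: g_def \<omega>_def mix_norm_def)
  have "isCont g 0"
    unfolding continuous_at_sequentially
  proof (intro allI impI)
    fix X :: "nat \<Rightarrow> real^'n" assume X: "X \<longlonglongrightarrow> 0"
    have "(\<lambda>k. \<omega> (X k)) \<longlonglongrightarrow> 0"
      unfolding \<omega>_def
    proof (rule mix_norm_translation_continuous[OF p s stf_measurable[OF m] _ _ X])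
      show "continuous_on UNIV (\<lambda>\<xi>. stf \<phi> f \<xi> x)" for x
        unfolding stf_def by (rule continuous_fourier[OF tested_integrable[OF f \<phi>]])
      show "mix_norm p s (\<lambda>\<xi> x. cmod (stf \<phi> f \<xi> x)) < \<infinity>" using fin mf by simp
    qed
    hence "(\<lambda>k. enn2real (\<omega> (X k))) \<longlonglongrightarrow> enn2real 0"
      by (intro tendsto_enn2real) auto
    thus "(g \<circ> X) \<longlonglongrightarrow> g 0" unfolding D0 by (simp add: g_def o_def)
  qed
  hence "(\<lambda>k. LINT y|lborel. heat (1 / real (Suc k)) (y - 0) *\<^sub>R g y) \<longlonglongrightarrow> ((2 * pi) ^ CARD('n)) *\<^sub>R g 0"
    using decay[of 1] by (intro heat_approximate_identity) auto
  hence "(\<lambda>k. LINT y|lborel. heat (1 / real (Suc k)) y * g y) \<longlonglongrightarrow> 0"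
    unfolding D0 by simp
  from tendsto_ennrealI[OF this]
  have lim: "(\<lambda>k. ennreal (LINT y|lborel. heat (1 / real (Suc k)) y * g y)) \<longlonglongrightarrow> 0" by simp
  have "mod_norm \<phi> p s (\<lambda>t. of_real (gauss (1 / real (Suc k)) t) * f t - f t) \<le> ennreal (LINT y|lborel. heat (1 / real (Suc k)) y * g y)" for k
  proof -
    let ?a = "1 / real (Suc k)"
    have a: "0 < ?a" by simp
    have "mod_norm \<phi> p s (\<lambda>t. of_real (gauss ?a t) * f t - f t) \<le> (\<integral>\<^sup>+ \<eta>. ennreal (heat ?a \<eta>) * \<omega> \<eta> \<partial>lborel)"
      unfolding \<omega>_def by (rule mod_norm_gauss_mult_diff_le[OF p f \<phi> a])
    also have "\<dots> = (\<integral>\<^sup>+ \<eta>. ennreal (heat ?a \<eta> * g \<eta>) \<partial>lborel)"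
      unfolding g by (intro nn_integral_cong) (simp add: ennreal_mult[symmetric] g0)
    also have "\<dots> = ennreal (LINT y|lborel. heat ?a y * g y)"
      by (intro nn_integral_eq_integral hg a) (simp add: g0)
    finally show ?thesis .
  qed
  note le = this
  show ?thesis
    by (rule tendsto_sandwich[OF _ always_eventually[OF allI[OF le]] tendsto_const lim]) simp
qed

subsection \<open>Summing a series of symbols\<close>

text \<open>Completeness of weighted \<open>L\<^sup>1\<close>: an absolutely convergent series of symbols converges almost
  everywhere, and the integral that defines the inverse transform can be taken termwise.\<close>

lemma has_symbol_suminf:
  fixes d h :: "nat \<Rightarrow> real^'n::finite \<Rightarrow> complex"
  assumes s: "0 \<le> s" and dh: "\<And>j. has_symbol s (d j) (h j)" and fin: "(\<Sum>j. beurling_mass s (h j)) < \<infinity>"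
    and f: "\<And>t. (\<lambda>j. d j t) sums f t"
  shows "\<exists>H. has_symbol s f H \<and> beurling_mass s H \<le> (\<Sum>j. beurling_mass s (h j))"
proof -
  have [measurable]: "h j \<in> borel_measurable borel" for j using dh[of j] by (simp add: has_symbol_def)
  have hi: "integrable lborel (h j)" for j by (rule has_symbol_integrable[OF s dh])
  define H where "H \<zeta> = (\<Sum>j. h j \<zeta>)" for \<zeta>
  have Hm: "H \<in> borel_measurable borel" unfolding H_def by measurable
  have tot: "(\<integral>\<^sup>+ \<zeta>. (\<Sum>j. ennreal (cmod (h j \<zeta>))) \<partial>lborel) < \<infinity>"
  proof -
    have "(\<integral>\<^sup>+ \<zeta>. (\<Sum>j. ennreal (cmod (h j \<zeta>))) \<partial>lborel) = (\<Sum>j. \<integral>\<^sup>+ \<zeta>. ennreal (cmod (h j \<zeta>)) \<partial>lborel)"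
      by (rule nn_integral_suminf) measurable
    also have "\<dots> \<le> (\<Sum>j. beurling_mass s (h j))"
      by (intro suminf_le nn_integral_norm_le_beurling_mass s) auto
    finally show ?thesis using fin by (rule le_less_trans)
  qed
  have "AE \<zeta> in lborel. (\<Sum>j. ennreal (cmod (h j \<zeta>))) \<noteq> \<infinity>"
    using tot by (intro nn_integral_PInf_AE) auto
  hence sm: "AE \<zeta> in lborel. summable (\<lambda>j. cmod (h j \<zeta>))"
    by eventually_elim (auto intro!: summable_suminf_not_top)
  have "(\<Sum>j. ennreal (LINT \<zeta>|lborel. cmod (h j \<zeta>))) \<noteq> top"
  proof -
    have "(\<Sum>j. ennreal (LINT \<zeta>|lborel. cmod (h j \<zeta>))) = (\<Sum>j. \<integral>\<^sup>+ \<zeta>. ennreal (cmod (h j \<zeta>)) \<partial>lborel)"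
      using hi by (intro arg_cong[where f = suminf] ext nn_integral_eq_integral[symmetric]) auto
    also have "\<dots> = (\<integral>\<^sup>+ \<zeta>. (\<Sum>j. ennreal (cmod (h j \<zeta>))) \<partial>lborel)"
      by (rule nn_integral_suminf[symmetric]) measurable
    finally show ?thesis using tot by simp
  qed
  hence sm2: "summable (\<lambda>j. LINT \<zeta>|lborel. cmod (h j \<zeta>))"
    by (intro summable_suminf_not_top) auto
  have inv: "f t = inverse_fourier H t" for t
  proof -
    let ?e = "\<lambda>\<zeta>. exp (\<i> * complex_of_real (\<zeta> \<bullet> t))" and ?c = "complex_of_real ((2 * pi) ^ CARD('n))"
    have i: "integrable lborel (\<lambda>\<zeta>. h j \<zeta> * ?e \<zeta>)" for j
      using character_integrable[OF hi[of j], of "- t"] by simp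
    have "(\<lambda>j. LINT \<zeta>|lborel. h j \<zeta> * ?e \<zeta>) sums (LINT \<zeta>|lborel. (\<Sum>j. h j \<zeta> * ?e \<zeta>))"
      by (rule sums_integral[OF i]) (use sm sm2 in \<open>simp_all add: norm_mult\<close>)
    also have "(LINT \<zeta>|lborel. (\<Sum>j. h j \<zeta> * ?e \<zeta>)) = (LINT \<zeta>|lborel. H \<zeta> * ?e \<zeta>)"
    proof (rule integral_cong_AE)
      show "AE \<zeta> in lborel. (\<Sum>j. h j \<zeta> * ?e \<zeta>) = H \<zeta> * ?e \<zeta>"
        using sm by eventually_elim (simp add: H_def suminf_mult2 summable_norm_cancel)
      have [measurable]: "?e \<in> borel_measurable borel" using character_measurable[of "- t"] by simp
      show "(\<lambda>\<zeta>. \<Sum>j. h j \<zeta> * ?e \<zeta>) \<in> borel_measurable lborel" by measurable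
      show "(\<lambda>\<zeta>. H \<zeta> * ?e \<zeta>) \<in> borel_measurable lborel" using Hm by measurable
    qed
    finally have "(\<lambda>j. (LINT \<zeta>|lborel. h j \<zeta> * ?e \<zeta>) / ?c) sums ((LINT \<zeta>|lborel. H \<zeta> * ?e \<zeta>) / ?c)"
      by (rule sums_divide)
    hence "(\<lambda>j. d j t) sums inverse_fourier H t"
      using dh by (simp add: has_symbol_def inverse_fourier_def)
    with f[of t] show ?thesis by (rule sums_unique2)
  qed
  have le: "beurling_mass s H \<le> (\<Sum>j. beurling_mass s (h j))"
  proof -
    have "beurling_mass s H \<le> (\<integral>\<^sup>+ \<zeta>. (\<Sum>j. ennreal (bracket \<zeta> powr s * cmod (h j \<zeta>))) \<partial>lborel)"
      unfolding beurling_mass_def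
    proof (intro nn_integral_mono_AE)
      show "AE \<zeta> in lborel. ennreal (bracket \<zeta> powr s * cmod (H \<zeta>)) \<le> (\<Sum>j. ennreal (bracket \<zeta> powr s * cmod (h j \<zeta>)))"
        using sm
      proof eventually_elim
        case (elim \<zeta>)
        have "bracket \<zeta> powr s * cmod (H \<zeta>) \<le> bracket \<zeta> powr s * (\<Sum>j. cmod (h j \<zeta>))"
          unfolding H_def by (intro mult_left_mono summable_norm elim) simp
        also have "\<dots> = (\<Sum>j. bracket \<zeta> powr s * cmod (h j \<zeta>))" by (rule suminf_mult[OF elim, symmetric])
        finally have "ennreal (bracket \<zeta> powr s * cmod (H \<zeta>)) \<le> ennreal (\<Sum>j. bracket \<zeta> powr s * cmod (h j \<zeta>))"
          by (rule ennreal_leI)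
        also have "\<dots> = (\<Sum>j. ennreal (bracket \<zeta> powr s * cmod (h j \<zeta>)))"
          by (rule suminf_ennreal2[symmetric]) (auto intro: summable_mult elim)
        finally show ?case .
      qed
    qed
    also have "\<dots> = (\<Sum>j. beurling_mass s (h j))"
      unfolding beurling_mass_def by (rule nn_integral_suminf) measurable
    finally show ?thesis .
  qed
  have "has_symbol s f H"
    unfolding has_symbol_def using Hm inv le fin by (auto intro: le_less_trans)
  thus ?thesis using le by blast
qed

lemma gauss_mult_integrable:
  fixes f :: "real^'n::finite \<Rightarrow> complex"
  assumes "tested f" "0 < a" shows "integrable lborel (\<lambda>t. of_real (gauss a t) * f t)"
proof -
  have "integrable lborel (\<lambda>t. f t * of_real (gauss a t))"
    using assms(1) schwartz_gauss[OF assms(2), where 'n='n] by (auto simp: tested_def)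
  thus ?thesis by (simp only: mult.commute)
qed

lemma has_symbol_fourier:
  fixes f :: "real^'n::finite \<Rightarrow> complex"
  assumes s: "0 \<le> s" and f: "integrable lborel f" "continuous_on UNIV f" and fin: "beurling_mass s (fourier f) < \<infinity>"
  shows "has_symbol s f (fourier f)"
proof -
  have m: "fourier f \<in> borel_measurable borel" using f by auto
  have i: "integrable lborel (fourier f)" by (rule beurling_mass_integrable[OF s m fin])
  have "f t = inverse_fourier (fourier f) t" for t
    using fourier_inversion[OF f(1) _ i, of t] f(2)
    by (simp add: inverse_fourier_def continuous_on_eq_continuous_at)
  thus ?thesis using m fin by (auto simp: has_symbol_def)
qed

text \<open>The Gaussian multiples of \<open>f\<close> are integrable and converge to \<open>f\<close> in the modulation norm, hence
  their transforms converge in the weighted \<open>L\<^sup>1\<close> space; the limit is written as a telescoping series.\<close>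

theorem has_symbol_if_mod_norm_finite:
  fixes \<phi> :: "real^'n::finite \<Rightarrow> complex"
  assumes p: "1 \<le> p" "p \<le> 2" and s: "0 \<le> s" and \<phi>: "\<phi> \<in> schwartz" and nz: "\<phi> \<noteq> (\<lambda>x. 0)"
  shows "\<exists>C\<ge>0. \<forall>f e. continuous_on UNIV f \<longrightarrow> tested f \<longrightarrow> mod_norm \<phi> p s f < \<infinity> \<longrightarrow> 0 < (e::real)
    \<longrightarrow> (\<exists>h. has_symbol s f h \<and> beurling_mass s h \<le> ennreal C * mod_norm \<phi> p s f + ennreal e)"
proof -
  obtain C where C0: "0 \<le> C" and C: "\<And>f. integrable lborel f \<Longrightarrow> beurling_mass s (fourier f) \<le> ennreal C * mod_norm \<phi> p s f"
    using beurling_mass_fourier_le[OF p s \<phi> nz] by blast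
  have "\<exists>h. has_symbol s f h \<and> beurling_mass s h \<le> ennreal C * mod_norm \<phi> p s f + ennreal e"
    if fc: "continuous_on UNIV f" and ft: "tested f" and fin: "mod_norm \<phi> p s f < \<infinity>" and e: "0 < e" for f and e :: real
  proof -
    \<comment> \<open>The first term of the series contributes one \<open>\<epsilon>\<close> and the geometric series four.\<close>
    define \<epsilon> where "\<epsilon> = e / (5 * (C + 1))"
    have \<epsilon>: "0 < \<epsilon>" using e C0 by (simp add: \<epsilon>_def)
    define F where "F k t = complex_of_real (gauss (1 / real (Suc k)) t) * f t" for k t
    have Ft: "tested (F k)" for k
      unfolding F_def by (rule tested_bounded_mult[OF ft, where B = 1]) (auto intro: gauss_le_1)
    have Fi: "integrable lborel (F k)" for k unfolding F_def by (rule gauss_mult_integrable[OF ft]) simp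
    have Fc: "continuous_on UNIV (F k)" for k
    proof -
      have "continuous_on UNIV (\<lambda>t :: real^'n. complex_of_real (gauss (1 / real (Suc k)) t))"
        by (rule schwartz_continuous[OF schwartz_gauss]) simp
      thus ?thesis unfolding F_def by (intro continuous_on_mult fc)
    qed
    have lim: "(\<lambda>k. mod_norm \<phi> p s (\<lambda>t. F k t - f t)) \<longlonglongrightarrow> 0"
      unfolding F_def by (rule mod_norm_gauss_mult_tendsto[OF p(1) s ft \<phi> fin])
    have "\<exists>k\<ge>j. mod_norm \<phi> p s (\<lambda>t. F k t - f t) \<le> ennreal (\<epsilon> * (1 / 2) ^ j)" for j
    proof -
      have "0 < \<epsilon> * (1 / 2) ^ j" using \<epsilon> by simp
      from eventually_conj[OF eventually_ge_at_top[of j] ennreal_tendsto_0D[OF lim this]] show ?thesis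
        by (auto simp: eventually_sequentially)
    qed
    then obtain r where r: "\<And>j. r j \<ge> j" "\<And>j. mod_norm \<phi> p s (\<lambda>t. F (r j) t - f t) \<le> ennreal (\<epsilon> * (1 / 2) ^ j)"
      by metis
    define d where "d j = (case j of 0 \<Rightarrow> F (r 0) | Suc i \<Rightarrow> (\<lambda>t. F (r (Suc i)) t - F (r i) t))" for j
    have d0: "d 0 = F (r 0)" and dS: "d (Suc i) = (\<lambda>t. F (r (Suc i)) t - F (r i) t)" for i
      by (simp_all add: d_def)
    have di: "integrable lborel (d j)" and dc: "continuous_on UNIV (d j)" for j
      by (cases j; simp add: d0 dS Fi Fc continuous_on_diff)+
    have neg: "mod_norm \<phi> p s (\<lambda>t. f t - F k t) = mod_norm \<phi> p s (\<lambda>t. F k t - f t)" for k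
      using mod_norm_cmult[OF p(1) tested_diff[OF Ft[of k] ft] \<phi>, of s "- 1"] by simp
    have M0: "mod_norm \<phi> p s (d 0) \<le> mod_norm \<phi> p s f + ennreal \<epsilon>"
    proof -
      have "mod_norm \<phi> p s (\<lambda>t. f t + (F (r 0) t - f t)) \<le> mod_norm \<phi> p s f + mod_norm \<phi> p s (\<lambda>t. F (r 0) t - f t)"
        by (intro mod_norm_add_le p ft tested_diff Ft \<phi>)
      also have "\<dots> \<le> mod_norm \<phi> p s f + ennreal \<epsilon>" using r(2)[of 0] by (intro add_left_mono) simp
      finally show ?thesis by (simp add: d0)
    qed
    have MS: "mod_norm \<phi> p s (d (Suc i)) \<le> ennreal (2 * \<epsilon> * (1 / 2) ^ i)" for i
    proof -
      have "mod_norm \<phi> p s (\<lambda>t. (F (r (Suc i)) t - f t) + (f t - F (r i) t))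
          \<le> mod_norm \<phi> p s (\<lambda>t. F (r (Suc i)) t - f t) + mod_norm \<phi> p s (\<lambda>t. f t - F (r i) t)"
        by (intro mod_norm_add_le p ft tested_diff Ft \<phi>)
      also have "\<dots> \<le> ennreal (\<epsilon> * (1 / 2) ^ Suc i) + ennreal (\<epsilon> * (1 / 2) ^ i)"
        unfolding neg by (intro add_mono r)
      also have "\<dots> \<le> ennreal (2 * \<epsilon> * (1 / 2) ^ i)"
        using \<epsilon> by (simp add: ennreal_plus[symmetric] del: ennreal_plus)
      finally show ?thesis by (simp add: dS)
    qed
    have geo: "(\<Sum>i. ennreal (C * (2 * \<epsilon> * (1 / 2) ^ i))) = ennreal (4 * C * \<epsilon>)"
    proof -
      have "(\<lambda>i. (C * 2 * \<epsilon>) * (1 / 2) ^ i) sums ((C * 2 * \<epsilon>) * (1 / (1 - 1 / 2)))"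
        by (intro sums_mult geometric_sums) simp
      hence "(\<lambda>i. C * (2 * \<epsilon> * (1 / 2) ^ i)) sums (4 * C * \<epsilon>)" by (simp add: mult_ac)
      thus ?thesis using \<epsilon> C0 by (intro suminf_ennreal_eq) auto
    qed
    have total: "(\<Sum>j. beurling_mass s (fourier (d j))) \<le> ennreal C * mod_norm \<phi> p s f + ennreal e"
    proof -
      have "(\<Sum>j. beurling_mass s (fourier (d j))) = beurling_mass s (fourier (d 0)) + (\<Sum>i. beurling_mass s (fourier (d (Suc i))))"
        by (subst suminf_offset[of _ 1]) (auto simp: add.commute)
      also have "\<dots> \<le> (ennreal C * (mod_norm \<phi> p s f + ennreal \<epsilon>)) + (\<Sum>i. ennreal (C * (2 * \<epsilon> * (1 / 2) ^ i)))"
      proof (intro add_mono suminf_le)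
        show "beurling_mass s (fourier (d 0)) \<le> ennreal C * (mod_norm \<phi> p s f + ennreal \<epsilon>)"
          by (rule order_trans[OF C[OF di] mult_left_mono[OF M0]]) simp
        show "beurling_mass s (fourier (d (Suc i))) \<le> ennreal (C * (2 * \<epsilon> * (1 / 2) ^ i))" for i
          using order_trans[OF C[OF di] mult_left_mono[OF MS]] C0 \<epsilon> by (simp add: ennreal_mult)
      qed auto
      also have "\<dots> = ennreal C * mod_norm \<phi> p s f + ennreal (5 * C * \<epsilon>)"
        unfolding geo distrib_left add.assoc using C0 \<epsilon>
        by (simp add: ennreal_mult[symmetric] ennreal_plus[symmetric] del: ennreal_plus)
      also have "5 * C * \<epsilon> \<le> e"
        using C0 e by (simp add: \<epsilon>_def field_simps)
      hence "ennreal C * mod_norm \<phi> p s f + ennreal (5 * C * \<epsilon>) \<le> ennreal C * mod_norm \<phi> p s f + ennreal e"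
        by (intro add_left_mono ennreal_leI)
      finally show ?thesis .
    qed
    also have "\<dots> < \<infinity>" using fin by (simp add: ennreal_mult_less_top)
    finally have fin2: "(\<Sum>j. beurling_mass s (fourier (d j))) < \<infinity>" .
    have ds: "has_symbol s (d j) (fourier (d j))" for j
    proof (rule has_symbol_fourier[OF s di dc])
      have "beurling_mass s (fourier (d j)) \<le> (\<Sum>j. beurling_mass s (fourier (d j)))"
        using sum_le_suminf[of "\<lambda>j. beurling_mass s (fourier (d j))" "{j}"] by simp
      thus "beurling_mass s (fourier (d j)) < \<infinity>" using fin2 by (rule le_less_trans)
    qed
    have sums: "(\<lambda>j. d j t) sums f t" for t
    proof -
      have part: "(\<Sum>j<Suc n. d j t) = F (r n) t" for n
        by (induction n) (simp_all add: d0 dS)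
      have "(\<lambda>k. F k t) \<longlonglongrightarrow> of_real 1 * f t"
        unfolding F_def by (intro tendsto_intros gauss_tendsto_1)
      moreover have "filterlim r at_top sequentially"
        by (rule filterlim_at_top_mono[OF filterlim_ident]) (use r(1) in auto)
      ultimately have "(\<lambda>n. F (r n) t) \<longlonglongrightarrow> f t" by (auto dest: filterlim_compose)
      hence "(\<lambda>n. \<Sum>j<Suc n. d j t) \<longlonglongrightarrow> f t" unfolding part .
      thus ?thesis unfolding sums_def by (rule LIMSEQ_imp_Suc)
    qed
    from has_symbol_suminf[OF s ds fin2 sums] total show ?thesis by (meson order_trans)
  qed
  thus ?thesis using C0 by blast
qed

section \<open>Smooth cutoff functions\<close>

text \<open>The functions \<open>r\<^sup>-\<^sup>k e\<^sup>-\<^sup>1\<^sup>/\<^sup>r\<close>, extended by zero, have derivatives that are combinations of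
  functions of the same family.\<close>

definition flat :: "nat \<Rightarrow> real \<Rightarrow> real" where
  "flat k r = (if 0 < r then exp (- inverse r) / r ^ k else 0)"

lemma flat_nonneg [simp]: "0 \<le> flat k r"
  by (simp add: flat_def)

lemma flat_derivative:
  "(flat k has_real_derivative (- real k * flat (Suc k) r + flat (Suc (Suc k)) r)) (at r)"
proof (cases r "0 :: real" rule: linorder_cases)
  case greater
  have "((\<lambda>r. exp (- inverse r) / r ^ k) has_real_derivative
      (- real k * (exp (- inverse r) / r ^ Suc k) + exp (- inverse r) / r ^ Suc (Suc k))) (at r)"
  proof (induction k)
    case 0
    show ?case using greater
      by (auto intro!: derivative_eq_intros simp: field_simps power2_eq_square)
  next
    case (Suc k)
    have eq: "(\<lambda>r::real. exp (- inverse r) / r ^ k / r) = (\<lambda>r. exp (- inverse r) / r ^ Suc k)"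
      by (simp add: mult.commute)
    have "r \<noteq> 0" using greater by simp
    from DERIV_divide[OF Suc.IH DERIV_ident this] show ?case
      unfolding eq by (rule DERIV_cong) (use greater in \<open>simp_all add: field_simps\<close>)
  qed
  hence "((\<lambda>r. exp (- inverse r) / r ^ k) has_real_derivative (- real k * flat (Suc k) r + flat (Suc (Suc k)) r)) (at r)"
    using greater by (simp add: flat_def)
  thus ?thesis
    by (rule has_field_derivative_transform_within_open[of _ _ _ "{0<..}"]) (use greater in \<open>auto simp: flat_def\<close>)
next
  case less
  have "((\<lambda>r. 0) has_real_derivative 0) (at r)" by simp
  hence "(flat k has_real_derivative 0) (at r)"
    by (rule has_field_derivative_transform_within_open[of _ _ _ "{..<0}"]) (use less in \<open>auto simp: flat_def\<close>)
  thus ?thesis using less by (simp add: flat_def)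
next
  case equal
  have "((\<lambda>h. (flat k (0 + h) - flat k 0) / h) \<longlongrightarrow> 0) (at 0)"
  proof (rule filterlim_split_at_real)
    show "((\<lambda>h. (flat k (0 + h) - flat k 0) / h) \<longlongrightarrow> 0) (at_left 0)"
      by (rule tendsto_eventually) (auto simp: eventually_at_filter flat_def)
    have "((\<lambda>h::real. exp (- inverse h) / h ^ k / h) \<longlongrightarrow> 0) (at_right 0)" by real_asymp
    thus "((\<lambda>h. (flat k (0 + h) - flat k 0) / h) \<longlongrightarrow> 0) (at_right 0)"
      by (rule Lim_transform_eventually) (auto simp: eventually_at_filter flat_def)
  qed
  hence "(flat k has_real_derivative 0) (at 0)" by (simp add: DERIV_def)
  thus ?thesis using equal by (simp add: flat_def)
qed

definition bump :: "nat \<Rightarrow> real^'n::finite \<Rightarrow> real" where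
  "bump k x = flat k (1 - (norm x)\<^sup>2)"

lemma bump_nonneg [simp]: "0 \<le> bump k x" by (simp add: bump_def)

lemma bump_0_pos: "norm x < 1 \<Longrightarrow> 0 < bump 0 x"
  by (simp add: bump_def flat_def abs_square_less_1)

lemma bump_eq_0: "1 \<le> norm x \<Longrightarrow> bump k x = 0"
  by (simp add: bump_def flat_def not_less one_le_power)

lemma bump_has_derivative:
  "((\<lambda>x. complex_of_real (bump k x)) has_derivative
     (\<lambda>h. of_real ((- real k * bump (Suc k) x + bump (Suc (Suc k)) x) * (- 2 * (x \<bullet> h))))) (at x)"
proof -
  have "((\<lambda>x. 1 - (norm x)\<^sup>2) has_derivative (\<lambda>h. - 2 * (x \<bullet> h))) (at x)"
    unfolding power2_norm_eq_inner by (auto intro!: derivative_eq_intros simp: inner_commute)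
  moreover have "(flat k has_derivative (*) (- real k * bump (Suc k) x + bump (Suc (Suc k)) x)) (at (1 - (norm x)\<^sup>2))"
    using flat_derivative[of k "1 - (norm x)\<^sup>2"] by (simp add: has_field_derivative_def bump_def)
  ultimately have "((\<lambda>x. bump k x) has_derivative (\<lambda>h. (- real k * bump (Suc k) x + bump (Suc (Suc k)) x) * (- 2 * (x \<bullet> h)))) (at x)"
    unfolding bump_def by (rule has_derivative_compose)
  thus ?thesis by (rule has_derivative_of_real)
qed

lemma schwartz_bump: "(\<lambda>x :: real^'n::finite. complex_of_real (bump k x)) \<in> schwartz"
proof -
  have rapid: "rapid (\<lambda>x :: real^'n. complex_of_real (bump k x))" for k
  proof -
    have "continuous_on (cball 0 1) (\<lambda>x :: real^'n. complex_of_real (bump k x))"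
      using bump_has_derivative has_derivative_continuous by (blast intro: continuous_at_imp_continuous_on)
    hence "bounded ((\<lambda>x :: real^'n. complex_of_real (bump k x)) ` cball 0 1)"
      by (intro compact_imp_bounded compact_continuous_image compact_cball)
    then obtain B where "\<forall>y\<in>(\<lambda>x :: real^'n. complex_of_real (bump k x)) ` cball 0 1. cmod y \<le> B"
      unfolding bounded_iff by blast
    hence B: "cmod (complex_of_real (bump k x)) \<le> B" if "norm x \<le> 1" for x :: "real^'n"
      using that by auto
    show ?thesis unfolding rapid_def
    proof (intro allI exI)
      fix j and x :: "real^'n"
      have B0: "0 \<le> B" using order_trans[OF norm_ge_zero B[of 0]] by simp
      show "bracket x ^ j * cmod (complex_of_real (bump k x)) \<le> 2 ^ j * B"
      proof (cases "norm x \<le> 1")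
        case True
        hence "(norm x)\<^sup>2 \<le> 1" by (simp add: power_le_one)
        hence "bracket x \<le> 2" unfolding bracket_def by (intro real_le_lsqrt) auto
        thus ?thesis using B[OF True] by (intro mult_mono power_mono) auto
      next
        case False
        thus ?thesis using B0 by (simp add: bump_eq_0)
      qed
    qed
  qed
  have par: "partial j (\<lambda>x :: real^'n. complex_of_real (bump k x)) =
      (\<lambda>x. of_real (2 * real k) * (of_real (x $ j) * of_real (bump (Suc k) x)) + of_real (- 2) * (of_real (x $ j) * of_real (bump (Suc (Suc k)) x)))" for k j
    using partial_eq[OF bump_has_derivative, of j k] by (auto simp: inner_axis algebra_simps)
  have dif: "(\<lambda>x :: real^'n. complex_of_real (bump k x)) differentiable (at x)" for k x
    by (rule differentiableI[OF bump_has_derivative])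
  have "smooth_upto rapid n (\<lambda>x :: real^'n. complex_of_real (bump k x))" for n
  proof (induction n arbitrary: k)
    case (Suc n)
    have "smooth_upto rapid n (partial j (\<lambda>x :: real^'n. complex_of_real (bump k x)))" for j
      unfolding par by (intro smooth_upto_add rapid_add smooth_rapid_mult smooth_slow_const smooth_slow_coordinate Suc.IH)
    thus ?case using rapid dif by simp
  qed (use rapid dif in simp)
  thus ?thesis by (simp add: schwartz_iff)
qed

text \<open>Peetre's inequality \<open>\<langle>x\<rangle>\<^sup>k \<le> 2\<^sup>k \<langle>x + t\<rangle>\<^sup>k \<langle>t\<rangle>\<^sup>k\<close> distributes the weight over the two factors.\<close>

lemma rapid_correlation:
  fixes u v :: "real^'n::finite \<Rightarrow> complex"
  assumes u: "rapid u" "u \<in> borel_measurable borel" and v: "rapid v" "v \<in> borel_measurable borel"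
  shows "\<exists>C\<ge>0. \<forall>x. bracket x ^ k * (LINT t|lborel. cmod (u (x + t)) * cmod (v t)) \<le> C"
proof -
  have [measurable]: "u \<in> borel_measurable borel" "v \<in> borel_measurable borel" by fact+
  obtain B where B: "0 \<le> B" "\<And>x. bracket x ^ k * cmod (u x) \<le> B" using rapidD[OF u(1), of k] by blast
  have vi: "integrable lborel (\<lambda>t. bracket t powr real k * cmod (v t))"
    by (rule rapid_powr_integrable[OF v])
  hence vi: "integrable lborel (\<lambda>t. bracket t ^ k * cmod (v t))" by (simp add: powr_realpow)
  let ?I = "LINT t|lborel. bracket t ^ k * cmod (v t)"
  obtain B' where B': "\<And>x. cmod (u x) \<le> B'" using rapid_bounded[OF u(1)] by blast
  have int: "integrable lborel (\<lambda>t. cmod (u (x + t)) * cmod (v t))" for x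
  proof -
    have "integrable lborel (\<lambda>t. u (x + t) * v t)"
      by (rule integrable_mult_bounded(2)[OF rapid_integrable[OF v] _ B']) simp
    from integrable_norm[OF this] show ?thesis by (simp add: norm_mult)
  qed
  have "bracket x ^ k * (LINT t|lborel. cmod (u (x + t)) * cmod (v t)) \<le> 2 ^ k * B * ?I" for x
  proof -
    have "bracket x ^ k * (LINT t|lborel. cmod (u (x + t)) * cmod (v t)) = (LINT t|lborel. bracket x ^ k * (cmod (u (x + t)) * cmod (v t)))"
      by simp
    also have "\<dots> \<le> (LINT t|lborel. (2 ^ k * B) * (bracket t ^ k * cmod (v t)))"
    proof (intro integral_mono integrable_mult_right int vi)
      fix t :: "real^'n"
      have "bracket x ^ k \<le> 2 ^ k * bracket (x + t) ^ k * bracket t ^ k"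
        using bracket_power_add_le[of "x + t" "- t" k] by simp
      hence "bracket x ^ k * (cmod (u (x + t)) * cmod (v t)) \<le> (2 ^ k * bracket (x + t) ^ k * bracket t ^ k) * (cmod (u (x + t)) * cmod (v t))"
        by (intro mult_right_mono) auto
      also have "\<dots> = 2 ^ k * (bracket (x + t) ^ k * cmod (u (x + t))) * (bracket t ^ k * cmod (v t))" by (simp add: mult_ac)
      also have "\<dots> \<le> 2 ^ k * B * (bracket t ^ k * cmod (v t))"
        by (intro mult_right_mono mult_left_mono B) auto
      finally show "bracket x ^ k * (cmod (u (x + t)) * cmod (v t)) \<le> (2 ^ k * B) * (bracket t ^ k * cmod (v t))" .
    qed
    also have "\<dots> = 2 ^ k * B * ?I" by simp
    finally show ?thesis .
  qed
  moreover have "0 \<le> 2 ^ k * B * ?I" using B by (intro mult_nonneg_nonneg) auto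
  ultimately show ?thesis by blast
qed

text \<open>The short-time Fourier transform decays in \<open>x\<close> because \<open>\<kappa>\<close> does and in \<open>\<xi>\<close> because its Fourier
  transform does; the geometric mean of the two bounds decays in both variables.\<close>

lemma mod_norm_finite_if_rapid:
  fixes \<phi> \<kappa> :: "real^'n::finite \<Rightarrow> complex"
  assumes p: "1 \<le> p" and \<phi>: "\<phi> \<in> schwartz" and \<kappa>: "rapid \<kappa>" "\<kappa> \<in> borel_measurable borel"
    and F: "rapid (fourier \<kappa>)"
  shows "mod_norm \<phi> p s \<kappa> < \<infinity>"
proof -
  obtain m0 :: nat where m0: "s \<le> real m0" using real_arch_simple by blast
  define m where "m = m0 + 2 * CARD('n)"
  note [measurable] = \<kappa>(2) schwartz_measurable[OF \<phi>]
  have \<kappa>i: "integrable lborel \<kappa>" by (rule rapid_integrable[OF \<kappa>])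
  obtain C1 where C1: "0 \<le> C1" "\<And>x. bracket x ^ (2 * m) * (LINT t|lborel. cmod (\<kappa> (x + t)) * cmod (\<phi> t)) \<le> C1"
    using rapid_correlation[OF \<kappa> schwartz_rapid[OF \<phi>] schwartz_measurable[OF \<phi>], of "2 * m"] by blast
  have F\<phi>: "fourier \<phi> \<in> schwartz" by (rule schwartz_fourier[OF \<phi>])
  obtain C2 where C2: "0 \<le> C2" "\<And>\<xi>. bracket \<xi> ^ (2 * m) * (LINT \<eta>|lborel. cmod (fourier \<kappa> (\<xi> + \<eta>)) * cmod (fourier \<phi> \<eta>)) \<le> C2"
    using rapid_correlation[OF F fourier_measurable[OF \<kappa>i] schwartz_rapid[OF F\<phi>] schwartz_measurable[OF F\<phi>], of "2 * m"] by blast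
  have b1: "bracket x ^ (2 * m) * cmod (stf \<phi> \<kappa> \<xi> x) \<le> C1" for x \<xi>
  proof -
    have "cmod (stf \<phi> \<kappa> \<xi> x) \<le> (LINT t|lborel. cmod (\<kappa> t * cnj (\<phi> (t - x)) * exp (- (\<i> * of_real (t \<bullet> \<xi>)))))"
      unfolding stf_def fourier_def by (rule integral_norm_bound)
    also have "\<dots> = (LINT t|lborel. (\<lambda>t. cmod (\<kappa> (x + t)) * cmod (\<phi> t)) (t + - x))"
      by (simp add: norm_mult)
    also have "\<dots> = (LINT t|lborel. cmod (\<kappa> (x + t)) * cmod (\<phi> t))"
      by (rule integral_translate) measurable
    finally have "bracket x ^ (2 * m) * cmod (stf \<phi> \<kappa> \<xi> x) \<le> bracket x ^ (2 * m) * (LINT t|lborel. cmod (\<kappa> (x + t)) * cmod (\<phi> t))"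
      by (intro mult_left_mono) auto
    thus ?thesis using C1(2)[of x] by linarith
  qed
  have b2: "bracket \<xi> ^ (2 * m) * cmod (stf \<phi> \<kappa> \<xi> x) \<le> C2" for x \<xi>
  proof -
    have "bracket \<xi> ^ (2 * m) * cmod (stf \<phi> \<kappa> \<xi> x) \<le> bracket \<xi> ^ (2 * m) * (LINT \<eta>|lborel. cmod (fourier \<kappa> (\<xi> + \<eta>)) * cmod (fourier \<phi> \<eta>))"
      by (intro mult_left_mono norm_stf_le(2) \<kappa>i \<phi>) simp
    thus ?thesis using C2(2)[of \<xi>] by linarith
  qed
  define C where "C = sqrt (C1 * C2)"
  have b: "cmod (stf \<phi> \<kappa> \<xi> x) \<le> C * inverse (bracket \<xi> ^ m) * inverse (bracket x ^ m)" for x \<xi>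
  proof -
    have "(bracket x ^ m * bracket \<xi> ^ m * cmod (stf \<phi> \<kappa> \<xi> x))\<^sup>2
        = (bracket x ^ (2 * m) * cmod (stf \<phi> \<kappa> \<xi> x)) * (bracket \<xi> ^ (2 * m) * cmod (stf \<phi> \<kappa> \<xi> x))"
      unfolding mult_2 power_add power2_eq_square by (simp only: mult_ac)
    also have "\<dots> \<le> C1 * C2" using C1 C2 by (intro mult_mono b1 b2) auto
    also have "\<dots> = C\<^sup>2" using C1 C2 by (simp add: C_def)
    finally have "bracket x ^ m * bracket \<xi> ^ m * cmod (stf \<phi> \<kappa> \<xi> x) \<le> C"
      by (rule power2_le_imp_le) (use C1 C2 in \<open>simp add: C_def\<close>)
    thus ?thesis by (simp add: field_simps)
  qed
  have C0: "0 \<le> C" using C1 C2 by (simp add: C_def)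
  let ?l = "lpn p lborel (\<lambda>x :: real^'n. inverse (bracket x ^ m))"
  have mint: "inverse (bracket x ^ m) \<le> inverse (bracket x ^ (2 * CARD('n)))" for x :: "real^'n"
    unfolding m_def by (intro le_imp_inverse_le power_increasing bracket_ge_1) auto
  have l: "?l < \<infinity>"
  proof -
    have "(\<integral>\<^sup>+ x. ennreal (inverse (bracket (x :: real^'n) ^ m) powr p) \<partial>lborel) \<le> (\<integral>\<^sup>+ x. ennreal (inverse (bracket (x :: real^'n) ^ (2 * CARD('n)))) \<partial>lborel)"
    proof (intro nn_integral_mono ennreal_leI)
      fix x :: "real^'n"
      have "inverse (bracket x ^ m) \<le> 1" using one_le_power[OF bracket_ge_1[of x]] by (simp add: inverse_le_1_iff)
      hence "inverse (bracket x ^ m) powr p \<le> inverse (bracket x ^ m) powr 1" using p by (intro powr_mono') auto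
      hence "inverse (bracket x ^ m) powr p \<le> inverse (bracket x ^ m)" by simp
      thus "inverse (bracket x ^ m) powr p \<le> inverse (bracket x ^ (2 * CARD('n)))"
        by (rule order_trans[OF _ mint])
    qed
    also have "\<dots> < \<infinity>" by (rule nn_integral_bracket_finite)
    finally show ?thesis by (simp only: lpn_finite_iff)
  qed
  have "mod_norm \<phi> p s \<kappa> \<le> (\<integral>\<^sup>+ \<xi>. ennreal (inverse (bracket (\<xi> :: real^'n) ^ (2 * CARD('n)))) * (ennreal C * ?l) \<partial>lborel)"
    unfolding mod_norm_def
  proof (intro nn_integral_mono)
    fix \<xi> :: "real^'n"
    have "slice \<phi> p \<kappa> \<xi> \<le> lpn p lborel (\<lambda>x :: real^'n. (C * inverse (bracket \<xi> ^ m)) * inverse (bracket x ^ m))"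
      unfolding slice_def using p b by (intro lpn_mono AE_I2) auto
    also have "\<dots> = ennreal (C * inverse (bracket \<xi> ^ m)) * ?l"
      using p C0 by (intro lpn_cmult) auto
    finally have "ennreal (bracket \<xi> powr s) * slice \<phi> p \<kappa> \<xi> \<le> ennreal (bracket \<xi> powr s) * (ennreal (C * inverse (bracket \<xi> ^ m)) * ?l)"
      by (rule mult_left_mono) simp
    also have "\<dots> = ennreal (bracket \<xi> powr s * inverse (bracket \<xi> ^ m)) * (ennreal C * ?l)"
      using C0 by (simp add: ennreal_mult mult_ac)
    also have "\<dots> \<le> ennreal (inverse (bracket \<xi> ^ (2 * CARD('n)))) * (ennreal C * ?l)"
    proof (intro mult_right_mono ennreal_leI)
      have "bracket \<xi> powr s \<le> bracket \<xi> ^ m0"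
        using powr_mono[OF m0 bracket_ge_1[of \<xi>]] by (simp add: powr_realpow)
      thus "bracket \<xi> powr s * inverse (bracket \<xi> ^ m) \<le> inverse (bracket \<xi> ^ (2 * CARD('n)))"
        by (simp add: m_def power_add field_simps)
    qed simp
    finally show "ennreal (bracket \<xi> powr s) * slice \<phi> p \<kappa> \<xi> \<le> ennreal (inverse (bracket \<xi> ^ (2 * CARD('n)))) * (ennreal C * ?l)" .
  qed
  also have "\<dots> = (\<integral>\<^sup>+ \<xi>. ennreal (inverse (bracket (\<xi> :: real^'n) ^ (2 * CARD('n)))) \<partial>lborel) * (ennreal C * ?l)"
    by (rule nn_integral_multc) measurable
  also have "\<dots> < \<infinity>" using l nn_integral_bracket_finite[where 'n='n] by (simp add: ennreal_mult_less_top)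
  finally show ?thesis .
qed

text \<open>The indicator function of a ball is mollified by a bump. On the Fourier side the transform of the
  indicator is bounded and that of the bump decreases rapidly, which makes the product rapid without
  differentiating the convolution.\<close>

lemma cutoff_exists:
  fixes r :: real
  obtains \<kappa> :: "real^'n::finite \<Rightarrow> complex" where "continuous_on UNIV \<kappa>" "rapid \<kappa>" "rapid (fourier \<kappa>)"
    "\<And>x. norm x \<le> r \<Longrightarrow> \<kappa> x = 1"
proof -
  define b where "b x = complex_of_real (bump 0 (x :: real^'n))" for x
  have bS: "b \<in> schwartz" unfolding b_def by (rule schwartz_bump)
  note [measurable] = schwartz_measurable[OF bS]
  have bi: "integrable lborel b" by (rule schwartz_integrable[OF bS])
  obtain B where B: "\<And>x. cmod (b x) \<le> B" using rapid_bounded[OF schwartz_rapid[OF bS]] by blast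
  define u where "u x = (if norm (x :: real^'n) \<le> r + 1 then 1 else 0 :: complex)" for x
  have [measurable]: "u \<in> borel_measurable borel" unfolding u_def by measurable
  have ui: "integrable lborel u"
  proof -
    have "integrable lborel (indicator (cball (0 :: real^'n) (r + 1)) :: _ \<Rightarrow> real)"
      using emeasure_lborel_cball_finite[of "0 :: real^'n" "r + 1"] by (simp add: integrable_indicator_iff)
    hence "integrable lborel (\<lambda>x :: real^'n. complex_of_real (indicator (cball 0 (r + 1)) x))"
      by (simp only: complex_of_real_integrable_eq)
    moreover have "(\<lambda>x :: real^'n. complex_of_real (indicator (cball 0 (r + 1)) x)) = u"
      by (auto simp: u_def indicator_def)
    ultimately show ?thesis by simp
  qed
  define \<beta> where "\<beta> = (LINT x|lborel. b x)"
  have \<beta>: "\<beta> \<noteq> 0"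
  proof
    assume "\<beta> = 0"
    have bri: "integrable lborel (bump 0 :: real^'n \<Rightarrow> real)"
      using bi unfolding b_def by (simp only: complex_of_real_integrable_eq)
    have "complex_of_real (LINT x|lborel. bump 0 (x :: real^'n)) = 0"
      using \<open>\<beta> = 0\<close> unfolding \<beta>_def b_def by simp
    hence "(LINT x|lborel. bump 0 (x :: real^'n)) = 0" by (simp only: of_real_eq_0_iff)
    hence "AE x in lborel. bump 0 (x :: real^'n) = 0"
      using integral_nonneg_eq_0_iff_AE[OF bri] by simp
    hence "AE x in lborel. x \<notin> ball (0 :: real^'n) 1"
      by eventually_elim (use bump_0_pos in fastforce)
    hence "emeasure lborel (ball (0 :: real^'n) 1) = 0"
      by (subst (asm) AE_iff_measurable[OF _ refl]) (auto simp: ball_def)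
    hence "measure lborel (ball (0 :: real^'n) 1) = 0" by (simp add: measure_def)
    thus False using content_ball_pos[of 1 "0 :: real^'n"] by simp
  qed
  define \<kappa> where "\<kappa> x = (1 / \<beta>) * conv u b x" for x
  have c: "continuous_on UNIV \<kappa>"
    unfolding \<kappa>_def by (intro continuous_intros continuous_conv[OF ui schwartz_continuous[OF bS] B])
  have one: "\<kappa> x = 1" if x: "norm x \<le> r" for x
  proof -
    have "conv u b x = (LINT t|lborel. (\<lambda>t. b t) (x - t))"
      unfolding conv_def
    proof (intro Bochner_Integration.integral_cong refl)
      fix t
      show "u t * b (x - t) = b (x - t)"
      proof (cases "norm (x - t) < 1")
        case True
        have "norm t \<le> norm x + norm (x - t)" using norm_triangle_ineq4[of x "x - t"] by simp
        thus ?thesis using True x by (simp add: u_def)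
      qed (simp add: b_def bump_eq_0)
    qed
    also have "\<dots> = \<beta>" unfolding \<beta>_def by (rule integral_reflect) measurable
    finally show ?thesis using \<beta> by (simp add: \<kappa>_def)
  qed
  have zero: "\<kappa> x = 0" if x: "norm x > r + 2" for x
  proof -
    have z: "u t * b (x - t) = 0" for t
    proof (cases "norm t \<le> r + 1")
      case True
      have "norm x \<le> norm t + norm (x - t)" using norm_triangle_ineq[of t "x - t"] by simp
      thus ?thesis using True x by (simp add: b_def bump_eq_0)
    qed (simp add: u_def)
    show ?thesis unfolding \<kappa>_def conv_def z by simp
  qed
  have rap: "rapid \<kappa>"
  proof -
    have "compact (\<kappa> ` cball 0 (r + 2))"
      by (intro compact_continuous_image compact_cball continuous_on_subset[OF c]) auto
    from compact_imp_bounded[OF this] obtain A where "\<forall>y\<in>\<kappa> ` cball 0 (r + 2). cmod y \<le> A"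
      unfolding bounded_iff by blast
    hence A: "cmod (\<kappa> x) \<le> A" if "norm x \<le> r + 2" for x using that by auto
    show ?thesis unfolding rapid_def
    proof (intro allI exI)
      fix k and x :: "real^'n"
      show "bracket x ^ k * cmod (\<kappa> x) \<le> sqrt (1 + (r + 2)\<^sup>2) ^ k * max 0 A"
      proof (cases "norm x \<le> r + 2")
        case True
        have "bracket x \<le> sqrt (1 + (r + 2)\<^sup>2)"
          unfolding bracket_def using True by (intro real_sqrt_le_mono add_left_mono power_mono) auto
        thus ?thesis using A[OF True] by (intro mult_mono power_mono) auto
      next
        case False
        thus ?thesis by (simp add: zero)
      qed
    qed
  qed
  have "rapid (\<lambda>\<xi>. ((1 / \<beta>) * fourier u \<xi>) * fourier b \<xi>)"
  proof (rule slow_mult_rapid)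
    show "rapid (fourier b)" by (rule schwartz_rapid[OF schwartz_fourier[OF bS]])
    show "slow (\<lambda>\<xi>. (1 / \<beta>) * fourier u \<xi>)"
      unfolding slow_def
    proof (intro exI allI)
      fix \<xi>
      show "cmod ((1 / \<beta>) * fourier u \<xi>) \<le> (cmod (1 / \<beta>) * (LINT x|lborel. cmod (u x))) * bracket \<xi> ^ 0"
        unfolding norm_mult using norm_fourier_le[OF ui, of \<xi>] by (simp add: mult_left_mono divide_right_mono)
    qed
  qed
  hence rf: "rapid (fourier \<kappa>)"
    unfolding \<kappa>_def fourier_cmult[abs_def] fourier_conv(2)[OF ui bi] by (simp add: mult.assoc)
  show thesis by (rule that[OF c rap rf one])
qed

section \<open>Closed ideals of function algebras\<close>

lemma function_ideal_add:
  "function_ideal X I \<Longrightarrow> f \<in> I \<Longrightarrow> g \<in> I \<Longrightarrow> (\<lambda>x. f x + g x) \<in> I"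
  by (simp add: function_ideal_def)

locale function_algebra =
  fixes X :: "'n::finite cfun set" and d :: "'n cfun \<Rightarrow> 'n cfun \<Rightarrow> real"
  assumes zero: "(\<lambda>x. 0) \<in> X"
    and add: "f \<in> X \<Longrightarrow> g \<in> X \<Longrightarrow> (\<lambda>x. f x + g x) \<in> X"
    and cmult: "f \<in> X \<Longrightarrow> (\<lambda>x. c * f x) \<in> X"
    and mult: "f \<in> X \<Longrightarrow> g \<in> X \<Longrightarrow> (\<lambda>x. f x * g x) \<in> X"
    and metric: "Metric_space X d"
    and evaluation: "\<exists>C. \<forall>f\<in>X. \<forall>g\<in>X. cmod (f t - g t) \<le> C * d f g"
begin

lemma closed_ideal_iff:
  "closed_ideal X d I \<longleftrightarrow> function_ideal X I \<and> (\<forall>f\<in>X. f \<notin> I \<longrightarrow> (\<exists>r>0. \<forall>g\<in>I. r \<le> d f g))"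
proof -
  interpret Metric_space X d by (rule metric)
  have "closedin mtopology I \<longleftrightarrow> I \<subseteq> X \<and> (\<forall>f\<in>X. f \<notin> I \<longrightarrow> (\<exists>r>0. \<forall>g\<in>I. r \<le> d f g))"
    unfolding closedin_metric disjnt_iff by (auto simp: not_less) (meson not_le subset_iff)+
  thus ?thesis unfolding closed_ideal_def by (auto simp: function_ideal_def)
qed

text \<open>Closedness of a preimage under a Lipschitz map: the distance in the target is at most \<open>C\<close> times
  the distance in \<open>X\<close>.\<close>

lemma closed_ideal_preimageI:
  assumes I: "function_ideal X I"
    and sep: "\<And>f. f \<in> X \<Longrightarrow> f \<notin> I \<Longrightarrow> \<exists>C r. 0 < r \<and> (\<forall>g\<in>I. r \<le> C * d f g)"
  shows "closed_ideal X d I"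
  unfolding closed_ideal_iff
proof (intro conjI I ballI impI)
  interpret Metric_space X d by (rule metric)
  fix f assume "f \<in> X" "f \<notin> I"
  from sep[OF this] obtain C r where r: "0 < r" "\<And>g. g \<in> I \<Longrightarrow> r \<le> C * d f g" by blast
  show "\<exists>r>0. \<forall>g\<in>I. r \<le> d f g"
  proof (intro exI[of _ "r / (\<bar>C\<bar> + 1)"] conjI ballI)
    fix g assume "g \<in> I"
    have "r \<le> C * d f g" by (rule r(2)[OF \<open>g \<in> I\<close>])
    also have "\<dots> \<le> (\<bar>C\<bar> + 1) * d f g" by (intro mult_right_mono) auto
    finally show "r / (\<bar>C\<bar> + 1) \<le> d f g" by (simp add: divide_le_eq mult.commute)
  qed (use r in auto)
qed

lemma closed_ideal_whole: "closed_ideal X d X"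
  unfolding closed_ideal_iff function_ideal_def using zero add cmult mult by auto

lemma closed_ideal_J: "closed_ideal X d (ideal_J X d E)"
proof -
  let ?F = "{I. closed_ideal X d I \<and> ideal_J0 X E \<subseteq> I}"
  have X: "X \<in> ?F" using closed_ideal_whole by (auto simp: ideal_J0_def)
  have "function_ideal X (\<Inter>?F)"
    unfolding function_ideal_def
  proof (intro conjI ballI allI)
    show "\<Inter>?F \<subseteq> X" using X by blast
  qed (auto simp: closed_ideal_iff function_ideal_def)
  moreover have "\<exists>r>0. \<forall>g\<in>\<Inter>?F. r \<le> d f g" if f: "f \<in> X" "f \<notin> \<Inter>?F" for f
  proof -
    obtain I where I: "I \<in> ?F" "f \<notin> I" using f by blast
    then obtain r where "r > 0" "\<forall>g\<in>I. r \<le> d f g" using f unfolding closed_ideal_iff by blast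
    thus ?thesis using I by blast
  qed
  ultimately show ?thesis unfolding closed_ideal_iff ideal_J_def generated_closed_ideal_def by blast
qed

lemma J_subset: "closed_ideal X d I \<Longrightarrow> ideal_J0 X E \<subseteq> I \<Longrightarrow> ideal_J X d E \<subseteq> I"
  unfolding ideal_J_def generated_closed_ideal_def by blast

lemma J0_subset_J: "ideal_J0 X E \<subseteq> ideal_J X d E"
  unfolding ideal_J_def generated_closed_ideal_def by blast

lemma closed_ideal_I: "closed_ideal X d (ideal_I X E)"
proof (rule closed_ideal_preimageI)
  show "function_ideal X (ideal_I X E)"
    unfolding function_ideal_def ideal_I_def using zero add cmult mult by auto
  fix f assume f: "f \<in> X" "f \<notin> ideal_I X E"
  then obtain t where t: "t \<in> E" "f t \<noteq> 0" by (auto simp: ideal_I_def)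
  obtain C where C: "\<And>g. g \<in> X \<Longrightarrow> cmod (f t - g t) \<le> C * d f g" using evaluation[of t] f by blast
  show "\<exists>C r. 0 < r \<and> (\<forall>g\<in>ideal_I X E. r \<le> C * d f g)"
  proof (rule exI[of _ C], rule exI[of _ "cmod (f t)"], intro conjI ballI)
    fix g assume "g \<in> ideal_I X E"
    thus "cmod (f t) \<le> C * d f g" using C[of g] t by (simp add: ideal_I_def)
  qed (use t in simp)
qed

lemma J_subset_I: "ideal_J X d E \<subseteq> ideal_I X E"
  by (rule J_subset[OF closed_ideal_I]) (auto simp: ideal_J0_def ideal_I_def)

lemma synthesis_iff: "spectral_synthesis X d E \<longleftrightarrow> closed E \<and> ideal_I X E \<subseteq> ideal_J X d E"
  unfolding spectral_synthesis_def using J_subset_I by auto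

end

text \<open>A subalgebra \<open>Y\<close> that absorbs \<open>X\<close> by multiplication and contains a function equal to \<open>1\<close> near
  \<open>E\<close> has the same sets of synthesis: modulo functions vanishing near \<open>E\<close>, which belong to both
  ideals, every element of \<open>X\<close> equals \<open>\<kappa>\<close> times itself and so lies in \<open>Y\<close>.\<close>

theorem synthesis_transfer:
  assumes X: "function_algebra X dX" and Y: "function_algebra Y dY"
    and sub: "Y \<subseteq> X" and embed: "\<exists>C. \<forall>f\<in>Y. \<forall>g\<in>Y. dX f g \<le> C * dY f g"
    and absorb: "\<And>f g. f \<in> X \<Longrightarrow> g \<in> Y \<Longrightarrow> (\<lambda>x. f x * g x) \<in> Y"
    and absorb_cont: "\<And>g. g \<in> Y \<Longrightarrow> \<exists>C. \<forall>f\<in>X. \<forall>f'\<in>X. dY (\<lambda>x. f x * g x) (\<lambda>x. f' x * g x) \<le> C * dX f f'"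
    and \<kappa>: "\<kappa> \<in> Y" and U: "open U" "E \<subseteq> U" "\<And>x. x \<in> U \<Longrightarrow> \<kappa> x = 1"
  shows "spectral_synthesis Y dY E \<longleftrightarrow> spectral_synthesis X dX E"
proof -
  interpret X: function_algebra X dX by fact
  interpret Y: function_algebra Y dY by fact
  interpret MY: Metric_space Y dY by (rule Y.metric)
  let ?JX = "ideal_J X dX E" and ?JY = "ideal_J Y dY E"
  have JX: "function_ideal X ?JX" using X.closed_ideal_J X.closed_ideal_iff by blast
  have JY: "function_ideal Y ?JY" using Y.closed_ideal_J Y.closed_ideal_iff by blast
  have cutX: "(\<lambda>x. f x * \<kappa> x) \<in> Y" if "f \<in> X" for f using absorb[OF that \<kappa>] .
  have outside: "(\<lambda>x. f x - f x * \<kappa> x) \<in> ideal_J0 Z E"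
    if "f \<in> Z" "(\<lambda>x. f x - f x * \<kappa> x) \<in> Z" for f Z
    unfolding ideal_J0_def using that U by (auto intro!: exI[of _ U])
  have "ideal_I Y E \<subseteq> ?JY" if syn: "ideal_I X E \<subseteq> ?JX"
  proof
    \<comment> \<open>Multiplication by \<open>\<kappa>\<close> maps the closed ideal of \<open>X\<close> into that of \<open>Y\<close>.\<close>
    define I where "I = {f \<in> X. (\<lambda>x. f x * \<kappa> x) \<in> ?JY \<and> (\<forall>g\<in>X. (\<lambda>x. g x * f x * \<kappa> x) \<in> ?JY)}"
    have "function_ideal X I"
      unfolding function_ideal_def
    proof (intro conjI ballI allI)
      show "(\<lambda>x. 0) \<in> I" using X.zero JY by (auto simp: I_def function_ideal_def)
      show "(\<lambda>x. f x + g x) \<in> I" if "f \<in> I" "g \<in> I" for f g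
        using that X.add JY by (simp add: I_def function_ideal_def distrib_left distrib_right)
      show "(\<lambda>x. c * f x) \<in> I" if "f \<in> I" for c f
        using that X.cmult JY by (simp add: I_def function_ideal_def mult.assoc mult.left_commute[of _ c])
      show "(\<lambda>x. f x * g x) \<in> I" if f: "f \<in> X" and g: "g \<in> I" for f g
      proof -
        have "(\<lambda>x. h x * (f x * g x) * \<kappa> x) \<in> ?JY" if "h \<in> X" for h
          using g X.mult[OF that f] by (auto simp: I_def mult.assoc)
        thus ?thesis using g f X.mult by (auto simp: I_def)
      qed
    qed (auto simp: I_def)
    moreover have "\<exists>C r. 0 < r \<and> (\<forall>g\<in>I. r \<le> C * dX f g)" if f: "f \<in> X" "f \<notin> I" for f
    proof -
      have "\<exists>k\<in>Y. (\<lambda>x. f x * k x) \<notin> ?JY \<and> (\<forall>g\<in>I. (\<lambda>x. g x * k x) \<in> ?JY)"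
      proof (cases "(\<lambda>x. f x * \<kappa> x) \<in> ?JY")
        case True
        then obtain g where g: "g \<in> X" "(\<lambda>x. g x * f x * \<kappa> x) \<notin> ?JY" using f by (auto simp: I_def)
        have "(\<lambda>x. h x * (g x * \<kappa> x)) \<in> ?JY" if "h \<in> I" for h
          using that g(1) by (auto simp: I_def mult_ac)
        thus ?thesis using g(2) cutX[OF g(1)] by (intro bexI[of _ "\<lambda>x. g x * \<kappa> x"]) (auto simp: mult_ac)
      next
        case False
        thus ?thesis using \<kappa> by (intro bexI[of _ \<kappa>]) (auto simp: I_def)
      qed
      then obtain k where k: "k \<in> Y" "(\<lambda>x. f x * k x) \<notin> ?JY" "\<And>g. g \<in> I \<Longrightarrow> (\<lambda>x. g x * k x) \<in> ?JY" by blast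
      obtain r where r: "r > 0" "\<And>h. h \<in> ?JY \<Longrightarrow> r \<le> dY (\<lambda>x. f x * k x) h"
        using Y.closed_ideal_J[of E] absorb[OF f(1) k(1)] k(2) unfolding Y.closed_ideal_iff by blast
      obtain C where C: "\<And>g. g \<in> X \<Longrightarrow> dY (\<lambda>x. f x * k x) (\<lambda>x. g x * k x) \<le> C * dX f g"
        using absorb_cont[OF k(1)] f(1) by blast
      have "r \<le> C * dX f g" if "g \<in> I" for g
        using r(2)[OF k(3)[OF that]] C[of g] that by (auto simp: I_def intro: order_trans)
      thus ?thesis using r(1) by blast
    qed
    ultimately have cl: "closed_ideal X dX I" by (rule X.closed_ideal_preimageI)
    have "ideal_J0 X E \<subseteq> I"
    proof
      fix f assume f: "f \<in> ideal_J0 X E"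
      then obtain V where V: "f \<in> X" "open V" "E \<subseteq> V" "\<forall>x\<in>V. f x = 0" by (auto simp: ideal_J0_def)
      have "(\<lambda>x. f x * \<kappa> x) \<in> ideal_J0 Y E"
        using cutX[OF V(1)] V by (auto simp: ideal_J0_def intro!: exI[of _ V])
      moreover have "(\<lambda>x. g x * f x * \<kappa> x) \<in> ideal_J0 Y E" if "g \<in> X" for g
        using cutX[OF X.mult[OF that V(1)]] V by (auto simp: ideal_J0_def intro!: exI[of _ V])
      ultimately show "f \<in> I" using Y.J0_subset_J[of E] V(1) by (auto simp: I_def)
    qed
    from X.J_subset[OF cl this] have JI: "?JX \<subseteq> I" .
    fix f assume f: "f \<in> ideal_I Y E"
    hence fY: "f \<in> Y" by (simp add: ideal_I_def)
    have "f \<in> ideal_I X E" using f sub by (auto simp: ideal_I_def)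
    hence a: "(\<lambda>x. f x * \<kappa> x) \<in> ?JY" using syn JI by (auto simp: I_def)
    have "(\<lambda>x. f x + (- 1) * (f x * \<kappa> x)) \<in> Y" by (intro Y.add Y.cmult Y.mult fY \<kappa>)
    hence "(\<lambda>x. f x - f x * \<kappa> x) \<in> ?JY" using outside[OF fY] Y.J0_subset_J by auto
    with a have "(\<lambda>x. f x * \<kappa> x + (f x - f x * \<kappa> x)) \<in> ?JY"
      by (rule function_ideal_add[OF JY])
    thus "f \<in> ?JY" by simp
  qed
  moreover have "ideal_I X E \<subseteq> ?JX" if syn: "ideal_I Y E \<subseteq> ?JY"
  proof
    define I where "I = Y \<inter> ?JX"
    have "function_ideal Y I"
      using JX Y.zero Y.add Y.cmult Y.mult sub unfolding function_ideal_def I_def by auto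
    moreover have "\<exists>C r. 0 < r \<and> (\<forall>g\<in>I. r \<le> C * dY f g)" if f: "f \<in> Y" "f \<notin> I" for f
    proof -
      obtain r where r: "r > 0" "\<And>g. g \<in> ?JX \<Longrightarrow> r \<le> dX f g"
        using X.closed_ideal_J[of E] f sub unfolding X.closed_ideal_iff I_def by blast
      obtain C where "\<And>g. g \<in> Y \<Longrightarrow> dX f g \<le> C * dY f g" using embed f(1) by blast
      hence "r \<le> C * dY f g" if "g \<in> I" for g
        using that r(2)[of g] by (auto simp: I_def intro: order_trans)
      thus ?thesis using r(1) by blast
    qed
    ultimately have cl: "closed_ideal Y dY I" by (rule Y.closed_ideal_preimageI)
    have "ideal_J0 Y E \<subseteq> I" using sub X.J0_subset_J[of E] by (auto simp: I_def ideal_J0_def)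
    from Y.J_subset[OF cl this] have JI: "?JY \<subseteq> I" .
    fix f assume f: "f \<in> ideal_I X E"
    hence fX: "f \<in> X" by (simp add: ideal_I_def)
    have "(\<lambda>x. f x * \<kappa> x) \<in> ideal_I Y E" using f cutX[OF fX] by (auto simp: ideal_I_def)
    hence a: "(\<lambda>x. f x * \<kappa> x) \<in> ?JX" using syn JI by (auto simp: I_def)
    have "(\<lambda>x. f x + (- 1) * (f x * \<kappa> x)) \<in> X" using cutX[OF fX] sub by (intro X.add X.cmult fX) auto
    hence "(\<lambda>x. f x - f x * \<kappa> x) \<in> ?JX" using outside[OF fX] X.J0_subset_J by auto
    with a have "(\<lambda>x. f x * \<kappa> x + (f x - f x * \<kappa> x)) \<in> ?JX"
      by (rule function_ideal_add[OF JX])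
    thus "f \<in> ?JX" by simp
  qed
  ultimately show ?thesis unfolding X.synthesis_iff Y.synthesis_iff by blast
qed

section \<open>Spectral synthesis in the two algebras\<close>

lemma norm_dist_eq: "norm_dist N f g = enn2real (N (distr_of (\<lambda>x. f x - g x)))"
  by (simp add: norm_dist_def)

lemma distr_of_uminus: "distr_of (\<lambda>x. - f x) = (\<lambda>\<psi>\<in>schwartz. - distr_of f \<psi>)"
  by (auto simp: distr_of_def restrict_def)

text \<open>Symmetry of a metric in \<^locale>\<open>Metric_space\<close> is demanded for all pairs of functions, not only for
  members of the space, so the argument works with arbitrary \<open>f\<close>.\<close>

lemma FB_norm_uminus: "fourier_beurling_norm s (distr_of (\<lambda>x. - f x)) = fourier_beurling_norm s (distr_of f)"
  for f :: "real^'n::finite \<Rightarrow> complex"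
proof -
  have le: "fourier_beurling_norm s (distr_of (\<lambda>x. - f x)) \<le> fourier_beurling_norm s (distr_of f)"
    for f :: "real^'n \<Rightarrow> complex"
    unfolding fourier_beurling_norm_def
  proof (rule INF_mono)
    fix h :: "real^'n \<Rightarrow> complex" assume "h \<in> {h. given_by (fourier_distr (distr_of f)) h}"
    hence h: "given_by (fourier_distr (distr_of f)) h" by simp
    have "fourier_distr (distr_of (\<lambda>x. - f x)) = (\<lambda>\<psi>\<in>schwartz. - fourier_distr (distr_of f) \<psi>)"
      by (auto simp: fourier_distr_def distr_of_uminus schwartz_fourier restrict_def)
    also have "\<dots> = (\<lambda>\<psi>\<in>schwartz. - distr_of h \<psi>)" using h by (simp add: given_by_def)
    also have "\<dots> = distr_of (\<lambda>x. - h x)" by (rule distr_of_uminus[symmetric])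
    finally have "given_by (fourier_distr (distr_of (\<lambda>x. - f x))) (\<lambda>x. - h x)"
      using h by (simp add: given_by_def)
    thus "\<exists>k\<in>{h. given_by (fourier_distr (distr_of (\<lambda>x. - f x))) h}.
        (\<integral>\<^sup>+ \<xi>. ennreal (bracket \<xi> powr s * cmod (k \<xi>)) \<partial>lborel) \<le> (\<integral>\<^sup>+ \<xi>. ennreal (bracket \<xi> powr s * cmod (h \<xi>)) \<partial>lborel)"
      by (intro bexI[of _ "\<lambda>x. - h x"]) auto
  qed
  from le[of f] le[of "\<lambda>x. - f x"] show ?thesis by simp
qed

lemma mod_norm_uminus: "mod_norm \<phi> p s (\<lambda>x. - f x) = mod_norm \<phi> p s f"
proof -
  have "stf \<phi> (\<lambda>t. - f t) \<xi> x = - stf \<phi> f \<xi> x" for \<xi> x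
    using stf_cmult[of \<phi> "- 1" f \<xi> x] by simp
  thus ?thesis by (simp add: mod_norm_def slice_def)
qed

lemma enn2real_le_add:
  assumes "a \<le> b + c" "b < \<infinity>" "c < \<infinity>" shows "enn2real a \<le> enn2real b + enn2real c"
proof -
  have "enn2real a \<le> enn2real (b + c)" using assms by (intro enn2real_mono) auto
  thus ?thesis using assms by (simp add: enn2real_plus)
qed

lemma FB_norm_add_le:
  assumes s: "0 \<le> s" and f: "f \<in> FB s" and g: "g \<in> FB s"
  shows "fourier_beurling_norm s (distr_of (\<lambda>x. f x + g x)) \<le> fourier_beurling_norm s (distr_of f) + fourier_beurling_norm s (distr_of g)"
proof (rule ennreal_le_epsilon)
  fix e :: real assume e: "0 < e"
  let ?N = "\<lambda>f. fourier_beurling_norm s (distr_of f)"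
  have lt: "?N f < ?N f + ennreal (e / 2)" "?N g < ?N g + ennreal (e / 2)"
    using FB_norm_finite[OF f] FB_norm_finite[OF g] e
    by (auto simp: ennreal_add_left_cancel_less[of _ 0, simplified] less_top)
  obtain h where h: "has_symbol s f h" "beurling_mass s h < ?N f + ennreal (e / 2)"
    using FB_norm_approx[OF s f lt(1)] by blast
  obtain k where k: "has_symbol s g k" "beurling_mass s k < ?N g + ennreal (e / 2)"
    using FB_norm_approx[OF s g lt(2)] by blast
  have "?N (\<lambda>x. f x + g x) \<le> beurling_mass s (\<lambda>x. h x + k x)"
    by (rule FB_norm_le[OF s has_symbol_add[OF s h(1) k(1)]])
  also have "\<dots> \<le> beurling_mass s h + beurling_mass s k"
    using h(1) k(1) by (intro beurling_mass_add_le) (auto simp: has_symbol_def)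
  also have "\<dots> \<le> (?N f + ennreal (e / 2)) + (?N g + ennreal (e / 2))"
    using h(2) k(2) by (intro add_mono) auto
  also have "\<dots> = ?N f + ?N g + (ennreal (e / 2) + ennreal (e / 2))" by (simp only: ac_simps)
  also have "ennreal (e / 2) + ennreal (e / 2) = ennreal e" using e by (simp flip: ennreal_plus)
  finally show "?N (\<lambda>x. f x + g x) \<le> ?N f + ?N g + ennreal e" .
qed

lemma norm_value_le_FB_norm:
  fixes f :: "real^'n::finite \<Rightarrow> complex"
  assumes s: "0 \<le> s" and f: "f \<in> FB s"
  shows "ennreal (cmod (f t)) \<le> ennreal (1 / (2 * pi) ^ CARD('n)) * fourier_beurling_norm s (distr_of f)"
proof (rule ennreal_le_epsilon)
  fix e :: real assume e: "0 < e"
  let ?c = "(1 / (2 * pi) ^ CARD('n)) :: real" and ?N = "fourier_beurling_norm s (distr_of f)"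
  have c: "?c > 0" by simp
  have lt: "?N < ?N + ennreal (e / ?c)"
    using FB_norm_finite[OF f] e c by (auto simp: ennreal_add_left_cancel_less[of _ 0, simplified] less_top)
  obtain h where h: "has_symbol s f h" "beurling_mass s h < ?N + ennreal (e / ?c)"
    using FB_norm_approx[OF s f lt] by blast
  have "ennreal (cmod (f t)) \<le> ennreal ?c * beurling_mass s h" by (rule norm_value_le_beurling_mass[OF s h(1)])
  also have "\<dots> \<le> ennreal ?c * (?N + ennreal (e / ?c))" using h(2) by (intro mult_left_mono) auto
  also have "\<dots> = ennreal ?c * ?N + ennreal e"
    using e c by (simp add: distrib_left ennreal_mult[symmetric])
  finally show "ennreal (cmod (f t)) \<le> ennreal ?c * ?N + ennreal e" .
qed

lemma function_algebra_FB:
  assumes s: "0 \<le> s"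
  shows "function_algebra (FB s :: (real^'n::finite \<Rightarrow> complex) set) (norm_dist (fourier_beurling_norm s))"
proof (rule function_algebra.intro)
  let ?X = "FB s :: (real^'n \<Rightarrow> complex) set" and ?d = "norm_dist (fourier_beurling_norm s) :: 'n cfun \<Rightarrow> 'n cfun \<Rightarrow> real"
  let ?N = "\<lambda>f :: real^'n \<Rightarrow> complex. fourier_beurling_norm s (distr_of f)"
  show "(\<lambda>x. 0) \<in> ?X" by (rule FB_zero[OF s])
  show "(\<lambda>x. f x + g x) \<in> ?X" "(\<lambda>x. f x * g x) \<in> ?X" if "f \<in> ?X" "g \<in> ?X" for f g
    using that by (auto intro: FB_add[OF s] FB_mult[OF s])
  show "(\<lambda>x. c * f x) \<in> ?X" if "f \<in> ?X" for f c by (rule FB_cmult[OF s that])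
  have val: "cmod (f t - g t) \<le> (1 / (2 * pi) ^ CARD('n)) * ?d f g" if "f \<in> ?X" "g \<in> ?X" for f g t
  proof -
    have fg: "(\<lambda>x. f x - g x) \<in> ?X" by (rule FB_diff[OF s that])
    have "enn2real (ennreal (cmod (f t - g t))) \<le> enn2real (ennreal (1 / (2 * pi) ^ CARD('n)) * ?N (\<lambda>x. f x - g x))"
      using norm_value_le_FB_norm[OF s fg, of t] FB_norm_finite[OF fg] by (intro enn2real_mono) (auto simp: ennreal_mult_less_top)
    thus ?thesis by (simp add: enn2real_mult norm_dist_eq)
  qed
  show "\<exists>C. \<forall>f\<in>?X. \<forall>g\<in>?X. cmod (f t - g t) \<le> C * ?d f g" for t using val by blast
  show "Metric_space ?X ?d"
  proof
    fix f g h :: "real^'n \<Rightarrow> complex"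
    show "0 \<le> ?d f g" by (simp add: norm_dist_eq)
    show "?d f g = ?d g f" using FB_norm_uminus[of s "\<lambda>x. f x - g x"] by (simp add: norm_dist_eq)
    show "?d f g = 0 \<longleftrightarrow> f = g" if "f \<in> ?X" "g \<in> ?X"
    proof
      assume "?d f g = 0"
      hence "f t = g t" for t using val[OF that, of t] by simp
      thus "f = g" by blast
    next
      assume "f = g"
      moreover have "?N (\<lambda>x. 0) \<le> beurling_mass s (\<lambda>x :: real^'n. 0)"
        by (rule FB_norm_le[OF s]) (auto simp: has_symbol_def beurling_mass_def inverse_fourier_def)
      ultimately show "?d f g = 0" by (simp add: norm_dist_eq beurling_mass_def)
    qed
    show "?d f h \<le> ?d f g + ?d g h" if "f \<in> ?X" "g \<in> ?X" "h \<in> ?X"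
    proof -
      have m: "(\<lambda>x. f x - g x) \<in> ?X" "(\<lambda>x. g x - h x) \<in> ?X" using that FB_diff[OF s] by blast+
      have "?N (\<lambda>x. f x - h x) \<le> ?N (\<lambda>x. f x - g x) + ?N (\<lambda>x. g x - h x)"
        using FB_norm_add_le[OF s m] by simp
      thus ?thesis unfolding norm_dist_eq using m by (intro enn2real_le_add FB_norm_finite)
    qed
  qed
qed

lemma MS_subset_FB:
  assumes "1 \<le> p" "p \<le> 2" "0 \<le> s" "\<phi> \<in> schwartz" "\<phi> \<noteq> (\<lambda>x. 0)"
  shows "MS \<phi> p s \<subseteq> FB s"
    and "\<exists>C\<ge>0. \<forall>f\<in>MS \<phi> p s. fourier_beurling_norm s (distr_of f) \<le> ennreal C * mod_norm \<phi> p s f"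
proof -
  obtain C where C: "0 \<le> C" "\<And>f e. continuous_on UNIV f \<Longrightarrow> tested f \<Longrightarrow> mod_norm \<phi> p s f < \<infinity> \<Longrightarrow> 0 < (e::real)
    \<Longrightarrow> \<exists>h. has_symbol s f h \<and> beurling_mass s h \<le> ennreal C * mod_norm \<phi> p s f + ennreal e"
    using has_symbol_if_mod_norm_finite[OF assms] by blast
  have *: "\<exists>h. has_symbol s f h \<and> beurling_mass s h \<le> ennreal C * mod_norm \<phi> p s f + ennreal e"
    if "f \<in> MS \<phi> p s" "0 < e" for f and e :: real
    using that by (intro C) (auto simp: MS_iff[OF assms(4)])
  show "MS \<phi> p s \<subseteq> FB s"
    using *[of _ 1] FB_iff[OF assms(3)] by fastforce
  have "fourier_beurling_norm s (distr_of f) \<le> ennreal C * mod_norm \<phi> p s f" if f: "f \<in> MS \<phi> p s" for f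
  proof (rule ennreal_le_epsilon)
    fix e :: real assume "0 < e"
    from *[OF f this] show "fourier_beurling_norm s (distr_of f) \<le> ennreal C * mod_norm \<phi> p s f + ennreal e"
      using FB_norm_le[OF assms(3)] order_trans by blast
  qed
  thus "\<exists>C\<ge>0. \<forall>f\<in>MS \<phi> p s. fourier_beurling_norm s (distr_of f) \<le> ennreal C * mod_norm \<phi> p s f"
    using C(1) by blast
qed

lemma FB_tested:
  assumes "0 \<le> s" "f \<in> FB s" shows "continuous_on UNIV f" "tested f" "distr_of f \<in> tempered_distributions"
  using continuous_functions_ofD[OF assms(2)] by (auto simp: fourier_beurling_space_def tested_if_given_by)

text \<open>Once the embedding is known, elements of the modulation space are bounded, and membership
  reduces to finiteness of the norm.\<close>

lemma MS_if_FB: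
  assumes "0 \<le> s" "\<phi> \<in> schwartz" "f \<in> FB s" "mod_norm \<phi> p s f < \<infinity>" shows "f \<in> MS \<phi> p s"
  using FB_tested[OF assms(1,3)] assms by (simp add: MS_iff)

lemma norm_dist_MS:
  assumes "\<phi> \<in> schwartz" shows "norm_dist (modulation_norm \<phi> p s) f g = enn2real (mod_norm \<phi> p s (\<lambda>x. f x - g x))"
  by (simp add: norm_dist_def modulation_norm_distr_of[OF assms])

theorem theorem6p3:
  fixes p s :: real and K :: "(real ^ 'n::finite) set" and \<phi> :: "real ^ 'n \<Rightarrow> complex"
  assumes "1 \<le> p" and "p \<le> 2" and "0 \<le> s"
    and "\<phi> \<in> schwartz" and "\<phi> \<noteq> (\<lambda>x. 0)"
    and "compact K"
  shows "spectral_synthesis_modulation \<phi> p s K \<longleftrightarrow> spectral_synthesis_fourier_beurling s K"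
proof -
  note p = \<open>1 \<le> p\<close> \<open>p \<le> 2\<close> and s = \<open>0 \<le> s\<close> and \<phi> = \<open>\<phi> \<in> schwartz\<close>
  let ?X = "FB s :: (real^'n \<Rightarrow> complex) set" and ?dX = "norm_dist (fourier_beurling_norm s) :: 'n cfun \<Rightarrow> 'n cfun \<Rightarrow> real"
  let ?Y = "MS \<phi> p s" and ?dY = "norm_dist (modulation_norm \<phi> p s)"
  let ?N = "\<lambda>f :: real^'n \<Rightarrow> complex. fourier_beurling_norm s (distr_of f)"
  interpret X: function_algebra ?X ?dX by (rule function_algebra_FB[OF s])
  interpret MX: Metric_space ?X ?dX by (rule X.metric)
  have YX: "?Y \<subseteq> ?X" by (rule MS_subset_FB(1)[OF assms(1-5)])
  obtain C where C: "0 \<le> C" "\<And>f. f \<in> ?Y \<Longrightarrow> ?N f \<le> ennreal C * mod_norm \<phi> p s f"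
    using MS_subset_FB(2)[OF assms(1-5)] by blast
  have Yfin: "mod_norm \<phi> p s f < \<infinity>" if "f \<in> ?Y" for f using that by (simp add: MS_iff[OF \<phi>])
  have Ytest: "tested f" if "f \<in> ?Y" for f using that by (simp add: MS_iff[OF \<phi>])
  have Yadd: "(\<lambda>x. f x + g x) \<in> ?Y" if "f \<in> ?Y" "g \<in> ?Y" for f g
  proof (rule MS_if_FB[OF s \<phi> X.add])
    have "mod_norm \<phi> p s (\<lambda>x. f x + g x) \<le> mod_norm \<phi> p s f + mod_norm \<phi> p s g"
      by (intro mod_norm_add_le p Ytest that \<phi>)
    also have "\<dots> < \<infinity>" using Yfin that by simp
    finally show "mod_norm \<phi> p s (\<lambda>x. f x + g x) < \<infinity>" .
  qed (use that YX in auto)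
  have Ycmult: "(\<lambda>x. c * f x) \<in> ?Y" if "f \<in> ?Y" for f c
    using mod_norm_cmult[OF p(1) Ytest[OF that] \<phi>, of s c] Yfin[OF that] YX that
    by (intro MS_if_FB[OF s \<phi> X.cmult]) (auto simp: ennreal_mult_less_top)
  have Ydiff: "(\<lambda>x. f x - g x) \<in> ?Y" if "f \<in> ?Y" "g \<in> ?Y" for f g
    using Yadd[OF that(1) Ycmult[OF that(2), of "- 1"]] by simp
  have absorb_le: "mod_norm \<phi> p s (\<lambda>x. f x * g x) \<le> ennreal (2 powr s) * ?N f * mod_norm \<phi> p s g"
    if f: "f \<in> ?X" and g: "g \<in> ?Y" for f g
  proof (rule ennreal_le_epsilon)
    fix e :: real assume e: "0 < e"
    obtain M where M: "mod_norm \<phi> p s g = ennreal M" "0 \<le> M"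
      using Yfin[OF g] by (cases "mod_norm \<phi> p s g" rule: ennreal_cases) auto
    \<comment> \<open>An error of \<open>e'\<close> in the norm of \<open>f\<close> costs at most \<open>e\<close> in the product.\<close>
    define e' where "e' = e / (2 powr s * (M + 1))"
    have e': "0 < e'" using e M by (simp add: e'_def)
    have lt: "?N f < ?N f + ennreal e'"
      using FB_norm_finite[OF f] e' by (auto simp: ennreal_add_left_cancel_less[of _ 0, simplified] less_top)
    obtain h where h: "has_symbol s f h" "beurling_mass s h < ?N f + ennreal e'"
      using FB_norm_approx[OF s f lt] by blast
    have "mod_norm \<phi> p s (\<lambda>x. f x * g x) \<le> ennreal (2 powr s) * beurling_mass s h * mod_norm \<phi> p s g"
      by (rule mod_norm_mult_le[OF p(1) s Ytest[OF g] \<phi> h(1)])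
    also have "\<dots> \<le> ennreal (2 powr s) * (?N f + ennreal e') * mod_norm \<phi> p s g"
      using h(2) by (intro mult_right_mono mult_left_mono) auto
    also have "\<dots> = ennreal (2 powr s) * ?N f * mod_norm \<phi> p s g + ennreal (2 powr s * e' * M)"
      using e' M by (simp add: distrib_left distrib_right ennreal_mult)
    also have "2 powr s * e' * M \<le> e"
    proof -
      have "2 powr s * e' * M \<le> 2 powr s * e' * (M + 1)" using e' by (intro mult_left_mono) auto
      also have "\<dots> = e" using M by (simp add: e'_def)
      finally show ?thesis .
    qed
    hence "ennreal (2 powr s) * ?N f * mod_norm \<phi> p s g + ennreal (2 powr s * e' * M) \<le> ennreal (2 powr s) * ?N f * mod_norm \<phi> p s g + ennreal e"
      by (intro add_left_mono ennreal_leI)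
    finally show "mod_norm \<phi> p s (\<lambda>x. f x * g x) \<le> ennreal (2 powr s) * ?N f * mod_norm \<phi> p s g + ennreal e" .
  qed
  have absorb: "(\<lambda>x. f x * g x) \<in> ?Y" if f: "f \<in> ?X" and g: "g \<in> ?Y" for f g
  proof (rule MS_if_FB[OF s \<phi> X.mult[OF f]])
    show "g \<in> ?X" using g YX by blast
    show "mod_norm \<phi> p s (\<lambda>x. f x * g x) < \<infinity>"
      using absorb_le[OF f g] by (rule le_less_trans) (use FB_norm_finite[OF f] Yfin[OF g] in \<open>simp add: ennreal_mult_less_top\<close>)
  qed
  have embed: "?dX f g \<le> C * ?dY f g" if "f \<in> ?Y" "g \<in> ?Y" for f g
  proof -
    have "enn2real (?N (\<lambda>x. f x - g x)) \<le> enn2real (ennreal C * mod_norm \<phi> p s (\<lambda>x. f x - g x))"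
      using C(2)[OF Ydiff[OF that]] Yfin[OF Ydiff[OF that]] by (intro enn2real_mono) (auto simp: ennreal_mult_less_top)
    thus ?thesis unfolding norm_dist_MS[OF \<phi>] norm_dist_eq[of "fourier_beurling_norm s"] using C(1) by (simp add: enn2real_mult)
  qed
  have Y: "function_algebra ?Y ?dY"
  proof (rule function_algebra.intro)
    have "mod_norm \<phi> p s (\<lambda>x. 0) = 0"
      using p by (simp add: mod_norm_def slice_def stf_def fourier_def)
    thus z: "(\<lambda>x. 0) \<in> ?Y" by (intro MS_if_FB[OF s \<phi> X.zero]) simp
    show "(\<lambda>x. f x + g x) \<in> ?Y" "(\<lambda>x. f x * g x) \<in> ?Y" if "f \<in> ?Y" "g \<in> ?Y" for f g
      using that YX by (auto intro: Yadd absorb)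
    show "(\<lambda>x. c * f x) \<in> ?Y" if "f \<in> ?Y" for f c by (rule Ycmult[OF that])
    show "\<exists>C. \<forall>f\<in>?Y. \<forall>g\<in>?Y. cmod (f t - g t) \<le> C * ?dY f g" for t
    proof -
      obtain B where B: "\<And>f g. f \<in> ?X \<Longrightarrow> g \<in> ?X \<Longrightarrow> cmod (f t - g t) \<le> B * ?dX f g"
        using X.evaluation by blast
      have "cmod (f t - g t) \<le> (\<bar>B\<bar> * C) * ?dY f g" if "f \<in> ?Y" "g \<in> ?Y" for f g
      proof -
        have "cmod (f t - g t) \<le> B * ?dX f g" using that YX by (intro B) auto
        also have "\<dots> \<le> \<bar>B\<bar> * ?dX f g" by (intro mult_right_mono) auto
        also have "\<dots> \<le> \<bar>B\<bar> * (C * ?dY f g)" by (intro mult_left_mono embed that) auto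
        finally show ?thesis by (simp add: mult.assoc)
      qed
      thus ?thesis by blast
    qed
    show "Metric_space ?Y ?dY"
    proof
      fix f g h :: "real^'n \<Rightarrow> complex"
      show "0 \<le> ?dY f g" by (simp add: norm_dist_eq)
      show "?dY f g = ?dY g f"
        using mod_norm_uminus[of \<phi> p s "\<lambda>x. f x - g x"] by (simp add: norm_dist_MS[OF \<phi>])
      show "?dY f g = 0 \<longleftrightarrow> f = g" if "f \<in> ?Y" "g \<in> ?Y"
      proof
        assume "?dY f g = 0"
        hence "?dX f g \<le> 0" using embed[OF that] by simp
        hence "?dX f g = 0" using MX.nonneg[of f g] by linarith
        thus "f = g" using that YX MX.zero[of f g] by blast
      next
        assume "f = g"
        thus "?dY f g = 0" using p by (simp add: norm_dist_MS[OF \<phi>] mod_norm_def slice_def stf_def fourier_def)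
      qed
      show "?dY f h \<le> ?dY f g + ?dY g h" if "f \<in> ?Y" "g \<in> ?Y" "h \<in> ?Y"
      proof -
        have m: "(\<lambda>x. f x - g x) \<in> ?Y" "(\<lambda>x. g x - h x) \<in> ?Y" using that Ydiff by blast+
        have "mod_norm \<phi> p s (\<lambda>x. f x - h x) \<le> mod_norm \<phi> p s (\<lambda>x. f x - g x) + mod_norm \<phi> p s (\<lambda>x. g x - h x)"
          using mod_norm_add_le[OF p(1) Ytest[OF m(1)] Ytest[OF m(2)] \<phi>, of s] by simp
        thus ?thesis unfolding norm_dist_MS[OF \<phi>] using m by (intro enn2real_le_add Yfin)
      qed
    qed
  qed
  have absorb_cont: "\<exists>B. \<forall>f\<in>?X. \<forall>f'\<in>?X. ?dY (\<lambda>x. f x * g x) (\<lambda>x. f' x * g x) \<le> B * ?dX f f'" if g: "g \<in> ?Y" for g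
  proof (intro exI ballI)
    fix f f' assume f: "f \<in> ?X" "f' \<in> ?X"
    have d: "(\<lambda>x. f x - f' x) \<in> ?X" by (rule FB_diff[OF s f])
    have "enn2real (mod_norm \<phi> p s (\<lambda>x. (f x - f' x) * g x)) \<le> enn2real (ennreal (2 powr s) * ?N (\<lambda>x. f x - f' x) * mod_norm \<phi> p s g)"
      using absorb_le[OF d g] FB_norm_finite[OF d] Yfin[OF g] by (intro enn2real_mono) (auto simp: ennreal_mult_less_top)
    from this[unfolded left_diff_distrib]
    show "?dY (\<lambda>x. f x * g x) (\<lambda>x. f' x * g x) \<le> (2 powr s * enn2real (mod_norm \<phi> p s g)) * ?dX f f'"
      by (simp add: norm_dist_eq modulation_norm_distr_of[OF \<phi>] enn2real_mult mult_ac)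
  qed
  obtain r where r: "K \<subseteq> ball 0 r" using compact_imp_bounded[OF \<open>compact K\<close>] bounded_subset_ballD by blast
  obtain \<kappa> :: "real^'n \<Rightarrow> complex" where \<kappa>: "continuous_on UNIV \<kappa>" "rapid \<kappa>" "rapid (fourier \<kappa>)" "\<And>x. norm x \<le> r \<Longrightarrow> \<kappa> x = 1"
    using cutoff_exists[of r] by blast
  have \<kappa>m: "\<kappa> \<in> borel_measurable borel" by (rule borel_measurable_continuous_onI[OF \<kappa>(1)])
  have \<kappa>i: "integrable lborel \<kappa>" by (rule rapid_integrable[OF \<kappa>(2) \<kappa>m])
  have "beurling_mass s (fourier \<kappa>) < \<infinity>"
    using rapid_powr_integrable[OF \<kappa>(3) fourier_measurable[OF \<kappa>i], of s]
    unfolding beurling_mass_def by (simp add: integrable_iff_bounded abs_mult)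
  from has_symbol_fourier[OF s \<kappa>i \<kappa>(1) this] have "\<kappa> \<in> ?X" using FB_iff[OF s] by blast
  hence "\<kappa> \<in> ?Y" by (rule MS_if_FB[OF s \<phi>]) (rule mod_norm_finite_if_rapid[OF p(1) \<phi> \<kappa>(2) \<kappa>m \<kappa>(3)])
  show ?thesis
    unfolding spectral_synthesis_modulation_def spectral_synthesis_fourier_beurling_def
  proof (rule synthesis_transfer[OF function_algebra_FB[OF s] Y YX _ absorb absorb_cont \<open>\<kappa> \<in> ?Y\<close> open_ball r])
    show "\<exists>C. \<forall>f\<in>?Y. \<forall>g\<in>?Y. ?dX f g \<le> C * ?dY f g" using embed by blast
    show "\<kappa> x = 1" if "x \<in> ball 0 r" for x using that by (intro \<kappa>(4)) auto
  qed
qed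

end
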